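(* Let $k\ge1$, $\mathbf n=(n_1,\dots,n_k)$, $n=n_1+\dots+n_k\ge1$ and let $\delta=(\delta_{ij})$ be an $n\times k$ matrix of nonnegative integers. With $E(\mathbf n,\delta)$, $BKK(\mathbf n,\delta)$, $\Delta(\mathbf n,\delta)$ and $\Delta_{1/2}(\mathbf n,\delta)$ as defined in the context, $$\frac{\mathrm{per}\,\Delta_{1/2}(\mathbf n,\delta)}{n_1!\cdots n_k!}\;\ge\;E(\mathbf n,\delta)\;\ge\;\sqrt{BKK(\mathbf n,\delta)}=\sqrt{\frac{\mathrm{per}\,\Delta(\mathbf n,\delta)}{n_1!\cdots n_k!}}.$$ Each of the two inequalities holds with equality if and only if $(\mathbf n,\delta)$ is simply reducible.
   Context: Setting. $k\ge1$ is an integer, $\mathbf n=(n_1,\dots,n_k)$ are nonnegative integers, $n=n_1+\dots+n_k$, and $\delta=(\delta_{ij})_{1\le i\le n,\,1\le j\le k}$ is a matrix of nonnegative integers. Variables are $\mathbf x=(\mathbf y_1,\dots,\mathbf y_k)$ with $\mathbf y_j=(y_{j0},y_{j1},\dots,y_{jn_j})$. For each $i$ let $\mathcal A_i=\mathcal A_{i1}\times\dots\times\mathcal A_{ik}$ where $\mathcal A_{ij}=\{\alpha\in\mathbb N^{n_j+1}:\alpha_0+\dots+\alpha_{n_j}=\delta_{ij}\}$ ($0\in\mathbb N$). A coefficient vector $f_i=(f_{ia})_{a\in\mathcal A_i}\in\mathbb R^{\mathcal A_i}$ is identified with the polynomial $f_i(\mathbf x)=\sum_{a\in\mathcal A_i}f_{ia}\mathbf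 x^a$, which is homogeneous of degree $\delta_{ij}$ in $\mathbf y_j$ for each $j$. For $a\in\mathcal A_i$, with components $a_{jh}$ ($1\le j\le k$, $0\le h\le n_j$), let $\eta(a)=\prod_{j=1}^k\frac{a_{j0}!\cdots a_{jn_j}!}{(a_{j0}+\dots+a_{jn_j})!}$. Random system: $\tilde f=(\tilde f_1,\dots,\tilde f_n)$, where all coefficients $\tilde f_{ia}$ are independent normal random variables with mean $0$ and variance $\eta(a)^{-1}$. Root space: $P=\mathbf P^{n_1}(\mathbb R)\times\dots\times\mathbf P^{n_k}(\mathbb R)$; the condition $f_i(\zeta)=0$ is well defined for $\zeta\in P$. $E(\mathbf n,\delta)=\mathbb E\bigl(\#\{\zeta\in P:\tilde f(\zeta)=0\}\bigr)$. The BKK number. For convex polytopes $Q_1,\dots,Q_n\subset\mathbb R^n$ the mixed volume $\mathcal{MV}(Q_1,\dots,Q_n)$ is the coefficient of $\lambda_1\cdots\lambda_n$ in the polynomial $\mathrm{vol}(\lambda_1Q_1+\dots+\lambda_nQ_n)$ ($\lambda_i\ge0$). Let $\Delta(n_j)=\{z\in\mathbb R^{n_j}_{\ge0}:z_1+\dots+z_{n_j}\le1\}$ and $$BKK(\mathbf n,\delta)=\mathcal{MV}\Bigl(\prod_{j:n_j>0}\delta_{1j}\Delta(n_j),\dots,\prod_{j:n_j>0}\delta_{nj}\Delta(n_j)\Bigr)$$ (by Bernshtein's theorem this is the generic number of complex roots of the system). By convention, $BKK((0,\dots,0),\delta_0)=E((0,\dots,0),\delta_0)=1$, where $\delta_0$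 is the $0\times k$ matrix. Matrices. $\Delta(\mathbf n,\delta)$ (resp. $\Delta_{1/2}(\mathbf n,\delta)$) is the $n\times n$ matrix with rows indexed by $i=1,\dots,n$, columns indexed by pairs $jh$ with $1\le j\le k$, $1\le h\le n_j$, and $(i,jh)$-entry $\delta_{ij}$ (resp. $\sqrt{\delta_{ij}}$). $\mathrm{per}\,D=\sum_{\sigma}\prod_{i=1}^nd_{i\sigma(i)}$ (sum over permutations $\sigma$ of $\{1,\dots,n\}$) is the permanent of an $n\times n$ matrix. Simple reducibility. $\delta^{-i}$ is $\delta$ with row $i$ removed and $\mathbf e_j$ is the $j$-th standard basis vector of $\mathbb R^k$. For $n\ge1$, the pair $(\mathbf n,\delta)$ is simply reducible (defined inductively on $n$) if there is some $i\in\{1,\dots,n\}$ for which there is at most one $j$ with $n_j>0$, $\delta_{ij}>0$ and $BKK(\mathbf n-\mathbf e_j,\delta^{-i})>0$, and, if $n>1$ and such a $j$ exists, $(\mathbf n-\mathbf e_j,\delta^{-i})$ is also simply reducible. *)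

theory Defs
  imports "HOL-Probability.Probability" "HOL-Library.Poly_Mapping" "HOL-Combinatorics.Permutations"
begin

(* Blocks j < k, equations i < total_dim k nv, and nv j, \<delta> i j stand for n_j, \<delta>_ij.
   Values of nv and \<delta> outside these ranges never matter. The homogeneous coordinates of
   block j are h = 0, ..., nv j. *)

definition total_dim :: "nat \<Rightarrow> (nat \<Rightarrow> nat) \<Rightarrow> nat" where
  "total_dim k nv = (\<Sum>j<k. nv j)"

section \<open>Multihomogeneous systems\<close>

definition exponents :: "nat \<Rightarrow> (nat \<Rightarrow> nat) \<Rightarrow> (nat \<Rightarrow> nat) \<Rightarrow> (nat \<Rightarrow> nat \<Rightarrow> nat) set" where
  "exponents k nv d =
     (\<Pi>\<^sub>E j\<in>{..<k}. {\<alpha> \<in> {..nv j} \<rightarrow>\<^sub>E UNIV. (\<Sum>h\<le>nv j. \<alpha> h) = d j})"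

definition poly_eval ::
  "nat \<Rightarrow> (nat \<Rightarrow> nat) \<Rightarrow> (nat \<Rightarrow> nat) \<Rightarrow> ((nat \<Rightarrow> nat \<Rightarrow> nat) \<Rightarrow> real) \<Rightarrow> (nat \<Rightarrow> nat \<Rightarrow> real) \<Rightarrow> real" where
  "poly_eval k nv d c x = (\<Sum>a\<in>exponents k nv d. c a * (\<Prod>j<k. \<Prod>h\<le>nv j. x j h ^ a j h))"

lemma poly_eval_scale:
  assumes "\<And>j h. j < k \<Longrightarrow> h \<le> nv j \<Longrightarrow> y j h = s j * x j h"
  shows "poly_eval k nv d c y = (\<Prod>j<k. s j ^ d j) * poly_eval k nv d c x"
proof -
  have "(\<Prod>j<k. \<Prod>h\<le>nv j. y j h ^ a j h)
      = (\<Prod>j<k. s j ^ d j) * (\<Prod>j<k. \<Prod>h\<le>nv j. x j h ^ a j h)"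
    if "a \<in> exponents k nv d" for a
  proof -
    have "(\<Prod>h\<le>nv j. y j h ^ a j h) = s j ^ d j * (\<Prod>h\<le>nv j. x j h ^ a j h)" if "j < k" for j
    proof -
      have "(\<Prod>h\<le>nv j. y j h ^ a j h) = (\<Prod>h\<le>nv j. s j ^ a j h * x j h ^ a j h)"
        using assms that by (intro prod.cong) (auto simp: power_mult_distrib)
      moreover have "(\<Sum>h\<le>nv j. a j h) = d j"
        using \<open>a \<in> exponents k nv d\<close> that by (auto simp: exponents_def PiE_iff)
      ultimately show ?thesis
        by (simp add: prod.distrib flip: power_sum)
    qed
    then show ?thesis
      by (simp add: prod.distrib)
  qed
  then show ?thesis
    by (simp add: poly_eval_def sum_distrib_left mult.left_commute)
qed

definition nonzero_vectors :: "nat \<Rightarrow> (nat \<Rightarrow> real) set" where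
  "nonzero_vectors m = {v \<in> {..m} \<rightarrow>\<^sub>E UNIV. \<exists>h\<le>m. v h \<noteq> 0}"

definition proportional :: "nat \<Rightarrow> ((nat \<Rightarrow> real) \<times> (nat \<Rightarrow> real)) set" where
  "proportional m = {(v, w). v \<in> nonzero_vectors m \<and> w \<in> nonzero_vectors m \<and>
     (\<exists>c. c \<noteq> 0 \<and> (\<forall>h\<le>m. w h = c * v h))}"

definition proj_space :: "nat \<Rightarrow> (nat \<Rightarrow> real) set set" where
  "proj_space m = nonzero_vectors m // proportional m"

lemma equiv_proportional: "equiv (nonzero_vectors m) (proportional m)"
proof (rule equivI)
  show "refl_on (nonzero_vectors m) (proportional m)"
    by (auto simp: refl_on_def proportional_def intro!: exI[of _ 1])
  show "sym (proportional m)"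
  proof (rule symI)
    fix v w assume "(v, w) \<in> proportional m"
    then obtain c where "v \<in> nonzero_vectors m" "w \<in> nonzero_vectors m" "c \<noteq> 0"
      "\<forall>h\<le>m. w h = c * v h" by (auto simp: proportional_def)
    then show "(w, v) \<in> proportional m"
      by (auto simp: proportional_def intro!: exI[of _ "1 / c"])
  qed
  show "trans (proportional m)"
  proof (rule transI)
    fix u v w assume "(u, v) \<in> proportional m" "(v, w) \<in> proportional m"
    then obtain c d where "u \<in> nonzero_vectors m" "w \<in> nonzero_vectors m" "c \<noteq> 0" "d \<noteq> 0"
      "\<forall>h\<le>m. v h = c * u h" "\<forall>h\<le>m. w h = d * v h" by (auto simp: proportional_def)
    then show "(u, w) \<in> proportional m"
      by (auto simp: proportional_def intro!: exI[of _ "d * c"])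
  qed
qed (auto simp: proportional_def)

(* f (i, a) is the coefficient f_ia. The choice of the representatives x j of \<zeta> j is immaterial
   by poly_eval_scale. *)
definition roots ::
  "nat \<Rightarrow> (nat \<Rightarrow> nat) \<Rightarrow> (nat \<Rightarrow> nat \<Rightarrow> nat) \<Rightarrow> (nat \<times> (nat \<Rightarrow> nat \<Rightarrow> nat) \<Rightarrow> real)
    \<Rightarrow> (nat \<Rightarrow> (nat \<Rightarrow> real) set) set" where
  "roots k nv \<delta> f =
     {\<zeta> \<in> (\<Pi>\<^sub>E j\<in>{..<k}. proj_space (nv j)).
       \<forall>i<total_dim k nv. \<forall>x. (\<forall>j<k. x j \<in> \<zeta> j) \<longrightarrow> poly_eval k nv (\<delta> i) (\<lambda>a. f (i, a)) x = 0}"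

section \<open>The expected number of real roots\<close>

definition eta :: "nat \<Rightarrow> (nat \<Rightarrow> nat) \<Rightarrow> (nat \<Rightarrow> nat \<Rightarrow> nat) \<Rightarrow> real" where
  "eta k nv a = (\<Prod>j<k. (\<Prod>h\<le>nv j. fact (a j h)) / fact (\<Sum>h\<le>nv j. a j h))"

(* Joint law of independent centred normal coefficients. The second argument of normal_density
   is the standard deviation, so f_ia has variance 1 / eta(a). *)
definition coeff_law ::
  "nat \<Rightarrow> (nat \<Rightarrow> nat) \<Rightarrow> (nat \<Rightarrow> nat \<Rightarrow> nat) \<Rightarrow> (nat \<times> (nat \<Rightarrow> nat \<Rightarrow> nat) \<Rightarrow> real) measure" where
  "coeff_law k nv \<delta> =
     (\<Pi>\<^sub>M (i, a) \<in> (SIGMA i:{..<total_dim k nv}. exponents k nv (\<delta> i)).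
        density lborel (\<lambda>t. ennreal (normal_density 0 (sqrt (inverse (eta k nv a))) t)))"

(* The count is infinity on the (null) set of systems with infinitely many roots. *)
definition expected_roots :: "nat \<Rightarrow> (nat \<Rightarrow> nat) \<Rightarrow> (nat \<Rightarrow> nat \<Rightarrow> nat) \<Rightarrow> ennreal" where
  "expected_roots k nv \<delta> =
     (\<integral>\<^sup>+ f. emeasure (count_space UNIV) (roots k nv \<delta> f) \<partial>coeff_law k nv \<delta>)"

section \<open>Mixed volumes and the BKK number\<close>

(* Points of Euclidean space with coordinates indexed by a finite set I are the elements
   of I \<rightarrow>\<^sub>E UNIV; the volume is the product Lebesgue measure. *)

definition minkowski_comb ::
  "'b set \<Rightarrow> nat \<Rightarrow> (nat \<Rightarrow> real) \<Rightarrow> (nat \<Rightarrow> ('b \<Rightarrow> real) set) \<Rightarrow> ('b \<Rightarrow> real) set" where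
  "minkowski_comb I m l Q = {\<lambda>c\<in>I. \<Sum>i<m. l i * q i c | q. \<forall>i<m. q i \<in> Q i}"

(* p is a polynomial in the variables l_0, ..., l_(m-1), given by its coefficients. *)
definition is_volume_polynomial ::
  "'b set \<Rightarrow> nat \<Rightarrow> (nat \<Rightarrow> ('b \<Rightarrow> real) set) \<Rightarrow> ((nat \<Rightarrow>\<^sub>0 nat) \<Rightarrow>\<^sub>0 real) \<Rightarrow> bool" where
  "is_volume_polynomial I m Q p \<longleftrightarrow>
     (\<forall>e\<in>Poly_Mapping.keys p. Poly_Mapping.keys e \<subseteq> {..<m}) \<and>
     (\<forall>l. (\<forall>i<m. 0 \<le> l i) \<longrightarrow>
        measure (\<Pi>\<^sub>M c\<in>I. lborel) (minkowski_comb I m l Q) =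
        (\<Sum>e\<in>Poly_Mapping.keys p. Poly_Mapping.lookup p e * (\<Prod>i<m. l i ^ Poly_Mapping.lookup e i)))"

definition mixed_volume :: "'b set \<Rightarrow> (nat \<Rightarrow> ('b \<Rightarrow> real) set) \<Rightarrow> real" where
  "mixed_volume I Q =
     (THE v. \<exists>p. is_volume_polynomial I (card I) Q p \<and>
        v = Poly_Mapping.lookup p (\<Sum>i<card I. Poly_Mapping.single i 1))"

definition corner_simplex :: "nat \<Rightarrow> (nat \<Rightarrow> real) set" where
  "corner_simplex m = {z \<in> {1..m} \<rightarrow>\<^sub>E UNIV. (\<forall>h\<in>{1..m}. 0 \<le> z h) \<and> (\<Sum>h=1..m. z h) \<le> 1}"

definition dilate :: "nat \<Rightarrow> real \<Rightarrow> (nat \<Rightarrow> real) set \<Rightarrow> (nat \<Rightarrow> real) set" where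
  "dilate m c S = (\<lambda>w. \<lambda>h\<in>{1..m}. c * w h) ` S"

definition coords :: "nat \<Rightarrow> (nat \<Rightarrow> nat) \<Rightarrow> (nat \<times> nat) set" where
  "coords k nv = (SIGMA j:{..<k}. {1..nv j})"

definition simplex_product :: "nat \<Rightarrow> (nat \<Rightarrow> nat) \<Rightarrow> (nat \<Rightarrow> nat) \<Rightarrow> (nat \<times> nat \<Rightarrow> real) set" where
  "simplex_product k nv d = {z \<in> coords k nv \<rightarrow>\<^sub>E UNIV.
     \<forall>j<k. nv j > 0 \<longrightarrow> (\<lambda>h\<in>{1..nv j}. z (j, h)) \<in> dilate (nv j) (real (d j)) (corner_simplex (nv j))}"

definition BKK :: "nat \<Rightarrow> (nat \<Rightarrow> nat) \<Rightarrow> (nat \<Rightarrow> nat \<Rightarrow> nat) \<Rightarrow> real" where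
  "BKK k nv \<delta> = mixed_volume (coords k nv) (\<lambda>i. simplex_product k nv (\<delta> i))"

lemma card_coords: "card (coords k nv) = total_dim k nv"
  by (simp add: coords_def total_dim_def)

section \<open>The conventions for the empty system\<close>

lemma proj_space_0_unique: "\<exists>!L. L \<in> proj_space 0"
proof -
  define v where "v = (\<lambda>h\<in>{..0::nat}. 1::real)"
  have v: "v \<in> nonzero_vectors 0"
    by (auto simp: nonzero_vectors_def v_def)
  have vw: "(v, w) \<in> proportional 0" if "w \<in> nonzero_vectors 0" for w
    using that v by (auto simp: proportional_def nonzero_vectors_def v_def)
  then have "L = proportional 0 `` {v}" if "L \<in> proj_space 0" for L
  proof -
    from that obtain w where "w \<in> nonzero_vectors 0" "L = proportional 0 `` {w}"
      unfolding proj_space_def by (rule quotientE)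
    then show ?thesis
      using equiv_class_eq[OF equiv_proportional vw]
      by simp
  qed
  moreover have "proportional 0 `` {v} \<in> proj_space 0"
    unfolding proj_space_def using v by (rule quotientI)
  ultimately show ?thesis by blast
qed

lemma expected_roots_empty:
  assumes "\<forall>j<k. nv j = 0"
  shows "expected_roots k nv \<delta> = 1"
proof -
  obtain L where "proj_space 0 = {L}"
    using proj_space_0_unique by blast
  then have "(\<Pi>\<^sub>E j\<in>{..<k}. proj_space (nv j)) = (\<Pi>\<^sub>E j\<in>{..<k}. {L})"
    using assms by (intro PiE_cong) auto
  moreover have "total_dim k nv = 0"
    using assms by (simp add: total_dim_def)
  ultimately show ?thesis
    by (simp add: expected_roots_def roots_def coeff_law_def PiM_empty PiE_singleton[of "\<lambda>j\<in>{..<k}. L", simplified])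
qed

lemma BKK_empty:
  assumes "\<forall>j<k. nv j = 0"
  shows "BKK k nv \<delta> = 1"
proof -
  have c: "coords k nv = {}"
    using assms by (auto simp: coords_def)
  have "simplex_product k nv d = {\<lambda>_. undefined}" for d
    using assms by (auto simp: simplex_product_def c)
  then have iff: "is_volume_polynomial {} 0 (\<lambda>i. simplex_product k nv (\<delta> i)) p \<longleftrightarrow>
      Poly_Mapping.keys p \<subseteq> {0} \<and> 1 = (\<Sum>e\<in>Poly_Mapping.keys p. Poly_Mapping.lookup p e)" for p
    by (auto simp: is_volume_polynomial_def minkowski_comb_def PiM_empty measure_def
        restrict_def)
  have look: "Poly_Mapping.lookup p 0 = 1"
    if "Poly_Mapping.keys p \<subseteq> {0}" "1 = (\<Sum>e\<in>Poly_Mapping.keys p. Poly_Mapping.lookup p e)"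
    for p :: "(nat \<Rightarrow>\<^sub>0 nat) \<Rightarrow>\<^sub>0 real"
    using that by (cases "Poly_Mapping.keys p = {}") (auto dest: subset_singletonD)
  have "mixed_volume {} (\<lambda>i. simplex_product k nv (\<delta> i)) = 1"
    unfolding mixed_volume_def card.empty iff
  proof (rule the_equality)
    show "\<exists>p::(nat \<Rightarrow>\<^sub>0 nat) \<Rightarrow>\<^sub>0 real. (Poly_Mapping.keys p \<subseteq> {0} \<and>
        1 = (\<Sum>e\<in>Poly_Mapping.keys p. Poly_Mapping.lookup p e)) \<and>
        1 = Poly_Mapping.lookup p (\<Sum>i<0. Poly_Mapping.single i 1)"
      by (intro exI[of _ "Poly_Mapping.single 0 1"]) auto
  qed (auto simp: look)
  then show ?thesis
    by (simp add: BKK_def c)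
qed

section \<open>Permanents\<close>

definition per :: "nat \<Rightarrow> (nat \<Rightarrow> nat \<Rightarrow> real) \<Rightarrow> real" where
  "per n D = (\<Sum>\<sigma> | \<sigma> permutes {..<n}. \<Prod>i<n. D i (\<sigma> i))"

(* The column labels (j, h) in lexicographic order. *)
definition columns :: "nat \<Rightarrow> (nat \<Rightarrow> nat) \<Rightarrow> (nat \<times> nat) list" where
  "columns k nv = concat (map (\<lambda>j. map (Pair j) [1..<Suc (nv j)]) [0..<k])"

lemma columns_enumerate:
  "set (columns k nv) = coords k nv" "distinct (columns k nv)" "length (columns k nv) = total_dim k nv"
proof -
  show s: "set (columns k nv) = coords k nv"
    by (auto simp: columns_def coords_def image_iff simp del: upt_Suc)
  show l: "length (columns k nv) = total_dim k nv"
    by (simp add: columns_def total_dim_def length_concat comp_def interv_sum_list_conv_sum_set_nat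
        atLeast0LessThan del: upt_Suc)
  show "distinct (columns k nv)"
    by (rule card_distinct) (simp add: s l card_coords)
qed

definition Delta :: "nat \<Rightarrow> (nat \<Rightarrow> nat) \<Rightarrow> (nat \<Rightarrow> nat \<Rightarrow> nat) \<Rightarrow> nat \<Rightarrow> nat \<Rightarrow> real" where
  "Delta k nv \<delta> i c = real (\<delta> i (fst (columns k nv ! c)))"

definition Delta_half :: "nat \<Rightarrow> (nat \<Rightarrow> nat) \<Rightarrow> (nat \<Rightarrow> nat \<Rightarrow> nat) \<Rightarrow> nat \<Rightarrow> nat \<Rightarrow> real" where
  "Delta_half k nv \<delta> i c = sqrt (real (\<delta> i (fst (columns k nv ! c))))"

section \<open>Simple reducibility\<close>

definition remove_row :: "nat \<Rightarrow> (nat \<Rightarrow> nat \<Rightarrow> nat) \<Rightarrow> nat \<Rightarrow> nat \<Rightarrow> nat" where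
  "remove_row i \<delta> = (\<lambda>r. if r < i then \<delta> r else \<delta> (Suc r))"

definition decrement :: "nat \<Rightarrow> (nat \<Rightarrow> nat) \<Rightarrow> nat \<Rightarrow> nat" where
  "decrement j nv = nv(j := nv j - 1)"

definition reduction_index ::
  "nat \<Rightarrow> (nat \<Rightarrow> nat) \<Rightarrow> (nat \<Rightarrow> nat \<Rightarrow> nat) \<Rightarrow> nat \<Rightarrow> nat \<Rightarrow> bool" where
  "reduction_index k nv \<delta> i j \<longleftrightarrow>
     j < k \<and> nv j > 0 \<and> \<delta> i j > 0 \<and> BKK k (decrement j nv) (remove_row i \<delta>) > 0"

(* The recursion is on total_dim, so the least fixed point is the only one. *)
inductive simply_reducible :: "nat \<Rightarrow> (nat \<Rightarrow> nat) \<Rightarrow> (nat \<Rightarrow> nat \<Rightarrow> nat) \<Rightarrow> bool" for k where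
  "simply_reducible k nv \<delta>"
  if "i < total_dim k nv"
     "\<And>j j'. reduction_index k nv \<delta> i j \<Longrightarrow> reduction_index k nv \<delta> i j' \<Longrightarrow> j = j'"
     "\<And>j. total_dim k nv > 1 \<Longrightarrow> reduction_index k nv \<delta> i j \<Longrightarrow>
        simply_reducible k (decrement j nv) (remove_row i \<delta>)"

end

theory Submission
  imports Defs "Jordan_Normal_Form.Determinant"
begin

text \<open>
  In an affine chart the equations read \<open>Y\<^sub>i + \<Sum>\<^sub>a X\<^sub>i\<^sub>a u\<^sub>i\<^sub>a(x) = 0\<close> with independent normal
  \<open>Y\<^sub>i, X\<^sub>i\<^sub>a\<close>. The area formula turns the expected number of solutions into an integral over \<open>x\<close>
  of the expectation of an absolute determinant with independent rows. Such an expectation depends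
  on a row only through the mean absolute values of its linear forms, and these are computed from
  the covariance kernel \<open>\<Prod>\<^sub>j \<langle>x\<^sub>j, y\<^sub>j\<rangle> ^ \<delta>\<^sub>i\<^sub>j\<close>. Hence \<open>E(n, \<delta>)\<close> is a factor not depending on
  \<open>\<delta>\<close> times the mean absolute determinant of the matrix with entries \<open>sqrt \<delta>\<^sub>i\<^sub>j Z\<^sub>i\<^sub>c\<close>,
  where \<open>j\<close> is the block of the column \<open>c\<close>. The factor is found from the system in which every
  equation is linear in a single block, which almost surely has exactly one root.

  Expanding the determinant along row \<open>i\<close> gives the mean of
  \<open>sqrt (\<Sum>\<^sub>j \<delta>\<^sub>i\<^sub>j |G\<^sub>j|\<^sup>2)\<close>, where \<open>G\<^sub>j\<close> is the vector of the minors of block \<open>j\<close> and the mean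
  of \<open>|G\<^sub>j|\<close> is, up to normalization, \<open>E(n - e\<^sub>j, \<delta>\<^sup>-\<^sup>i)\<close>. The subadditivity of the square
  root and the triangle inequality for vector-valued means bound this from above and below by
  expressions that match the expansions of the permanents of \<open>sqrt \<delta>\<close> and \<open>\<delta>\<close>; both
  bounds are strict as soon as two blocks contribute.
\<close>

section \<open>Counting zeros measurably\<close>

text \<open>All equations see the same geometry: the second mixed derivative of the logarithm of the
  covariance kernel of equation \<open>i\<close> is the sum over the blocks of \<delta>_ij times a
  form that does not depend on \<open>i\<close>. A square root of these forms therefore splits off
  as a right factor of the Jacobian matrix, which is what separates the point \<open>x\<close> from
  the degrees. No projective volume is computed: \<open>ndet\<close> divides by the mean determinant
  of a reference system, and the Gaussian constants produced by a row expansion are the same for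
  both. Two obstacles shape the analytic half. The Jacobian of a random system may vanish, so the
  area formula has to include critical points and needs a Sard argument; and the number of zeros
  must be a measurable function of the coefficients, which is why the domains are sigma-compact
  sets. In the inequality half the delicate point is strictness: positive permanents have to become
  almost surely nonzero minors, and the proportionality of two block norms is refuted by the full
  support of Gaussian matrices.\<close>

abbreviation lebR :: "'a set => ('a => real) measure" where
 "lebR I \<equiv> Pi\<^sub>M I (\<lambda>_. lborel)"

abbreviation fvec :: "'a set => ('a => real) set" where
 "fvec I \<equiv> I \<rightarrow>\<^sub>E UNIV"

interpretation plb: product_sigma_finite "\<lambda>_::'a. lborel :: real measure"
 by (simp add: product_sigma_finite_def sigma_finite_lborel)

lemma space_lebR [simp]: "space (lebR I) = fvec I" by (simp add: space_PiM)

text \<open>A point of R^I is a total function that is \<open>undefined\<close> off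
  \<open>I\<close>, so its topology comes from the full space \<open>'a => real\<close> while its
  sigma-algebra is that of \<open>lebR I\<close>. Countability of the index type makes the Borel
  sets of the full space the product sigma-algebra, which allows the two structures to be
  mixed.\<close>

lemma id_lebR_borel: "(\<lambda>x. x) \<in> lebR I \<rightarrow>\<^sub>M (borel :: ('a::countable => real) measure)"
proof -
 have "(\<lambda>x. x i) \<in> borel_measurable (lebR I)" for i
 proof (cases "i \<in> I")
  case False
  then have "(\<lambda>x. x i) \<in> borel_measurable (lebR I) \<longleftrightarrow> (\<lambda>x. undefined :: real) \<in> borel_measurable (lebR I)"
   by (intro measurable_cong) (auto simp: PiE_def extensional_def)
  then show ?thesis by simp
 qed simp
 then have "(\<lambda>x. x) \<in> lebR I \<rightarrow>\<^sub>M (Pi\<^sub>M UNIV (\<lambda>_::'a. borel :: real measure))"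
  by (intro measurable_PiM_single') (auto simp: space_PiM)
 then show ?thesis by (subst measurable_cong_sets[OF refl sets_PiM_equal_borel[symmetric]])
qed

lemma borel_Int_lebR: "S \<in> sets (borel :: ('a::countable => real) measure) \<Longrightarrow> S \<inter> fvec I \<in> sets (lebR I)"
 using measurable_sets[OF id_lebR_borel, of S I] by simp

lemma lebR_measurable_if:
 fixes F :: "('a::countable => real) => 'b::topological_space"
 assumes "S \<in> sets borel" "continuous_on S F"
 shows "(\<lambda>x. if x \<in> S then F x else c) \<in> borel_measurable (lebR I)"
proof -
 have "(\<lambda>x. if x \<in> S then F x else c) \<in> borel_measurable borel"
  using assms by (intro borel_measurable_continuous_on_if) auto
 from measurable_compose[OF id_lebR_borel this] show ?thesis .
qed

section \<open>Compact and open boxes in the spaces \<open>fvec I\<close>\<close>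

lemma compact_PiE_UNIV:
 fixes S :: "'a => real set"
 assumes "\<And>i. compact (S i)"
 shows "compact (PiE UNIV S)"
proof -
 have "compactin (product_topology (\<lambda>_. euclidean) UNIV) (PiE UNIV S)"
  using assms by (auto simp: compactin_PiE)
 then show ?thesis by (simp add: euclidean_product_topology)
qed

text \<open>Off \<open>I\<close> every coordinate is confined to the single point
  \<open>undefined\<close>, so the box is a full product of compact sets and Tychonoff's theorem
  applies.\<close>

lemma compact_box:
 fixes a b :: "'a => real"
 shows "compact {x \<in> fvec I. \<forall>i\<in>I. a i \<le> x i \<and> x i \<le> b i}"
proof -
 have "{x \<in> fvec I. \<forall>i\<in>I. a i \<le> x i \<and> x i \<le> b i} = PiE UNIV (\<lambda>i. if i \<in> I then {a i..b i} else {undefined})"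
  by (auto simp: PiE_def Pi_def extensional_def split: if_splits)
 then show ?thesis by (auto intro!: compact_PiE_UNIV)
qed

text \<open>If no box of equal sides worked, points of \<open>fvec I\<close> outside
  \<open>W\<close> at coordinate distances below \<open>inverse (Suc m)\<close> would converge
  coordinatewise to \<open>x\<close>, and this is convergence in the product topology.\<close>

lemma open_fvec_box:
 fixes x :: "'a::countable => real"
 assumes W: "open W" "x \<in> W" and x: "x \<in> fvec I"
 obtains d where "d > 0" "\<And>y. y \<in> fvec I \<Longrightarrow> (\<And>i. i \<in> I \<Longrightarrow> \<bar>y i - x i\<bar> < d) \<Longrightarrow> y \<in> W"
proof (rule ccontr)
 assume neg: "\<not> thesis"
 have "\<exists>y. y \<in> fvec I \<and> (\<forall>i\<in>I. \<bar>y i - x i\<bar> < inverse (real (Suc m))) \<and> y \<notin> W" for m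
 proof (rule ccontr)
  assume "\<not> ?thesis"
  then show False using neg that[of "inverse (real (Suc m))"] by fastforce
 qed
 then obtain y where y: "\<And>m. y m \<in> fvec I" "\<And>m i. i \<in> I \<Longrightarrow> \<bar>y m i - x i\<bar> < inverse (real (Suc m))"
  "\<And>m. y m \<notin> W" by metis
 have "(\<lambda>m. y m i) \<longlonglongrightarrow> x i" for i
 proof (cases "i \<in> I")
  case True
  then have "(\<lambda>m. y m i - x i) \<longlonglongrightarrow> 0"
   using y(2) by (intro Lim_null_comparison[OF _ LIMSEQ_inverse_real_of_nat])
    (auto intro!: eventuallyI less_imp_le)
  then show ?thesis by (simp add: LIM_zero_iff)
 next
  case False
  then have "y m i = x i" for m using y(1)[of m] x by (auto simp: PiE_def extensional_def)
  then show ?thesis by simp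
 qed
 then have "y \<longlonglongrightarrow> x"
 proof -
  have "limitin (product_topology (\<lambda>_::'a. euclidean :: real topology) UNIV) y x sequentially"
   using \<open>\<And>i. (\<lambda>m. y m i) \<longlonglongrightarrow> x i\<close> by (simp add: limitin_componentwise)
  then show ?thesis by (simp add: euclidean_product_topology)
 qed
 then have "eventually (\<lambda>m. y m \<in> W) sequentially" using W by (rule topological_tendstoD)
 then show False using y(3) by auto
qed

lemma open_box:
 fixes x :: "'a => real"
 assumes "finite I"
 shows "open {y. \<forall>i\<in>I. \<bar>y i - x i\<bar> < d i}"
proof -
 have "{y. \<forall>i\<in>I. \<bar>y i - x i\<bar> < d i} = (\<Inter>i\<in>I. {y. \<bar>y i - x i\<bar> < d i})" by auto
 also have "open \<dots>"
  using assms by (intro open_INT ballI open_Collect_less continuous_intros continuous_on_product_coordinates) auto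
 finally show ?thesis .
qed

section \<open>Sigma-compact sets\<close>

text \<open>The class is stable under countable unions, continuous images and intersections with
  open and closed sets, and its members are Borel. The area formula projects level sets to fewer
  coordinates, and a projection of a mere Borel set need not be Borel.\<close>

definition sigma_compact :: "'a::topological_space set => bool" where
 "sigma_compact A \<longleftrightarrow> (\<exists>K::nat => 'a set. (\<forall>m. compact (K m)) \<and> A = (\<Union>m. K m))"

lemma sigma_compactI: "(\<And>m::nat. compact (K m)) \<Longrightarrow> A = (\<Union>m. K m) \<Longrightarrow> sigma_compact A"
 unfolding sigma_compact_def by blast

lemma sigma_compact_UN:
 assumes "\<And>m::nat. sigma_compact (A m)"
 shows "sigma_compact (\<Union>m. A m)"
proof -
 obtain K :: "nat => nat => 'a set" where K: "\<And>m l. compact (K m l)" "\<And>m. A m = (\<Union>l. K m l)"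
  using assms unfolding sigma_compact_def by metis
 show ?thesis
 proof (rule sigma_compactI)
  show "compact (K (fst (prod_decode p)) (snd (prod_decode p)))" for p by (rule K)
  show "(\<Union>m. A m) = (\<Union>p. K (fst (prod_decode p)) (snd (prod_decode p)))"
  proof safe
   fix x m assume "x \<in> A m"
   then obtain l where "x \<in> K m l" using K(2) by auto
   then show "x \<in> (\<Union>p. K (fst (prod_decode p)) (snd (prod_decode p)))"
    by (intro UN_I[of "prod_encode (m, l)"]) auto
  next
   fix x p assume "x \<in> K (fst (prod_decode p)) (snd (prod_decode p))"
   then show "x \<in> (\<Union>m. A m)" using K(2) by auto
  qed
 qed
qed

lemma sigma_compact_Int_closed:
 assumes "sigma_compact A" "closed C"
 shows "sigma_compact (A \<inter> C)"
proof -
 obtain K where "\<And>m::nat. compact (K m)" "A = (\<Union>m. K m)" using assms(1) unfolding sigma_compact_def by blast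
 then show ?thesis
  using assms(2) by (intro sigma_compactI[of "\<lambda>m. K m \<inter> C"]) (auto intro: compact_Int_closed)
qed

lemma open_UN_closed:
 fixes W :: "'a::metric_space set"
 assumes "open W"
 obtains C :: "nat => 'a set" where "\<And>m. closed (C m)" "W = (\<Union>m. C m)"
proof (cases "W = UNIV")
 \<comment> \<open>Kept apart because \<open>infdist\<close> to the empty set is 0, so the
   description by distances used below would give the empty set.\<close>
 case True
 then show ?thesis using that[of "\<lambda>_. UNIV"] by auto
next
 case False
 have cl: "closed {x. inverse (real (Suc m)) \<le> infdist x (- W)}" for m
  by (intro closed_Collect_le continuous_intros)
 have "x \<in> W \<longleftrightarrow> (\<exists>m. inverse (real (Suc m)) \<le> infdist x (- W))" for x
 proof -
  have "infdist x (- W) > 0 \<longleftrightarrow> x \<in> W"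
   using in_closed_iff_infdist_zero[of "- W" x] assms False infdist_nonneg[of x "-W"]
   by (auto simp: closed_def less_le)
  moreover have "infdist x (- W) > 0 \<longleftrightarrow> (\<exists>m. inverse (real (Suc m)) \<le> infdist x (- W))"
  proof
   assume "infdist x (- W) > 0"
   then show "\<exists>m. inverse (real (Suc m)) \<le> infdist x (- W)" using reals_Archimedean less_imp_le by blast
  next
   assume "\<exists>m. inverse (real (Suc m)) \<le> infdist x (- W)"
   then obtain m where "inverse (real (Suc m)) \<le> infdist x (- W)" by auto
   moreover have "inverse (real (Suc m)) > 0" by simp
   ultimately show "infdist x (- W) > 0" by linarith
  qed
  ultimately show ?thesis by simp
 qed
 then have "W = (\<Union>m. {x. inverse (real (Suc m)) \<le> infdist x (- W)})"
  unfolding set_eq_iff UN_iff mem_Collect_eq by blast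
 then show ?thesis by (rule that[OF cl])
qed

lemma sigma_compact_Int_open:
 fixes A :: "'a::metric_space set"
 assumes "sigma_compact A" "open W"
 shows "sigma_compact (A \<inter> W)"
proof -
 obtain C where C: "\<And>m::nat. closed (C m)" "W = (\<Union>m. C m)" using open_UN_closed[OF assms(2)] by blast
 then have "A \<inter> W = (\<Union>m. A \<inter> C m)" by auto
 moreover have "sigma_compact (\<Union>m. A \<inter> C m)"
  using C(1) assms(1) by (intro sigma_compact_UN sigma_compact_Int_closed)
 ultimately show ?thesis by simp
qed

lemma sigma_compact_image:
 assumes "sigma_compact A" "continuous_on A f"
 shows "sigma_compact (f ` A)"
proof -
 obtain K where K: "\<And>m::nat. compact (K m)" "A = (\<Union>m. K m)"
  using assms(1) unfolding sigma_compact_def by blast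
 then show ?thesis using assms(2) by (intro sigma_compactI[of "\<lambda>m. f ` K m"])
   (auto intro!: compact_continuous_image intro: continuous_on_subset)
qed

lemma sigma_compact_borel:
 fixes A :: "'a::t2_space set"
 assumes "sigma_compact A"
 shows "A \<in> sets borel"
 proof -
 obtain K where K: "\<And>m::nat. compact (K m)" "A = (\<Union>m. K m)" using assms unfolding sigma_compact_def by blast
 have "K m \<in> sets borel" for m by (intro borel_closed compact_imp_closed K)
 then show ?thesis unfolding K(2) by auto
qed

lemma sigma_compact_fvec:
 assumes "finite I"
 shows "sigma_compact (fvec I :: ('a => real) set)"
proof (rule sigma_compactI)
 show "compact {x \<in> fvec I. \<forall>i\<in>I. - real m \<le> x i \<and> x i \<le> real m}" for m by (rule compact_box)
 show "fvec I = (\<Union>m. {x \<in> fvec I. \<forall>i\<in>I. - real m \<le> x i \<and> x i \<le> real m})"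
 proof safe
  fix x :: "'a => real" assume x: "x \<in> fvec I"
  obtain m where m: "(\<Sum>i\<in>I. \<bar>x i\<bar>) \<le> real m" using real_arch_simple by blast
  have "\<bar>x i\<bar> \<le> real m" if "i \<in> I" for i using member_le_sum[of i I "\<lambda>i. \<bar>x i\<bar>"] that m assms by simp
  then show "x \<in> (\<Union>m. {x \<in> fvec I. \<forall>i\<in>I. - real m \<le> x i \<and> x i \<le> real m})"
   using x by (intro UN_I[of m]) (auto simp: abs_le_iff minus_le_iff)
 qed
qed

section \<open>Measurability of the number of zeros\<close>

text \<open>By compactness an exact common zero exists as soon as approximate zeros of every
  tolerance exist, and by continuity these may be sought in a countable dense subset of
  \<open>K\<close>. This leaves countably many quantifiers over measurable events.\<close>

lemma zero_set_hits_compact_measurable: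
 fixes F :: "'w => 'x::metric_space => nat => real"
 assumes K: "compact K"
  and cont: "\<And>\<omega> i. \<omega> \<in> space M \<Longrightarrow> i < n \<Longrightarrow> continuous_on K (\<lambda>x. F \<omega> x i)"
  and meas: "\<And>x i. x \<in> K \<Longrightarrow> i < n \<Longrightarrow> (\<lambda>\<omega>. F \<omega> x i) \<in> borel_measurable M"
 shows "{\<omega> \<in> space M. \<exists>x\<in>K. \<forall>i<n. F \<omega> x i = 0} \<in> sets M"
proof -
 have "\<exists>k. finite k \<and> k \<subseteq> K \<and> K \<subseteq> (\<Union>x\<in>k. ball x (inverse (real (Suc m))))" for m
  using seq_compact_imp_totally_bounded[OF K[unfolded compact_eq_seq_compact_metric]] by simp
 then obtain k where k: "\<And>m. finite (k m)" "\<And>m. k m \<subseteq> K"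
  "\<And>m. K \<subseteq> (\<Union>x\<in>k m. ball x (inverse (real (Suc m))))" by metis
 define D where "D = (\<Union>m::nat. k m)"
 have D: "countable D" "D \<subseteq> K" using k by (auto simp: D_def intro: countable_finite)
 have dense: "\<exists>y\<in>D. dist y x < d" if "x \<in> K" "d > 0" for x d
 proof -
  obtain m where m: "inverse (real (Suc m)) < d" using reals_Archimedean[OF \<open>d > 0\<close>] by auto
  have "x \<in> (\<Union>y\<in>k m. ball y (inverse (real (Suc m))))" using k(3)[of m] that(1) by (rule subsetD)
  then obtain y where "y \<in> k m" "dist y x < inverse (real (Suc m))" unfolding UN_iff mem_ball by blast
  then show ?thesis using m by (auto simp: D_def intro!: bexI[of _ y])
 qed
 have eq: "(\<exists>x\<in>K. \<forall>i<n. F \<omega> x i = 0) \<longleftrightarrow> (\<forall>m. \<exists>x\<in>D. \<forall>i<n. \<bar>F \<omega> x i\<bar> < inverse (real (Suc m)))"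
  if \<omega>: "\<omega> \<in> space M" for \<omega>
 proof
  assume "\<exists>x\<in>K. \<forall>i<n. F \<omega> x i = 0"
  then obtain x where x: "x \<in> K" "\<And>i. i < n \<Longrightarrow> F \<omega> x i = 0" by auto
  show "\<forall>m. \<exists>x\<in>D. \<forall>i<n. \<bar>F \<omega> x i\<bar> < inverse (real (Suc m))"
  proof
   fix m
   have "eventually (\<lambda>y. \<bar>F \<omega> y i\<bar> < inverse (real (Suc m))) (at x within K)" if "i < n" for i
   proof -
    have "((\<lambda>y. F \<omega> y i) \<longlongrightarrow> 0) (at x within K)" using cont[OF \<omega> that] x that by (metis continuous_on_def)
    from tendstoD[OF this, of "inverse (real (Suc m))"] show ?thesis by simp
   qed
   then have "eventually (\<lambda>y. \<forall>i\<in>{..<n}. \<bar>F \<omega> y i\<bar> < inverse (real (Suc m))) (at x within K)"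
    by (intro eventually_ball_finite) auto
   then obtain d where d: "d > 0" "\<And>y. y \<in> K \<Longrightarrow> y \<noteq> x \<Longrightarrow> dist y x < d \<Longrightarrow> \<forall>i\<in>{..<n}. \<bar>F \<omega> y i\<bar> < inverse (real (Suc m))"
    unfolding eventually_at by blast
   obtain y where "y \<in> D" "dist y x < d" using dense[OF x(1) d(1)] by auto
   then show "\<exists>x\<in>D. \<forall>i<n. \<bar>F \<omega> x i\<bar> < inverse (real (Suc m))"
    using d(2)[of y] D x by (intro bexI[of _ y], cases "y = x") (auto simp del: of_nat_Suc)
  qed
 next
  assume "\<forall>m. \<exists>x\<in>D. \<forall>i<n. \<bar>F \<omega> x i\<bar> < inverse (real (Suc m))"
  then obtain y where y: "\<And>m. y m \<in> D" "\<And>m i. i < n \<Longrightarrow> \<bar>F \<omega> (y m) i\<bar> < inverse (real (Suc m))" by metis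
  have "\<forall>m. y m \<in> K" using y D by auto
  then obtain x r where x: "x \<in> K" "strict_mono r" "(y \<circ> r) \<longlonglongrightarrow> x"
   using K[unfolded compact_eq_seq_compact_metric seq_compact_def] by blast
  have "F \<omega> x i = 0" if "i < n" for i
  proof (rule LIMSEQ_unique)
   show "(\<lambda>m. F \<omega> ((y \<circ> r) m) i) \<longlonglongrightarrow> F \<omega> x i"
    using continuous_on_tendsto_compose[OF cont[OF \<omega> that] x(3) x(1)] \<open>\<forall>m. y m \<in> K\<close> by auto
   have "(\<lambda>m. F \<omega> (y m) i) \<longlonglongrightarrow> 0"
    using y(2)[OF that] by (intro Lim_null_comparison[OF _ LIMSEQ_inverse_real_of_nat])
     (auto intro!: eventuallyI less_imp_le)
   from LIMSEQ_subseq_LIMSEQ[OF this x(2)] show "(\<lambda>m. F \<omega> ((y \<circ> r) m) i) \<longlonglongrightarrow> 0" by (simp add: o_def)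
  qed
  then show "\<exists>x\<in>K. \<forall>i<n. F \<omega> x i = 0" using x by auto
 qed
 have [measurable]: "(\<lambda>\<omega>. F \<omega> x i) \<in> borel_measurable M" if "x \<in> D" "i \<in> {..<n}" for x i
  using meas that D by auto
 have "{\<omega> \<in> space M. \<forall>m. \<exists>x\<in>D. \<forall>i\<in>{..<n}. \<bar>F \<omega> x i\<bar> < inverse (real (Suc m))} \<in> sets M" using D(1)
  by (intro sets.sets_Collect_countable_All sets.sets_Collect_countable_Ex' sets.sets_Collect_finite_All
   borel_measurable_less borel_measurable_abs borel_measurable_const meas) (use D in auto)
 also have "{\<omega> \<in> space M. \<forall>m. \<exists>x\<in>D. \<forall>i\<in>{..<n}. \<bar>F \<omega> x i\<bar> < inverse (real (Suc m))} =
   {\<omega> \<in> space M. \<exists>x\<in>K. \<forall>i<n. F \<omega> x i = 0}" using eq unfolding Ball_def lessThan_iff by blast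
 finally show ?thesis .
qed

lemma zero_set_hits_measurable:
 fixes F :: "'w => 'x::metric_space => nat => real"
 assumes A: "sigma_compact A"
  and cont: "\<And>\<omega> i. \<omega> \<in> space M \<Longrightarrow> i < n \<Longrightarrow> continuous_on A (\<lambda>x. F \<omega> x i)"
  and meas: "\<And>x i. x \<in> A \<Longrightarrow> i < n \<Longrightarrow> (\<lambda>\<omega>. F \<omega> x i) \<in> borel_measurable M"
 shows "{\<omega> \<in> space M. \<exists>x\<in>A. \<forall>i<n. F \<omega> x i = 0} \<in> sets M"
proof -
 obtain K where K: "\<And>m::nat. compact (K m)" "A = (\<Union>m. K m)" using A unfolding sigma_compact_def by blast
 have "{\<omega> \<in> space M. \<exists>x\<in>A. \<forall>i<n. F \<omega> x i = 0} = (\<Union>m. {\<omega> \<in> space M. \<exists>x\<in>K m. \<forall>i<n. F \<omega> x i = 0})"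
  using K by auto
 also have "\<dots> \<in> sets M"
 proof -
  have "{\<omega> \<in> space M. \<exists>x\<in>K m. \<forall>i<n. F \<omega> x i = 0} \<in> sets M" for m
   using K(2) by (intro zero_set_hits_compact_measurable K meas continuous_on_subset[OF cont]) auto
  then show ?thesis by auto
 qed
 finally show ?thesis .
qed

abbreviation ncard :: "'a set => ennreal" where
 "ncard S \<equiv> emeasure (count_space UNIV) S"

lemma ncard_finite: "finite S \<Longrightarrow> ncard S = of_nat (card S)" by (simp add: emeasure_count_space)

lemma ennreal_eq_infinityI:
 assumes "\<And>m. of_nat m \<le> (R::ennreal)"
 shows "R = \<infinity>"
proof (rule ccontr)
 assume "R \<noteq> \<infinity>"
 then obtain m where "R < of_nat m"
  using ennreal_Ex_less_of_nat[of R] by (auto simp: less_top infinity_ennreal_def)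
 with assms[of m] show False by simp
qed

text \<open>Finitely many points are separated by disjoint basis sets, and disjoint sets that are
  hit contain distinct points. With a countable basis the count is thus a countable supremum of
  finite sums of hitting events, which makes it measurable in a parameter.\<close>

lemma ncard_eq_SUP:
 fixes S :: "'x::metric_space set"
 assumes B: "topological_basis B"
 shows "ncard S = (SUP \<F>\<in>{\<F>. \<F> \<subseteq> B \<and> finite \<F> \<and> disjoint \<F>}. \<Sum>W\<in>\<F>. of_bool (\<exists>x\<in>S. x \<in> W))" (is "_ = ?R")
proof (rule antisym)
 have sub: "of_nat (card P) \<le> ?R" if P: "finite P" "P \<subseteq> S" for P
 proof -
  \<comment> \<open>Smallest distance between points of \<open>P\<close>; the inserted 1 keeps the
    minimum defined when \<open>P\<close> has at most one point.\<close>
  define d' where "d' = Min (insert 1 ((\<lambda>(x, y). dist x y) ` {p \<in> P \<times> P. fst p \<noteq> snd p}))"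
  have fin: "finite (insert 1 ((\<lambda>(x, y). dist x y) ` {p \<in> P \<times> P. fst p \<noteq> snd p}))" using P by auto
  have d': "d' > 0" unfolding d'_def using fin by (subst Min_gr_iff) auto
  have dd: "d' \<le> dist x y" if "x \<in> P" "y \<in> P" "x \<noteq> y" for x y
   unfolding d'_def using fin that by (intro Min_le) (auto simp: image_iff)
  have "\<exists>W\<in>B. x \<in> W \<and> W \<subseteq> ball x (d' / 2)" for x
   using topological_basisE[OF B, of "ball x (d' / 2)" x] d' by (metis centre_in_ball half_gt_zero open_ball)
  then obtain W where W: "\<And>x. W x \<in> B" "\<And>x. x \<in> W x" "\<And>x. W x \<subseteq> ball x (d' / 2)" by metis
  have disj: "W x \<inter> W y = {}" if "x \<in> P" "y \<in> P" "x \<noteq> y" for x y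
  proof -
   have "False" if "z \<in> W x" "z \<in> W y" for z
   proof -
    have "dist x z < d' / 2" "dist y z < d' / 2" using W(3)[of x] W(3)[of y] that by (auto simp: mem_ball subset_iff)
    then show False using dd[OF \<open>x \<in> P\<close> \<open>y \<in> P\<close> \<open>x \<noteq> y\<close>] dist_triangle2[of x y z] by linarith
   qed
   then show ?thesis by auto
  qed
  have inj: "inj_on W P" using disj W(2) by (auto simp: inj_on_def) blast
  have "of_nat (card P) = (\<Sum>V\<in>W ` P. of_bool (\<exists>x\<in>S. x \<in> V) :: ennreal)"
  proof -
   have "(\<Sum>V\<in>W ` P. of_bool (\<exists>x\<in>S. x \<in> V) :: ennreal) = (\<Sum>x\<in>P. of_bool (\<exists>y\<in>S. y \<in> W x))"
    by (simp add: sum.reindex[OF inj])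
   also have "\<dots> = (\<Sum>x\<in>P. 1)" using W(2) P(2) by (intro sum.cong) auto
   finally show ?thesis by simp
  qed
  also have "\<dots> \<le> ?R"
  proof (intro SUP_upper)
   have "disjoint (W ` P)" using disj unfolding disjoint_def by blast
   then show "W ` P \<in> {\<F>. \<F> \<subseteq> B \<and> finite \<F> \<and> disjoint \<F>}" using P W(1) by auto
  qed
  finally show ?thesis .
 qed
 show "ncard S \<le> ?R"
 proof (cases "finite S")
  case True
  then show ?thesis using sub[of S] by (simp add: ncard_finite)
 next
  case False
  have "of_nat m \<le> ?R" for m using infinite_arbitrarily_large[OF False, of m] sub by auto
  then have "?R = \<infinity>" by (rule ennreal_eq_infinityI)
  then show ?thesis unfolding infinity_ennreal_def by (simp only: top_greatest)
 qed
 show "?R \<le> ncard S"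
 proof (rule SUP_least)
  fix \<F> assume F: "\<F> \<in> {\<F>. \<F> \<subseteq> B \<and> finite \<F> \<and> disjoint \<F>}"
  define \<G> where "\<G> = {W\<in>\<F>. \<exists>x\<in>S. x \<in> W}"
  define p where "p = (\<lambda>W. SOME x. x \<in> S \<and> x \<in> W)"
  have p: "p W \<in> S \<and> p W \<in> W" if "W \<in> \<G>" for W
  proof -
   have "\<exists>x. x \<in> S \<and> x \<in> W" using that by (auto simp: \<G>_def)
   then show ?thesis unfolding p_def by (rule someI_ex)
  qed
  have "inj_on p \<G>"
  proof (rule inj_onI)
   fix V W assume VW: "V \<in> \<G>" "W \<in> \<G>" "p V = p W"
   then have "p V \<in> V \<inter> W" using p[of V] p[of W] by simp
   moreover have "V \<in> \<F>" "W \<in> \<F>" using VW by (auto simp: \<G>_def)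
   ultimately show "V = W" using F unfolding disjoint_def by blast
  qed
  have "(\<Sum>W\<in>\<F>. of_bool (\<exists>x\<in>S. x \<in> W) :: ennreal) = of_nat (card \<G>)"
   using F by (simp add: \<G>_def of_bool_def sum.If_cases Int_def)
  also have "\<dots> = of_nat (card (p ` \<G>))" using \<open>inj_on p \<G>\<close> by (simp add: card_image)
  also have "\<dots> = ncard (p ` \<G>)" using F by (simp add: ncard_finite \<G>_def)
  also have "\<dots> \<le> ncard S" using p by (intro emeasure_mono) auto
  finally show "(\<Sum>W\<in>\<F>. of_bool (\<exists>x\<in>S. x \<in> W)) \<le> ncard S" .
 qed
qed

text \<open>The basis sets are open, so their traces on \<open>A\<close> remain sigma-compact and
  each hitting event is measurable.\<close>

lemma ncard_zero_set_measurable: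
 fixes F :: "'w => 'x::{metric_space, second_countable_topology} => nat => real"
 assumes A: "sigma_compact A"
  and cont: "\<And>\<omega> i. \<omega> \<in> space M \<Longrightarrow> i < n \<Longrightarrow> continuous_on A (\<lambda>x. F \<omega> x i)"
  and meas: "\<And>x i. x \<in> A \<Longrightarrow> i < n \<Longrightarrow> (\<lambda>\<omega>. F \<omega> x i) \<in> borel_measurable M"
 shows "(\<lambda>\<omega>. ncard {x \<in> A. \<forall>i<n. F \<omega> x i = 0}) \<in> borel_measurable M"
proof -
 obtain B :: "'x set set" where B: "countable B" "topological_basis B" using ex_countable_basis by blast
 have hit[measurable]: "{\<omega> \<in> space M. \<exists>x\<in>A \<inter> W. \<forall>i<n. F \<omega> x i = 0} \<in> sets M" if "open W" for W
  using cont meas A that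
  by (intro zero_set_hits_measurable sigma_compact_Int_open) (auto intro: continuous_on_subset)
 have "(\<lambda>\<omega>. of_bool (\<exists>x\<in>{x \<in> A. \<forall>i<n. F \<omega> x i = 0}. x \<in> W) :: ennreal) \<in> borel_measurable M" if "open W" for W
 proof -
  have "(\<lambda>\<omega>. indicator {\<omega> \<in> space M. \<exists>x\<in>A \<inter> W. \<forall>i<n. F \<omega> x i = 0} \<omega> :: ennreal) \<in> borel_measurable M"
   using hit[OF that] by simp
  then show ?thesis by (rule measurable_cong[THEN iffD1, rotated]) (auto simp: indicator_def)
 qed
 then show ?thesis unfolding ncard_eq_SUP[OF B(2)]
 proof (intro borel_measurable_SUP borel_measurable_sum)
  show "countable {\<F>. \<F> \<subseteq> B \<and> finite \<F> \<and> disjoint \<F>}"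
   by (rule countable_subset[OF _ countable_Collect_finite_subset[OF B(1)]]) auto
 qed (use B(2) in \<open>auto simp: topological_basis_open subset_iff\<close>)
qed

lemma ncard_UN_disjoint:
 assumes "disjoint_family (A :: nat => _)"
 shows "ncard {x \<in> (\<Union>m. A m). P x} = suminf (\<lambda>m. ncard {x \<in> A m. P x})"
proof -
 have eq: "{x \<in> (\<Union>m. A m). P x} = (\<Union>m. {x \<in> A m. P x})" by auto
 have "disjoint_family (\<lambda>m. {x \<in> A m. P x})" using assms unfolding disjoint_family_on_def by blast
 then show ?thesis unfolding eq by (intro suminf_emeasure[symmetric]) auto
qed

section \<open>The area formula\<close>

abbreviation adet :: "nat => (nat \<times> nat => real) => real" where
 "adet n f \<equiv> \<bar>det (mat n n f)\<bar>"

abbreviation eadet :: "nat => (nat \<times> nat => real) => ennreal" where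
 "eadet n f \<equiv> ennreal (adet n f)"

text \<open>Column elimination with the unipotent matrix \<open>U\<close> leaves a last row whose
  only entry is the pivot. The Schur complement that remains is also the derivative matrix of the
  system after one variable has been eliminated by implicit differentiation, and this is how the
  area formula uses it.\<close>

lemma abs_det_schur:
 fixes M :: "nat => nat => real"
 assumes nz: "M n n \<noteq> 0"
 shows "adet (Suc n) (\<lambda>(i, j). M i j) = \<bar>M n n\<bar> * adet n (\<lambda>(i, j). M i j - M i n * M n j / M n n)"
proof -
 define A where "A = mat (Suc n) (Suc n) (\<lambda>(i, j). M i j)"
 define U where "U = mat (Suc n) (Suc n) (\<lambda>(k, j). if k = j then 1 else if k = n then - M n j / M n n else 0)"
 define R where "R = mat (Suc n) (Suc n) (\<lambda>(i, j). if j = n then M i n else M i j - M i n * M n j / M n n)"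
 have c: "A \<in> carrier_mat (Suc n) (Suc n)" "U \<in> carrier_mat (Suc n) (Suc n)" "R \<in> carrier_mat (Suc n) (Suc n)"
  by (auto simp: A_def U_def R_def)
 have "A * U = R"
 proof (rule eq_matI)
  fix i j assume "i < dim_row R" "j < dim_col R"
  then have ij: "i < Suc n" "j < Suc n" by (auto simp: R_def)
  have "(A * U) $$ (i, j) = (\<Sum>k = 0..<Suc n. M i k * (if k = j then 1 else if k = n then - M n j / M n n else 0))"
   using ij by (simp add: A_def U_def scalar_prod_def)
  also have "\<dots> = (\<Sum>k = 0..<n. M i k * (if k = j then 1 else 0)) + M i n * (if n = j then 1 else - M n j / M n n)"
   by (subst sum.atLeastLessThan_Suc, simp, intro arg_cong2[of _ _ _ _ "(+)"] sum.cong) auto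
  also have "\<dots> = R $$ (i, j)"
   using ij by (auto simp: R_def if_distrib[of "\<lambda>x. M i _ * x"] sum.delta' cong: if_cong)
  finally show "(A * U) $$ (i, j) = R $$ (i, j)" .
 qed (auto simp: A_def U_def R_def)
 moreover have "det U = 1"
 proof -
  have "det U = prod_list (diag_mat U)" by (rule det_lower_triangular[OF _ c(2)]) (auto simp: U_def)
  also have "diag_mat U = map (\<lambda>i. 1) [0..<Suc n]"
   unfolding diag_mat_def by (intro map_cong) (auto simp: U_def)
  also have "prod_list \<dots> = 1" by (induction n) auto
  finally show ?thesis .
 qed
 ultimately have "det A = det R" using det_mult[OF c(1,2)] by simp
 also have "det R = (\<Sum>j<Suc n. R $$ (n, j) * cofactor R n j)" by (rule laplace_expansion_row[OF c(3)]) simp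
 also have "\<dots> = R $$ (n, n) * cofactor R n n"
 proof -
  have "R $$ (n, j) = 0" if "j < n" for j using that nz by (simp add: R_def)
  then show ?thesis by simp
 qed
 also have "R $$ (n, n) = M n n" by (simp add: R_def)
 also have "cofactor R n n = det (mat_delete R n n)" by (simp add: cofactor_def flip: mult_2)
 also have "mat_delete R n n = mat n n (\<lambda>(i, j). M i j - M i n * M n j / M n n)"
  by (rule eq_matI) (auto simp: mat_delete_def R_def)
 finally show ?thesis by (simp add: A_def abs_mult)
qed

text \<open>Brings the pivot variable of an elimination step into the last column; the absolute
  value absorbs the sign.\<close>

lemma abs_det_swap_columns:
 fixes f :: "nat => 'a => real"
 assumes "length cs = Suc n" "p < Suc n"
 shows "adet (Suc n) (\<lambda>(i, j). f i (cs[p := cs ! n, n := cs ! p] ! j)) =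
  adet (Suc n) (\<lambda>(i, j). f i (cs ! j))" proof (cases "p = n") case True then show ?thesis by simp next
 case False
 have eq: "mat (Suc n) (Suc n) (\<lambda>(i, j). f i (cs[p := cs ! n, n := cs ! p] ! j)) =
   swapcols p n (mat (Suc n) (Suc n) (\<lambda>(i, j). f i (cs ! j)))"
  using assms False by (intro eq_matI) (auto simp: mat_swapcols_def nth_list_update)
 show ?thesis unfolding eq using assms False by (subst det_swapcols[where n = "Suc n"]) auto
qed

lemma det_mat_sum:
 fixes D :: "nat => nat => real"
 shows "det (mat n n (\<lambda>(i, j). D i j)) = (\<Sum>p | p permutes {0..<n}. signof p * (\<Prod>i = 0..<n. D i (p i)))"
 by (subst det_def) (auto intro!: sum.cong prod.cong dest: permutes_in_image)

lemma det_measurable: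
 fixes E :: "nat => nat => 'w => real"
 assumes "\<And>i j. i < n \<Longrightarrow> j < n \<Longrightarrow> E i j \<in> borel_measurable M"
 shows "(\<lambda>x. det (mat n n (\<lambda>(i, j). E i j x))) \<in> borel_measurable M" unfolding det_mat_sum
proof (intro borel_measurable_sum borel_measurable_times borel_measurable_const borel_measurable_prod)
 fix p i assume "p \<in> {p. p permutes {0..<n}}" "i \<in> {0..<n}"
 then show "E i (p i) \<in> borel_measurable M" using permutes_in_image[of p "{0..<n}" i] by (intro assms) auto
qed

lemma eadet_measurable:
 assumes "\<And>i j. i < n \<Longrightarrow> j < n \<Longrightarrow> E i j \<in> borel_measurable M"
 shows "(\<lambda>x. eadet n (\<lambda>(i, j). E i j x)) \<in> borel_measurable M"
 by (intro measurable_compose[OF _ measurable_ennreal] borel_measurable_abs det_measurable assms)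

section \<open>Mean value estimates and critical values\<close>

lemma fun_upd_fvec: "w \<in> fvec I \<Longrightarrow> w(c := t) \<in> fvec (insert c I)" by (auto simp: PiE_def extensional_def)

lemma fun_upd_fvec_in: "x \<in> fvec I \<Longrightarrow> c \<in> I \<Longrightarrow> x(c := t) \<in> fvec I" by (auto simp: PiE_def extensional_def)

text \<open>The path from \<open>x\<close> to \<open>y\<close> changes one coordinate at a time and
  stays in the coordinate box spanned by the two points, so bounds on the partial derivatives in
  that box suffice; no total derivative is involved.\<close>

lemma mvt_box:
 fixes F :: "('a => real) => real"
 assumes "finite I" "x \<in> fvec I" "y \<in> fvec I"
  and der: "\<And>z c. z \<in> fvec I \<Longrightarrow> (\<And>d. d \<in> I \<Longrightarrow> z d \<in> closed_segment (x d) (y d)) \<Longrightarrow> c \<in> I \<Longrightarrow>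
    ((\<lambda>t. F (z(c := t))) has_real_derivative F' c z) (at (z c)) \<and> \<bar>F' c z\<bar> \<le> C c"
 shows "\<bar>F y - F x\<bar> \<le> (\<Sum>c\<in>I. C c * \<bar>y c - x c\<bar>)"
proof -
 have "\<bar>F (\<lambda>i. if i \<in> J then y i else x i) - F x\<bar> \<le> (\<Sum>c\<in>J. C c * \<bar>y c - x c\<bar>)" if "J \<subseteq> I" for J
 proof -
  have "finite J" using that assms finite_subset by blast
  then show ?thesis using that
  proof (induction J)
   case (insert c J)
   define z where "z = (\<lambda>i. if i \<in> J then y i else x i)"
   have z: "z \<in> fvec I" using assms insert.prems by (auto simp: z_def PiE_def extensional_def)
   have c: "c \<in> I" "z c = x c" using insert by (auto simp: z_def)
   have zc: "(\<lambda>i. if i \<in> insert c J then y i else x i) = z(c := y c)" by (auto simp: z_def)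
   have d: "((\<lambda>t. F (z(c := t))) has_real_derivative F' c (z(c := t))) (at t) \<and> \<bar>F' c (z(c := t))\<bar> \<le> C c"
    if t: "t \<in> closed_segment (x c) (y c)" for t
   proof -
    have "((\<lambda>s. F ((z(c := t))(c := s))) has_real_derivative F' c (z(c := t))) (at ((z(c := t)) c)) \<and> \<bar>F' c (z(c := t))\<bar> \<le> C c"
    proof (rule der)
     show "z(c := t) \<in> fvec I" using z c fun_upd_fvec_in by metis
     show "(z(c := t)) d \<in> closed_segment (x d) (y d)" if "d \<in> I" for d using t by (auto simp: z_def)
    qed (rule c)
    then show ?thesis by simp
   qed
   have "\<bar>F (z(c := y c)) - F (z(c := x c))\<bar> \<le> C c * \<bar>y c - x c\<bar>"
   proof -
    have "norm (F (z(c := y c)) - F (z(c := x c))) \<le> C c * norm (y c - x c)"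
    proof (rule field_differentiable_bound[of "closed_segment (x c) (y c)" "\<lambda>t. F (z(c := t))" "\<lambda>t. F' c (z(c := t))"])
     fix t assume "t \<in> closed_segment (x c) (y c)"
     from d[OF this] show "((\<lambda>t. F (z(c := t))) has_field_derivative F' c (z(c := t))) (at t within closed_segment (x c) (y c))"
      "norm (F' c (z(c := t))) \<le> C c" by (auto intro: has_field_derivative_at_within)
    qed auto
    then show ?thesis by simp
   qed
   moreover have "z(c := x c) = z" using c by auto
   moreover have "\<bar>F z - F x\<bar> \<le> (\<Sum>c\<in>J. C c * \<bar>y c - x c\<bar>)" using insert by (auto simp: z_def)
   ultimately show ?case unfolding zc using insert by (simp add: abs_le_iff)
  qed simp
 qed
 from this[of I] have "\<bar>F (\<lambda>i. if i \<in> I then y i else x i) - F x\<bar> \<le> (\<Sum>c\<in>I. C c * \<bar>y c - x c\<bar>)" by simp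
 moreover have "(\<lambda>i. if i \<in> I then y i else x i) = y" using assms by (auto simp: PiE_def extensional_def)
 ultimately show ?thesis by simp
qed

text \<open>A Lebesgue number for the cover of \<open>K\<close> by boxes inside \<open>V\<close>:
  the finite subcover uses half of the admissible side lengths, so that the other half remains for
  the distance from \<open>x\<close> to \<open>y\<close>.\<close>

lemma compact_uniform_box:
 fixes K :: "('a::countable => real) set"
 assumes "finite I" "compact K" "K \<subseteq> fvec I" "open V" "K \<subseteq> V"
 obtains d where "d > 0"
  "\<And>x y. x \<in> K \<Longrightarrow> y \<in> fvec I \<Longrightarrow> (\<And>i. i \<in> I \<Longrightarrow> \<bar>y i - x i\<bar> < d) \<Longrightarrow> y \<in> V"
proof -
 have "\<exists>d>0. \<forall>y\<in>fvec I. (\<forall>i\<in>I. \<bar>y i - x i\<bar> < d) \<longrightarrow> y \<in> V" if "x \<in> K" for x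
 proof -
  have "x \<in> V" "x \<in> fvec I" using that assms by auto
  from open_fvec_box[OF \<open>open V\<close> this] show ?thesis by metis
 qed
 then obtain e where e: "\<And>x. x \<in> K \<Longrightarrow> e x > 0"
  "\<And>x y. x \<in> K \<Longrightarrow> y \<in> fvec I \<Longrightarrow> (\<forall>i\<in>I. \<bar>y i - x i\<bar> < e x) \<Longrightarrow> y \<in> V" by metis
 have "K \<subseteq> (\<Union>x\<in>K. {y. \<forall>i\<in>I. \<bar>y i - x i\<bar> < e x / 2})" using e(1) by fastforce
 then obtain D where D: "D \<subseteq> K" "finite D" "K \<subseteq> (\<Union>x\<in>D. {y. \<forall>i\<in>I. \<bar>y i - x i\<bar> < e x / 2})"
 proof (rule compactE_image[OF assms(2), of K "\<lambda>x. {y. \<forall>i\<in>I. \<bar>y i - x i\<bar> < e x / 2}", rotated])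
  fix D assume "D \<subseteq> K" "finite D" "K \<subseteq> (\<Union>x\<in>D. {y. \<forall>i\<in>I. \<bar>y i - x i\<bar> < e x / 2})"
  then show thesis by (rule that)
 qed (rule open_box[OF assms(1)])
 define d where "d = Min (insert 1 ((\<lambda>x. e x / 2) ` D))"
 have d: "d > 0" "\<And>x. x \<in> D \<Longrightarrow> d \<le> e x / 2"
  unfolding d_def using D e by (auto simp: subset_iff simp del: le_divide_eq_numeral1 intro!: Min_le)
 show ?thesis
 proof (rule that[OF d(1)])
  fix x y assume x: "x \<in> K" and y: "y \<in> fvec I" and xy: "\<And>i. i \<in> I \<Longrightarrow> \<bar>y i - x i\<bar> < d"
  obtain z where z: "z \<in> D" "\<forall>i\<in>I. \<bar>x i - z i\<bar> < e z / 2" using x D(3) by blast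
  have "\<bar>y i - z i\<bar> < e z" if "i \<in> I" for i
   using xy[OF that] z(2)[rule_format, OF that] d(2)[OF z(1)] by linarith
  then show "y \<in> V" using e(2)[of z y] z D y by auto
 qed
qed

text \<open>Smoothness is expressed by continuous partial derivatives along coordinate lines, since
  the ambient function space carries no norm. In use \<open>U\<close> is a relatively open subset of
  \<open>fvec I\<close>.\<close>

definition C1_map :: "'a set => ('a => real) set => nat => (nat => ('a => real) => real) =>
  (nat => 'a => ('a => real) => real) => bool" where
 "C1_map I U n g g' \<longleftrightarrow> (\<forall>i<n. continuous_on U (g i) \<and> (\<forall>c\<in>I. continuous_on U (g' i c) \<and>
   (\<forall>x\<in>U. ((\<lambda>t. g i (x(c := t))) has_real_derivative g' i c x) (at (x c)))))"  lemma C1_mapD: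
 assumes "C1_map I U n g g'" "i < n"
 shows "continuous_on U (g i)" "c \<in> I \<Longrightarrow> continuous_on U (g' i c)"
  "c \<in> I \<Longrightarrow> x \<in> U \<Longrightarrow> ((\<lambda>t. g i (x(c := t))) has_real_derivative g' i c x) (at (x c))"
 using assms by (auto simp: C1_map_def)

lemma open_preimage_fvec:
 fixes F :: "('a::countable => real) => real"
 assumes "open W" "continuous_on (W \<inter> fvec I) F" "open T"
 shows "\<exists>V. open V \<and> V \<inter> fvec I = {x \<in> W \<inter> fvec I. F x \<in> T}"
proof -
 have "openin (top_of_set (W \<inter> fvec I)) (W \<inter> fvec I \<inter> F -` T)"
  using assms by (intro continuous_openin_preimage_gen)
 then obtain V where "open V" "W \<inter> fvec I \<inter> F -` T = W \<inter> fvec I \<inter> V" by (auto simp: openin_open)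
 then show ?thesis using assms by (intro exI[of _ "W \<inter> V"]) auto
qed

text \<open>An image set in which one coordinate varies only to second order is covered, cell by
 cell of a grid of mesh \<^term>\<open>r\<close>, by boxes of total volume \<^term>\<open>O(\<eta>)\<close>.\<close>

lemma sard_null:
 fixes g :: "nat => ('a::countable => real) => real"
 assumes I: "finite I" "card I = Suc n" and W: "open W" and K: "compact K" "K \<subseteq> W \<inter> fvec I"
  and C1: "C1_map I (W \<inter> fvec I) (Suc n) g g'"
  and crit: "\<And>x c. x \<in> K \<Longrightarrow> c \<in> I \<Longrightarrow> g' n c x = 0"
 shows "emeasure (lebR {..<Suc n}) ((\<lambda>x. \<lambda>i\<in>{..<Suc n}. g i x) ` K) = 0"
proof -
 have bdd: "\<exists>B. \<forall>x\<in>K. \<bar>F x\<bar> \<le> B" if "continuous_on K F" for F :: "_ => real"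
  using compact_imp_bounded[OF compact_continuous_image[OF that K(1)]] by (auto simp: bounded_iff)
 have contK: "continuous_on K (g' i c)" if "i < Suc n" "c \<in> I" for i c
  using continuous_on_subset[OF C1_mapD(2)[OF C1 that] K(2)] .
 define B where "B i c = (SOME b. \<forall>x\<in>K. \<bar>g' i c x\<bar> \<le> b)" for i c
 have B: "\<bar>g' i c x\<bar> \<le> B i c" if "i < Suc n" "c \<in> I" "x \<in> K" for i c x
  using someI_ex[OF bdd[OF contK[OF that(1,2)]]] that(3) unfolding B_def by blast
 \<comment> \<open>The summand 1 makes the bound on the derivatives strict and positive, so that
   \<open>K\<close> lies in the preimage of the open interval from \<open>-C\<close> to
   \<open>C\<close>.\<close>
 define C where "C = 1 + (\<Sum>i<Suc n. \<Sum>c\<in>I. \<bar>B i c\<bar>)"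
 have C: "\<bar>g' i c x\<bar> < C" if "i < Suc n" "c \<in> I" "x \<in> K" for i c x
 proof -
  have "\<bar>B i c\<bar> \<le> (\<Sum>c\<in>I. \<bar>B i c\<bar>)" using that I by (intro member_le_sum[of c I "\<lambda>c. \<bar>B i c\<bar>"]) auto
  also have "\<dots> \<le> (\<Sum>i<Suc n. \<Sum>c\<in>I. \<bar>B i c\<bar>)"
   using that by (intro member_le_sum[of i "{..<Suc n}" "\<lambda>i. \<Sum>c\<in>I. \<bar>B i c\<bar>"]) (auto intro: sum_nonneg)
  finally show ?thesis using B[OF that] by (simp add: C_def)
 qed
 have C_pos: "C > 0" unfolding C_def by (intro add_pos_nonneg sum_nonneg) auto
 have "\<forall>c\<in>I. \<exists>B. \<forall>x\<in>K. \<bar>x c\<bar> \<le> B"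
  using bdd[OF continuous_on_subset[OF continuous_on_product_coordinates subset_UNIV]] by auto
 then obtain X where X: "\<And>c x. c \<in> I \<Longrightarrow> x \<in> K \<Longrightarrow> \<bar>x c\<bar> \<le> X c" by metis
 define M where "M = 1 + (\<Sum>c\<in>I. \<bar>X c\<bar>)"
 have M: "\<bar>x c\<bar> < M" if "c \<in> I" "x \<in> K" for c x
  using X[OF that] member_le_sum[of c I "\<lambda>c. \<bar>X c\<bar>"] that I by (auto simp: M_def)
 have M_pos: "M > 0" unfolding M_def by (intro add_pos_nonneg sum_nonneg) auto
 define q where "q = real (Suc n)"
 define G where "G = (\<lambda>x. \<lambda>i\<in>{..<Suc n}. g i x)"
 \<comment> \<open>The constant collects \<open>N ^ Suc n\<close> cells of mesh \<open>r\<close>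
   with \<open>r * N = 2 * M\<close>, each mapped into a box with \<open>n\<close> sides
   \<open>2 * q * C * r\<close> and one side \<open>2 * q * \<eta> * r\<close>. The factor
   \<open>q\<close> is the number of variables, over which the mean value bound sums.\<close>
 have bound: "emeasure (lebR {..<Suc n}) (G ` K) \<le> ennreal ((4 * q * M) ^ Suc n * C ^ n * \<eta>)"
  if \<eta>: "\<eta> > 0" for \<eta>
 proof -
  have "\<exists>V. open V \<and> V \<inter> fvec I = {x \<in> W \<inter> fvec I. g' i c x \<in> {-C<..<C} \<inter> (if i = n then {-\<eta><..<\<eta>} else UNIV)}"
   if "i < Suc n" "c \<in> I" for i c
  proof -
   have "open ({-C<..<C} \<inter> (if i = n then {-\<eta><..<\<eta>} else UNIV))" by auto
   from open_preimage_fvec[OF W C1_mapD(2)[OF C1 that] this] show ?thesis .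
  qed
  note ex = this
  define V where "V i c = (SOME V. open V \<and> V \<inter> fvec I = {x \<in> W \<inter> fvec I. g' i c x \<in> {-C<..<C} \<inter> (if i = n then {-\<eta><..<\<eta>} else UNIV)})" for i c
  have V: "open (V i c)" "V i c \<inter> fvec I = {x \<in> W \<inter> fvec I. g' i c x \<in> {-C<..<C} \<inter> (if i = n then {-\<eta><..<\<eta>} else UNIV)}"
   if "i < Suc n" "c \<in> I" for i c using someI_ex[OF ex[OF that]] unfolding V_def by blast+
  have KV: "K \<subseteq> W \<inter> (\<Inter>i\<in>{..<Suc n}. \<Inter>c\<in>I. V i c)"
  proof (intro Int_greatest INT_greatest)
   fix i c assume ic: "i \<in> {..<Suc n}" "c \<in> I"
   show "K \<subseteq> V i c"
   proof
    fix x assume x: "x \<in> K"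
    have "x \<in> {x \<in> W \<inter> fvec I. g' i c x \<in> {-C<..<C} \<inter> (if i = n then {-\<eta><..<\<eta>} else UNIV)}"
     using x K(2) C[of i c x] ic crit[OF x] \<eta> by (auto simp: abs_less_iff)
    then show "x \<in> V i c" using V(2)[of i c] ic by auto
   qed
  qed (use K in auto)
  obtain \<delta> where \<delta>: "\<delta> > 0" "\<And>x y. x \<in> K \<Longrightarrow> y \<in> fvec I \<Longrightarrow> (\<And>i. i \<in> I \<Longrightarrow> \<bar>y i - x i\<bar> < \<delta>) \<Longrightarrow>
    y \<in> W \<inter> (\<Inter>i\<in>{..<Suc n}. \<Inter>c\<in>I. V i c)" proof (rule compact_uniform_box[OF I(1) K(1) _ _ KV])
   show "open (W \<inter> (\<Inter>i\<in>{..<Suc n}. \<Inter>c\<in>I. V i c))" using W V(1) I by (intro open_Int open_INT) auto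
  qed (use K in auto)
  have near: "y \<in> W \<inter> fvec I \<and> \<bar>g' i c y\<bar> \<le> (if i = n then \<eta> else C)"
   if "x \<in> K" "y \<in> fvec I" "\<And>i. i \<in> I \<Longrightarrow> \<bar>y i - x i\<bar> < \<delta>" "i < Suc n" "c \<in> I" for x y i c
  proof -
   have "y \<in> V i c \<inter> fvec I" "y \<in> W" using \<delta>(2)[OF that(1-3)] that by auto
   then show ?thesis using V(2)[OF that(4,5)] by (auto simp: abs_le_iff)
  qed
  obtain N :: nat where N: "2 * M / \<delta> < real N" using reals_Archimedean2 by blast
  then have Npos: "N > 0" using M_pos \<delta>(1) by (cases N) (auto simp: field_simps)
  define r where "r = 2 * M / real N"
  have r: "r > 0" "r < \<delta>" "r * real N = 2 * M" using Npos M_pos N \<delta>(1) by (auto simp: r_def field_simps)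
  define P where "P = (I \<rightarrow>\<^sub>E {..<N})"
  define cell where "cell p = {x \<in> K. \<forall>c\<in>I. - M + real (p c) * r \<le> x c \<and> x c \<le> - M + (real (p c) + 1) * r}" for p
  have finP: "finite P" "card P = N ^ Suc n" using I by (auto simp: P_def card_PiE intro!: finite_PiE)
  have cover: "K \<subseteq> (\<Union>p\<in>P. cell p)"
  proof
   fix x assume x: "x \<in> K"
   define p where "p = (\<lambda>c\<in>I. nat \<lfloor>(x c + M) / r\<rfloor>)"
   have pc: "real (p c) * r \<le> x c + M" "x c + M \<le> (real (p c) + 1) * r" "p c < N" if c: "c \<in> I" for c
   proof -
    have pos: "0 \<le> (x c + M) / r" using M[OF c x] r by (auto simp: abs_less_iff)
    then have e: "real (p c) = of_int \<lfloor>(x c + M) / r\<rfloor>" using c by (simp add: p_def)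
    have "of_int \<lfloor>(x c + M) / r\<rfloor> \<le> (x c + M) / r" "(x c + M) / r \<le> of_int \<lfloor>(x c + M) / r\<rfloor> + 1"
     by linarith+
    then show 1: "real (p c) * r \<le> x c + M" "x c + M \<le> (real (p c) + 1) * r"
     using r(1) unfolding e[symmetric] by (simp_all add: pos_le_divide_eq pos_divide_le_eq)
    have "real (p c) * r < real N * r" using 1(1) M[OF c x] r(3) by (simp add: abs_less_iff mult.commute)
    then show "p c < N" using r(1) by simp
   qed
   have "p \<in> P" using pc(3) by (auto simp: P_def p_def)
   moreover have "x \<in> cell p" using x pc by (auto simp: cell_def algebra_simps)
   ultimately show "x \<in> (\<Union>p\<in>P. cell p)" by auto
  qed
  define rad where "rad i = q * (if i = n then \<eta> else C) * r" for i
  define pt where "pt p = (SOME x. x \<in> cell p)" for p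
  define box where "box p = (\<Pi>\<^sub>E i\<in>{..<Suc n}. {g i (pt p) - rad i..g i (pt p) + rad i})" for p
  have rad0: "rad i \<ge> 0" for i using \<eta> C_pos r by (auto simp: rad_def q_def)
  have sub: "G ` cell p \<subseteq> box p" for p
  proof
   fix z assume "z \<in> G ` cell p"
   then obtain y where y: "y \<in> cell p" "z = G y" by auto
   have x: "pt p \<in> cell p" unfolding pt_def using y(1) by (rule someI[of "\<lambda>x. x \<in> cell p"])
   have xy: "\<bar>y c - pt p c\<bar> \<le> r" if "c \<in> I" for c
   proof -
    have "- M + real (p c) * r \<le> pt p c" "pt p c \<le> - M + (real (p c) + 1) * r"
     "- M + real (p c) * r \<le> y c" "y c \<le> - M + (real (p c) + 1) * r"
     using x y(1) that unfolding cell_def by blast+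
    then show ?thesis unfolding distrib_right mult_1 abs_le_iff by linarith
   qed
   have "\<bar>g i y - g i (pt p)\<bar> \<le> rad i" if i: "i < Suc n" for i
   proof -
    have "\<bar>g i y - g i (pt p)\<bar> \<le> (\<Sum>c\<in>I. (if i = n then \<eta> else C) * \<bar>y c - pt p c\<bar>)"
    proof (rule mvt_box[where F' = "g' i"])
     show "pt p \<in> fvec I" "y \<in> fvec I" using x y K by (auto simp: cell_def)
     fix z c assume z: "z \<in> fvec I" "\<And>d. d \<in> I \<Longrightarrow> z d \<in> closed_segment (pt p d) (y d)" "c \<in> I"
     have "\<bar>z d - pt p d\<bar> < \<delta>" if "d \<in> I" for d
      using z(2)[OF that] xy[OF that] r(2) by (auto simp: closed_segment_eq_real_ivl split: if_splits)
     then have "z \<in> W \<inter> fvec I \<and> \<bar>g' i c z\<bar> \<le> (if i = n then \<eta> else C)"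
      using near[of "pt p" z i c] x z i by (auto simp: cell_def)
     then show "((\<lambda>t. g i (z(c := t))) has_real_derivative g' i c z) (at (z c)) \<and> \<bar>g' i c z\<bar> \<le> (if i = n then \<eta> else C)"
      using C1_mapD(3)[OF C1 i z(3)] by auto
    qed (rule I)
    also have "\<dots> \<le> (\<Sum>c\<in>I. (if i = n then \<eta> else C) * r)"
     using xy \<eta> C_pos by (intro sum_mono mult_left_mono) auto
    also have "\<dots> = rad i" using I by (simp add: rad_def q_def)
    finally show ?thesis .
   qed
   then show "z \<in> box p" unfolding y(2) G_def box_def by (auto simp: abs_le_iff algebra_simps)
  qed
  have box: "box p \<in> sets (lebR {..<Suc n})" "emeasure (lebR {..<Suc n}) (box p) = ennreal ((2 * q * r) ^ Suc n * C ^ n * \<eta>)" for p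
  proof -
   show "box p \<in> sets (lebR {..<Suc n})" unfolding box_def by (intro sets_PiM_I_finite) auto
   have "emeasure (lebR {..<Suc n}) (box p) = (\<Prod>i<Suc n. emeasure lborel {g i (pt p) - rad i..g i (pt p) + rad i})"
    unfolding box_def by (intro plb.emeasure_PiM) auto
   also have "\<dots> = (\<Prod>i<Suc n. ennreal (2 * rad i))"
    using rad0 by (intro prod.cong) (auto simp: emeasure_lborel_Icc)
   also have "\<dots> = ennreal (\<Prod>i<Suc n. 2 * rad i)" using rad0 by (intro prod_ennreal) auto
   also have "(\<Prod>i<Suc n. 2 * rad i) = (2 * q * r) ^ Suc n * C ^ n * \<eta>"
    by (simp add: rad_def power_mult_distrib algebra_simps)
   finally show "emeasure (lebR {..<Suc n}) (box p) = ennreal ((2 * q * r) ^ Suc n * C ^ n * \<eta>)" .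
  qed
  have "emeasure (lebR {..<Suc n}) (G ` K) \<le> emeasure (lebR {..<Suc n}) (\<Union>p\<in>P. box p)"
  proof (rule emeasure_mono)
   show "G ` K \<subseteq> (\<Union>p\<in>P. box p)" using cover sub by blast
  qed (use box finP in auto)
  also have "\<dots> \<le> (\<Sum>p\<in>P. emeasure (lebR {..<Suc n}) (box p))"
   using box finP by (intro emeasure_subadditive_finite) auto
  also have "\<dots> = of_nat (N ^ Suc n) * ennreal ((2 * q * r) ^ Suc n * C ^ n * \<eta>)"
   by (simp add: box(2) finP del: power_Suc)
  also have "\<dots> = ennreal (real (N ^ Suc n)) * ennreal ((2 * q * r) ^ Suc n * C ^ n * \<eta>)"
   by (simp only: ennreal_of_nat_eq_real_of_nat)
  also have "\<dots> = ennreal (real (N ^ Suc n) * ((2 * q * r) ^ Suc n * C ^ n * \<eta>))"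
   by (rule ennreal_mult'[symmetric]) simp
  also have "real (N ^ Suc n) * ((2 * q * r) ^ Suc n * C ^ n * \<eta>) = (2 * q * (r * real N)) ^ Suc n * C ^ n * \<eta>"
   by (simp only: power_mult_distrib of_nat_power mult_ac)
  also have "2 * q * (r * real N) = 4 * q * M" by (simp add: r(3))
  finally show ?thesis .
 qed
 define L where "L = (4 * q * M) ^ Suc n * C ^ n"
 have Lpos: "L > 0" using M_pos C_pos unfolding L_def q_def by (intro mult_pos_pos zero_less_power) auto
 define m where "m = emeasure (lebR {..<Suc n}) (G ` K)"
 have le: "m \<le> ennreal (L * \<eta>)" if "\<eta> > 0" for \<eta> using bound[OF that] by (simp only: m_def L_def)
 obtain x where x: "x \<ge> 0" "m = ennreal x" using le[of 1] by (cases m) (auto simp: top_unique)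
 \<comment> \<open>For \<eta> = \<open>x / (2 * L)\<close> the bound is \<open>x / 2\<close>, which
   a positive measure \<open>x\<close> cannot satisfy.\<close>
 have "x = 0"
 proof (rule ccontr)
  assume "x \<noteq> 0"
  then have "x > 0" using x by simp
  then have "ennreal x \<le> ennreal (L * (x / (2 * L)))" using le[of "x / (2 * L)"] Lpos x by simp
  moreover have "L * (x / (2 * L)) = x / 2" using Lpos by simp
  ultimately show False using \<open>x > 0\<close> by (simp add: ennreal_le_iff)
 qed
 then show ?thesis using x by (simp add: m_def G_def)
qed

section \<open>One-variable calculus along a curve\<close>

text \<open>\<open>G t u\<close> is a function of two variables and \<tau> a curve. The mean value
  theorem in \<open>u\<close> between \<open>\<tau> t0\<close> and \<open>\<tau> t\<close> produces
  the factor \<open>q\<close>, and setting it to \<open>b\<close> where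
  \<open>\<tau> t = \<tau> t0\<close> keeps the product identity valid there. The chain rule and
  implicit differentiation then need partial derivatives only.\<close>

lemma curve_quotient:
 fixes G G2 :: "real => real => real"
 assumes der: "eventually (\<lambda>t. \<forall>u\<in>closed_segment (\<tau> t0) (\<tau> t). (G t has_real_derivative G2 t u) (at u)) (at t0)"
  and lim: "\<And>e. e > 0 \<Longrightarrow> eventually (\<lambda>t. \<forall>u\<in>closed_segment (\<tau> t0) (\<tau> t). \<bar>G2 t u - b\<bar> < e) (at t0)"
 obtains q where "(q \<longlongrightarrow> b) (at t0)" "eventually (\<lambda>t. G t (\<tau> t) - G t (\<tau> t0) = q t * (\<tau> t - \<tau> t0)) (at t0)"
proof -
 define q where "q t = (if \<tau> t = \<tau> t0 then b else (G t (\<tau> t) - G t (\<tau> t0)) / (\<tau> t - \<tau> t0))" for t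
 have "(q \<longlongrightarrow> b) (at t0)"
 proof (rule tendstoI)
  fix e :: real assume e: "e > 0"
  show "eventually (\<lambda>t. dist (q t) b < e) (at t0)" using der lim[OF e]
  proof eventually_elim
   case (elim t)
   show ?case
   proof (cases "\<tau> t = \<tau> t0")
    case False
    define a where "a = min (\<tau> t) (\<tau> t0)"
    define c where "c = max (\<tau> t) (\<tau> t0)"
    have ac: "a < c" "\<And>u. a \<le> u \<Longrightarrow> u \<le> c \<Longrightarrow> u \<in> closed_segment (\<tau> t0) (\<tau> t)"
     using False by (auto simp: a_def c_def closed_segment_eq_real_ivl)
    obtain z where z: "z > a" "z < c" "G t c - G t a = (c - a) * G2 t z"
     using MVT2[OF ac(1), of "G t" "G2 t"] elim ac by blast
    have "q t = G2 t z"
    proof (cases "\<tau> t < \<tau> t0")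
     case True
     then show ?thesis using z(3) by (simp add: q_def a_def c_def min_def max_def field_simps)
    next
     case F: False
     then show ?thesis using z(3) False by (simp add: q_def a_def c_def min_def max_def field_simps)
    qed
    then show ?thesis using elim ac(2)[of z] z by (auto simp: dist_real_def)
   qed (use e in \<open>simp add: q_def\<close>)
  qed
 qed
 moreover have "G t (\<tau> t) - G t (\<tau> t0) = q t * (\<tau> t - \<tau> t0)" for t by (simp add: q_def)
 ultimately show ?thesis using that[of q] by simp
qed

text \<open>Along the level set the increment \<open>G t (\<tau> t0) - G t0 (\<tau> t0)\<close> is
  balanced by \<open>q t * (\<tau> t - \<tau> t0)\<close>. Division by \<open>t - t0\<close> and by
  \<open>q t\<close>, which tends to \<open>b \<noteq> 0\<close>, gives the limit.\<close>

lemma curve_implicit_deriv: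
 fixes G G2 :: "real => real => real"
 assumes "eventually (\<lambda>t. \<forall>u\<in>closed_segment (\<tau> t0) (\<tau> t). (G t has_real_derivative G2 t u) (at u)) (at t0)"
  and "\<And>e. e > 0 \<Longrightarrow> eventually (\<lambda>t. \<forall>u\<in>closed_segment (\<tau> t0) (\<tau> t). \<bar>G2 t u - b\<bar> < e) (at t0)"
  and a: "((\<lambda>t. G t (\<tau> t0)) has_real_derivative a) (at t0)"
  and b: "b \<noteq> 0" and const: "eventually (\<lambda>t. G t (\<tau> t) = G t0 (\<tau> t0)) (at t0)"
 shows "(\<tau> has_real_derivative - a / b) (at t0)"
proof -
 obtain q where q: "(q \<longlongrightarrow> b) (at t0)" "eventually (\<lambda>t. G t (\<tau> t) - G t (\<tau> t0) = q t * (\<tau> t - \<tau> t0)) (at t0)"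
  using curve_quotient[OF assms(1,2)] by blast
 have "eventually (\<lambda>t. q t \<noteq> 0) (at t0)" by (rule tendsto_imp_eventually_ne[OF q(1) b])
 have lim: "((\<lambda>t. - ((G t (\<tau> t0) - G t0 (\<tau> t0)) / (t - t0)) / q t) \<longlongrightarrow> - a / b) (at t0)"
  using a[unfolded has_field_derivative_iff] by (intro tendsto_intros q b)
 show ?thesis unfolding has_field_derivative_iff
 proof (rule Lim_transform_eventually[OF lim])
  show "eventually (\<lambda>t. - ((G t (\<tau> t0) - G t0 (\<tau> t0)) / (t - t0)) / q t = (\<tau> t - \<tau> t0) / (t - t0)) (at t0)"
   using q(2) const \<open>eventually (\<lambda>t. q t \<noteq> 0) (at t0)\<close>
  proof eventually_elim
   case (elim t)
   then have "\<tau> t - \<tau> t0 = - (G t (\<tau> t0) - G t0 (\<tau> t0)) / q t" by (simp add: field_simps)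
   then have "(\<tau> t - \<tau> t0) / (t - t0) = (- (G t (\<tau> t0) - G t0 (\<tau> t0)) / q t) / (t - t0)" by (rule arg_cong)
   then show ?case by (simp only: minus_divide_left divide_divide_eq_left mult.commute)
  qed
 qed
qed

lemma curve_chain_deriv:
 fixes G G2 :: "real => real => real"
 assumes "eventually (\<lambda>t. \<forall>u\<in>closed_segment (\<tau> t0) (\<tau> t). (G t has_real_derivative G2 t u) (at u)) (at t0)"
  and "\<And>e. e > 0 \<Longrightarrow> eventually (\<lambda>t. \<forall>u\<in>closed_segment (\<tau> t0) (\<tau> t). \<bar>G2 t u - b\<bar> < e) (at t0)"
  and a: "((\<lambda>t. G t (\<tau> t0)) has_real_derivative a) (at t0)"
  and \<tau>: "(\<tau> has_real_derivative \<tau>') (at t0)"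
 shows "((\<lambda>t. G t (\<tau> t)) has_real_derivative a + b * \<tau>') (at t0)"
proof -
 obtain q where q: "(q \<longlongrightarrow> b) (at t0)" "eventually (\<lambda>t. G t (\<tau> t) - G t (\<tau> t0) = q t * (\<tau> t - \<tau> t0)) (at t0)"
  using curve_quotient[OF assms(1,2)] by blast
 have lim: "((\<lambda>t. (G t (\<tau> t0) - G t0 (\<tau> t0)) / (t - t0) + q t * ((\<tau> t - \<tau> t0) / (t - t0))) \<longlongrightarrow> a + b * \<tau>') (at t0)"
  using a[unfolded has_field_derivative_iff] \<tau>[unfolded has_field_derivative_iff] by (intro tendsto_intros q)
 show ?thesis unfolding has_field_derivative_iff
 proof (rule Lim_transform_eventually[OF lim])
  show "eventually (\<lambda>t. (G t (\<tau> t0) - G t0 (\<tau> t0)) / (t - t0) + q t * ((\<tau> t - \<tau> t0) / (t - t0)) =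
    (G t (\<tau> t) - G t0 (\<tau> t0)) / (t - t0)) (at t0)" using q(2) proof eventually_elim case (elim t)
   then have "G t (\<tau> t) - G t0 (\<tau> t0) = (G t (\<tau> t0) - G t0 (\<tau> t0)) + q t * (\<tau> t - \<tau> t0)" by simp
   then show ?case by (simp only: add_divide_distrib times_divide_eq_right)
  qed
 qed
qed

lemma ncard_bij_betw:
 assumes "bij_betw f S T"
 shows "ncard S = ncard T"
 using bij_betw_same_card[OF assms] bij_betw_finite[OF assms] by (simp add: emeasure_count_space)

text \<open>Multiplication by the sign \<sigma> turns a decreasing substitution into an increasing
  one. The support condition lets the left integral run over the whole line.\<close>

lemma nn_integral_substitution_sign:
 fixes f :: "real => ennreal"
 assumes f: "f \<in> borel_measurable borel" and ab: "a < b" and \<sigma>: "\<sigma> = 1 \<or> \<sigma> = (-1::real)"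
  and der: "\<And>t. t \<in> {a..b} \<Longrightarrow> (G has_real_derivative G' t) (at t)"
  and cont: "continuous_on {a..b} G'"
  and pos: "\<And>t. t \<in> {a..b} \<Longrightarrow> \<sigma> * G' t > 0"
  and supp: "\<And>s. f s \<noteq> 0 \<Longrightarrow> s \<in> G ` {a..b}"
 shows "(\<integral>\<^sup>+s. f s \<partial>lborel) = (\<integral>\<^sup>+t. f (G t) * ennreal \<bar>G' t\<bar> * indicator {a..b} t \<partial>lborel)"
proof -
 have \<sigma>2: "\<sigma> * \<sigma> = 1" "\<bar>\<sigma>\<bar> = 1" using \<sigma> by auto
 have ivl: "\<sigma> * G t \<in> {\<sigma> * G a..\<sigma> * G b}" if t: "t \<in> {a..b}" for t
 proof -
  have inc: "\<sigma> * G u \<le> \<sigma> * G v" if "a \<le> u" "u \<le> v" "v \<le> b" for u v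
  proof (rule DERIV_nonneg_imp_nondecreasing[OF \<open>u \<le> v\<close>])
   fix x assume "u \<le> x" "x \<le> v"
   then have "x \<in> {a..b}" using that by auto
   then show "\<exists>y. ((\<lambda>u. \<sigma> * G u) has_real_derivative y) (at x) \<and> 0 \<le> y"
    using der pos[of x] by (intro exI[of _ "\<sigma> * G' x"] conjI DERIV_cmult) auto
  qed
  show ?thesis using inc[of a t] inc[of t b] t by auto
 qed
 have "(\<integral>\<^sup>+s. f s \<partial>lborel) = (\<integral>\<^sup>+s. f (\<sigma> * s) \<partial>lborel)" using nn_integral_real_affine[OF f, of \<sigma> 0] \<sigma> by auto
 also have "\<dots> = (\<integral>\<^sup>+s. f (\<sigma> * s) * indicator {\<sigma> * G a..\<sigma> * G b} s \<partial>lborel)"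
 proof (rule nn_integral_cong)
  fix s
  show "f (\<sigma> * s) = f (\<sigma> * s) * indicator {\<sigma> * G a..\<sigma> * G b} s"
  proof (cases "f (\<sigma> * s) = 0")
   case False
   then obtain t where t: "t \<in> {a..b}" "\<sigma> * s = G t" using supp by blast
   have "s = \<sigma> * (\<sigma> * s)" using \<sigma>2 by (simp flip: mult.assoc)
   then have "s = \<sigma> * G t" using t by simp
   then show ?thesis using ivl[OF t(1)] by simp
  qed simp
 qed
 also have "\<dots> = (\<integral>\<^sup>+t. f (\<sigma> * (\<sigma> * G t)) * ennreal (\<sigma> * G' t) * indicator {a..b} t \<partial>lborel)"
 proof (rule nn_integral_substitution_aux[where f = "\<lambda>s. f (\<sigma> * s)"])
  show "(\<lambda>s. f (\<sigma> * s)) \<in> borel_measurable borel" using f by measurable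
  show "continuous_on {a..b} (\<lambda>t. \<sigma> * G' t)" using cont by (intro continuous_intros)
  show "\<And>x. x \<in> {a..b} \<Longrightarrow> ((\<lambda>t. \<sigma> * G t) has_real_derivative \<sigma> * G' x) (at x)"
   using der by (intro DERIV_cmult) auto
  show "\<And>x. x \<in> {a..b} \<Longrightarrow> 0 \<le> \<sigma> * G' x" using pos less_imp_le by blast
 qed (use ab in auto)
 also have "\<dots> = (\<integral>\<^sup>+t. f (G t) * ennreal \<bar>G' t\<bar> * indicator {a..b} t \<partial>lborel)"
 proof (rule nn_integral_cong)
  fix t
  have e: "\<sigma> * (\<sigma> * G t) = G t" using \<sigma>2 by (simp flip: mult.assoc)
  have "\<sigma> * G' t = \<bar>G' t\<bar>" if "t \<in> {a..b}" using pos[OF that] \<sigma> by auto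
  then show "f (\<sigma> * (\<sigma> * G t)) * ennreal (\<sigma> * G' t) * indicator {a..b} t =
    f (G t) * ennreal \<bar>G' t\<bar> * indicator {a..b} t" unfolding e by (cases "t \<in> {a..b}") simp_all qed
 finally show ?thesis .
qed

section \<open>The area formula with a weight on the target\<close>

text \<open>The weight \<open>h\<close> belongs to the notion because the induction fixes the last
  target coordinate, and a slice of a weight is again a weight. The list \<open>cs\<close> fixes an
  order of the columns.\<close>

definition area_holds :: "nat => 'a set => 'a list => (nat => ('a => real) => real) =>
  (nat => 'a => ('a => real) => real) => ('a => real) set => bool" where
 "area_holds n I cs g g' A \<longleftrightarrow> (\<forall>h\<in>borel_measurable (lebR {..<n}).
   (\<integral>\<^sup>+y. ncard {x \<in> A. \<forall>i<n. g i x = y i} * h y \<partial>lebR {..<n}) =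
   (\<integral>\<^sup>+x. indicator A x * eadet n (\<lambda>(i, j). g' i (cs ! j) x) * h (\<lambda>i\<in>{..<n}. g i x) \<partial>lebR I))" 
lemma area_count_measurable:
 fixes g :: "nat => ('a::countable => real) => real"
 assumes "sigma_compact A" "\<And>i. i < n \<Longrightarrow> continuous_on A (g i)"
 shows "(\<lambda>y. ncard {x \<in> A. \<forall>i<n. g i x = y i}) \<in> borel_measurable (lebR {..<n})"
proof -
 have "(\<lambda>y. ncard {x \<in> A. \<forall>i<n. g i x - y i = 0}) \<in> borel_measurable (lebR {..<n})"
  using assms by (intro ncard_zero_set_measurable) (auto intro!: continuous_intros)
 then show ?thesis by simp
qed

lemma area_integrand_measurable:
 fixes g :: "nat => ('a::countable => real) => real"
 assumes A: "sigma_compact A" "A \<subseteq> fvec I"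
  and g: "\<And>i. i < m \<Longrightarrow> continuous_on A (g i)"
  and E: "\<And>i j. i < n \<Longrightarrow> j < n \<Longrightarrow> continuous_on A (E i j)"
  and h: "h \<in> borel_measurable (lebR {..<m})"
 shows "(\<lambda>x. indicator A x * eadet n (\<lambda>(i, j). E i j x) * h (\<lambda>i\<in>{..<m}. g i x)) \<in> borel_measurable (lebR I)"
proof -
 have bA: "A \<in> sets borel" using A(1) by (rule sigma_compact_borel)
 then have sA: "A \<in> sets (lebR I)" using borel_Int_lebR[of A I] A(2) by (simp add: Int_absorb2)
 have [measurable]: "(\<lambda>x. if x \<in> A then E i j x else 0) \<in> borel_measurable (lebR I)" if "i < n" "j < n" for i j
  using lebR_measurable_if[OF bA E[OF that]] .
 have g'[measurable]: "(\<lambda>x. if x \<in> A then g i x else 0) \<in> borel_measurable (lebR I)" if "i < m" for i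
  using lebR_measurable_if[OF bA g[OF that]] .
 have 1: "(\<lambda>x. det (mat n n (\<lambda>(i, j). if x \<in> A then E i j x else 0))) \<in> borel_measurable (lebR I)"
  by (intro det_measurable) auto
 have 2: "(\<lambda>x. \<lambda>i\<in>{..<m}. if x \<in> A then g i x else 0) \<in> lebR I \<rightarrow>\<^sub>M lebR {..<m}"
  using g' by (intro measurable_restrict) auto
 have "(\<lambda>x. indicator A x * eadet n (\<lambda>(i, j). if x \<in> A then E i j x else 0) *
   h (\<lambda>i\<in>{..<m}. if x \<in> A then g i x else 0)) \<in> borel_measurable (lebR I)"
  using sA 1 measurable_compose[OF 2 h] by measurable
 also have "(\<lambda>x. indicator A x * eadet n (\<lambda>(i, j). if x \<in> A then E i j x else 0) *
   h (\<lambda>i\<in>{..<m}. if x \<in> A then g i x else 0)) =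
   (\<lambda>x. indicator A x * eadet n (\<lambda>(i, j). E i j x) * h (\<lambda>i\<in>{..<m}. g i x))"
  by (auto simp: fun_eq_iff indicator_def)
 finally show ?thesis .
qed

text \<open>Both sides are countably additive in the set, so the formula may be proved separately on
  pieces of different nature.\<close>

lemma area_holds_UN:
 fixes g :: "nat => ('a::countable => real) => real"
 assumes A: "\<And>m. sigma_compact (A m)" "\<And>m. A m \<subseteq> U" "disjoint_family (A :: nat => _)"
  and U: "U \<subseteq> fvec I" and cs: "set cs \<subseteq> I" "length cs = n"
  and C1: "C1_map I U n g g'"
  and ar: "\<And>m. area_holds n I cs g g' (A m)"
 shows "area_holds n I cs g g' (\<Union>m. A m)" unfolding area_holds_def
proof
 fix h :: "(nat => real) => ennreal" assume h[measurable]: "h \<in> borel_measurable (lebR {..<n})"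
 have g: "continuous_on (A m) (g i)" if "i < n" for i m
  using C1_mapD(1)[OF C1 that] A(2) by (rule continuous_on_subset)
 have g': "continuous_on (A m) (g' i (cs ! j))" if "i < n" "j < n" for i j m
  using C1_mapD(2)[OF C1 that(1)] A(2) cs that by (metis continuous_on_subset nth_mem subsetD)
 have [measurable]: "(\<lambda>y. ncard {x \<in> A m. \<forall>i<n. g i x = y i}) \<in> borel_measurable (lebR {..<n})" for m
  using A(1) g by (rule area_count_measurable)
 have meas: "(\<lambda>x. indicator (A m) x * eadet n (\<lambda>(i, j). g' i (cs ! j) x) * h (\<lambda>i\<in>{..<n}. g i x)) \<in> borel_measurable (lebR I)" for m
  using A(1) subset_trans[OF A(2) U] g g' h by (intro area_integrand_measurable)
 have "(\<integral>\<^sup>+y. ncard {x \<in> \<Union> (range A). \<forall>i<n. g i x = y i} * h y \<partial>lebR {..<n}) =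
   (\<integral>\<^sup>+y. suminf (\<lambda>m. ncard {x \<in> A m. \<forall>i<n. g i x = y i} * h y) \<partial>lebR {..<n})"
  unfolding ncard_UN_disjoint[OF A(3)] by (simp add: ennreal_suminf_multc)
 also have "\<dots> = suminf (\<lambda>m. \<integral>\<^sup>+y. ncard {x \<in> A m. \<forall>i<n. g i x = y i} * h y \<partial>lebR {..<n})"
  by (intro nn_integral_suminf) measurable
 also have "\<dots> = suminf (\<lambda>m. \<integral>\<^sup>+x. indicator (A m) x * eadet n (\<lambda>(i, j). g' i (cs ! j) x) * h (\<lambda>i\<in>{..<n}. g i x) \<partial>lebR I)"
  using ar h by (simp add: area_holds_def)
 also have "\<dots> = (\<integral>\<^sup>+x. suminf (\<lambda>m. indicator (A m) x * eadet n (\<lambda>(i, j). g' i (cs ! j) x) * h (\<lambda>i\<in>{..<n}. g i x)) \<partial>lebR I)"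
  using meas by (intro nn_integral_suminf[symmetric])
 also have "\<dots> = (\<integral>\<^sup>+x. indicator (\<Union> (range A)) x * eadet n (\<lambda>(i, j). g' i (cs ! j) x) * h (\<lambda>i\<in>{..<n}. g i x) \<partial>lebR I)"
  unfolding suminf_indicator[OF A(3), symmetric] by (simp add: ennreal_suminf_multc)
 finally show "(\<integral>\<^sup>+y. ncard {x \<in> \<Union> (range A). \<forall>i<n. g i x = y i} * h y \<partial>lebR {..<n}) =
   (\<integral>\<^sup>+x. indicator (\<Union> (range A)) x * eadet n (\<lambda>(i, j). g' i (cs ! j) x) * h (\<lambda>i\<in>{..<n}. g i x) \<partial>lebR I)" .
qed

lemma continuous_on_restrict_vec: "continuous_on S (\<lambda>x :: 'a => real. restrict x I)"
proof (rule continuous_on_coordinatewise_then_product)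
 fix i
 show "continuous_on S (\<lambda>x :: 'a => real. restrict x I i)"
 proof (cases "i \<in> I")
  case True
  then show ?thesis by (simp add: continuous_on_subset[OF continuous_on_product_coordinates subset_UNIV])
 qed simp
qed

lemma continuous_on_upd_vec: "continuous_on S (\<lambda>w :: 'a => real. w(c := t))"
proof (rule continuous_on_coordinatewise_then_product)
 fix i
 show "continuous_on S (\<lambda>w :: 'a => real. (w(c := t)) i)"
  by (cases "i = c") (auto intro: continuous_on_subset[OF continuous_on_product_coordinates subset_UNIV])
qed

lemma restrict_upd_vec: "w \<in> fvec I \<Longrightarrow> c \<notin> I \<Longrightarrow> restrict (w(c := t)) I = w"
 by (auto simp: fun_eq_iff PiE_def extensional_def)

lemma upd_restrict_vec: "x \<in> fvec (insert c I) \<Longrightarrow> c \<notin> I \<Longrightarrow> (restrict x I)(c := x c) = x"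
 by (auto simp: fun_eq_iff PiE_def extensional_def)

section \<open>Elimination of one variable\<close>

text \<open>On the closed coordinate box the partial derivative of \<open>g n\<close> in direction
  \<open>c\<close> has the constant sign \<sigma>. Hence \<Theta> can trade the coordinate
  \<open>c\<close> for the value of \<open>g n\<close>, and the remaining equations are studied on
  the level sets of \<open>g n\<close>, parametrized by the other coordinates.\<close>

locale area_box =
 fixes n :: nat and I' :: "'a::countable set" and c :: 'a and W :: "('a => real) set"
  and g :: "nat => ('a => real) => real" and g' :: "nat => 'a => ('a => real) => real"
  and \<alpha> \<beta> :: "'a => real" and \<sigma> :: real
 assumes fin: "finite I'" and c: "c \<notin> I'" and W: "open W"
  and \<alpha>\<beta>: "\<And>d. d \<in> insert c I' \<Longrightarrow> \<alpha> d < \<beta> d"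
  and BW: "{x \<in> fvec (insert c I'). \<forall>d\<in>insert c I'. \<alpha> d \<le> x d \<and> x d \<le> \<beta> d} \<subseteq> W"
  and C1: "C1_map (insert c I') (W \<inter> fvec (insert c I')) (Suc n) g g'"
  and \<sigma>: "\<sigma> = 1 \<or> \<sigma> = -1"
  and pos: "\<And>x. x \<in> {x \<in> fvec (insert c I'). \<forall>d\<in>insert c I'. \<alpha> d \<le> x d \<and> x d \<le> \<beta> d} \<Longrightarrow> \<sigma> * g' n c x > 0"
begin

abbreviation "I \<equiv> insert c I'"
definition "B = {x \<in> fvec I. \<forall>d\<in>I. \<alpha> d \<le> x d \<and> x d \<le> \<beta> d}"
definition "Bo = {x \<in> fvec I. \<forall>d\<in>I. \<alpha> d < x d \<and> x d < \<beta> d}"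
definition "\<Theta> x = (g n x, restrict x I')"
definition "\<Psi> = inv_into B \<Theta>"

lemma BU: "B \<subseteq> W \<inter> fvec I" using BW by (auto simp: B_def)
lemma Bo_B: "Bo \<subseteq> B" by (auto simp: B_def Bo_def less_imp_le)
lemma compact_B: "compact B" unfolding B_def by (rule compact_box)
lemma posB: "x \<in> B \<Longrightarrow> \<sigma> * g' n c x > 0" using pos by (simp add: B_def)

lemma sections_mono:
 assumes w: "w \<in> fvec I'" "\<And>d. d \<in> I' \<Longrightarrow> \<alpha> d \<le> w d \<and> w d \<le> \<beta> d"
 shows "t \<in> {\<alpha> c..\<beta> c} \<Longrightarrow> w(c := t) \<in> B"
  and "t \<in> {\<alpha> c..\<beta> c} \<Longrightarrow> ((\<lambda>t. g n (w(c := t))) has_real_derivative g' n c (w(c := t))) (at t)"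
  and "\<alpha> c \<le> s \<Longrightarrow> s < t \<Longrightarrow> t \<le> \<beta> c \<Longrightarrow> \<sigma> * g n (w(c := s)) < \<sigma> * g n (w(c := t))"
proof -
 show 1: "w(c := t) \<in> B" if "t \<in> {\<alpha> c..\<beta> c}" for t using that w c fun_upd_fvec[OF w(1)] by (auto simp: B_def)
 show 2: "((\<lambda>t. g n (w(c := t))) has_real_derivative g' n c (w(c := t))) (at t)" if "t \<in> {\<alpha> c..\<beta> c}" for t
  using C1_mapD(3)[OF C1, of n c "w(c := t)"] 1[OF that] BU by auto
 show "\<sigma> * g n (w(c := s)) < \<sigma> * g n (w(c := t))" if "\<alpha> c \<le> s" "s < t" "t \<le> \<beta> c" for s t
 proof (rule DERIV_pos_imp_increasing[OF \<open>s < t\<close>])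
  fix x assume "s \<le> x" "x \<le> t"
  then have x: "x \<in> {\<alpha> c..\<beta> c}" using that by auto
  show "\<exists>y. ((\<lambda>t. \<sigma> * g n (w(c := t))) has_real_derivative y) (at x) \<and> 0 < y"
   using DERIV_cmult[OF 2[OF x], of \<sigma>] posB[OF 1[OF x]] by blast
 qed
qed

lemma sect_B:
 assumes "x \<in> B"
 shows "restrict x I' \<in> fvec I'" "\<And>d. d \<in> I' \<Longrightarrow> \<alpha> d \<le> restrict x I' d \<and> restrict x I' d \<le> \<beta> d"
  "x c \<in> {\<alpha> c..\<beta> c}" "(restrict x I')(c := x c) = x" using assms c by (auto simp: B_def upd_restrict_vec)

lemma inj_\<Theta>: "inj_on \<Theta> B"
proof (rule inj_onI)
 fix x x' assume x: "x \<in> B" "x' \<in> B" "\<Theta> x = \<Theta> x'"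
 define w where "w = restrict x I'"
 have w: "w \<in> fvec I'" "\<And>d. d \<in> I' \<Longrightarrow> \<alpha> d \<le> w d \<and> w d \<le> \<beta> d" using sect_B(1,2)[OF x(1)] by (auto simp: w_def)
 have e: "x = w(c := x c)" "x' = w(c := x' c)"
  using sect_B(4)[OF x(1)] sect_B(4)[OF x(2)] x(3) by (auto simp: w_def \<Theta>_def)
 have "\<sigma> * g n (w(c := x c)) = \<sigma> * g n (w(c := x' c))" using x(3) e by (simp add: \<Theta>_def)
 then have "x c = x' c"
  using sections_mono(3)[OF w, of "x c" "x' c"] sections_mono(3)[OF w, of "x' c" "x c"] sect_B(3)[OF x(1)] sect_B(3)[OF x(2)]
  by (cases "x c" "x' c" rule: linorder_cases) auto
 then show "x = x'" using e by metis
qed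

lemma cont_\<Theta>: "continuous_on B \<Theta>"
proof -
 have "continuous_on B (g n)" using C1_mapD(1)[OF C1, of n] BU by (auto intro: continuous_on_subset)
 then show ?thesis unfolding \<Theta>_def by (intro continuous_on_Pair continuous_on_restrict_vec)
qed

lemma \<Psi>_\<Theta>: "x \<in> B \<Longrightarrow> \<Psi> (\<Theta> x) = x" unfolding \<Psi>_def using inj_\<Theta> by (rule inv_into_f_f)

text \<open>Compactness of the closed box yields continuity of the inverse, without an inverse
  function theorem.\<close>

lemma cont_\<Psi>: "continuous_on (\<Theta> ` B) \<Psi>" by (rule continuous_on_inv[OF cont_\<Theta> compact_B]) (auto simp: \<Psi>_\<Theta>)

lemma \<Psi>:
 assumes "(s, w) \<in> \<Theta> ` B"
 shows "\<Psi> (s, w) \<in> B" "g n (\<Psi> (s, w)) = s" "restrict (\<Psi> (s, w)) I' = w" "\<Psi> (s, w) = w(c := \<Psi> (s, w) c)"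
proof -
 obtain x where x: "x \<in> B" "(s, w) = \<Theta> x" using assms by auto
 then have e: "\<Psi> (s, w) = x" by (simp add: \<Psi>_\<Theta>)
 then show "\<Psi> (s, w) \<in> B" "g n (\<Psi> (s, w)) = s" "restrict (\<Psi> (s, w)) I' = w" using x by (auto simp: \<Theta>_def)
 then show "\<Psi> (s, w) = w(c := \<Psi> (s, w) c)" using sect_B(4)[OF x(1)] e by simp
qed

text \<open>The parameters for which the level \<open>s\<close> is attained strictly inside the open
  box: by monotonicity along \<open>c\<close> it is enough to compare \<open>s\<close> with the two
  end values. The strict inequalities make the set relatively open, as the induction hypothesis
  demands.\<close>

definition "V s = {w \<in> fvec I'. (\<forall>d\<in>I'. \<alpha> d < w d \<and> w d < \<beta> d) \<and>
  \<sigma> * g n (w(c := \<alpha> c)) < \<sigma> * s \<and> \<sigma> * s < \<sigma> * g n (w(c := \<beta> c))}"  lemma V_Theta: assumes w: "w \<in> V s"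
 shows "(s, w) \<in> \<Theta> ` B" "\<Psi> (s, w) \<in> Bo"
proof -
 have w': "w \<in> fvec I'" "\<And>d. d \<in> I' \<Longrightarrow> \<alpha> d \<le> w d \<and> w d \<le> \<beta> d" using w by (auto simp: V_def less_imp_le)
 have ab: "\<alpha> c \<le> \<beta> c" using \<alpha>\<beta>[of c] by simp
 have "\<exists>t\<ge>\<alpha> c. t \<le> \<beta> c \<and> \<sigma> * g n (w(c := t)) = \<sigma> * s"
 proof (rule IVT'[OF _ _ ab])
  have "continuous_on {\<alpha> c..\<beta> c} (\<lambda>t. g n (w(c := t)))"
   using sections_mono(2)[OF w'] by (intro DERIV_continuous_on) (auto intro: has_field_derivative_at_within)
  then show "continuous_on {\<alpha> c..\<beta> c} (\<lambda>t. \<sigma> * g n (w(c := t)))" by (intro continuous_intros)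
 qed (use w in \<open>auto simp: V_def\<close>)
 then obtain t where t: "t \<in> {\<alpha> c..\<beta> c}" "g n (w(c := t)) = s" using \<sigma> by auto
 have e: "\<Theta> (w(c := t)) = (s, w)" using t w' c by (simp add: \<Theta>_def restrict_upd_vec)
 then show 1: "(s, w) \<in> \<Theta> ` B" using sections_mono(1)[OF w' t(1)] by (metis image_eqI)
 have p: "\<Psi> (s, w) = w(c := t)" using \<Psi>_\<Theta>[OF sections_mono(1)[OF w' t(1)]] e by simp
 have "t \<noteq> \<alpha> c" "t \<noteq> \<beta> c" using w t by (auto simp: V_def)
 then show "\<Psi> (s, w) \<in> Bo" using w c t(1) fun_upd_fvec[OF w'(1)] unfolding p by (auto simp: Bo_def V_def)
qed

lemma Bo_V:
 assumes x: "x \<in> Bo"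
 shows "restrict x I' \<in> V (g n x)"
proof -
 have xB: "x \<in> B" using x Bo_B by auto
 define w where "w = restrict x I'"
 have w: "w \<in> fvec I'" "\<And>d. d \<in> I' \<Longrightarrow> \<alpha> d \<le> w d \<and> w d \<le> \<beta> d" using sect_B(1,2)[OF xB] by (auto simp: w_def)
 have e: "x = w(c := x c)" using sect_B(4)[OF xB] by (simp add: w_def)
 have "\<alpha> c < x c" "x c < \<beta> c" using x by (auto simp: Bo_def)
 then have "\<sigma> * g n (w(c := \<alpha> c)) < \<sigma> * g n (w(c := x c))" "\<sigma> * g n (w(c := x c)) < \<sigma> * g n (w(c := \<beta> c))"
  using sections_mono(3)[OF w] by auto
 then show ?thesis using x w(1) e unfolding V_def w_def[symmetric] by (auto simp: Bo_def w_def)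
qed

lemma V_open: "\<exists>W'. open W' \<and> V s = W' \<inter> fvec I'"
proof -
 define O' where "O' = {w :: 'a => real. \<forall>d\<in>I'. \<bar>w d - (\<alpha> d + \<beta> d) / 2\<bar> < (\<beta> d - \<alpha> d) / 2}"
 have O: "open O'" unfolding O'_def using open_box[OF fin, of "\<lambda>d. (\<alpha> d + \<beta> d) / 2" "\<lambda>d. (\<beta> d - \<alpha> d) / 2"] by simp
 have Oiff: "w \<in> O' \<longleftrightarrow> (\<forall>d\<in>I'. \<alpha> d < w d \<and> w d < \<beta> d)" for w
  unfolding O'_def by (auto simp: abs_less_iff field_simps)
 have cont: "continuous_on (O' \<inter> fvec I') (\<lambda>w. \<sigma> * g n (w(c := t)))" if t: "t \<in> {\<alpha> c..\<beta> c}" for t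
 proof -
  have "continuous_on (O' \<inter> fvec I') (\<lambda>w. g n (w(c := t)))"
  proof (rule continuous_on_compose2[OF C1_mapD(1)[OF C1, of n]])
   show "continuous_on (O' \<inter> fvec I') (\<lambda>w. w(c := t))" by (rule continuous_on_upd_vec)
   show "(\<lambda>w. w(c := t)) ` (O' \<inter> fvec I') \<subseteq> W \<inter> fvec I"
   proof (rule image_subsetI)
    fix w assume "w \<in> O' \<inter> fvec I'"
    then have "w(c := t) \<in> B" by (intro sections_mono(1)[OF _ _ t]) (auto simp: Oiff less_imp_le)
    then show "w(c := t) \<in> W \<inter> fvec I" using BU by blast
   qed
  qed simp
  then show ?thesis by (intro continuous_intros)
 qed
 have ab: "\<alpha> c \<in> {\<alpha> c..\<beta> c}" "\<beta> c \<in> {\<alpha> c..\<beta> c}" using \<alpha>\<beta>[of c] by auto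
 obtain W1 where W1: "open W1" "W1 \<inter> fvec I' = {x \<in> O' \<inter> fvec I'. \<sigma> * g n (x(c := \<alpha> c)) \<in> {..<\<sigma> * s}}"
  using open_preimage_fvec[OF O cont[OF ab(1)] open_lessThan[of "\<sigma> * s"]] by (elim exE conjE)
 obtain W2 where W2: "open W2" "W2 \<inter> fvec I' = {x \<in> O' \<inter> fvec I'. \<sigma> * g n (x(c := \<beta> c)) \<in> {\<sigma> * s<..}}"
  using open_preimage_fvec[OF O cont[OF ab(2)] open_greaterThan[of "\<sigma> * s"]] by (elim exE conjE)
 have "V s = (W1 \<inter> fvec I') \<inter> (W2 \<inter> fvec I')" unfolding W1(2) W2(2) V_def using Oiff by auto
 then show ?thesis using W1(1) W2(1) by (intro exI[of _ "W1 \<inter> W2"]) auto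
qed

text \<open>The first \<open>n\<close> equations restricted to the level set of \<open>g n\<close>
  at height \<open>s\<close>. \<open>H'\<close> is implicit differentiation, and as a matrix it is
  the Schur complement of \<open>abs_det_schur\<close>.\<close>

definition "H s i w = g i (\<Psi> (s, w))"
definition "H' s i d w = g' i d (\<Psi> (s, w)) - g' i c (\<Psi> (s, w)) * g' n d (\<Psi> (s, w)) / g' n c (\<Psi> (s, w))"

lemma cont_\<Psi>_section: "continuous_on (V s) (\<lambda>w. \<Psi> (s, w))"
 by (rule continuous_on_compose2[OF cont_\<Psi>]) (auto intro!: continuous_intros V_Theta)

lemma \<Psi>_section_in: "(\<lambda>w. \<Psi> (s, w)) ` V s \<subseteq> W \<inter> fvec I"
proof (rule image_subsetI)
 fix w assume "w \<in> V s"
 then have "\<Psi> (s, w) \<in> B" by (rule subsetD[OF Bo_B V_Theta(2)])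
 then show "\<Psi> (s, w) \<in> W \<inter> fvec I" using BU by (rule subsetD[rotated])
qed

text \<open>To differentiate in direction \<open>d\<close>, the point of the level set is moved
  along a curve on which coordinate \<open>d\<close> is \<open>t\<close> and coordinate
  \<open>c\<close> follows as \<open>\<tau> t\<close>. Constancy of \<open>g n\<close> along it
  gives the derivative of \<tau>, and the chain rule that of \<open>H s i\<close>.\<close>

lemma C1_H: "C1_map I' (V s) n (H s) (H' s)" unfolding C1_map_def
proof (intro allI impI conjI ballI)
 fix i assume i: "i < n"
 have cc: "continuous_on (V s) (\<lambda>w. F (\<Psi> (s, w)))" if "continuous_on (W \<inter> fvec I) F" for F :: "_ => real"
  by (rule continuous_on_compose2[OF that cont_\<Psi>_section \<Psi>_section_in])
 show "continuous_on (V s) (H s i)" unfolding H_def using C1_mapD(1)[OF C1, of i] i by (intro cc) auto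
 fix d assume d: "d \<in> I'"
 have nz: "\<forall>w\<in>V s. g' n c (\<Psi> (s, w)) \<noteq> 0" using posB V_Theta(2) Bo_B by fastforce
 show "continuous_on (V s) (H' s i d)" unfolding H'_def using i d nz
  by (intro continuous_on_diff continuous_on_mult continuous_on_divide cc C1_mapD(2)[OF C1]) auto
 fix w assume w: "w \<in> V s"
 define x where "x = \<Psi> (s, w)"
 define \<tau> where "\<tau> t = \<Psi> (s, w(d := t)) c" for t
 define P where "P t u = (w(d := t))(c := u)" for t u
 have dc: "d \<noteq> c" using d c by auto
 have wI: "w \<in> fvec I'" using w by (simp add: V_def)
 have xB: "x \<in> Bo" using V_Theta(2)[OF w] by (simp add: x_def)
 have xP: "x = P (w d) (\<tau> (w d))" using \<Psi>(4)[OF V_Theta(1)[OF w]] by (simp add: x_def P_def \<tau>_def)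
 obtain W' where W': "open W'" "V s = W' \<inter> fvec I'" using V_open by blast
 have "w \<in> W'" using w W' by auto
 from open_fvec_box[OF W'(1) this wI] obtain e where e: "e > 0"
  "\<And>y. y \<in> fvec I' \<Longrightarrow> (\<And>i. i \<in> I' \<Longrightarrow> \<bar>y i - w i\<bar> < e) \<Longrightarrow> y \<in> W'" by metis
 have wt: "w(d := t) \<in> V s" if "\<bar>t - w d\<bar> < e" for t
 proof -
  have "w(d := t) \<in> fvec I'" using wI d fun_upd_fvec_in by metis
  moreover have "\<bar>(w(d := t)) i - w i\<bar> < e" for i using that e(1) by auto
  ultimately show ?thesis using e(2) W'(2) by auto
 qed
 have near: "eventually (\<lambda>t. \<bar>t - w d\<bar> < r) (at (w d))" if "r > 0" for r
  using that eventually_at[of "\<lambda>t. \<bar>t - w d\<bar> < r" "w d" UNIV] by (auto simp: dist_real_def)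
 have "isCont \<tau> (w d)"
 proof -
  have "continuous_on (ball (w d) e) \<tau>"
  proof -
   have "continuous_on (ball (w d) e) (\<lambda>t. \<Psi> (s, w(d := t)))"
   proof (rule continuous_on_compose2[OF cont_\<Psi>_section])
    show "continuous_on (ball (w d) e) (\<lambda>t. w(d := t))"
    proof (rule continuous_on_coordinatewise_then_product)
     fix i show "continuous_on (ball (w d) e) (\<lambda>t. (w(d := t)) i)"
      by (cases "i = d") (auto intro: continuous_intros)
    qed
    show "(\<lambda>t. w(d := t)) ` ball (w d) e \<subseteq> V s" using wt by (auto simp: dist_real_def abs_minus_commute)
   qed
   then show ?thesis unfolding \<tau>_def by (rule continuous_on_product_then_coordinatewise)
  qed
  then show ?thesis using e(1) by (auto simp: continuous_on_eq_continuous_at)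
 qed
 then have \<tau>near: "eventually (\<lambda>t. \<bar>\<tau> t - \<tau> (w d)\<bar> < r) (at (w d))" if "r > 0" for r
  using tendstoD[of \<tau> "\<tau> (w d)" "at (w d)" r] that by (auto simp: isCont_def dist_real_def)
 \<comment> \<open>The lemmas on curves need control on the whole segment from
   \<open>\<tau> (w d)\<close> to \<open>\<tau> t\<close>; continuity of \<tau> keeps this segment
   inside any neighbourhood of \<open>x\<close>.\<close>
 have seg: "eventually (\<lambda>t. \<forall>u\<in>closed_segment (\<tau> (w d)) (\<tau> t). P t u \<in> T \<inter> fvec I) (at (w d))"
  if T: "open T" "x \<in> T" for T
 proof -
  have xI: "x \<in> fvec I" using xB by (simp add: Bo_def)
  from open_fvec_box[OF T xI] obtain r where r: "r > 0"
   "\<And>y. y \<in> fvec I \<Longrightarrow> (\<And>i. i \<in> I \<Longrightarrow> \<bar>y i - x i\<bar> < r) \<Longrightarrow> y \<in> T" by metis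
  show ?thesis using near[OF r(1)] \<tau>near[OF r(1)]
  proof eventually_elim
   case (elim t)
   show ?case
   proof
    fix u assume u: "u \<in> closed_segment (\<tau> (w d)) (\<tau> t)"
    have PI: "P t u \<in> fvec I" unfolding P_def using wI d fun_upd_fvec_in[OF wI d] fun_upd_fvec by metis
    moreover have "\<bar>P t u i - x i\<bar> < r" for i
    proof -
     have "\<bar>u - \<tau> (w d)\<bar> < r" using u elim by (auto simp: closed_segment_eq_real_ivl split: if_splits)
     then show ?thesis unfolding xP P_def using elim r(1) dc by auto
    qed
    ultimately show "P t u \<in> T \<inter> fvec I" using r(2) by auto
   qed
  qed
 qed
 have xW: "x \<in> W \<inter> fvec I" using xB Bo_B BU by auto
 have der: "eventually (\<lambda>t. \<forall>u\<in>closed_segment (\<tau> (w d)) (\<tau> t).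
   ((\<lambda>u. g l (P t u)) has_real_derivative g' l c (P t u)) (at u)) (at (w d))" if l: "l < Suc n" for l
 proof -
  have "x \<in> W" using xW by auto
  from seg[OF W this] show ?thesis
  proof eventually_elim
   case (elim t)
   show ?case
   proof
    fix u assume "u \<in> closed_segment (\<tau> (w d)) (\<tau> t)"
    then have "P t u \<in> W \<inter> fvec I" using elim by blast
    from C1_mapD(3)[OF C1 l insertI1 this] show "((\<lambda>u. g l (P t u)) has_real_derivative g' l c (P t u)) (at u)"
     by (simp add: P_def)
   qed
  qed
 qed
 have lim: "eventually (\<lambda>t. \<forall>u\<in>closed_segment (\<tau> (w d)) (\<tau> t). \<bar>g' l c (P t u) - g' l c x\<bar> < \<epsilon>) (at (w d))"
  if l: "l < Suc n" and \<epsilon>: "\<epsilon> > 0" for l \<epsilon>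
 proof -
  obtain T where T: "open T" "T \<inter> fvec I = {y \<in> W \<inter> fvec I. g' l c y \<in> ball (g' l c x) \<epsilon>}"
   using open_preimage_fvec[OF W C1_mapD(2)[OF C1 l insertI1] open_ball[of "g' l c x" \<epsilon>]] by (elim exE conjE)
  have "x \<in> T" using T(2) xW \<epsilon> by auto
  from seg[OF T(1) this] show ?thesis
  proof eventually_elim
   case (elim t)
   show ?case
   proof
    fix u assume "u \<in> closed_segment (\<tau> (w d)) (\<tau> t)"
    then have "P t u \<in> {y \<in> W \<inter> fvec I. g' l c y \<in> ball (g' l c x) \<epsilon>}" using elim T(2) by blast
    then show "\<bar>g' l c (P t u) - g' l c x\<bar> < \<epsilon>" by (auto simp: dist_real_def abs_minus_commute)
   qed
  qed
 qed
 have a: "((\<lambda>t. g l (P t (\<tau> (w d)))) has_real_derivative g' l d x) (at (w d))" if l: "l < Suc n" for l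
 proof -
  have "((\<lambda>t. g l (x(d := t))) has_real_derivative g' l d x) (at (x d))"
   using C1_mapD(3)[OF C1 l insertI2[OF d] xW] .
  moreover have "x d = w d" "x(d := t) = P t (\<tau> (w d))" for t using dc unfolding xP P_def by auto
  ultimately show ?thesis by simp
 qed
 have nzx: "g' n c x \<noteq> 0" using posB[of x] xB Bo_B by auto
 have Pt: "\<Psi> (s, w(d := t)) = P t (\<tau> t)" if "\<bar>t - w d\<bar> < e" for t
  using \<Psi>(4)[OF V_Theta(1)[OF wt[OF that]]] by (simp add: P_def \<tau>_def)
 have \<tau>': "(\<tau> has_real_derivative - g' n d x / g' n c x) (at (w d))"
 proof (rule curve_implicit_deriv[where G = "\<lambda>t u. g n (P t u)" and ?G2.0 = "\<lambda>t u. g' n c (P t u)"])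
  show "eventually (\<lambda>t. g n (P t (\<tau> t)) = g n (P (w d) (\<tau> (w d)))) (at (w d))" using near[OF e(1)]
  proof eventually_elim
   case (elim t)
   have "g n (P t (\<tau> t)) = s" using \<Psi>(2)[OF V_Theta(1)[OF wt[OF elim]]] Pt[OF elim] by simp
   moreover have "g n (P (w d) (\<tau> (w d))) = s" using \<Psi>(2)[OF V_Theta(1)[OF w]] xP by (simp add: x_def)
   ultimately show ?case by simp
  qed
 qed (use der lim a nzx in auto)
 have "((\<lambda>t. g i (P t (\<tau> t))) has_real_derivative g' i d x + g' i c x * (- g' n d x / g' n c x)) (at (w d))"
  by (rule curve_chain_deriv[where G = "\<lambda>t u. g i (P t u)" and ?G2.0 = "\<lambda>t u. g' i c (P t u)"])
   (use der[of i] lim[of i] a[of i] \<tau>' i in auto)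
 then have "((\<lambda>t. H s i (w(d := t))) has_real_derivative g' i d x + g' i c x * (- g' n d x / g' n c x)) (at (w d))"
 proof (rule has_field_derivative_transform_within[OF _ e(1)])
  show "g i (P t (\<tau> t)) = H s i (w(d := t))" if "dist t (w d) < e" for t
   using Pt[of t] that by (simp add: H_def dist_real_def)
 qed simp
 then show "((\<lambda>t. H s i (w(d := t))) has_real_derivative H' s i d w) (at (w d))" by (simp add: H'_def x_def)
qed

text \<open>Fubini splits off the last target coordinate \<open>s\<close>, the induction hypothesis
  treats the slice at \<open>s\<close>, a second use of Fubini makes \<open>s\<close> the inner
  variable, and the substitution \<open>s = g n (w(c := t))\<close> restores the coordinate
  \<open>c\<close>. The factor from the substitution times the determinant of the Schur complement
  is the full determinant.\<close>

lemma area_step: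
 assumes bs: "length bs = n" "set bs = I'"
  and IH: "\<And>W g g' A. open W \<Longrightarrow> A \<subseteq> W \<inter> fvec I' \<Longrightarrow> sigma_compact A \<Longrightarrow>
    C1_map I' (W \<inter> fvec I') n g g' \<Longrightarrow> area_holds n I' bs g g' A" and A: "sigma_compact A" "A \<subseteq> Bo"
 shows "area_holds (Suc n) I (bs @ [c]) g g' A" unfolding area_holds_def
proof
 fix h :: "(nat => real) => ennreal" assume h[measurable]: "h \<in> borel_measurable (lebR {..<Suc n})"
 have AB: "A \<subseteq> B" using A(2) Bo_B by blast
 have contg: "continuous_on A (g i)" "continuous_on B (g i)" if "i < Suc n" for i
  using continuous_on_subset[OF C1_mapD(1)[OF C1 that]] AB BU by blast+
 have contg': "continuous_on A (g' i d)" "continuous_on B (g' i d)" if "i < Suc n" "d \<in> I" for i d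
  using continuous_on_subset[OF C1_mapD(2)[OF C1 that]] AB BU by blast+
 have bsI: "bs ! j \<in> I'" if "j < n" for j using bs that by auto
 define As where "As s = (\<lambda>x. restrict x I') ` (A \<inter> {x \<in> B. g n x = s})" for s
 have As: "sigma_compact (As s)" "As s \<subseteq> V s" for s
 proof -
  have "closed {x \<in> B. g n x = s}"
   using continuous_closed_preimage_constant[OF contg(2)[of n] compact_imp_closed[OF compact_B]] by simp
  then show "sigma_compact (As s)"
   unfolding As_def by (intro sigma_compact_image sigma_compact_Int_closed A continuous_on_restrict_vec)
  show "As s \<subseteq> V s" unfolding As_def using Bo_V A(2) by auto
 qed
 have AsI: "w \<in> As s \<longleftrightarrow> (s, w) \<in> \<Theta> ` B \<and> \<Psi> (s, w) \<in> A" for s w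
 proof
  assume "w \<in> As s"
  then obtain x where x: "x \<in> A" "x \<in> B" "\<Theta> x = (s, w)" by (auto simp: As_def \<Theta>_def)
  then show "(s, w) \<in> \<Theta> ` B \<and> \<Psi> (s, w) \<in> A" using \<Psi>_\<Theta>[OF x(2)] by (metis image_eqI)
 next
  assume "(s, w) \<in> \<Theta> ` B \<and> \<Psi> (s, w) \<in> A"
  then show "w \<in> As s" using \<Psi>[of s w] unfolding As_def by (intro image_eqI[of _ _ "\<Psi> (s, w)"]) auto
 qed
 have IHs: "area_holds n I' bs (H s) (H' s) (As s)" for s
 proof -
  obtain W' where W': "open W'" "V s = W' \<inter> fvec I'" using V_open by blast
  have "As s \<subseteq> W' \<inter> fvec I'" "C1_map I' (W' \<inter> fvec I') n (H s) (H' s)"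
   using As(2)[of s] C1_H[of s] unfolding W'(2) by auto
  from IH[OF W'(1) this(1) As(1) this(2)] show ?thesis .
 qed
 define K where "K i j x = g' i (bs ! j) x - g' i c x * g' n (bs ! j) x / g' n c x" for i j x
 define k where "k x = indicator A x * eadet n (\<lambda>(i, j). K i j x) * h (\<lambda>i\<in>{..<Suc n}. g i x)" for x
 define F where "F x = indicator A x * eadet (Suc n) (\<lambda>(i, j). g' i ((bs @ [c]) ! j) x) * h (\<lambda>i\<in>{..<Suc n}. g i x)" for x
 have nz: "g' n c x \<noteq> 0" if "x \<in> B" for x using posB[OF that] by auto
 have AI: "A \<subseteq> fvec I" using AB BU by blast
 have k_meas[measurable]: "k \<in> borel_measurable (lebR I)" unfolding k_def
 proof (rule area_integrand_measurable[OF A(1) AI contg(1) _ h])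
  fix i j assume "i < n" "j < n"
  then show "continuous_on A (K i j)"
   unfolding K_def using nz AB bsI by (intro continuous_on_diff continuous_on_mult continuous_on_divide contg'(1)) auto
 qed
 have F_meas[measurable]: "F \<in> borel_measurable (lebR I)" unfolding F_def
 proof (rule area_integrand_measurable[OF A(1) AI contg(1) _ h])
  fix i j assume "i < Suc n" "j < Suc n"
  then show "continuous_on A (g' i ((bs @ [c]) ! j))"
   using bsI bs by (intro contg'(1)) (auto simp: nth_append)
 qed
 have kF: "k x * ennreal \<bar>g' n c x\<bar> = F x" for x
 proof (cases "x \<in> A")
  case True
  define M where "M i j = g' i ((bs @ [c]) ! j) x" for i j
  have M: "M n n \<noteq> 0" "M n n = g' n c x" using nz True AB bs by (auto simp: M_def nth_append)
  have "mat n n (\<lambda>(i, j). M i j - M i n * M n j / M n n) = mat n n (\<lambda>(i, j). K i j x)"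
   using bs by (intro eq_matI) (auto simp: M_def K_def nth_append)
  then have "adet (Suc n) (\<lambda>(i, j). g' i ((bs @ [c]) ! j) x) = \<bar>g' n c x\<bar> * adet n (\<lambda>(i, j). K i j x)"
   using abs_det_schur[of M n] M by (simp add: M_def)
  then show ?thesis using True by (simp add: k_def F_def ennreal_mult mult_ac)
 qed (simp add: k_def F_def)
 define S where "S = {x. (x c, restrict x I') \<in> \<Theta> ` B}"
 have "closed S"
 proof -
  have "closed ((\<lambda>x :: 'a => real. (x c, restrict x I')) -` (\<Theta> ` B))"
   by (intro closed_vimage compact_imp_closed compact_continuous_image cont_\<Theta> compact_B
    continuous_on_Pair continuous_on_product_coordinates continuous_on_restrict_vec)
  then show ?thesis by (simp add: S_def vimage_def)
 qed
 then have bS: "S \<in> sets borel" by simp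
 define x0 where "x0 = restrict \<alpha> I"
 have x0: "x0 \<in> B" using \<alpha>\<beta> unfolding x0_def B_def by (auto simp: less_imp_le)
 \<comment> \<open>Off the closed set \<open>S\<close> a fixed point of the box serves as default
   value, which makes \<Phi> a measurable map into the box.\<close>
 define \<Phi> where "\<Phi> x = (if x \<in> S then \<Psi> (x c, restrict x I') else x0)" for x
 have \<Phi>B: "\<Phi> x \<in> B" for x using x0 \<Psi>(1) by (auto simp: \<Phi>_def S_def)
 have \<Phi>_meas: "\<Phi> \<in> lebR I \<rightarrow>\<^sub>M lebR I"
 proof (rule measurable_PiM_single')
  have "\<Phi> x \<in> fvec I" for x using \<Phi>B BU by blast
  then show "\<Phi> \<in> space (lebR I) \<rightarrow> (\<Pi>\<^sub>E i\<in>I. space lborel)" by (intro Pi_I) simp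
  fix d
  have "continuous_on S (\<lambda>x. \<Psi> (x c, restrict x I') d)"
  proof (rule continuous_on_product_then_coordinatewise, rule continuous_on_compose2[OF cont_\<Psi>])
   show "continuous_on S (\<lambda>x. (x c, restrict x I'))"
    by (intro continuous_on_Pair continuous_on_subset[OF continuous_on_product_coordinates] continuous_on_restrict_vec) auto
   show "(\<lambda>x. (x c, restrict x I')) ` S \<subseteq> \<Theta> ` B" by (rule image_subsetI) (simp only: S_def mem_Collect_eq)
  qed
  from lebR_measurable_if[OF bS this, of "x0 d"]
  show "(\<lambda>x. \<Phi> x d) \<in> lebR I \<rightarrow>\<^sub>M lborel" by (simp add: \<Phi>_def if_distrib[of "\<lambda>f. f d"])
 qed
 define q where "q x = indicator S x * k (\<Phi> x)" for x
 have q_meas[measurable]: "q \<in> borel_measurable (lebR I)"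
 proof -
  have "(\<lambda>x. indicator S x :: ennreal) \<in> borel_measurable (lebR I)"
   using measurable_compose[OF id_lebR_borel borel_measurable_indicator[OF bS]] .
  then show ?thesis
   unfolding q_def using measurable_compose[OF \<Phi>_meas k_meas] by (rule borel_measurable_times_ennreal)
 qed
 have qS: "q (w(c := s)) = (if (s, w) \<in> \<Theta> ` B then k (\<Psi> (s, w)) else 0)" if "w \<in> fvec I'" for s w
  using that c by (simp add: q_def \<Phi>_def S_def restrict_upd_vec)
 have slice: "(\<integral>\<^sup>+y. ncard {x \<in> A. \<forall>i<Suc n. g i x = (y(n := s)) i} * h (y(n := s)) \<partial>lebR {..<n}) =
   (\<integral>\<^sup>+w. q (w(c := s)) \<partial>lebR I')" for s proof -
  have "ncard {x \<in> A. \<forall>i<Suc n. g i x = (y(n := s)) i} = ncard {w \<in> As s. \<forall>i<n. H s i w = y i}" for y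
  proof (rule ncard_bij_betw)
   show "bij_betw (\<lambda>x. restrict x I') {x \<in> A. \<forall>i<Suc n. g i x = (y(n := s)) i} {w \<in> As s. \<forall>i<n. H s i w = y i}"
    unfolding bij_betw_def
   proof
    show "inj_on (\<lambda>x. restrict x I') {x \<in> A. \<forall>i<Suc n. g i x = (y(n := s)) i}"
    proof (rule inj_onI)
     fix x x' assume x: "x \<in> {x \<in> A. \<forall>i<Suc n. g i x = (y(n := s)) i}"
      "x' \<in> {x \<in> A. \<forall>i<Suc n. g i x = (y(n := s)) i}" "restrict x I' = restrict x' I'"
     then have "g n x = s" "g n x' = s" by auto
     then show "x = x'" using x inj_onD[OF inj_\<Theta>, of x x'] AB by (auto simp: \<Theta>_def)
    qed
    have 1: "restrict x I' \<in> As s \<and> \<Psi> (s, restrict x I') = x" if "x \<in> A" "g n x = s" for x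
     using that AB \<Psi>_\<Theta>[of x] by (auto simp: As_def \<Theta>_def)
    show "(\<lambda>x. restrict x I') ` {x \<in> A. \<forall>i<Suc n. g i x = (y(n := s)) i} = {w \<in> As s. \<forall>i<n. H s i w = y i}"
    proof (intro equalityI subsetI)
     fix w assume "w \<in> (\<lambda>x. restrict x I') ` {x \<in> A. \<forall>i<Suc n. g i x = (y(n := s)) i}"
     then obtain x where x: "x \<in> A" "\<forall>i<Suc n. g i x = (y(n := s)) i" "w = restrict x I'" by auto
     from x(2) have gx: "g n x = s" "\<And>i. i < n \<Longrightarrow> g i x = y i" by (auto dest: less_SucI)
     show "w \<in> {w \<in> As s. \<forall>i<n. H s i w = y i}" using 1[OF x(1) gx(1)] gx(2) x(3) by (simp add: H_def)
    next
     fix w assume w: "w \<in> {w \<in> As s. \<forall>i<n. H s i w = y i}"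
     then have "(s, w) \<in> \<Theta> ` B" "\<Psi> (s, w) \<in> A" using AsI by auto
     then show "w \<in> (\<lambda>x. restrict x I') ` {x \<in> A. \<forall>i<Suc n. g i x = (y(n := s)) i}"
      using w \<Psi>[of s w] by (intro image_eqI[of _ _ "\<Psi> (s, w)"]) (auto simp: less_Suc_eq H_def)
    qed
   qed
  qed
  moreover have "(\<lambda>y. h (y(n := s))) \<in> borel_measurable (lebR {..<n})"
  proof -
   have "(\<lambda>y. y(n := s)) \<in> lebR {..<n} \<rightarrow>\<^sub>M lebR {..<Suc n}"
    by (rule measurable_fun_upd[of _ "{..<n}"]) auto
   from measurable_compose[OF this h] show ?thesis .
  qed
  ultimately have "(\<integral>\<^sup>+y. ncard {x \<in> A. \<forall>i<Suc n. g i x = (y(n := s)) i} * h (y(n := s)) \<partial>lebR {..<n}) =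
    (\<integral>\<^sup>+w. indicator (As s) w * eadet n (\<lambda>(i, j). H' s i (bs ! j) w) * h ((\<lambda>i\<in>{..<n}. H s i w)(n := s)) \<partial>lebR I')"
   using IHs[of s] by (simp add: area_holds_def)
  also have "\<dots> = (\<integral>\<^sup>+w. q (w(c := s)) \<partial>lebR I')"
  proof (rule nn_integral_cong)
   fix w assume "w \<in> space (lebR I')"
   then have w: "w \<in> fvec I'" by simp
   show "indicator (As s) w * eadet n (\<lambda>(i, j). H' s i (bs ! j) w) * h ((\<lambda>i\<in>{..<n}. H s i w)(n := s)) = q (w(c := s))"
   proof (cases "(s, w) \<in> \<Theta> ` B")
    case True
    have "(\<lambda>i\<in>{..<n}. H s i w)(n := s) = (\<lambda>i\<in>{..<Suc n}. g i (\<Psi> (s, w)))"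
     using \<Psi>(2)[OF True] by (auto simp: fun_eq_iff H_def)
    then show ?thesis using True by (simp add: qS[OF w] k_def AsI H'_def K_def indicator_def)
   next
    case False
    then show ?thesis by (simp add: qS[OF w] AsI)
   qed
  qed
  finally show ?thesis .
 qed
 \<comment> \<open>For \<open>w\<close> inside the box this is a one-variable substitution along
   \<open>c\<close>; for any other \<open>w\<close> both integrands vanish.\<close>
 have inner: "(\<integral>\<^sup>+s. q (w(c := s)) \<partial>lborel) = (\<integral>\<^sup>+t. F (w(c := t)) \<partial>lborel)" if w: "w \<in> fvec I'" for w
 proof (cases "\<forall>d\<in>I'. \<alpha> d \<le> w d \<and> w d \<le> \<beta> d")
  case True
  then have w': "w \<in> fvec I'" "\<And>d. d \<in> I' \<Longrightarrow> \<alpha> d \<le> w d \<and> w d \<le> \<beta> d" using w by auto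
  have upd: "(\<lambda>s. w(c := s)) \<in> lborel \<rightarrow>\<^sub>M lebR I"
   using w by (intro measurable_fun_upd[of _ I']) (auto simp: space_PiM)
  have TB: "\<Theta> (w(c := t)) = (g n (w(c := t)), w)" for t using w c by (simp add: \<Theta>_def restrict_upd_vec)
  have "(\<integral>\<^sup>+s. q (w(c := s)) \<partial>lborel) =
    (\<integral>\<^sup>+t. q (w(c := g n (w(c := t)))) * ennreal \<bar>g' n c (w(c := t))\<bar> * indicator {\<alpha> c..\<beta> c} t \<partial>lborel)"
  proof (rule nn_integral_substitution_sign[OF _ _ \<sigma>])
   show "(\<lambda>s. q (w(c := s))) \<in> borel_measurable borel" using measurable_compose[OF upd q_meas] by simp
   show "\<alpha> c < \<beta> c" using \<alpha>\<beta> by simp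
   show "((\<lambda>t. g n (w(c := t))) has_real_derivative g' n c (w(c := t))) (at t)" if "t \<in> {\<alpha> c..\<beta> c}" for t
    using sections_mono(2)[OF w' that] .
   show "continuous_on {\<alpha> c..\<beta> c} (\<lambda>t. g' n c (w(c := t)))"
   proof (rule continuous_on_compose2[OF contg'(2)])
    show "continuous_on {\<alpha> c..\<beta> c} (\<lambda>t. w(c := t))"
    proof (rule continuous_on_coordinatewise_then_product)
     fix i show "continuous_on {\<alpha> c..\<beta> c} (\<lambda>t. (w(c := t)) i)"
      by (cases "i = c") (auto intro: continuous_intros)
    qed
    show "(\<lambda>t. w(c := t)) ` {\<alpha> c..\<beta> c} \<subseteq> B" using sections_mono(1)[OF w'] by (rule image_subsetI)
   qed auto
   show "\<sigma> * g' n c (w(c := t)) > 0" if "t \<in> {\<alpha> c..\<beta> c}" for t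
    using posB[OF sections_mono(1)[OF w' that]] .
   show "s \<in> (\<lambda>t. g n (w(c := t))) ` {\<alpha> c..\<beta> c}" if "q (w(c := s)) \<noteq> 0" for s
   proof -
    have T: "(s, w) \<in> \<Theta> ` B" using that qS[OF w] by (metis (full_types))
    have "s = g n (w(c := \<Psi> (s, w) c))" using \<Psi>(2,4)[OF T] by metis
    then show ?thesis using sect_B(3)[OF \<Psi>(1)[OF T]] by (rule image_eqI)
   qed
  qed
  also have "\<dots> = (\<integral>\<^sup>+t. F (w(c := t)) \<partial>lborel)"
  proof (rule nn_integral_cong)
   fix t
   show "q (w(c := g n (w(c := t)))) * ennreal \<bar>g' n c (w(c := t))\<bar> * indicator {\<alpha> c..\<beta> c} t = F (w(c := t))"
   proof (cases "t \<in> {\<alpha> c..\<beta> c}")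
    case True
    have "w(c := t) \<in> B" using sections_mono(1)[OF w' True] .
    then have "(g n (w(c := t)), w) \<in> \<Theta> ` B" "\<Psi> (g n (w(c := t)), w) = w(c := t)"
     using TB[of t] \<Psi>_\<Theta>[of "w(c := t)"] by (metis image_eqI, simp)
    then have "q (w(c := g n (w(c := t)))) = k (w(c := t))" by (simp add: qS[OF w])
    then show ?thesis using True kF[of "w(c := t)"] by simp
   next
    case False
    then have "w(c := t) \<notin> B" by (auto simp: B_def)
    then have "w(c := t) \<notin> A" using AB by blast
    then show ?thesis using False by (simp add: F_def)
   qed
  qed
  finally show ?thesis .
 next
  case False
  then obtain d where d: "d \<in> I'" "\<not> (\<alpha> d \<le> w d \<and> w d \<le> \<beta> d)" by blast
  have dc: "d \<noteq> c" using d c by auto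
  have "w(c := t) \<notin> B" for t using d dc unfolding B_def by auto
  then have "w(c := t) \<notin> A" for t using AB by blast
  then have F0: "F (w(c := t)) = 0" for t by (simp add: F_def)
  have "(s, w) \<notin> \<Theta> ` B" for s
  proof
   assume "(s, w) \<in> \<Theta> ` B"
   then have "\<Psi> (s, w) \<in> B" "\<Psi> (s, w) d = w d" using \<Psi>(1)[of s w] \<Psi>(3)[of s w] d(1) by (auto dest: fun_cong[of _ _ d])
   then show False using d by (auto simp: B_def)
  qed
  then have "q (w(c := s)) = 0" for s by (simp add: qS[OF w])
  then show ?thesis using F0 by simp
 qed
 have cnt_meas: "(\<lambda>y. ncard {x \<in> A. \<forall>i<Suc n. g i x = y i} * h y) \<in> borel_measurable (lebR (insert n {..<n}))"
  using area_count_measurable[OF A(1) contg(1), of "Suc n"] h unfolding lessThan_Suc by (intro borel_measurable_times_ennreal) auto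
 have "(\<integral>\<^sup>+y. ncard {x \<in> A. \<forall>i<Suc n. g i x = y i} * h y \<partial>lebR {..<Suc n}) =
   (\<integral>\<^sup>+s. \<integral>\<^sup>+y. ncard {x \<in> A. \<forall>i<Suc n. g i x = (y(n := s)) i} * h (y(n := s)) \<partial>lebR {..<n} \<partial>lborel)"
  unfolding lessThan_Suc by (rule plb.product_nn_integral_insert_rev[OF _ _ cnt_meas]) auto
 also have "\<dots> = (\<integral>\<^sup>+s. \<integral>\<^sup>+w. q (w(c := s)) \<partial>lebR I' \<partial>lborel)" unfolding slice ..
 also have "\<dots> = (\<integral>\<^sup>+x. q x \<partial>lebR I)" by (rule plb.product_nn_integral_insert_rev[OF fin c q_meas, symmetric])
 also have "\<dots> = (\<integral>\<^sup>+w. \<integral>\<^sup>+s. q (w(c := s)) \<partial>lborel \<partial>lebR I')"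
  by (rule plb.product_nn_integral_insert[OF fin c q_meas])
 also have "\<dots> = (\<integral>\<^sup>+w. \<integral>\<^sup>+t. F (w(c := t)) \<partial>lborel \<partial>lebR I')" by (intro nn_integral_cong inner) simp
 also have "\<dots> = (\<integral>\<^sup>+x. F x \<partial>lebR I)" by (rule plb.product_nn_integral_insert[OF fin c F_meas, symmetric])
 finally show "(\<integral>\<^sup>+y. ncard {x \<in> A. \<forall>i<Suc n. g i x = y i} * h y \<partial>lebR {..<Suc n}) =
  (\<integral>\<^sup>+x. indicator A x * eadet (Suc n) (\<lambda>(i, j). g' i ((bs @ [c]) ! j) x) * h (\<lambda>i\<in>{..<Suc n}. g i x) \<partial>lebR I)"
  unfolding F_def .
qed

end

section \<open>Critical points and the general area formula\<close>

lemma det_zero_row: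
 assumes "i < n" "\<And>j. j < n \<Longrightarrow> f i j = (0::real)"
 shows "det (mat n n (\<lambda>(i, j). f i j)) = 0"
proof -
 have "det (mat n n (\<lambda>(i, j). f i j)) = (\<Sum>j<n. mat n n (\<lambda>(i, j). f i j) $$ (i, j) * cofactor (mat n n (\<lambda>(i, j). f i j)) i j)"
  by (rule laplace_expansion_row) (use assms in auto)
 also have "\<dots> = 0" using assms by (intro sum.neutral) auto
 finally show ?thesis .
qed

text \<open>Both sides are zero: the image is a null set by \<open>sard_null\<close>, and the last
  row of the derivative matrix vanishes on the set.\<close>

lemma area_critical:
 fixes g :: "nat => ('a::countable => real) => real"
 assumes cs: "set cs = I" "length cs = Suc n" "distinct cs" and W: "open W"
  and A: "sigma_compact A" "A \<subseteq> W \<inter> fvec I"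
  and C1: "C1_map I (W \<inter> fvec I) (Suc n) g g'"
  and crit: "\<And>x c. x \<in> A \<Longrightarrow> c \<in> I \<Longrightarrow> g' n c x = 0"
 shows "area_holds (Suc n) I cs g g' A" unfolding area_holds_def
proof
 fix h :: "(nat => real) => ennreal" assume h[measurable]: "h \<in> borel_measurable (lebR {..<Suc n})"
 have I: "finite I" "card I = Suc n" using cs distinct_card by force+
 obtain K where K: "\<And>m::nat. compact (K m)" "A = (\<Union>m. K m)" using A(1) unfolding sigma_compact_def by blast
 define G where "G x = (\<lambda>i\<in>{..<Suc n}. g i x)" for x
 have KW: "K m \<subseteq> W \<inter> fvec I" for m using K A by blast
 have null: "G ` K m \<in> null_sets (lebR {..<Suc n})" for m
 proof -
  have "emeasure (lebR {..<Suc n}) (G ` K m) = 0"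
   unfolding G_def by (rule sard_null[OF I W K(1) KW C1]) (use crit K(2) in auto)
  moreover have "continuous_on (K m) G" unfolding G_def
  proof (rule continuous_on_coordinatewise_then_product)
   fix i show "continuous_on (K m) (\<lambda>x. (\<lambda>i\<in>{..<Suc n}. g i x) i)"
    using continuous_on_subset[OF C1_mapD(1)[OF C1] KW] by (cases "i < Suc n") auto
  qed
  then have "G ` K m \<in> sets borel" by (intro borel_closed compact_imp_closed compact_continuous_image K)
  then have "G ` K m \<inter> fvec {..<Suc n} \<in> sets (lebR {..<Suc n})" by (rule borel_Int_lebR)
  moreover have "G ` K m \<inter> fvec {..<Suc n} = G ` K m" by (auto simp: G_def split: if_splits)
  ultimately show ?thesis by (simp add: null_sets_def)
 qed
 have "AE y in lebR {..<Suc n}. \<forall>m. y \<notin> G ` K m" using AE_not_in[OF null] by (simp add: AE_all_countable)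
 then have "AE y in lebR {..<Suc n}. ncard {x \<in> A. \<forall>i<Suc n. g i x = y i} * h y = 0"
 proof (rule AE_mp, intro AE_I2 impI)
  fix y assume y: "y \<in> space (lebR {..<Suc n})" "\<forall>m. y \<notin> G ` K m"
  have "G x = y" if "x \<in> A" "\<forall>i<Suc n. g i x = y i" for x
   using that y(1) by (auto simp: G_def fun_eq_iff PiE_def extensional_def)
  then have "{x \<in> A. \<forall>i<Suc n. g i x = y i} = {}" using y(2) K(2) by blast
  then show "ncard {x \<in> A. \<forall>i<Suc n. g i x = y i} * h y = 0" by (simp only: emeasure_empty mult_zero_left)
 qed
 then have "(\<integral>\<^sup>+y. ncard {x \<in> A. \<forall>i<Suc n. g i x = y i} * h y \<partial>lebR {..<Suc n}) = (\<integral>\<^sup>+y. 0 \<partial>lebR {..<Suc n})"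
  by (rule nn_integral_cong_AE)
 also have "\<dots> = (\<integral>\<^sup>+x. 0 \<partial>lebR I)" by simp
 also have "\<dots> = (\<integral>\<^sup>+x. indicator A x * eadet (Suc n) (\<lambda>(i, j). g' i (cs ! j) x) * h (\<lambda>i\<in>{..<Suc n}. g i x) \<partial>lebR I)"
 proof (rule nn_integral_cong)
  fix x
  have "det (mat (Suc n) (Suc n) (\<lambda>(i, j). g' i (cs ! j) x)) = 0" if "x \<in> A"
   using cs crit[OF that] by (intro det_zero_row[of n]) auto
  then show "0 = indicator A x * eadet (Suc n) (\<lambda>(i, j). g' i (cs ! j) x) * h (\<lambda>i\<in>{..<Suc n}. g i x)"
   by (cases "x \<in> A") auto
 qed
 finally show "(\<integral>\<^sup>+y. ncard {x \<in> A. \<forall>i<Suc n. g i x = y i} * h y \<partial>lebR {..<Suc n}) =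
  (\<integral>\<^sup>+x. indicator A x * eadet (Suc n) (\<lambda>(i, j). g' i (cs ! j) x) * h (\<lambda>i\<in>{..<Suc n}. g i x) \<partial>lebR I)" . qed

text \<open>Where some partial derivative of the last equation is nonzero, a small box around the
  point permits the elimination of that variable, and Lindelof's theorem reduces these boxes to
  countably many. What remains is critical for the last equation; degeneracies of the other
  equations are met at lower levels of the induction.\<close>

theorem area_formula:
 fixes g :: "nat => ('a::countable => real) => real"
 assumes "distinct cs" "length cs = n" "open W" "A \<subseteq> W \<inter> fvec (set cs)" "sigma_compact A"
  "C1_map (set cs) (W \<inter> fvec (set cs)) n g g'"
 shows "area_holds n (set cs) cs g g' A" using assms
proof (induction n arbitrary: cs W g g' A)
 case 0
 have cs: "cs = []" using 0 by simp
 have "A \<subseteq> {\<lambda>_. undefined}" using 0 by (auto simp: cs)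
 then have "A = {} \<or> A = {\<lambda>_. undefined}" by auto
 then show ?case unfolding area_holds_def cs by (auto simp: plb.nn_integral_empty det_dim_zero restrict_def)
next
 case (Suc n)
 define I where "I = set cs"
 note W = \<open>open W\<close> and A = \<open>sigma_compact A\<close> \<open>A \<subseteq> W \<inter> fvec (set cs)\<close>[folded I_def]
  and C1 = \<open>C1_map (set cs) (W \<inter> fvec (set cs)) (Suc n) g g'\<close>[folded I_def]
  and cs = \<open>distinct cs\<close> \<open>length cs = Suc n\<close>
 have finI: "finite I" by (simp add: I_def)
 \<comment> \<open>Quantifying over all sigma-compact parts of \<open>A \<inter> Q\<close> allows
   overlapping boxes to be cut into disjoint pieces afterwards.\<close>
 define good where "good Q \<longleftrightarrow> open Q \<and> (\<forall>x\<in>A \<inter> Q. \<exists>c\<in>I. g' n c x \<noteq> 0) \<and>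
   (\<forall>A'. sigma_compact A' \<longrightarrow> A' \<subseteq> A \<inter> Q \<longrightarrow> area_holds (Suc n) I cs g g' A')" for Q
 have good_ex: "\<exists>Q. good Q \<and> x \<in> Q" if x: "x \<in> A" and cI: "c \<in> I" "g' n c x \<noteq> 0" for x c
 proof -
  define \<sigma> :: real where "\<sigma> = (if g' n c x > 0 then 1 else -1)"
  have \<sigma>: "\<sigma> = 1 \<or> \<sigma> = -1" "\<sigma> * g' n c x > 0" using cI by (auto simp: \<sigma>_def)
  have xI: "x \<in> fvec I" "x \<in> W" using x A by auto
  have "continuous_on (W \<inter> fvec I) (\<lambda>x. \<sigma> * g' n c x)"
   using C1_mapD(2)[OF C1 _ cI(1), of n] by (intro continuous_intros) auto
  from open_preimage_fvec[OF W this open_greaterThan[of 0]]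
  obtain T where T: "open T" "T \<inter> fvec I = {y \<in> W \<inter> fvec I. \<sigma> * g' n c y \<in> {0<..}}" by (elim exE conjE)
  have "x \<in> T" using T(2) xI \<sigma> by auto
  from open_fvec_box[OF T(1) this xI(1)] obtain d where d: "d > 0"
   "\<And>y. y \<in> fvec I \<Longrightarrow> (\<And>i. i \<in> I \<Longrightarrow> \<bar>y i - x i\<bar> < d) \<Longrightarrow> y \<in> T" by metis
  define \<alpha> where "\<alpha> i = x i - d / 2" for i
  define \<beta> where "\<beta> i = x i + d / 2" for i
  define I' where "I' = I - {c}"
  have I': "insert c I' = I" "finite I'" "c \<notin> I'" using cI finI by (auto simp: I'_def)
  have inT: "y \<in> T \<inter> fvec I" if "y \<in> {y \<in> fvec I. \<forall>d\<in>I. \<alpha> d \<le> y d \<and> y d \<le> \<beta> d}" for y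
  proof -
   have "\<bar>y i - x i\<bar> < d" if "i \<in> I" for i
   proof -
    have "\<alpha> i \<le> y i" "y i \<le> \<beta> i" using that \<open>y \<in> _\<close> by auto
    then show ?thesis using d(1) unfolding \<alpha>_def \<beta>_def by (simp add: abs_less_iff)
   qed
   then show ?thesis using d(2)[of y] that by auto
  qed
  interpret area_box n I' c W g g' \<alpha> \<beta> \<sigma>
  proof
   show "{x \<in> fvec (insert c I'). \<forall>d\<in>insert c I'. \<alpha> d \<le> x d \<and> x d \<le> \<beta> d} \<subseteq> W"
    unfolding I'(1) using inT T(2) by blast
   show "\<sigma> * g' n c y > 0" if "y \<in> {x \<in> fvec (insert c I'). \<forall>d\<in>insert c I'. \<alpha> d \<le> x d \<and> x d \<le> \<beta> d}" for y
   proof -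
    have "y \<in> {y \<in> W \<inter> fvec I. \<sigma> * g' n c y \<in> {0<..}}" using inT[of y] that unfolding I'(1) T(2) by blast
    then show ?thesis by auto
   qed
   show "C1_map (insert c I') (W \<inter> fvec (insert c I')) (Suc n) g g'" unfolding I'(1) by (rule C1)
  qed (use I' d(1) W \<sigma> in \<open>auto simp: \<alpha>_def \<beta>_def\<close>)
  define Q where "Q = {y :: 'a => real. \<forall>i\<in>I. \<bar>y i - x i\<bar> < d / 2}"
  have Q: "y \<in> Bo" if "y \<in> Q" "y \<in> fvec I" for y
  proof -
   have "\<alpha> i < y i \<and> y i < \<beta> i" if "i \<in> I" for i
   proof -
    have "\<bar>y i - x i\<bar> < d / 2" using \<open>y \<in> Q\<close> that unfolding Q_def by blast
    then show ?thesis unfolding \<alpha>_def \<beta>_def abs_less_iff by linarith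
   qed
   then show ?thesis using that unfolding Bo_def I'(1) by auto
  qed
  obtain p where p: "p < Suc n" "cs ! p = c"  using cI(1) cs(2) unfolding I_def in_set_conv_nth by auto
  define cs' where "cs' = cs[p := cs ! n, n := cs ! p]"
  define bs where "bs = take n cs'"
  have len: "length cs' = Suc n" using cs by (simp add: cs'_def)
  have cs'n: "cs' ! n = c" using cs p by (simp add: cs'_def)
  have cs'b: "cs' = bs @ [c]" using len cs'n by (metis bs_def lessI take_Suc_conv_app_nth take_all le_refl)
  have "mset cs' = mset cs" unfolding cs'_def using p cs by (intro mset_swap) auto
  then have cs's: "distinct cs'" "set cs' = I"
   using cs by (metis mset_eq_imp_distinct_iff, metis I_def mset_eq_setD)
  have bs: "distinct bs" "set bs = I'" "length bs = n" using cs's len unfolding cs'b by (auto simp: I'_def)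
  have "good Q" unfolding good_def
  proof (intro conjI allI impI ballI)
   show "open Q" unfolding Q_def by (rule open_box[OF finI])
   show "\<exists>c\<in>I. g' n c y \<noteq> 0" if "y \<in> A \<inter> Q" for y
   proof -
    have "y \<in> B" using Q[of y] Bo_B that A(2) by blast
    from posB[OF this] show ?thesis using cI(1) by (intro bexI[of _ c]) auto
   qed
   fix A' assume A': "sigma_compact A'" "A' \<subseteq> A \<inter> Q"
   have "area_holds (Suc n) (insert c I') (bs @ [c]) g g' A'"
   proof (rule area_step[OF bs(3,2) _ A'(1)])
    show "area_holds n I' bs g g' A" if "open W" "A \<subseteq> W \<inter> fvec I'" "sigma_compact A" "C1_map I' (W \<inter> fvec I') n g g'" for W g g' A
     using Suc.IH[of bs W A g g'] that bs by simp
    show "A' \<subseteq> Bo" using A'(2) A(2) Q by blast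
   qed
   moreover have "adet (Suc n) (\<lambda>(i, j). g' i ((bs @ [c]) ! j) x) =
     adet (Suc n) (\<lambda>(i, j). g' i (cs ! j) x)" for x
    using abs_det_swap_columns[OF cs(2) p(1), of "\<lambda>i d. g' i d x"] unfolding cs'b[symmetric] cs'_def .
   ultimately show "area_holds (Suc n) I cs g g' A'" unfolding area_holds_def I'(1) by simp
  qed
  moreover have "x \<in> Q" using d(1) by (auto simp: Q_def)
  ultimately show ?thesis by blast
 qed
 have "\<And>Q. Q \<in> Collect good \<Longrightarrow> open Q" by (auto simp: good_def)
 then obtain \<F> where F: "\<F> \<subseteq> Collect good" "countable \<F>" "\<Union>\<F> = \<Union>(Collect good)"
  using Lindelof[of "Collect good"] by metis
 \<comment> \<open>Makes the family nonempty, so that \<open>from_nat_into\<close> enumerates it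
   even if there is no box at all.\<close>
 have "good {}"
 proof -
  have "area_holds (Suc n) I cs g g' {}" by (simp add: area_holds_def)
  then show ?thesis by (simp add: good_def)
 qed
 define q where "q = from_nat_into (insert {} \<F>)"
 have q: "good (q m)" for m using from_nat_into[of "insert {} \<F>" m] F(1) \<open>good {}\<close> by (auto simp: q_def)
 have rq: "(\<Union>m. q m) = \<Union>(Collect good)"
  using range_from_nat_into[of "insert {} \<F>"] F(2,3) by (auto simp: q_def)
 \<comment> \<open>Index 0 holds the points outside all boxes, which are critical for the last
   equation; the other indices hold the boxes made disjoint.\<close>
 define A1 where "A1 m = (case m of 0 => A - (\<Union>m. q m) | Suc m => A \<inter> (q m - (\<Union>l<m. q l)))" for m
 have opq: "open (q m)" for m using q by (simp add: good_def)
 have A1s: "sigma_compact (A1 m)" for m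
 proof (cases m)
  case 0
  have "A1 m = A \<inter> - (\<Union>m. q m)" by (auto simp: A1_def 0)
  then show ?thesis using A(1) opq by (simp only:) (intro sigma_compact_Int_closed closed_Compl open_UN ballI)
 next
  case (Suc l)
  have "A1 m = (A \<inter> - (\<Union>i<l. q i)) \<inter> q l" by (auto simp: A1_def Suc)
  then show ?thesis using A(1) opq
   by (simp only:) (intro sigma_compact_Int_closed sigma_compact_Int_open closed_Compl open_UN ballI)
 qed
 have A1A: "A1 m \<subseteq> A" for m by (auto simp: A1_def split: nat.splits)
 have "area_holds (Suc n) I cs g g' (\<Union>m. A1 m)"
 proof (rule area_holds_UN[OF A1s _ _ _ _ cs(2) C1])
  show "disjoint_family A1" unfolding disjoint_family_on_def
  proof (intro ballI impI)
   have 1: "A1 i \<inter> A1 j = {}" if "i < j" for i j using that by (cases i; cases j) (auto simp: A1_def)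
   show "A1 i \<inter> A1 j = {}" if "i \<noteq> j" for i j
    using 1[of i j] 1[of j i] that by (cases i j rule: linorder_cases) auto
  qed
  show "A1 m \<subseteq> W \<inter> fvec I" for m using A1A A(2) by blast
  show "area_holds (Suc n) I cs g g' (A1 m)" for m
  proof (cases m)
   case 0
   show ?thesis
   proof (rule area_critical[OF I_def[symmetric] cs(2,1) W A1s _ C1])
    show "A1 m \<subseteq> W \<inter> fvec I" using A1A A(2) by blast
    show "g' n c x = 0" if "x \<in> A1 m" "c \<in> I" for x c
     using good_ex[of x c] that rq by (auto simp: A1_def 0)
   qed
  next
   case (Suc l)
   have "A1 m \<subseteq> A \<inter> q l" by (auto simp: A1_def Suc)
   then show ?thesis using q[of l] A1s by (auto simp: good_def)
  qed
 qed (auto simp: I_def)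
 moreover have "(\<Union>m. A1 m) = A"
 proof
  show "A \<subseteq> (\<Union>m. A1 m)"
  proof
   fix x assume x: "x \<in> A"
   show "x \<in> (\<Union>m. A1 m)"
   proof (cases "x \<in> (\<Union>m. q m)")
    case True
    define m where "m = (LEAST m. x \<in> q m)"
    have "x \<in> q m" using True unfolding m_def by (auto intro: LeastI)
    moreover have "x \<notin> q l" if "l < m" for l using that not_less_Least unfolding m_def by blast
    ultimately have "x \<in> A1 (Suc m)" using x by (auto simp: A1_def)
    then show ?thesis by blast
   next
    case False
    then have "x \<in> A1 0" using x by (auto simp: A1_def)
    then show ?thesis by blast
   qed
  qed
 qed (use A1A in blast)
 ultimately show ?case by (simp add: I_def)
qed

section \<open>Gaussian determinants\<close>

text \<open>For \<open>c \<noteq> 0\<close> the rotation is composed of two affine substitutions in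
  one variable each, whose factors \<open>1 / \<bar>c\<bar>\<close> and \<open>\<bar>c\<bar>\<close>
  cancel; a quarter turn exchanges the variables up to sign.\<close>

lemma nn_integral_rotation:
 fixes K :: "real \<times> real => ennreal"
 assumes K[measurable]: "K \<in> borel_measurable (borel \<Otimes>\<^sub>M borel)" and cs: "c\<^sup>2 + s\<^sup>2 = 1"
 shows "(\<integral>\<^sup>+x. \<integral>\<^sup>+y. K (c * x - s * y, s * x + c * y) \<partial>lborel \<partial>lborel) = (\<integral>\<^sup>+x. \<integral>\<^sup>+y. K (x, y) \<partial>lborel \<partial>lborel)"
proof (cases "c = 0")
 case True
 then have s: "\<bar>s\<bar> = 1" "s \<noteq> 0" using cs by (auto simp: power2_eq_1_iff)
 have 1: "(\<integral>\<^sup>+y. f (s * y) \<partial>lborel) = (\<integral>\<^sup>+y. f y \<partial>lborel)" "(\<integral>\<^sup>+y. f (- s * y) \<partial>lborel) = (\<integral>\<^sup>+y. f y \<partial>lborel)"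
  if "f \<in> borel_measurable borel" for f
  using nn_integral_real_affine[OF that, of s 0] nn_integral_real_affine[OF that, of "-s" 0] s by auto
 have "(\<integral>\<^sup>+x. \<integral>\<^sup>+y. K (c * x - s * y, s * x + c * y) \<partial>lborel \<partial>lborel) = (\<integral>\<^sup>+x. \<integral>\<^sup>+y. K (- s * y, s * x) \<partial>lborel \<partial>lborel)"
  using True by simp
 also have "\<dots> = (\<integral>\<^sup>+x. \<integral>\<^sup>+y. K (y, s * x) \<partial>lborel \<partial>lborel)" by (intro nn_integral_cong 1(2)) measurable
 also have "\<dots> = (\<integral>\<^sup>+x. \<integral>\<^sup>+y. K (y, x) \<partial>lborel \<partial>lborel)" by (rule 1(1)) measurable
 also have "\<dots> = (\<integral>\<^sup>+x. \<integral>\<^sup>+y. K (x, y) \<partial>lborel \<partial>lborel)" by (rule lborel_pair.Fubini') measurable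
 finally show ?thesis .
next
 case False
 have "(\<integral>\<^sup>+x. \<integral>\<^sup>+y. K (c * x - s * y, s * x + c * y) \<partial>lborel \<partial>lborel) =
   (\<integral>\<^sup>+y. \<integral>\<^sup>+x. K (c * x - s * y, s * x + c * y) \<partial>lborel \<partial>lborel)" by (rule lborel_pair.Fubini') measurable
 also have "\<dots> = (\<integral>\<^sup>+y. ennreal (1 / \<bar>c\<bar>) * (\<integral>\<^sup>+x. K (x, (s * x + y) / c) \<partial>lborel) \<partial>lborel)"
 proof (rule nn_integral_cong)
  fix y
  have "(\<integral>\<^sup>+x. K (x, (s * x + y) / c) \<partial>lborel) = ennreal \<bar>c\<bar> * (\<integral>\<^sup>+x. K (- s * y + c * x, (s * (- s * y + c * x) + y) / c) \<partial>lborel)"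
   using False by (intro nn_integral_real_affine) auto
  also have "(\<lambda>x. K (- s * y + c * x, (s * (- s * y + c * x) + y) / c)) = (\<lambda>x. K (c * x - s * y, s * x + c * y))"
  proof
   fix x
   have "s * (- s * y + c * x) + y = s * c * x + (1 - s\<^sup>2) * y" by (simp add: algebra_simps power2_eq_square)
   also have "1 - s\<^sup>2 = c\<^sup>2" using cs by simp
   finally have "(s * (- s * y + c * x) + y) / c = s * x + c * y"
    using False by (simp add: field_simps power2_eq_square)
   then show "K (- s * y + c * x, (s * (- s * y + c * x) + y) / c) = K (c * x - s * y, s * x + c * y)"
    by (simp add: algebra_simps)
  qed
  finally show "(\<integral>\<^sup>+x. K (c * x - s * y, s * x + c * y) \<partial>lborel) = ennreal (1 / \<bar>c\<bar>) * (\<integral>\<^sup>+x. K (x, (s * x + y) / c) \<partial>lborel)"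
   using False by (simp add: mult.assoc[symmetric] ennreal_mult[symmetric])
 qed
 also have "\<dots> = ennreal (1 / \<bar>c\<bar>) * (\<integral>\<^sup>+y. \<integral>\<^sup>+x. K (x, (s * x + y) / c) \<partial>lborel \<partial>lborel)"
  by (rule nn_integral_cmult) measurable
 also have "(\<integral>\<^sup>+y. \<integral>\<^sup>+x. K (x, (s * x + y) / c) \<partial>lborel \<partial>lborel) = (\<integral>\<^sup>+x. \<integral>\<^sup>+y. K (x, (s * x + y) / c) \<partial>lborel \<partial>lborel)"
  by (rule lborel_pair.Fubini') measurable
 also have "\<dots> = (\<integral>\<^sup>+x. ennreal \<bar>c\<bar> * (\<integral>\<^sup>+y. K (x, y) \<partial>lborel) \<partial>lborel)"
 proof (rule nn_integral_cong)
  fix x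
  have "(\<integral>\<^sup>+y. K (x, y) \<partial>lborel) = ennreal \<bar>1 / c\<bar> * (\<integral>\<^sup>+y. K (x, s * x / c + 1 / c * y) \<partial>lborel)"
   using False by (intro nn_integral_real_affine) auto
  then show "(\<integral>\<^sup>+y. K (x, (s * x + y) / c) \<partial>lborel) = ennreal \<bar>c\<bar> * (\<integral>\<^sup>+y. K (x, y) \<partial>lborel)"
   using False by (simp add: mult.assoc[symmetric] ennreal_mult[symmetric] add_divide_distrib)
 qed
 also have "\<dots> = ennreal \<bar>c\<bar> * (\<integral>\<^sup>+x. \<integral>\<^sup>+y. K (x, y) \<partial>lborel \<partial>lborel)" by (rule nn_integral_cmult) measurable
 finally show ?thesis using False by (simp add: mult.assoc[symmetric] ennreal_mult[symmetric])
qed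

definition stdG :: "real measure" where
 "stdG = density lborel (\<lambda>x. ennreal (std_normal_density x))"

lemma sets_stdG [measurable_cong, simp]: "sets stdG = sets borel" and space_stdG [simp]: "space stdG = UNIV"
 by (auto simp: stdG_def)

interpretation stdG: prob_space stdG unfolding stdG_def by (rule prob_space_normal_density) simp

interpretation pG: product_sigma_finite "\<lambda>_::'i. stdG"
 by (simp add: product_sigma_finite_def stdG.sigma_finite_measure_axioms)

lemma nn_integral_stdG: "f \<in> borel_measurable borel \<Longrightarrow> (\<integral>\<^sup>+x. f x \<partial>stdG) = (\<integral>\<^sup>+x. ennreal (std_normal_density x) * f x \<partial>lborel)"
 unfolding stdG_def by (subst nn_integral_density) auto

text \<open>The product of two standard normal densities depends on the radius only, so the rotation
  of Lebesgue measure carries over.\<close>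

lemma stdG_rotation:
 fixes F :: "real \<times> real => ennreal"
 assumes F[measurable]: "F \<in> borel_measurable (borel \<Otimes>\<^sub>M borel)" and cs: "c\<^sup>2 + s\<^sup>2 = 1"
 shows "(\<integral>\<^sup>+x. \<integral>\<^sup>+y. F (c * x - s * y, s * x + c * y) \<partial>stdG \<partial>stdG) = (\<integral>\<^sup>+x. \<integral>\<^sup>+y. F (x, y) \<partial>stdG \<partial>stdG)"
proof -
 define K where "K p = ennreal (std_normal_density (fst p) * std_normal_density (snd p)) * F p" for p
 have K[measurable]: "K \<in> borel_measurable (borel \<Otimes>\<^sub>M borel)" unfolding K_def by measurable
 have inv: "std_normal_density (c * x - s * y) * std_normal_density (s * x + c * y) = std_normal_density x * std_normal_density y" for x y
 proof -
  have "(c * x - s * y)\<^sup>2 + (s * x + c * y)\<^sup>2 = (c\<^sup>2 + s\<^sup>2) * (x\<^sup>2 + y\<^sup>2)"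
   by (simp add: power2_eq_square algebra_simps)
  then have "- (c * x - s * y)\<^sup>2 / 2 + - (s * x + c * y)\<^sup>2 / 2 = - x\<^sup>2 / 2 + - y\<^sup>2 / 2" unfolding cs by simp
  then show ?thesis unfolding std_normal_density_def by (simp add: mult_exp_exp mult_ac flip: exp_add)
 qed
 have 1: "(\<integral>\<^sup>+x. \<integral>\<^sup>+y. G (x, y) \<partial>stdG \<partial>stdG) =
   (\<integral>\<^sup>+x. \<integral>\<^sup>+y. ennreal (std_normal_density x * std_normal_density y) * G (x, y) \<partial>lborel \<partial>lborel)"
  if [measurable]: "G \<in> borel_measurable (borel \<Otimes>\<^sub>M borel)" for G :: "real \<times> real => ennreal"
 proof -
  have "(\<integral>\<^sup>+x. \<integral>\<^sup>+y. G (x, y) \<partial>stdG \<partial>stdG) = (\<integral>\<^sup>+x. \<integral>\<^sup>+y. ennreal (std_normal_density y) * G (x, y) \<partial>lborel \<partial>stdG)"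
   by (intro nn_integral_cong nn_integral_stdG) measurable
  also have "\<dots> = (\<integral>\<^sup>+x. ennreal (std_normal_density x) * (\<integral>\<^sup>+y. ennreal (std_normal_density y) * G (x, y) \<partial>lborel) \<partial>lborel)"
   by (intro nn_integral_stdG) measurable
  also have "\<dots> = (\<integral>\<^sup>+x. \<integral>\<^sup>+y. ennreal (std_normal_density x * std_normal_density y) * G (x, y) \<partial>lborel \<partial>lborel)"
   by (intro nn_integral_cong) (simp add: nn_integral_cmult[symmetric] ennreal_mult mult.assoc)
  finally show ?thesis .
 qed
 have "(\<integral>\<^sup>+x. \<integral>\<^sup>+y. F (c * x - s * y, s * x + c * y) \<partial>stdG \<partial>stdG) =
   (\<integral>\<^sup>+x. \<integral>\<^sup>+y. K (c * x - s * y, s * x + c * y) \<partial>lborel \<partial>lborel)"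
  using 1[of "\<lambda>p. F (c * fst p - s * snd p, s * fst p + c * snd p)"] by (simp add: K_def inv)
 also have "\<dots> = (\<integral>\<^sup>+x. \<integral>\<^sup>+y. K (x, y) \<partial>lborel \<partial>lborel)" by (rule nn_integral_rotation[OF K cs])
 also have "\<dots> = (\<integral>\<^sup>+x. \<integral>\<^sup>+y. F (x, y) \<partial>stdG \<partial>stdG)" using 1[of F] by (simp add: K_def)
 finally show ?thesis .
qed

lemma stdG_pair: "pair_sigma_finite stdG stdG" by unfold_locales

text \<open>The rotation with cosine \<open>b / r\<close> and sine \<open>- a / r\<close> turns the
  linear form into \<open>r\<close> times the second variable.\<close>

lemma stdG_merge:
 assumes G[measurable]: "G \<in> borel_measurable borel"
 shows "(\<integral>\<^sup>+x. \<integral>\<^sup>+y. G (a * x + b * y) \<partial>stdG \<partial>stdG) = (\<integral>\<^sup>+y. G (sqrt (a\<^sup>2 + b\<^sup>2) * y) \<partial>stdG)"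
proof (cases "a = 0 \<and> b = 0")
 case True
 then show ?thesis by (simp add: stdG.emeasure_space_1[simplified])
next
 case False
 define r where "r = sqrt (a\<^sup>2 + b\<^sup>2)"
 have "a\<^sup>2 + b\<^sup>2 > 0" using False by (simp add: sum_power2_gt_zero_iff)
 then have r: "r > 0" "r\<^sup>2 = a\<^sup>2 + b\<^sup>2" by (auto simp: r_def)
 have one: "(b / r)\<^sup>2 + (- a / r)\<^sup>2 = 1" 
 proof -
  have "(b / r)\<^sup>2 + (- a / r)\<^sup>2 = (a\<^sup>2 + b\<^sup>2) / r\<^sup>2" by (simp add: power_divide add_divide_distrib)
  also have "\<dots> = 1" unfolding r(2)[symmetric] using r(1) by simp
  finally show ?thesis .
 qed
 have "(\<integral>\<^sup>+x. \<integral>\<^sup>+y. G (a * x + b * y) \<partial>stdG \<partial>stdG) =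
   (\<integral>\<^sup>+x. \<integral>\<^sup>+y. G (a * (b / r * x - (- a / r) * y) + b * ((- a / r) * x + b / r * y)) \<partial>stdG \<partial>stdG)"
  by (rule stdG_rotation[OF _ one, of "\<lambda>p. G (a * fst p + b * snd p)", symmetric, simplified fst_conv snd_conv]) measurable
 also have "\<dots> = (\<integral>\<^sup>+x. \<integral>\<^sup>+y. G (r * y) \<partial>stdG \<partial>stdG)"
 proof -
  have "a * (b / r * x - (- a / r) * y) + b * ((- a / r) * x + b / r * y) = r * y" for x y
  proof -
   have "a * (b / r * x - (- a / r) * y) + b * ((- a / r) * x + b / r * y) = (a\<^sup>2 + b\<^sup>2) * y / r"
    by (simp add: add_divide_distrib power2_eq_square algebra_simps)
   also have "\<dots> = r * y" unfolding r(2)[symmetric] using r(1) by (simp add: power2_eq_square)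
   finally show ?thesis .
  qed
  then show ?thesis by presburger
 qed
 also have "\<dots> = (\<integral>\<^sup>+y. G (r * y) \<partial>stdG)" by (simp add: stdG.emeasure_space_1[simplified])
 finally show ?thesis by (simp add: r_def)
qed

abbreviation normalM :: "real => real measure" where
 "normalM \<sigma> \<equiv> density lborel (\<lambda>t. ennreal (normal_density 0 \<sigma> t))"

lemma nn_integral_normalM:
 assumes [measurable]: "f \<in> borel_measurable borel" and \<sigma>: "\<sigma> > 0"
 shows "(\<integral>\<^sup>+x. f x \<partial>normalM \<sigma>) = (\<integral>\<^sup>+x. f (\<sigma> * x) \<partial>stdG)"
proof -
 have "(\<integral>\<^sup>+x. f x \<partial>normalM \<sigma>) = (\<integral>\<^sup>+x. ennreal (normal_density 0 \<sigma> x) * f x \<partial>lborel)"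
  by (subst nn_integral_density) auto
 also have "\<dots> = ennreal \<bar>\<sigma>\<bar> * (\<integral>\<^sup>+x. ennreal (normal_density 0 \<sigma> (0 + \<sigma> * x)) * f (0 + \<sigma> * x) \<partial>lborel)"
  using \<sigma> by (intro nn_integral_real_affine) auto
 also have "\<dots> = (\<integral>\<^sup>+x. ennreal (\<sigma> * normal_density 0 \<sigma> (\<sigma> * x)) * f (\<sigma> * x) \<partial>lborel)"
  using \<sigma> by (simp add: nn_integral_cmult[symmetric] ennreal_mult mult.assoc)
 also have "(\<lambda>x. \<sigma> * normal_density 0 \<sigma> (\<sigma> * x)) = std_normal_density"
  using \<sigma> by (auto simp: normal_density_def fun_eq_iff real_sqrt_mult power_mult_distrib)
 finally show ?thesis by (simp add: nn_integral_stdG)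
qed

text \<open>The two forms are brought to the triangular shape of a Cholesky factor of their Gram
  matrix, one variable at a time: a rotation frees the first form from the new variable, and what is
  left of it in the second form is merged with the independent part there. Stated for all test
  functions \<open>F\<close>, this describes the joint law.\<close>

lemma gauss_two_forms:
 assumes S: "finite S" and \<sigma>: "\<And>a. \<sigma> a > 0"
 shows "\<exists>\<alpha> \<beta> \<gamma>. \<alpha>\<^sup>2 = (\<Sum>a\<in>S. (\<sigma> a * u a)\<^sup>2) \<and> \<alpha> * \<beta> = (\<Sum>a\<in>S. (\<sigma> a)\<^sup>2 * u a * v a) \<and>
  \<beta>\<^sup>2 + \<gamma>\<^sup>2 = (\<Sum>a\<in>S. (\<sigma> a * v a)\<^sup>2) \<and>
  (\<forall>F\<in>borel_measurable (borel \<Otimes>\<^sub>M borel). (\<integral>\<^sup>+X. F (\<Sum>a\<in>S. u a * X a, \<Sum>a\<in>S. v a * X a) \<partial>Pi\<^sub>M S (\<lambda>a. normalM (\<sigma> a))) =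
   (\<integral>\<^sup>+x. \<integral>\<^sup>+y. F (\<alpha> * x, \<beta> * x + \<gamma> * y) \<partial>stdG \<partial>stdG))" using S proof induction case empty show ?case
  by (intro exI[of _ 0]) (auto simp: PiM_empty nn_integral_count_space_finite stdG.emeasure_space_1[simplified])
next
 case (insert b S)
 then obtain \<alpha> \<beta> \<gamma> where IH: "\<alpha>\<^sup>2 = (\<Sum>a\<in>S. (\<sigma> a * u a)\<^sup>2)" "\<alpha> * \<beta> = (\<Sum>a\<in>S. (\<sigma> a)\<^sup>2 * u a * v a)"
  "\<beta>\<^sup>2 + \<gamma>\<^sup>2 = (\<Sum>a\<in>S. (\<sigma> a * v a)\<^sup>2)"
  and F: "\<And>F. F \<in> borel_measurable (borel \<Otimes>\<^sub>M borel) \<Longrightarrow> (\<integral>\<^sup>+X. F (\<Sum>a\<in>S. u a * X a, \<Sum>a\<in>S. v a * X a) \<partial>Pi\<^sub>M S (\<lambda>a. normalM (\<sigma> a))) =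
   (\<integral>\<^sup>+x. \<integral>\<^sup>+y. F (\<alpha> * x, \<beta> * x + \<gamma> * y) \<partial>stdG \<partial>stdG)" by blast define u' where "u' = \<sigma> b * u b"
 define v' where "v' = \<sigma> b * v b"
 define \<rho> where "\<rho> = sqrt (\<alpha>\<^sup>2 + u'\<^sup>2)"
 \<comment> \<open>Cosine and sine of the rotation; if both coefficients of the first form vanish,
   the identity is taken.\<close>
 define c where "c = (if \<rho> = 0 then 1 else \<alpha> / \<rho>)"
 define s where "s = (if \<rho> = 0 then 0 else u' / \<rho>)"
 have \<rho>2: "\<rho>\<^sup>2 = \<alpha>\<^sup>2 + u'\<^sup>2" by (simp add: \<rho>_def)
 have cs: "c\<^sup>2 + s\<^sup>2 = 1" using \<rho>2 by (auto simp: c_def s_def power_divide simp flip: add_divide_distrib)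
 have \<rho>0: "\<alpha> = 0 \<and> u' = 0" if "\<rho> = 0" using \<rho>2 that by (simp add: sum_power2_eq_zero_iff)
 have ac: "\<alpha> = \<rho> * c" "u' = \<rho> * s" using \<rho>0 by (auto simp: c_def s_def)
 define \<beta>' where "\<beta>' = \<beta> * c + v' * s"
 define \<kappa> where "\<kappa> = v' * c - \<beta> * s"
 define \<tau> where "\<tau> = sqrt (\<kappa>\<^sup>2 + \<gamma>\<^sup>2)"
 have \<tau>2: "\<tau>\<^sup>2 = \<kappa>\<^sup>2 + \<gamma>\<^sup>2" by (simp add: \<tau>_def)
 interpret nM: product_sigma_finite "\<lambda>a. normalM (\<sigma> a)"
  using \<sigma> by (auto simp: product_sigma_finite_def intro!: prob_space_normal_density prob_space_imp_sigma_finite)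
 show ?case
 proof (rule exI[of _ \<rho>], rule exI[of _ \<beta>'], rule exI[of _ \<tau>], intro conjI ballI)
  show "\<rho>\<^sup>2 = (\<Sum>a\<in>insert b S. (\<sigma> a * u a)\<^sup>2)" using insert IH by (simp add: \<rho>2 u'_def)
  have "\<rho> * \<beta>' = \<alpha> * \<beta> + u' * v'" unfolding \<beta>'_def ac by (simp add: algebra_simps)
  then show "\<rho> * \<beta>' = (\<Sum>a\<in>insert b S. (\<sigma> a)\<^sup>2 * u a * v a)"
   using insert IH by (simp add: u'_def v'_def power2_eq_square)
  have "\<beta>'\<^sup>2 + \<tau>\<^sup>2 = (c\<^sup>2 + s\<^sup>2) * (\<beta>\<^sup>2 + v'\<^sup>2) + \<gamma>\<^sup>2" 
   unfolding \<tau>2 \<beta>'_def \<kappa>_def by (simp add: power2_eq_square algebra_simps)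
  then show "\<beta>'\<^sup>2 + \<tau>\<^sup>2 = (\<Sum>a\<in>insert b S. (\<sigma> a * v a)\<^sup>2)" using insert IH by (simp add: cs v'_def)
  fix F :: "real \<times> real => ennreal" assume [measurable]: "F \<in> borel_measurable (borel \<Otimes>\<^sub>M borel)"
  have eqS: "(\<Sum>a\<in>insert b S. w a * (X(b := z)) a) = (\<Sum>a\<in>S. w a * X a) + w b * z" for w X z
  proof -
   have "(\<Sum>a\<in>S. w a * (X(b := z)) a) = (\<Sum>a\<in>S. w a * X a)" using insert.hyps by (intro sum.cong) auto
   then show ?thesis using insert.hyps by (simp add: add.commute)
  qed
  have "(\<integral>\<^sup>+X. F (\<Sum>a\<in>insert b S. u a * X a, \<Sum>a\<in>insert b S. v a * X a) \<partial>Pi\<^sub>M (insert b S) (\<lambda>a. normalM (\<sigma> a))) =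
   (\<integral>\<^sup>+z. \<integral>\<^sup>+X. F ((\<Sum>a\<in>S. u a * X a) + u b * z, (\<Sum>a\<in>S. v a * X a) + v b * z) \<partial>Pi\<^sub>M S (\<lambda>a. normalM (\<sigma> a)) \<partial>normalM (\<sigma> b))"
   unfolding eqS[symmetric] using insert.hyps by (intro nM.product_nn_integral_insert_rev) measurable
  also have "\<dots> = (\<integral>\<^sup>+z. \<integral>\<^sup>+x. \<integral>\<^sup>+y. F (\<alpha> * x + u b * z, \<beta> * x + \<gamma> * y + v b * z) \<partial>stdG \<partial>stdG \<partial>normalM (\<sigma> b))"
  proof (rule nn_integral_cong)
   fix z
   show "(\<integral>\<^sup>+X. F ((\<Sum>a\<in>S. u a * X a) + u b * z, (\<Sum>a\<in>S. v a * X a) + v b * z) \<partial>Pi\<^sub>M S (\<lambda>a. normalM (\<sigma> a))) =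
    (\<integral>\<^sup>+x. \<integral>\<^sup>+y. F (\<alpha> * x + u b * z, \<beta> * x + \<gamma> * y + v b * z) \<partial>stdG \<partial>stdG)"
    using F[of "\<lambda>p. F (fst p + u b * z, snd p + v b * z)"] by simp
  qed
  also have "\<dots> = (\<integral>\<^sup>+z. \<integral>\<^sup>+x. \<integral>\<^sup>+y. F (\<alpha> * x + u' * z, \<beta> * x + \<gamma> * y + v' * z) \<partial>stdG \<partial>stdG \<partial>stdG)"
   unfolding u'_def v'_def mult.assoc mult.left_commute[of "\<sigma> b"]
   by (subst nn_integral_normalM[OF _ \<sigma>]) (simp_all add: mult.left_commute)
  also have "\<dots> = (\<integral>\<^sup>+x. \<integral>\<^sup>+z. \<integral>\<^sup>+y. F (\<alpha> * x + u' * z, \<beta> * x + \<gamma> * y + v' * z) \<partial>stdG \<partial>stdG \<partial>stdG)"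
   by (rule pair_sigma_finite.Fubini'[OF stdG_pair]) measurable
  also have "\<dots> = (\<integral>\<^sup>+x. \<integral>\<^sup>+z. \<integral>\<^sup>+y. F (\<alpha> * (c * x - s * z) + u' * (s * x + c * z), \<beta> * (c * x - s * z) + \<gamma> * y + v' * (s * x + c * z)) \<partial>stdG \<partial>stdG \<partial>stdG)"
   by (rule stdG_rotation[OF _ cs, of "\<lambda>p. \<integral>\<^sup>+y. F (\<alpha> * fst p + u' * snd p, \<beta> * fst p + \<gamma> * y + v' * snd p) \<partial>stdG", symmetric, simplified fst_conv snd_conv]) measurable
  also have "\<dots> = (\<integral>\<^sup>+x. \<integral>\<^sup>+z. \<integral>\<^sup>+y. F (\<rho> * x, \<beta>' * x + (\<kappa> * z + \<gamma> * y)) \<partial>stdG \<partial>stdG \<partial>stdG)"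
  proof -
   have "\<alpha> * (c * x - s * z) + u' * (s * x + c * z) = \<rho> * x" for x z
   proof -
    have "\<alpha> * (c * x - s * z) + u' * (s * x + c * z) = \<rho> * (c\<^sup>2 + s\<^sup>2) * x" 
     unfolding ac by (simp add: power2_eq_square algebra_simps)
    then show ?thesis by (simp add: cs)
   qed
   moreover have "\<beta> * (c * x - s * z) + \<gamma> * y + v' * (s * x + c * z) = \<beta>' * x + (\<kappa> * z + \<gamma> * y)" for x y z
    unfolding \<beta>'_def \<kappa>_def by (simp add: algebra_simps)
   ultimately show ?thesis by presburger
  qed
  also have "\<dots> = (\<integral>\<^sup>+x. \<integral>\<^sup>+y. F (\<rho> * x, \<beta>' * x + \<tau> * y) \<partial>stdG \<partial>stdG)"
  proof (rule nn_integral_cong)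
   fix x
   show "(\<integral>\<^sup>+z. \<integral>\<^sup>+y. F (\<rho> * x, \<beta>' * x + (\<kappa> * z + \<gamma> * y)) \<partial>stdG \<partial>stdG) = (\<integral>\<^sup>+y. F (\<rho> * x, \<beta>' * x + \<tau> * y) \<partial>stdG)"
    unfolding \<tau>_def by (rule stdG_merge[where G = "\<lambda>t. F (\<rho> * x, \<beta>' * x + t)"]) measurable
  qed
  finally show "(\<integral>\<^sup>+X. F (\<Sum>a\<in>insert b S. u a * X a, \<Sum>a\<in>insert b S. v a * X a) \<partial>Pi\<^sub>M (insert b S) (\<lambda>a. normalM (\<sigma> a))) =
   (\<integral>\<^sup>+x. \<integral>\<^sup>+y. F (\<rho> * x, \<beta>' * x + \<tau> * y) \<partial>stdG \<partial>stdG)" . qed qed 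
lemma nn_integral_abs_stdG: "(\<integral>\<^sup>+x. ennreal \<bar>r * x\<bar> \<partial>stdG) = ennreal (sqrt (2 / pi) * \<bar>r\<bar>)"
proof -
 have "has_bochner_integral lborel (\<lambda>x. std_normal_density x * \<bar>x\<bar> ^ (2 * 0 + 1)) (sqrt (2 / pi) * 2 ^ 0 * fact 0)"
  by (rule std_normal_moment_abs_odd)
 then have "(\<integral>\<^sup>+x. ennreal (std_normal_density x * \<bar>x\<bar>) \<partial>lborel) = ennreal (sqrt (2 / pi))"
  by (subst nn_integral_eq_integral) (auto simp: has_bochner_integral_iff)
 then have "(\<integral>\<^sup>+x. ennreal \<bar>x\<bar> \<partial>stdG) = ennreal (sqrt (2 / pi))" by (simp add: nn_integral_stdG ennreal_mult)
 then show ?thesis by (simp add: abs_mult ennreal_mult nn_integral_cmult) (simp add: mult.commute)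
qed

lemma nn_integral_abs_two_stdG:
 "(\<integral>\<^sup>+x. \<integral>\<^sup>+y. ennreal \<bar>a * x + b * y\<bar> \<partial>stdG \<partial>stdG) = ennreal (sqrt (2 / pi) * sqrt (a\<^sup>2 + b\<^sup>2))"
 by (subst stdG_merge[where G = "\<lambda>t. ennreal \<bar>t\<bar>"]) (auto simp: nn_integral_abs_stdG)

lemma gauss_abs_form:
 assumes "finite S" "\<And>a. \<sigma> a > 0"
 shows "(\<integral>\<^sup>+X. ennreal \<bar>\<Sum>a\<in>S. v a * X a\<bar> \<partial>Pi\<^sub>M S (\<lambda>a. normalM (\<sigma> a))) =
  ennreal (sqrt (2 / pi) * sqrt (\<Sum>a\<in>S. (\<sigma> a * v a)\<^sup>2))" proof -
 obtain \<alpha> \<beta> \<gamma> where g: "\<beta>\<^sup>2 + \<gamma>\<^sup>2 = (\<Sum>a\<in>S. (\<sigma> a * v a)\<^sup>2)"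
  and F: "\<forall>F\<in>borel_measurable (borel \<Otimes>\<^sub>M borel). (\<integral>\<^sup>+X. F (\<Sum>a\<in>S. 0 * X a, \<Sum>a\<in>S. v a * X a) \<partial>Pi\<^sub>M S (\<lambda>a. normalM (\<sigma> a))) =
   (\<integral>\<^sup>+x. \<integral>\<^sup>+y. F (\<alpha> * x, \<beta> * x + \<gamma> * y) \<partial>stdG \<partial>stdG)"
  using gauss_two_forms[OF assms(1), of \<sigma>, OF assms(2), where u = "\<lambda>_. 0" and v = v] by blast
 have "(\<lambda>p. ennreal \<bar>snd p\<bar>) \<in> borel_measurable (borel \<Otimes>\<^sub>M borel)" by measurable
 from F[rule_format, OF this] show ?thesis by (simp add: nn_integral_abs_two_stdG g)
qed

text \<open>The conditional expectation of \<^term>\<open>\<bar>V\<bar>\<close> given that \<^term>\<open>U\<close> plus an independent standard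
 normal variable vanishes, in terms of the Gram matrix of the linear forms \<^term>\<open>U\<close> and \<^term>\<open>V\<close>.\<close>

lemma gauss_conditional_abs:
 assumes "finite S" "\<And>a. \<sigma> a > 0"
 shows "(\<integral>\<^sup>+X. ennreal (\<bar>\<Sum>a\<in>S. v a * X a\<bar> * std_normal_density (\<Sum>a\<in>S. u a * X a)) \<partial>Pi\<^sub>M S (\<lambda>a. normalM (\<sigma> a))) =
  ennreal (1 / pi * sqrt ((\<Sum>a\<in>S. (\<sigma> a * v a)\<^sup>2) / (1 + (\<Sum>a\<in>S. (\<sigma> a * u a)\<^sup>2)) -
   ((\<Sum>a\<in>S. (\<sigma> a)\<^sup>2 * u a * v a) / (1 + (\<Sum>a\<in>S. (\<sigma> a * u a)\<^sup>2)))\<^sup>2))" proof -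
 obtain \<alpha> \<beta> \<gamma> where g: "\<alpha>\<^sup>2 = (\<Sum>a\<in>S. (\<sigma> a * u a)\<^sup>2)" "\<alpha> * \<beta> = (\<Sum>a\<in>S. (\<sigma> a)\<^sup>2 * u a * v a)"
  "\<beta>\<^sup>2 + \<gamma>\<^sup>2 = (\<Sum>a\<in>S. (\<sigma> a * v a)\<^sup>2)"
  and F: "\<forall>F\<in>borel_measurable (borel \<Otimes>\<^sub>M borel). (\<integral>\<^sup>+X. F (\<Sum>a\<in>S. u a * X a, \<Sum>a\<in>S. v a * X a) \<partial>Pi\<^sub>M S (\<lambda>a. normalM (\<sigma> a))) =
   (\<integral>\<^sup>+x. \<integral>\<^sup>+y. F (\<alpha> * x, \<beta> * x + \<gamma> * y) \<partial>stdG \<partial>stdG)"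
  using gauss_two_forms[OF assms(1), of \<sigma>, OF assms(2), where u = u and v = v] by blast
 \<comment> \<open>The product of the two normal densities is a constant times the density at
   \<open>\<kappa> * x\<close>, so after rescaling \<open>x\<close> only the absolute moment of a
   normal form remains.\<close>
 define \<kappa> where "\<kappa> = sqrt (1 + \<alpha>\<^sup>2)"
 have \<kappa>: "\<kappa> > 0" "\<kappa>\<^sup>2 = 1 + \<alpha>\<^sup>2" by (auto simp: \<kappa>_def add_pos_nonneg)
 have dens: "std_normal_density x * std_normal_density (\<alpha> * x) = 1 / sqrt (2 * pi) * std_normal_density (\<kappa> * x)" for x
 proof -
  have "- x\<^sup>2 / 2 + - (\<alpha> * x)\<^sup>2 / 2 = - (\<kappa> * x)\<^sup>2 / 2"
   unfolding power_mult_distrib \<kappa>(2) by (simp add: field_simps)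
  then show ?thesis unfolding std_normal_density_def by (simp add: mult_exp_exp flip: exp_add)
 qed
 have m: "(\<lambda>p. ennreal (\<bar>snd p\<bar> * std_normal_density (fst p))) \<in> borel_measurable (borel \<Otimes>\<^sub>M borel)" by measurable
 have "(\<integral>\<^sup>+X. ennreal (\<bar>\<Sum>a\<in>S. v a * X a\<bar> * std_normal_density (\<Sum>a\<in>S. u a * X a)) \<partial>Pi\<^sub>M S (\<lambda>a. normalM (\<sigma> a))) =
   (\<integral>\<^sup>+x. \<integral>\<^sup>+y. ennreal (\<bar>\<beta> * x + \<gamma> * y\<bar> * std_normal_density (\<alpha> * x)) \<partial>stdG \<partial>stdG)"
  using F[rule_format, OF m] by simp
 also have "\<dots> = (\<integral>\<^sup>+x. ennreal (std_normal_density (\<alpha> * x)) * (\<integral>\<^sup>+y. ennreal \<bar>\<beta> * x + \<gamma> * y\<bar> \<partial>stdG) \<partial>stdG)"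
  by (intro nn_integral_cong) (simp add: ennreal_mult mult.commute nn_integral_cmult[symmetric])
 also have "\<dots> = (\<integral>\<^sup>+x. ennreal (std_normal_density x * std_normal_density (\<alpha> * x)) * (\<integral>\<^sup>+y. ennreal \<bar>\<beta> * x + \<gamma> * y\<bar> \<partial>stdG) \<partial>lborel)"
  by (subst nn_integral_stdG) (auto simp: ennreal_mult mult.assoc)
 also have "\<dots> = (\<integral>\<^sup>+x. ennreal (1 / sqrt (2 * pi)) * (ennreal (std_normal_density (\<kappa> * x)) * (\<integral>\<^sup>+y. ennreal \<bar>\<beta> * x + \<gamma> * y\<bar> \<partial>stdG)) \<partial>lborel)"
  unfolding dens by (subst ennreal_mult) (simp_all add: mult.assoc)
 also have "\<dots> = ennreal (1 / sqrt (2 * pi)) * (\<integral>\<^sup>+x. ennreal (std_normal_density (\<kappa> * x)) * (\<integral>\<^sup>+y. ennreal \<bar>\<beta> * x + \<gamma> * y\<bar> \<partial>stdG) \<partial>lborel)"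
  by (rule nn_integral_cmult) measurable
 also have "(\<integral>\<^sup>+x. ennreal (std_normal_density (\<kappa> * x)) * (\<integral>\<^sup>+y. ennreal \<bar>\<beta> * x + \<gamma> * y\<bar> \<partial>stdG) \<partial>lborel) =
   ennreal \<bar>1 / \<kappa>\<bar> * (\<integral>\<^sup>+x. ennreal (std_normal_density (\<kappa> * (0 + 1 / \<kappa> * x))) * (\<integral>\<^sup>+y. ennreal \<bar>\<beta> * (0 + 1 / \<kappa> * x) + \<gamma> * y\<bar> \<partial>stdG) \<partial>lborel)"
  using \<kappa> by (intro nn_integral_real_affine) auto
 also have "\<dots> = ennreal (1 / \<kappa>) * (\<integral>\<^sup>+x. \<integral>\<^sup>+y. ennreal \<bar>\<beta> / \<kappa> * x + \<gamma> * y\<bar> \<partial>stdG \<partial>stdG)"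
  using \<kappa> by (subst nn_integral_stdG) auto
 also have "\<dots> = ennreal (1 / \<kappa>) * ennreal (sqrt (2 / pi) * sqrt ((\<beta> / \<kappa>)\<^sup>2 + \<gamma>\<^sup>2))"
  by (simp only: nn_integral_abs_two_stdG)
 also have "ennreal (1 / sqrt (2 * pi)) * (ennreal (1 / \<kappa>) * ennreal (sqrt (2 / pi) * sqrt ((\<beta> / \<kappa>)\<^sup>2 + \<gamma>\<^sup>2))) =
   ennreal (1 / sqrt (2 * pi) * (1 / \<kappa> * (sqrt (2 / pi) * sqrt ((\<beta> / \<kappa>)\<^sup>2 + \<gamma>\<^sup>2))))" proof -
  have "ennreal p * (ennreal q * ennreal t) = ennreal (p * (q * t))" if "p \<ge> 0" "q \<ge> 0" "t \<ge> 0" for p q t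
   using that by (simp add: ennreal_mult)
  then show ?thesis using \<kappa>(1) by simp
 qed
 also have "1 / sqrt (2 * pi) * (1 / \<kappa> * (sqrt (2 / pi) * sqrt ((\<beta> / \<kappa>)\<^sup>2 + \<gamma>\<^sup>2))) = 1 / pi * sqrt (((\<beta> / \<kappa>)\<^sup>2 + \<gamma>\<^sup>2) / \<kappa>\<^sup>2)"
  using \<kappa>(1) by (simp add: real_sqrt_divide real_sqrt_mult)
 also have "((\<beta> / \<kappa>)\<^sup>2 + \<gamma>\<^sup>2) / \<kappa>\<^sup>2 = (\<beta>\<^sup>2 + \<gamma>\<^sup>2) / \<kappa>\<^sup>2 - (\<alpha> * \<beta> / \<kappa>\<^sup>2)\<^sup>2"
 proof -
  have "\<beta>\<^sup>2 = \<beta>\<^sup>2 * (\<kappa>\<^sup>2 - \<alpha>\<^sup>2)" using \<kappa>(2) by simp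
  then have 1: "\<beta>\<^sup>2 + \<gamma>\<^sup>2 * \<kappa>\<^sup>2 = (\<beta>\<^sup>2 + \<gamma>\<^sup>2) * \<kappa>\<^sup>2 - (\<alpha> * \<beta>)\<^sup>2" by (simp add: algebra_simps power_mult_distrib)
  define k where "k = \<kappa>\<^sup>2"
  have k: "k > 0" using \<kappa>(1) by (simp add: k_def)
  have "((\<beta> / \<kappa>)\<^sup>2 + \<gamma>\<^sup>2) / \<kappa>\<^sup>2 = (\<beta>\<^sup>2 + \<gamma>\<^sup>2 * k) / (k * k)"
   using k unfolding power_divide k_def[symmetric] by (simp add: field_simps)
  also have "\<dots> = (\<beta>\<^sup>2 + \<gamma>\<^sup>2) / k - (\<alpha> * \<beta> / k)\<^sup>2"
   unfolding k_def 1 unfolding k_def[symmetric] power_divide power2_eq_square[of k] using k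
   by (simp add: diff_divide_distrib)
  also have "\<dots> = (\<beta>\<^sup>2 + \<gamma>\<^sup>2) / \<kappa>\<^sup>2 - (\<alpha> * \<beta> / \<kappa>\<^sup>2)\<^sup>2" by (simp add: k_def)
  finally show ?thesis .
 qed
 finally show ?thesis by (simp only: g \<kappa>(2))
qed

section \<open>Determinants with independent random rows\<close>

lemma det_row_expand:
 assumes "m < n"
 obtains cof where "\<And>q. det (mat n n (\<lambda>(i, c). if i = m then q c else N i c)) = (\<Sum>c<n. q c * cof c :: real)"
proof -
 define A where "A q = mat n n (\<lambda>(i, c). if i = m then q c else N i c)" for q :: "nat => real"
 have "det (A q) = (\<Sum>c<n. q c * cofactor (A (\<lambda>_. 0)) m c)" for q
 proof -
  have "det (A q) = (\<Sum>c<n. A q $$ (m, c) * cofactor (A q) m c)"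
   by (rule laplace_expansion_row) (use assms in \<open>auto simp: A_def\<close>)
  also have "\<dots> = (\<Sum>c<n. q c * cofactor (A (\<lambda>_. 0)) m c)"
  proof (rule sum.cong)
   fix c assume "c \<in> {..<n}"
   have "mat_delete (A q) m c = mat_delete (A (\<lambda>_. 0)) m c"
    unfolding mat_delete_def by (rule eq_matI) (use assms in \<open>auto simp: A_def\<close>)
   then show "A q $$ (m, c) * cofactor (A q) m c = q c * cofactor (A (\<lambda>_. 0)) m c"
    using \<open>c \<in> _\<close> assms by (simp add: cofactor_def A_def)
  qed simp
  finally show ?thesis .
 qed
 then show ?thesis using that unfolding A_def by blast
qed

lemma measurable_component_comp:
 assumes "f \<in> borel_measurable (M i)" "i \<in> I"
 shows "(\<lambda>\<omega>. f (\<omega> i)) \<in> borel_measurable (Pi\<^sub>M I M)"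
 using measurable_compose[OF measurable_component_singleton[OF assms(2), of M], of f borel] assms(1) by simp

lemma eadet_measurable_if:
 assumes "\<And>i c. i < n \<Longrightarrow> c < n \<Longrightarrow> P i \<Longrightarrow> f i c \<in> borel_measurable M"
 shows "(\<lambda>x. eadet n (\<lambda>(i, c). if P i then f i c x else R i c)) \<in> borel_measurable M"
proof (intro eadet_measurable)
 show "(\<lambda>x. if P i then f i c x else R i c) \<in> borel_measurable M" if "i < n" "c < n" for i c
  using assms[OF that] by (cases "P i") auto
qed

lemma eadet_measurable_if2:
 assumes "\<And>c. c < n \<Longrightarrow> g c \<in> borel_measurable M" "\<And>i c. i < n \<Longrightarrow> c < n \<Longrightarrow> P i \<Longrightarrow> f i c \<in> borel_measurable M"
 shows "(\<lambda>x. eadet n (\<lambda>(i, c). if i = m then g c x else if P i then f i c x else R i c)) \<in> borel_measurable M"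
proof (intro eadet_measurable)
 show "(\<lambda>x. if i = m then g c x else if P i then f i c x else R i c) \<in> borel_measurable M" if "i < n" "c < n" for i c
  using assms(1)[of c] assms(2)[OF that] that by (cases "i = m"; cases "P i") auto
qed

text \<open>By row-linearity of the determinant, the expected absolute determinant of a matrix with
 independent rows depends on each row only through the expected absolute values of its linear forms.\<close>

lemma expected_abs_det_cong:
 fixes \<mu> :: "nat => 'a measure" and \<nu> :: "nat => 'b measure"
  and \<rho> :: "nat => nat => 'a => real" and \<rho>' :: "nat => nat => 'b => real"
 assumes \<mu>: "\<And>i. sigma_finite_measure (\<mu> i)" and \<nu>: "\<And>i. sigma_finite_measure (\<nu> i)"
  and m1: "\<And>i c. i < n \<Longrightarrow> c < n \<Longrightarrow> \<rho> i c \<in> borel_measurable (\<mu> i)"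
  and m2: "\<And>i c. i < n \<Longrightarrow> c < n \<Longrightarrow> \<rho>' i c \<in> borel_measurable (\<nu> i)"
  and T: "\<And>i q. i < n \<Longrightarrow> (\<integral>\<^sup>+\<omega>. ennreal \<bar>\<Sum>c<n. \<rho> i c \<omega> * q c\<bar> \<partial>\<mu> i) =
    k i * (\<integral>\<^sup>+\<omega>. ennreal \<bar>\<Sum>c<n. \<rho>' i c \<omega> * q c\<bar> \<partial>\<nu> i)"
 shows "(\<integral>\<^sup>+\<omega>. eadet n (\<lambda>(i, c). \<rho> i c (\<omega> i)) \<partial>Pi\<^sub>M {..<n} \<mu>) =
  (\<Prod>i<n. k i) * (\<integral>\<^sup>+\<omega>. eadet n (\<lambda>(i, c). \<rho>' i c (\<omega> i)) \<partial>Pi\<^sub>M {..<n} \<nu>)" proof -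
 interpret M: product_sigma_finite \<mu> using \<mu> by (simp add: product_sigma_finite_def)
 interpret N: product_sigma_finite \<nu> using \<nu> by (simp add: product_sigma_finite_def)
 have meas1: "(\<lambda>\<omega>. eadet n (\<lambda>(i, c). if i < m then \<rho> i c (\<omega> i) else R i c)) \<in> borel_measurable (Pi\<^sub>M {..<m} \<mu>)" for m R
  by (intro eadet_measurable_if measurable_component_comp m1) auto
 have meas2: "(\<lambda>\<omega>. eadet n (\<lambda>(i, c). if i < m then \<rho>' i c (\<omega> i) else R i c)) \<in> borel_measurable (Pi\<^sub>M {..<m} \<nu>)" for m R
  by (intro eadet_measurable_if measurable_component_comp m2) auto
 \<comment> \<open>Rows are exchanged one at a time: in the hybrid matrix the rows of index less
   than \<open>m\<close> are random, and \<open>R\<close> holds arbitrary fixed values for the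
   others.\<close>
 have main: "(\<integral>\<^sup>+\<omega>. eadet n (\<lambda>(i, c). if i < m then \<rho> i c (\<omega> i) else R i c) \<partial>Pi\<^sub>M {..<m} \<mu>) =
  (\<Prod>i<m. k i) * (\<integral>\<^sup>+\<omega>. eadet n (\<lambda>(i, c). if i < m then \<rho>' i c (\<omega> i) else R i c) \<partial>Pi\<^sub>M {..<m} \<nu>)"
  if "m \<le> n" for m R using that
 proof (induction m arbitrary: R)
  case 0
  then show ?case by (simp add: PiM_empty nn_integral_count_space_finite)
 next
  case (Suc m)
  define D where "D \<omega> q = det (mat n n (\<lambda>(i, c). if i = m then q c else if i < m then \<rho>' i c (\<omega> i) else R i c))" for \<omega> q
  have e1: "mat n n (\<lambda>(i, c). if i < Suc m then \<rho> i c (fun_upd \<omega> m z i) else R i c) =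
   mat n n (\<lambda>(i, c). if i < m then \<rho> i c (\<omega> i) else if i = m then \<rho> m c z else R i c)" for \<omega> z
   by (rule eq_matI) auto
  have e2: "det (mat n n (\<lambda>(i, c). if i < m then \<rho>' i c (\<omega> i) else if i = m then q c else R i c)) = D \<omega> q" for \<omega> q
   unfolding D_def by (intro arg_cong[where f = det] eq_matI) auto
  have e3: "det (mat n n (\<lambda>(i, c). if i < Suc m then \<rho>' i c (fun_upd \<omega> m z i) else R i c)) = D \<omega> (\<lambda>c. \<rho>' m c z)" for \<omega> z
   unfolding D_def by (intro arg_cong[where f = det] eq_matI) auto
  have Dm: "(\<lambda>p. ennreal \<bar>D (snd p) (\<lambda>c. \<rho> m c (fst p))\<bar>) \<in> borel_measurable (\<mu> m \<Otimes>\<^sub>M Pi\<^sub>M {..<m} \<nu>)"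
   unfolding D_def using Suc.prems
   by (intro eadet_measurable_if2 measurable_compose[OF measurable_fst m1] measurable_compose[OF measurable_snd measurable_component_comp[where M = \<nu>, OF m2]]) auto
  have swap: "(\<integral>\<^sup>+z. \<integral>\<^sup>+\<omega>. ennreal \<bar>D \<omega> (\<lambda>c. \<rho> m c z)\<bar> \<partial>Pi\<^sub>M {..<m} \<nu> \<partial>\<mu> m) =
    (\<integral>\<^sup>+\<omega>. \<integral>\<^sup>+z. ennreal \<bar>D \<omega> (\<lambda>c. \<rho> m c z)\<bar> \<partial>\<mu> m \<partial>Pi\<^sub>M {..<m} \<nu>)" proof (rule pair_sigma_finite.Fubini')
   show "pair_sigma_finite (Pi\<^sub>M {..<m} \<nu>) (\<mu> m)"
    using \<mu> N.sigma_finite by (simp add: pair_sigma_finite_def)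
   have "(\<lambda>p. (snd p, fst p)) \<in> Pi\<^sub>M {..<m} \<nu> \<Otimes>\<^sub>M \<mu> m \<rightarrow>\<^sub>M \<mu> m \<Otimes>\<^sub>M Pi\<^sub>M {..<m} \<nu>" by measurable
   from measurable_compose[OF this Dm] show "(\<lambda>(x, y). ennreal \<bar>D x (\<lambda>c. \<rho> m c y)\<bar>) \<in> borel_measurable (Pi\<^sub>M {..<m} \<nu> \<Otimes>\<^sub>M \<mu> m)"
    by (simp add: case_prod_beta')
  qed
  have row: "(\<integral>\<^sup>+z. ennreal \<bar>D \<omega> (\<lambda>c. \<rho> m c z)\<bar> \<partial>\<mu> m) = k m * (\<integral>\<^sup>+z. ennreal \<bar>D \<omega> (\<lambda>c. \<rho>' m c z)\<bar> \<partial>\<nu> m)" for \<omega>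
  proof -
   have "m < n" using Suc.prems by simp
   from det_row_expand[OF this, of "\<lambda>i c. if i < m then \<rho>' i c (\<omega> i) else R i c"]
   obtain cof where cof: "\<And>q. D \<omega> q = (\<Sum>c<n. q c * cof c)" unfolding D_def by blast
   show ?thesis unfolding cof using T[OF \<open>m < n\<close>, of cof] by simp
  qed
  have Dk: "(\<lambda>\<omega>. \<integral>\<^sup>+z. ennreal \<bar>D \<omega> (\<lambda>c. \<rho>' m c z)\<bar> \<partial>\<nu> m) \<in> borel_measurable (Pi\<^sub>M {..<m} \<nu>)"
  proof (rule sigma_finite_measure.borel_measurable_nn_integral[OF \<nu>])
   have "(\<lambda>p. ennreal \<bar>D (fst p) (\<lambda>c. \<rho>' m c (snd p))\<bar>) \<in> borel_measurable (Pi\<^sub>M {..<m} \<nu> \<Otimes>\<^sub>M \<nu> m)"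
    unfolding D_def using Suc.prems
    by (intro eadet_measurable_if2 measurable_compose[OF measurable_snd m2] measurable_compose[OF measurable_fst measurable_component_comp[where M = \<nu>, OF m2]]) auto
   then show "(\<lambda>(\<omega>, z). ennreal \<bar>D \<omega> (\<lambda>c. \<rho>' m c z)\<bar>) \<in> borel_measurable (Pi\<^sub>M {..<m} \<nu> \<Otimes>\<^sub>M \<nu> m)"
    by (simp add: case_prod_beta')
  qed
  have "(\<integral>\<^sup>+\<omega>. eadet n (\<lambda>(i, c). if i < Suc m then \<rho> i c (\<omega> i) else R i c) \<partial>Pi\<^sub>M {..<Suc m} \<mu>) =
   (\<integral>\<^sup>+z. \<integral>\<^sup>+\<omega>. eadet n (\<lambda>(i, c). if i < m then \<rho> i c (\<omega> i) else if i = m then \<rho> m c z else R i c) \<partial>Pi\<^sub>M {..<m} \<mu> \<partial>\<mu> m)"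
   using meas1[of "Suc m" R] unfolding e1[symmetric] lessThan_Suc by (intro M.product_nn_integral_insert_rev) auto
  also have "\<dots> = (\<integral>\<^sup>+z. (\<Prod>i<m. k i) * (\<integral>\<^sup>+\<omega>. ennreal \<bar>D \<omega> (\<lambda>c. \<rho> m c z)\<bar> \<partial>Pi\<^sub>M {..<m} \<nu>) \<partial>\<mu> m)"
  proof (rule nn_integral_cong)
   fix z
   show "(\<integral>\<^sup>+\<omega>. eadet n (\<lambda>(i, c). if i < m then \<rho> i c (\<omega> i) else if i = m then \<rho> m c z else R i c) \<partial>Pi\<^sub>M {..<m} \<mu>) =
    (\<Prod>i<m. k i) * (\<integral>\<^sup>+\<omega>. ennreal \<bar>D \<omega> (\<lambda>c. \<rho> m c z)\<bar> \<partial>Pi\<^sub>M {..<m} \<nu>)"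
    using Suc.IH[of "\<lambda>i c. if i = m then \<rho> m c z else R i c"] Suc.prems by (simp add: e2)
  qed
  also have "\<dots> = (\<Prod>i<m. k i) * (\<integral>\<^sup>+z. \<integral>\<^sup>+\<omega>. ennreal \<bar>D \<omega> (\<lambda>c. \<rho> m c z)\<bar> \<partial>Pi\<^sub>M {..<m} \<nu> \<partial>\<mu> m)"
   using Dm by (intro nn_integral_cmult sigma_finite_measure.borel_measurable_nn_integral N.sigma_finite) (auto simp: case_prod_beta')
  also have "\<dots> = (\<Prod>i<m. k i) * (k m * (\<integral>\<^sup>+\<omega>. \<integral>\<^sup>+z. ennreal \<bar>D \<omega> (\<lambda>c. \<rho>' m c z)\<bar> \<partial>\<nu> m \<partial>Pi\<^sub>M {..<m} \<nu>))"
   unfolding swap row nn_integral_cmult[OF Dk] ..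
  also have "(\<integral>\<^sup>+\<omega>. \<integral>\<^sup>+z. ennreal \<bar>D \<omega> (\<lambda>c. \<rho>' m c z)\<bar> \<partial>\<nu> m \<partial>Pi\<^sub>M {..<m} \<nu>) =
   (\<integral>\<^sup>+\<omega>. eadet n (\<lambda>(i, c). if i < Suc m then \<rho>' i c (\<omega> i) else R i c) \<partial>Pi\<^sub>M {..<Suc m} \<nu>)"
   using meas2[of "Suc m" R] unfolding e3[symmetric] lessThan_Suc by (intro N.product_nn_integral_insert[symmetric]) auto
  finally show ?case by (simp add: mult.assoc)
 qed
 have "mat n n (\<lambda>(i, c). if i < n then f i c else (0::real)) = mat n n (\<lambda>(i, c). f i c)" for f
  by (rule eq_matI) auto
 then show ?thesis using main[of n "\<lambda>_ _. 0"] by simp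
qed

lemma sum_of_bool_lessThan:
 fixes f :: "nat => real"
 assumes "c < n"
 shows "(\<Sum>e<n. f e * of_bool (e = c)) = f c" "(\<Sum>e<n. f e * of_bool (c = e)) = f c"
  "(\<Sum>e<n. of_bool (e = c) * f e) = f c" "(\<Sum>e<n. of_bool (c = e) * f e) = f c"
proof -
 have "f e * of_bool (e = c) = (if e = c then f e else 0)" "f e * of_bool (c = e) = (if e = c then f e else 0)"
  "of_bool (e = c) * f e = (if e = c then f e else 0)" "of_bool (c = e) * f e = (if e = c then f e else 0)" for e
  by auto
 then show "(\<Sum>e<n. f e * of_bool (e = c)) = f c" "(\<Sum>e<n. f e * of_bool (c = e)) = f c"
  "(\<Sum>e<n. of_bool (e = c) * f e) = f c" "(\<Sum>e<n. of_bool (c = e) * f e) = f c"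
  using assms by (simp_all only:) simp_all
qed

abbreviation rowG :: "nat => (nat => real) measure" where
 "rowG n \<equiv> Pi\<^sub>M {..<n} (\<lambda>_. stdG)"

abbreviation matG :: "nat => (nat => nat => real) measure" where
 "matG n \<equiv> Pi\<^sub>M {..<n} (\<lambda>_. rowG n)"

lemma prob_rowG: "prob_space (rowG n)" by (intro prob_space_PiM stdG.prob_space_axioms)

lemma prob_matG: "prob_space (matG n)" by (intro prob_space_PiM prob_rowG)

lemma sf_rowG: "sigma_finite_measure (rowG n)" using prob_rowG by (rule prob_space_imp_sigma_finite)

lemma sf_matG: "sigma_finite_measure (matG n)" using prob_matG by (rule prob_space_imp_sigma_finite)

text \<open>The injection \<open>f\<close> lets the form involve only some of the variables, as
  happens for the columns of a minor.\<close>

lemma rowG_abs_form: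
 assumes f: "inj_on f K" "f ` K \<subseteq> {..<n}" "finite K"
 shows "(\<integral>\<^sup>+z. ennreal \<bar>\<Sum>c\<in>K. v c * z (f c)\<bar> \<partial>rowG n) = ennreal (sqrt (2 / pi) * sqrt (\<Sum>c\<in>K. (v c)\<^sup>2))"
proof -
 define w where "w a = (if a \<in> f ` K then v (inv_into K f a) else 0)" for a
 have S: "(\<Sum>a<n. F a) = (\<Sum>c\<in>K. F (f c))" if "\<And>a. a \<notin> f ` K \<Longrightarrow> F a = 0" for F :: "nat => real"
 proof -
  have "(\<Sum>a<n. F a) = (\<Sum>a\<in>f ` K. F a)" using f that by (intro sum.mono_neutral_right) auto
  then show ?thesis using f(1) by (simp add: sum.reindex)
 qed
 have w: "w (f c) = v c" if "c \<in> K" for c using that f(1) by (simp add: w_def)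
 have "(\<Sum>a<n. w a * z a) = (\<Sum>c\<in>K. v c * z (f c))" for z
  by (subst S) (simp add: w_def, intro sum.cong refl, simp add: w)
 moreover have "(\<Sum>a<n. (1 * w a)\<^sup>2) = (\<Sum>c\<in>K. (v c)\<^sup>2)"
  by (subst S) (simp add: w_def, intro sum.cong refl, simp add: w)
 ultimately show ?thesis using gauss_abs_form[of "{..<n}" "\<lambda>_. 1" w] by (simp add: stdG_def)
qed

lemma rowG_abs_form': "(\<integral>\<^sup>+z. ennreal \<bar>\<Sum>c<n. v c * z c\<bar> \<partial>rowG n) = ennreal (sqrt (2 / pi) * sqrt (\<Sum>c<n. (v c)\<^sup>2))"
 using rowG_abs_form[of "\<lambda>c. c" "{..<n}" n v] by simp

lemma measurable_rowG_entry [measurable]: "c < n \<Longrightarrow> (\<lambda>z. z c) \<in> borel_measurable (rowG n)"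
 using measurable_component_comp[of "\<lambda>x. x" "\<lambda>_. stdG" c "{..<n}"] by simp

lemma measurable_matG_entry [measurable]: "i < n \<Longrightarrow> c < n \<Longrightarrow> (\<lambda>Z. Z i c) \<in> borel_measurable (matG n)"
 using measurable_component_comp[of "\<lambda>z. z c" "\<lambda>_. rowG n" i "{..<n}"] by simp

text \<open>Coordinate \<open>i\<close> is replaced by an independent copy \<open>z\<close>. This
  expresses conditioning on all other coordinates without splitting the product space.\<close>

lemma nn_integral_resample:
 assumes M: "\<And>i. prob_space (M i)" and i: "finite I" "i \<in> I"
  and F: "F \<in> borel_measurable (Pi\<^sub>M I M)"
 shows "(\<integral>\<^sup>+w. F w \<partial>Pi\<^sub>M I M) = (\<integral>\<^sup>+w. \<integral>\<^sup>+z. F (w(i := z)) \<partial>M i \<partial>Pi\<^sub>M I M)"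
proof -
 interpret product_sigma_finite M using M by (simp add: product_sigma_finite_def prob_space_imp_sigma_finite)
 define J where "J = I - {i}"
 have I: "I = insert i J" "finite J" "i \<notin> J" using i by (auto simp: J_def)
 have m: "(\<lambda>w. \<integral>\<^sup>+z. F (w(i := z)) \<partial>M i) \<in> borel_measurable (Pi\<^sub>M I M)"
 proof (rule sigma_finite_measure.borel_measurable_nn_integral[OF sigma_finite_measures])
  have "(\<lambda>p. (fst p)(i := snd p)) \<in> Pi\<^sub>M I M \<Otimes>\<^sub>M M i \<rightarrow>\<^sub>M Pi\<^sub>M I M"
   using i(2) by (intro measurable_fun_upd[of _ I]) auto
  from measurable_compose[OF this F] show "(\<lambda>(w, z). F (w(i := z))) \<in> borel_measurable (Pi\<^sub>M I M \<Otimes>\<^sub>M M i)"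
   by (simp add: case_prod_beta')
 qed
 have "(\<integral>\<^sup>+w. \<integral>\<^sup>+z. F (w(i := z)) \<partial>M i \<partial>Pi\<^sub>M I M) = (\<integral>\<^sup>+w. \<integral>\<^sup>+w0. \<integral>\<^sup>+z. F (w(i := z)) \<partial>M i \<partial>M i \<partial>Pi\<^sub>M J M)"
  using m unfolding I(1) by (subst product_nn_integral_insert[OF I(2,3)]) auto
 also have "\<dots> = (\<integral>\<^sup>+w. \<integral>\<^sup>+z. F (w(i := z)) \<partial>M i \<partial>Pi\<^sub>M J M)"
  using M by (simp add: prob_space.emeasure_space_1)
 also have "\<dots> = (\<integral>\<^sup>+w. F w \<partial>Pi\<^sub>M I M)"
  using F unfolding I(1) by (subst product_nn_integral_insert[OF I(2,3)]) auto
 finally show ?thesis ..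
qed

text \<open>The Householder reflection that exchanges the direction of \<open>u\<close> with the
  unit vector at \<open>c0\<close>. It acts on the coordinates in \<open>J\<close> only, since
  \<open>u\<close> vanishes elsewhere.\<close>

lemma householder:
 fixes u :: "nat => real"
 assumes J: "J \<subseteq> {..<n}" "c0 \<in> J" and u: "\<And>c. c \<notin> J \<Longrightarrow> u c = 0"
 obtains H where "\<And>c d. H c d = (H d c :: real)" "\<And>c d. c \<notin> J \<or> d \<notin> J \<Longrightarrow> H c d = of_bool (c = d)"
  "\<And>c d. c < n \<Longrightarrow> d < n \<Longrightarrow> (\<Sum>e<n. H c e * H e d) = of_bool (c = d)"
  "\<And>c. c < n \<Longrightarrow> u c = sqrt (\<Sum>e<n. (u e)\<^sup>2) * H c0 c"
proof -
 define N where "N = sqrt (\<Sum>e<n. (u e)\<^sup>2)"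
 define w where "w c = u c - N * of_bool (c = c0)" for c
 define D where "D = (\<Sum>e<n. (w e)\<^sup>2)"
 have c0: "c0 < n" using J by auto
 have N2: "N\<^sup>2 = (\<Sum>e<n. (u e)\<^sup>2)" unfolding N_def by (rule real_sqrt_pow2) (auto intro: sum_nonneg)
 have D: "D = 2 * N * (N - u c0)"
 proof -
  have "D = (\<Sum>e<n. (u e)\<^sup>2 - 2 * N * (u e * of_bool (e = c0)) + N\<^sup>2 * of_bool (e = c0))"
   unfolding D_def w_def by (intro sum.cong) (auto simp: power2_eq_square algebra_simps)
  also have "\<dots> = (\<Sum>e<n. (u e)\<^sup>2) - 2 * N * (\<Sum>e<n. u e * of_bool (e = c0)) + N\<^sup>2 * (\<Sum>e<n. of_bool (e = c0))"
   by (simp only: sum.distrib sum_subtractf sum_distrib_left)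
  also have "(\<Sum>e<n. u e * of_bool (e = c0)) = u c0" using c0 by (simp only: sum_of_bool_lessThan)
  also have "(\<Sum>e<n. of_bool (e = c0) :: real) = 1" using c0 by (simp add: of_bool_def)
  finally show ?thesis unfolding N2[symmetric] by (simp add: power2_eq_square algebra_simps)
 qed
 define H where "H c d = of_bool (c = d) - 2 * w c * w d / D" for c d
 show ?thesis
 proof (rule that[of H])
  show "H c d = H d c" for c d by (auto simp: H_def)
  have wJ: "w c = 0" if "c \<notin> J" for c using that u J by (auto simp: w_def)
  then show "H c d = of_bool (c = d)" if "c \<notin> J \<or> d \<notin> J" for c d using that by (auto simp: H_def)
  show "(\<Sum>e<n. H c e * H e d) = of_bool (c = d)" if "c < n" "d < n" for c d
  proof -
   have "(\<Sum>e<n. H c e * H e d) = (\<Sum>e<n. of_bool (c = e) * of_bool (e = d) - 2 * w c * w d / D * of_bool (e = d) * 1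
     - 2 * w c * w d / D * of_bool (c = e) + 4 * w c * w d / (D * D) * (w e)\<^sup>2)"
    unfolding H_def by (intro sum.cong) (auto simp: power2_eq_square algebra_simps)
   also have "\<dots> = (\<Sum>e<n. of_bool (c = e) * of_bool (e = d)) - 2 * w c * w d / D * (\<Sum>e<n. of_bool (e = d))
     - 2 * w c * w d / D * (\<Sum>e<n. of_bool (c = e)) + 4 * w c * w d / (D * D) * D"
    unfolding D_def by (simp only: sum.distrib sum_subtractf sum_distrib_left mult_1_right)
   also have "(\<Sum>e<n. of_bool (e = d) :: real) = 1" using that by (simp add: of_bool_def)
   also have "(\<Sum>e<n. of_bool (c = e) :: real) = 1" using that by (simp add: of_bool_def)
   also have "(\<Sum>e<n. of_bool (c = e) * of_bool (e = d) :: real) = of_bool (c = d)"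
    using that by (simp only: sum_of_bool_lessThan)
   finally show ?thesis by (cases "D = 0") auto
  qed
  show "u c = sqrt (\<Sum>e<n. (u e)\<^sup>2) * H c0 c" if c: "c < n" for c
  proof (cases "D = 0")
   case True
   have "(w c)\<^sup>2 \<le> D" unfolding D_def using c by (intro member_le_sum) auto
   then have "w c = 0" using True by simp
   then show ?thesis using True by (auto simp: H_def w_def N_def[symmetric])
  next
   case False
   have "2 * N * w c0 / D = -1"
   proof -
    have "2 * N * w c0 = - D" unfolding D by (simp add: w_def algebra_simps)
    then show ?thesis using False by simp
   qed
   then have "N * H c0 c = N * of_bool (c = c0) + w c"
   proof -
    have "N * H c0 c = N * of_bool (c = c0) - (2 * N * w c0 / D) * w c"
     by (auto simp: H_def algebra_simps)
    then show ?thesis using \<open>2 * N * w c0 / D = -1\<close> by simp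
   qed
   then show ?thesis by (simp add: w_def N_def[symmetric])
  qed
 qed
qed

section \<open>Expansion of the mean determinant along a row\<close>

text \<open>\<open>bl ! c\<close> is the block of column \<open>c\<close>. With the column structure
  encoded as a list, passing to a minor is the deletion of one entry.\<close>

abbreviation sdeg :: "nat list => (nat => nat => nat) => nat => nat => real" where
 "sdeg bl \<delta> r c \<equiv> sqrt (real (\<delta> r (bl ! c)))"

definition expdet :: "nat list => (nat => nat => nat) => ennreal" where
 "expdet bl \<delta> = (\<integral>\<^sup>+Z. eadet (length bl) (\<lambda>(i, c). sdeg bl \<delta> i c * Z i c) \<partial>matG (length bl))"

definition rdet :: "nat list => (nat => nat => nat) => nat => (nat => real) => (nat => nat => real) => real" where
 "rdet bl \<delta> i q Z = det (mat (length bl) (length bl) (\<lambda>(r, c). if r = i then q c else sdeg bl \<delta> r c * Z r c))"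

text \<open>The cofactor at position \<open>(i, c)\<close>; it depends only on the rows of
  \<open>Z\<close> other than \<open>i\<close>.\<close>

definition gam :: "nat list => (nat => nat => nat) => nat => nat => (nat => nat => real) => real" where
 "gam bl \<delta> i c Z = rdet bl \<delta> i (\<lambda>d. of_bool (d = c)) Z"

lemma rdet_linear:
 assumes "i < length bl"
 shows "rdet bl \<delta> i q Z = (\<Sum>c<length bl. q c * gam bl \<delta> i c Z)"
proof -
 obtain cof where cof: "\<And>q. rdet bl \<delta> i q Z = (\<Sum>c<length bl. q c * cof c)"
  unfolding rdet_def using det_row_expand[OF assms, of "\<lambda>r c. sdeg bl \<delta> r c * Z r c"] by blast
 have "gam bl \<delta> i c Z = cof c" if "c < length bl" for c
  unfolding gam_def cof using that by (simp add: of_bool_def if_distrib[of "\<lambda>x. x * _"] cong: if_cong)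
 then show ?thesis unfolding cof by simp
qed

lemma rdet_measurable:
 assumes "\<And>c. c < length bl \<Longrightarrow> Q c \<in> borel_measurable M" "\<And>r c. r < length bl \<Longrightarrow> c < length bl \<Longrightarrow> (\<lambda>x. Zf x r c) \<in> borel_measurable M"
 shows "(\<lambda>x. rdet bl \<delta> i (\<lambda>c. Q c x) (Zf x)) \<in> borel_measurable M" unfolding rdet_def
proof (rule det_measurable)
 fix r c assume rc: "r < length bl" "c < length bl"
 show "(\<lambda>x. if r = i then Q c x else sdeg bl \<delta> r c * Zf x r c) \<in> borel_measurable M"
  using assms(1)[OF rc(2)] assms(2)[OF rc] by (cases "r = i") auto
qed

lemma gam_measurable [measurable]: "gam bl \<delta> i c \<in> borel_measurable (matG (length bl))"
proof -
 have "(\<lambda>x. rdet bl \<delta> i (\<lambda>d. of_bool (d = c)) x) \<in> borel_measurable (matG (length bl))"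
  by (rule rdet_measurable) measurable
 then show ?thesis unfolding gam_def .
qed

definition blockset :: "nat list => nat => nat set" where
 "blockset bl j = {c. c < length bl \<and> bl ! c = j}"

definition blocknorm :: "nat list => (nat => nat => nat) => nat => nat => (nat => nat => real) => real" where
 "blocknorm bl \<delta> i j Z = sqrt (\<Sum>c\<in>blockset bl j. (gam bl \<delta> i c Z)\<^sup>2)"

lemma finite_blockset [simp]: "finite (blockset bl j)" by (simp add: blockset_def)

lemma sum_blocks: "(\<Sum>c<length bl. F c) = (\<Sum>j\<in>set bl. \<Sum>c\<in>blockset bl j. F c)"
 for F :: "nat => 'b::comm_monoid_add" unfolding blockset_def
 by (subst sum.group[of "{..<length bl}" "set bl" "\<lambda>c. bl ! c" F, symmetric]) (auto intro!: sum.cong)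

lemma blocknorm_measurable [measurable]: "blocknorm bl \<delta> i j \<in> borel_measurable (matG (length bl))"
 unfolding blocknorm_def by measurable

text \<open>Given the other rows, the determinant is a linear form in the standard normal row
  \<open>i\<close>, so its mean absolute value is \<open>sqrt (2 / pi)\<close> times the length of
  the coefficient vector, here grouped by blocks.\<close>

lemma expdet_expand:
 assumes i: "i < length bl"
 shows "expdet bl \<delta> = ennreal (sqrt (2 / pi)) * (\<integral>\<^sup>+Z. ennreal (sqrt (\<Sum>j\<in>set bl. real (\<delta> i j) * (blocknorm bl \<delta> i j Z)\<^sup>2)) \<partial>matG (length bl))"
proof -
 define n where "n = length bl"
 have upd: "det (mat n n (\<lambda>(r, c). sdeg bl \<delta> r c * (Z(i := z)) r c)) = (\<Sum>c<n. (sdeg bl \<delta> i c * gam bl \<delta> i c Z) * z c)" for Z z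
 proof -
  have "det (mat n n (\<lambda>(r, c). sdeg bl \<delta> r c * (Z(i := z)) r c)) = rdet bl \<delta> i (\<lambda>c. sdeg bl \<delta> i c * z c) Z"
   unfolding rdet_def n_def by (intro arg_cong[where f = det] eq_matI) auto
  then show ?thesis unfolding rdet_linear[OF i] n_def by (simp add: mult_ac)
 qed
 have "expdet bl \<delta> = (\<integral>\<^sup>+Z. \<integral>\<^sup>+z. eadet n (\<lambda>(r, c). sdeg bl \<delta> r c * (Z(i := z)) r c) \<partial>rowG n \<partial>matG n)"
  unfolding expdet_def n_def
 proof (rule nn_integral_resample[OF prob_rowG])
  show "(\<lambda>Z. eadet (length bl) (\<lambda>(i, c). sdeg bl \<delta> i c * Z i c)) \<in> borel_measurable (matG (length bl))"
   by (intro eadet_measurable) measurable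
 qed (use i in auto)
 also have "\<dots> = (\<integral>\<^sup>+Z. ennreal (sqrt (2 / pi) * sqrt (\<Sum>c<n. (sdeg bl \<delta> i c * gam bl \<delta> i c Z)\<^sup>2)) \<partial>matG n)"
  unfolding upd rowG_abs_form' ..
 also have "(\<lambda>Z. \<Sum>c<n. (sdeg bl \<delta> i c * gam bl \<delta> i c Z)\<^sup>2) = (\<lambda>Z. \<Sum>j\<in>set bl. real (\<delta> i j) * (blocknorm bl \<delta> i j Z)\<^sup>2)"
 proof
  fix Z
  have "(\<Sum>c<n. (sdeg bl \<delta> i c * gam bl \<delta> i c Z)\<^sup>2) = (\<Sum>j\<in>set bl. \<Sum>c\<in>blockset bl j. real (\<delta> i j) * (gam bl \<delta> i c Z)\<^sup>2)"
   unfolding n_def sum_blocks by (intro sum.cong) (auto simp: blockset_def power_mult_distrib)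
  then show "(\<Sum>c<n. (sdeg bl \<delta> i c * gam bl \<delta> i c Z)\<^sup>2) = (\<Sum>j\<in>set bl. real (\<delta> i j) * (blocknorm bl \<delta> i j Z)\<^sup>2)"
   by (simp add: blocknorm_def sum_distrib_left sum_nonneg)
 qed
 finally show ?thesis unfolding n_def by (simp add: ennreal_mult' nn_integral_cmult)
qed

text \<open>Columns of one block carry equal weights, so an orthogonal change of variables within
  the block preserves the law of each random row as well as the absolute determinant. A reflection
  that carries \<open>u\<close> to the direction of \<open>c0\<close> thus reduces the replaced row
  to a multiple of a unit vector.\<close>

lemma isotropy:
 assumes i: "i < length bl" and c0: "c0 \<in> blockset bl j" and u: "\<And>c. c \<notin> blockset bl j \<Longrightarrow> u c = 0"
 shows "(\<integral>\<^sup>+Z. ennreal \<bar>rdet bl \<delta> i u Z\<bar> \<partial>matG (length bl)) =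
  ennreal (sqrt (\<Sum>c<length bl. (u c)\<^sup>2)) * (\<integral>\<^sup>+Z. ennreal \<bar>gam bl \<delta> i c0 Z\<bar> \<partial>matG (length bl))" proof -
 define n where "n = length bl"
 define J where "J = blockset bl j"
 have J: "J \<subseteq> {..<n}" "c0 \<in> J" using c0 by (auto simp: J_def blockset_def n_def)
 obtain H where H: "\<And>c d. H c d = (H d c :: real)" "\<And>c d. c \<notin> J \<or> d \<notin> J \<Longrightarrow> H c d = of_bool (c = d)"
  "\<And>c d. c < n \<Longrightarrow> d < n \<Longrightarrow> (\<Sum>e<n. H c e * H e d) = of_bool (c = d)"
  "\<And>c. c < n \<Longrightarrow> u c = sqrt (\<Sum>e<n. (u e)\<^sup>2) * H c0 c" using householder[of J n c0 u] J u J_def by blast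
 define N where "N = sqrt (\<Sum>e<n. (u e)\<^sup>2)"
 have N0: "N \<ge> 0" by (simp add: N_def sum_nonneg)
 define a where "a r c = sdeg bl \<delta> r c" for r c
 define \<rho> where "\<rho> r c z = (if r = i then u c else a r c * z c)" for r c and z :: "nat => real"
 define \<rho>' where "\<rho>' r c z = (\<Sum>d<n. (if r = i then N * of_bool (d = c0) else a r d * z d) * H d c)" for r c and z :: "nat => real"
 \<comment> \<open>The weights \<open>b\<close> are constant on \<open>J\<close> and the reflection
   is the identity elsewhere, so weighted lengths are preserved.\<close>
 have orth: "(\<Sum>c<n. b c * (\<Sum>d<n. H c d * q d)\<^sup>2) = (\<Sum>c<n. b c * (q c)\<^sup>2)" if b: "\<And>c d. c \<in> J \<Longrightarrow> d \<in> J \<Longrightarrow> b c = b d" for b q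
 proof -
  define y where "y c = (\<Sum>d<n. H c d * q d)" for c
  have yJ: "y c = q c" if "c \<notin> J" "c < n" for c
   using that H(2) unfolding y_def by (simp add: of_bool_def if_distrib[of "\<lambda>x. x * _"] cong: if_cong)
  have tot: "(\<Sum>c<n. (y c)\<^sup>2) = (\<Sum>c<n. (q c)\<^sup>2)"
  proof -
   have "(\<Sum>c<n. (y c)\<^sup>2) = (\<Sum>c<n. \<Sum>d<n. \<Sum>e<n. (H d c * H c e) * (q d * q e))"
    unfolding y_def power2_eq_square sum_product using H(1) by (intro sum.cong) (auto simp: mult_ac)
   also have "\<dots> = (\<Sum>d<n. \<Sum>e<n. (\<Sum>c<n. H d c * H c e) * (q d * q e))" unfolding sum_distrib_right
    by (rule trans[OF sum.swap sum.cong[OF refl sum.swap]])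
   also have "\<dots> = (\<Sum>d<n. \<Sum>e<n. of_bool (d = e) * (q d * q e))" using H(3) by (intro sum.cong) auto
   also have "\<dots> = (\<Sum>d<n. (q d)\<^sup>2)"
    by (intro sum.cong refl) (simp add: sum_of_bool_lessThan power2_eq_square)
   finally show ?thesis .
  qed
  have split: "(\<Sum>c<n. F c) = (\<Sum>c\<in>{..<n} - J. F c) + (\<Sum>c\<in>J. F c)" for F :: "nat => real"
   using J(1) by (intro sum.subset_diff) auto
  have "(\<Sum>c\<in>{..<n} - J. (y c)\<^sup>2) = (\<Sum>c\<in>{..<n} - J. (q c)\<^sup>2)" using yJ by (intro sum.cong) auto
  then have "(\<Sum>c\<in>J. (y c)\<^sup>2) = (\<Sum>c\<in>J. (q c)\<^sup>2)" using tot split[of "\<lambda>c. (y c)\<^sup>2"] split[of "\<lambda>c. (q c)\<^sup>2"] by simp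
  moreover have "(\<Sum>c\<in>J. b c * F c) = b c0 * (\<Sum>c\<in>J. F c)" for F :: "nat => real"
   unfolding sum_distrib_left using b[OF _ J(2)] by (intro sum.cong) auto
  moreover have "(\<Sum>c\<in>{..<n} - J. b c * (y c)\<^sup>2) = (\<Sum>c\<in>{..<n} - J. b c * (q c)\<^sup>2)" using yJ by (intro sum.cong) auto
  ultimately show ?thesis
   using split[of "\<lambda>c. b c * (y c)\<^sup>2"] split[of "\<lambda>c. b c * (q c)\<^sup>2"] by (simp add: y_def)
 qed
 have lin: "(\<Sum>c<n. \<rho>' r c z * q c) = (\<Sum>d<n. (if r = i then N * of_bool (d = c0) else a r d * z d) * (\<Sum>c<n. H d c * q c))" for r q z
  unfolding \<rho>'_def sum_distrib_left sum_distrib_right by (subst sum.swap) (simp add: mult_ac)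
 have T: "(\<integral>\<^sup>+z. ennreal \<bar>\<Sum>c<n. \<rho> r c z * q c\<bar> \<partial>rowG n) = 1 * (\<integral>\<^sup>+z. ennreal \<bar>\<Sum>c<n. \<rho>' r c z * q c\<bar> \<partial>rowG n)" if r: "r < n" for r q
 proof (cases "r = i")
  case True
  have "\<rho>' i c z = u c" if "c < n" for c z
  proof -
   have "\<rho>' i c z = N * H c0 c"
   proof -
    have "(\<Sum>d<n. (if i = i then N * of_bool (d = c0) else a i d * z d) * H d c) = (\<Sum>d<n. N * H d c * of_bool (d = c0))"
     by (intro sum.cong) auto
    also have "\<dots> = N * H c0 c" using J by (intro sum_of_bool_lessThan) auto
    finally show ?thesis by (simp add: \<rho>'_def)
   qed
   then show ?thesis using H(4)[OF that] by (simp add: N_def)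
  qed
  then show ?thesis using True by (simp add: \<rho>_def)
 next
  case False
  have "(\<Sum>c<n. \<rho> r c z * q c) = (\<Sum>c<n. (a r c * q c) * z c)" for z using False by (simp add: \<rho>_def mult_ac)
  moreover have "(\<Sum>c<n. \<rho>' r c z * q c) = (\<Sum>d<n. (a r d * (\<Sum>c<n. H d c * q c)) * z d)" for z
   unfolding lin using False by (simp add: mult_ac)
  moreover have "(\<Sum>d<n. (a r d * (\<Sum>c<n. H d c * q c))\<^sup>2) = (\<Sum>c<n. (a r c * q c)\<^sup>2)"
   unfolding power_mult_distrib by (intro orth) (auto simp: a_def J_def blockset_def)
  ultimately show ?thesis by (simp add: rowG_abs_form')
 qed
 have "(\<integral>\<^sup>+Z. eadet n (\<lambda>(r, c). \<rho> r c (Z r)) \<partial>matG n) =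
   (\<Prod>r<n. 1) * (\<integral>\<^sup>+Z. eadet n (\<lambda>(r, c). \<rho>' r c (Z r)) \<partial>matG n)"
 proof (rule expected_abs_det_cong[OF sf_rowG sf_rowG _ _ T])
  show "\<rho> r c \<in> borel_measurable (rowG n)" if "r < n" "c < n" for r c
   unfolding \<rho>_def using that by (cases "r = i") (auto intro!: borel_measurable_times measurable_rowG_entry)
  show "\<rho>' r c \<in> borel_measurable (rowG n)" if "r < n" "c < n" for r c
   unfolding \<rho>'_def using that by (cases "r = i") (auto intro!: borel_measurable_sum borel_measurable_times measurable_rowG_entry)
 qed
 moreover have "mat n n (\<lambda>(r, c). \<rho> r c (Z r)) = mat n n (\<lambda>(r, c). if r = i then u c else sdeg bl \<delta> r c * Z r c)" for Z
  by (rule eq_matI) (auto simp: \<rho>_def a_def)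
 \<comment> \<open>The matrix of \<open>\<rho>'\<close> is a product: its left factor has row
   \<open>i\<close> reduced to \<open>N\<close> times a unit vector, and its right factor is the
   reflection, an involution and hence of absolute determinant 1.\<close>
 moreover have "adet n (\<lambda>(r, c). \<rho>' r c (Z r)) = N * \<bar>gam bl \<delta> i c0 Z\<bar>" for Z
 proof -
  define A where "A = mat n n (\<lambda>(r, d). if r = i then N * of_bool (d = c0) else a r d * Z r d)"
  define B where "B = mat n n (\<lambda>(d, c). H d c)"
  have c: "A \<in> carrier_mat n n" "B \<in> carrier_mat n n" by (auto simp: A_def B_def)
  have "mat n n (\<lambda>(r, c). \<rho>' r c (Z r)) = A * B"
   by (rule eq_matI) (auto simp: A_def B_def \<rho>'_def scalar_prod_def atLeast0LessThan intro!: sum.cong)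
  moreover have "B * B = 1\<^sub>m n"
   by (rule eq_matI) (use H(3) in \<open>auto simp: B_def scalar_prod_def atLeast0LessThan\<close>)
  then have "det B * det B = 1" using det_mult[OF c(2,2)] by simp
  then have "\<bar>det B\<bar> = 1" by (metis abs_mult_self_eq abs_1 abs_square_eq_1 power2_eq_square)
  moreover have "det A = rdet bl \<delta> i (\<lambda>d. N * of_bool (d = c0)) Z"
   unfolding A_def rdet_def n_def a_def by (intro arg_cong[where f = det] eq_matI) auto
  then have "det A = N * gam bl \<delta> i c0 Z"
  proof -
   have "rdet bl \<delta> i (\<lambda>d. N * of_bool (d = c0)) Z = (\<Sum>c<n. N * gam bl \<delta> i c Z * of_bool (c = c0))"
    unfolding rdet_linear[OF i] n_def by (intro sum.cong) auto
   also have "\<dots> = N * gam bl \<delta> i c0 Z" using J by (intro sum_of_bool_lessThan) auto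
   finally show ?thesis using \<open>det A = _\<close> by simp
  qed
  ultimately show ?thesis using det_mult[OF c] N0 by (simp add: abs_mult)
 qed
 ultimately show ?thesis
  unfolding rdet_def n_def[symmetric] using N0 by (simp add: ennreal_mult nn_integral_cmult N_def n_def)
qed

lemma measurable_of_bool_eq:
 fixes f g :: "'a => real"
 assumes [measurable]: "f \<in> borel_measurable M" "g \<in> borel_measurable M"
 shows "(\<lambda>x. of_bool (f x = g x) :: ennreal) \<in> borel_measurable M"
  and "(\<lambda>x. of_bool (f x \<noteq> g x) :: ennreal) \<in> borel_measurable M"
proof -
 have "(\<lambda>x. indicator {x \<in> space M. f x = g x} x :: ennreal) \<in> borel_measurable M"
  "(\<lambda>x. indicator {x \<in> space M. f x \<noteq> g x} x :: ennreal) \<in> borel_measurable M" by measurable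
 then show "(\<lambda>x. of_bool (f x = g x) :: ennreal) \<in> borel_measurable M"
  "(\<lambda>x. of_bool (f x \<noteq> g x) :: ennreal) \<in> borel_measurable M"
  by (auto elim!: measurable_cong[THEN iffD1, rotated])
qed

definition blockmean :: "nat list => nat => ennreal" where
 "blockmean bl j = (\<integral>\<^sup>+z. ennreal (sqrt (\<Sum>c\<in>blockset bl j. (z c)\<^sup>2)) \<partial>rowG (length bl))"

text \<open>The mean absolute determinant with row \<open>i\<close> standard normal on block
  \<open>j\<close> and zero elsewhere is computed in two orders. Integrating this row before the
  others gives the left side; integrating the others before it gives the right side by
  \<open>isotropy\<close>, with the mean length of the row as a factor.\<close>

lemma blocknorm_mean:
 assumes i: "i < length bl" and c0: "c0 \<in> blockset bl j"
 shows "ennreal (sqrt (2 / pi)) * (\<integral>\<^sup>+Z. ennreal (blocknorm bl \<delta> i j Z) \<partial>matG (length bl)) =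
  blockmean bl j * (\<integral>\<^sup>+Z. ennreal \<bar>gam bl \<delta> i c0 Z\<bar> \<partial>matG (length bl))" proof -
 define n where "n = length bl"
 define J where "J = blockset bl j"
 have J: "J \<subseteq> {..<n}" by (auto simp: J_def blockset_def n_def)
 define u where "u z c = (if c \<in> J then z c else (0::real))" for z c
 have sumJ: "(\<Sum>c<n. if c \<in> J then F c else 0) = (\<Sum>c\<in>J. F c)" for F :: "nat => real"
  using J by (simp add: sum.If_cases Int_absorb1)
 have r1: "rdet bl \<delta> i (u z) Z = (\<Sum>c<n. (if c \<in> J then gam bl \<delta> i c Z else 0) * z c)" for z Z
  unfolding rdet_linear[OF i] n_def u_def by (intro sum.cong) auto
 have sq: "(\<Sum>c<n. (if c \<in> J then F c else 0)\<^sup>2) = (\<Sum>c\<in>J. (F c)\<^sup>2)" for F :: "nat => real"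
 proof -
  have "(\<Sum>c<n. (if c \<in> J then F c else 0)\<^sup>2) = (\<Sum>c<n. if c \<in> J then (F c)\<^sup>2 else 0)"
   by (intro sum.cong) auto
  then show ?thesis using sumJ[of "\<lambda>c. (F c)\<^sup>2"] by simp
 qed
 have "ennreal (sqrt (2 / pi)) * (\<integral>\<^sup>+Z. ennreal (blocknorm bl \<delta> i j Z) \<partial>matG n) =
   (\<integral>\<^sup>+Z. ennreal (sqrt (2 / pi) * blocknorm bl \<delta> i j Z) \<partial>matG n)"
  unfolding n_def by (simp add: ennreal_mult' nn_integral_cmult)
 also have "\<dots> = (\<integral>\<^sup>+Z. \<integral>\<^sup>+z. ennreal \<bar>rdet bl \<delta> i (u z) Z\<bar> \<partial>rowG n \<partial>matG n)"
  unfolding r1 rowG_abs_form' sq by (simp add: blocknorm_def J_def)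
 also have "\<dots> = (\<integral>\<^sup>+z. \<integral>\<^sup>+Z. ennreal \<bar>rdet bl \<delta> i (u z) Z\<bar> \<partial>matG n \<partial>rowG n)"
 proof (rule pair_sigma_finite.Fubini')
  show "pair_sigma_finite (rowG n) (matG n)" using sf_rowG sf_matG by (simp add: pair_sigma_finite_def)
  have "(\<lambda>p. ennreal \<bar>rdet bl \<delta> i (\<lambda>c. u (fst p) c) (snd p)\<bar>) \<in> borel_measurable (rowG n \<Otimes>\<^sub>M matG n)"
  proof (intro measurable_compose[OF _ measurable_ennreal] borel_measurable_abs rdet_measurable)
   show "(\<lambda>p. u (fst p) c) \<in> borel_measurable (rowG n \<Otimes>\<^sub>M matG n)" if "c < length bl" for c
    unfolding u_def using measurable_compose[OF measurable_fst measurable_rowG_entry, of c n "matG n"] that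
    by (cases "c \<in> J") (auto simp: n_def)
   show "(\<lambda>p. snd p r c) \<in> borel_measurable (rowG n \<Otimes>\<^sub>M matG n)" if "r < length bl" "c < length bl" for r c
    using measurable_compose[OF measurable_snd measurable_matG_entry, of r n c "rowG n"] that by (auto simp: n_def)
  qed
  then show "(\<lambda>(z, Z). ennreal \<bar>rdet bl \<delta> i (u z) Z\<bar>) \<in> borel_measurable (rowG n \<Otimes>\<^sub>M matG n)"
   by (simp add: case_prod_beta')
 qed
 also have "\<dots> = (\<integral>\<^sup>+z. ennreal (sqrt (\<Sum>c\<in>J. (z c)\<^sup>2)) * (\<integral>\<^sup>+Z. ennreal \<bar>gam bl \<delta> i c0 Z\<bar> \<partial>matG n) \<partial>rowG n)"
 proof (rule nn_integral_cong)
  fix z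
  show "(\<integral>\<^sup>+Z. ennreal \<bar>rdet bl \<delta> i (u z) Z\<bar> \<partial>matG n) =
    ennreal (sqrt (\<Sum>c\<in>J. (z c)\<^sup>2)) * (\<integral>\<^sup>+Z. ennreal \<bar>gam bl \<delta> i c0 Z\<bar> \<partial>matG n)"
   using isotropy[OF i c0, of "u z" \<delta>] sq[of z] by (simp add: u_def J_def n_def)
 qed
 also have "\<dots> = blockmean bl j * (\<integral>\<^sup>+Z. ennreal \<bar>gam bl \<delta> i c0 Z\<bar> \<partial>matG n)"
 proof -
  have "(\<lambda>z. ennreal (sqrt (\<Sum>c\<in>J. (z c)\<^sup>2))) \<in> borel_measurable (rowG n)"
  proof -
   have [measurable]: "(\<lambda>z. \<Sum>c\<in>J. (z c)\<^sup>2) \<in> borel_measurable (rowG n)"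
    using J by (intro borel_measurable_sum borel_measurable_power measurable_rowG_entry) auto
   show ?thesis by measurable
  qed
  then show ?thesis unfolding blockmean_def J_def n_def by (rule nn_integral_multc)
 qed
 finally show ?thesis unfolding n_def .
qed

definition del :: "nat => 'a list => 'a list" where
 "del c xs = take c xs @ drop (Suc c) xs"

lemma length_del: "c < length xs \<Longrightarrow> length (del c xs) = length xs - 1" by (simp add: del_def)

lemma nth_del: "c < length xs \<Longrightarrow> d < length xs - 1 \<Longrightarrow> del c xs ! d = xs ! insert_index c d"
 by (auto simp: del_def nth_append insert_index_def min_def)

lemma mset_del: "c < length xs \<Longrightarrow> mset xs = add_mset (xs ! c) (mset (del c xs))"
 unfolding del_def by (subst (1) id_take_nth_drop[of c xs]) auto

lemma insert_index_less: "i < n \<Longrightarrow> d < n - 1 \<Longrightarrow> insert_index i d < n" by (auto simp: insert_index_def)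

lemma insert_index_neq: "insert_index i d \<noteq> i" by (auto simp: insert_index_def)

lemma inj_insert_index: "inj (insert_index i)" by (auto simp: inj_def insert_index_def split: if_splits)

lemma remove_row_insert_index: "remove_row i \<delta> r = \<delta> (insert_index i r)"
 by (simp add: remove_row_def insert_index_def)

lemma gam_minor:
 assumes i: "i < length bl" and c: "c < length bl"
 shows "\<bar>gam bl \<delta> i c Z\<bar> = adet (length bl - 1)
  (\<lambda>(r, d). sdeg bl \<delta> (insert_index i r) (insert_index c d) * Z (insert_index i r) (insert_index c d))"
proof -
 define n where "n = length bl"
 define A where "A = mat n n (\<lambda>(r, d). if r = i then of_bool (d = c) else sdeg bl \<delta> r d * Z r d)"
 have "gam bl \<delta> i c Z = det A" by (simp add: gam_def rdet_def A_def n_def)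
 also have "det A = (\<Sum>d<n. A $$ (i, d) * cofactor A i d)"
  by (rule laplace_expansion_row) (use i in \<open>auto simp: A_def n_def\<close>)
 also have "\<dots> = (\<Sum>d<n. of_bool (d = c) * cofactor A i d)"
  using i by (intro sum.cong) (auto simp: A_def n_def)
 also have "\<dots> = cofactor A i c" using c by (simp only: sum_of_bool_lessThan n_def)
 finally have "\<bar>gam bl \<delta> i c Z\<bar> = \<bar>det (mat_delete A i c)\<bar>" by (simp add: cofactor_def abs_mult)
 also have "mat_delete A i c = mat (n - 1) (n - 1)
  (\<lambda>(r, d). sdeg bl \<delta> (insert_index i r) (insert_index c d) * Z (insert_index i r) (insert_index c d))"
  unfolding mat_delete_def
 proof (rule eq_matI)
  fix r d assume "r < dim_row (mat (n - 1) (n - 1) (\<lambda>(r, d). sdeg bl \<delta> (insert_index i r) (insert_index c d) * Z (insert_index i r) (insert_index c d)))"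
   "d < dim_col (mat (n - 1) (n - 1) (\<lambda>(r, d). sdeg bl \<delta> (insert_index i r) (insert_index c d) * Z (insert_index i r) (insert_index c d)))"
  then have rd: "r < n - 1" "d < n - 1" by auto
  have "insert_index i r < n" "insert_index c d < n" "insert_index i r \<noteq> i"
   using insert_index_less[of i n r] insert_index_less[of c n d] insert_index_neq i c rd by (auto simp: n_def)
  then have "A $$ (insert_index i r, insert_index c d) =
   sdeg bl \<delta> (insert_index i r) (insert_index c d) * Z (insert_index i r) (insert_index c d)"
   by (simp add: A_def)
  then show "mat (dim_row A - 1) (dim_col A - 1) (\<lambda>(i', j'). A $$ (if i' < i then i' else Suc i', if j' < c then j' else Suc j')) $$ (r, d) =
   mat (n - 1) (n - 1) (\<lambda>(r, d). sdeg bl \<delta> (insert_index i r) (insert_index c d) * Z (insert_index i r) (insert_index c d)) $$ (r, d)"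
   using rd by (simp add: A_def insert_index_def)
 qed (auto simp: A_def)
 finally show ?thesis by (simp add: n_def)
qed

lemma gam_mean:
 assumes i: "i < length bl" and c: "c < length bl"
 shows "(\<integral>\<^sup>+Z. ennreal \<bar>gam bl \<delta> i c Z\<bar> \<partial>matG (length bl)) = expdet (del c bl) (remove_row i \<delta>)"
proof -
 define n where "n = length bl"
 define D where "D Y = eadet (n - 1) (\<lambda>(r, d). sdeg bl \<delta> (insert_index i r) (insert_index c d) * Y r (insert_index c d))"
  for Y :: "nat => nat => real"
 have D_meas: "D \<in> borel_measurable (Pi\<^sub>M {..<n - 1} (\<lambda>_. rowG n))" unfolding D_def
 proof (intro eadet_measurable borel_measurable_times borel_measurable_const)
  fix r d assume "r < n - 1" "d < n - 1"
  then show "(\<lambda>Y. Y r (insert_index c d)) \<in> borel_measurable (Pi\<^sub>M {..<n - 1} (\<lambda>_. rowG n))"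
   using measurable_component_comp[of "\<lambda>z. z (insert_index c d)" "\<lambda>_. rowG n" r "{..<n-1}"] insert_index_less[of c n d] c by (simp add: n_def)
 qed
 have "distr (matG n) (Pi\<^sub>M {..<n - 1} (\<lambda>_. rowG n)) (\<lambda>Z. \<lambda>r\<in>{..<n - 1}. Z (insert_index i r)) = Pi\<^sub>M {..<n - 1} (\<lambda>_. rowG n)"
  using insert_index_less[of i n] i
  by (intro distr_PiM_reindex prob_rowG inj_on_subset[OF inj_insert_index subset_UNIV]) (auto simp: n_def)
 then have "(\<integral>\<^sup>+Y. D Y \<partial>Pi\<^sub>M {..<n - 1} (\<lambda>_. rowG n)) = (\<integral>\<^sup>+Y. D Y \<partial>distr (matG n) (Pi\<^sub>M {..<n - 1} (\<lambda>_. rowG n)) (\<lambda>Z. \<lambda>r\<in>{..<n - 1}. Z (insert_index i r)))"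
  by simp
 also have "\<dots> = (\<integral>\<^sup>+Z. D (\<lambda>r\<in>{..<n - 1}. Z (insert_index i r)) \<partial>matG n)"
  using D_meas insert_index_less[of i n] i
  by (intro nn_integral_distr measurable_restrict measurable_component_singleton) (auto simp: n_def)
 also have "\<dots> = (\<integral>\<^sup>+Z. ennreal \<bar>gam bl \<delta> i c Z\<bar> \<partial>matG n)"
 proof (rule nn_integral_cong)
  fix Z
  have "mat (n - 1) (n - 1) (\<lambda>(r, d). sdeg bl \<delta> (insert_index i r) (insert_index c d) * (\<lambda>r\<in>{..<n - 1}. Z (insert_index i r)) r (insert_index c d)) =
    mat (n - 1) (n - 1) (\<lambda>(r, d). sdeg bl \<delta> (insert_index i r) (insert_index c d) * Z (insert_index i r) (insert_index c d))"
   by (rule eq_matI) auto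
  then show "D (\<lambda>r\<in>{..<n - 1}. Z (insert_index i r)) = ennreal \<bar>gam bl \<delta> i c Z\<bar>"
   unfolding D_def gam_minor[OF i c] n_def by simp
 qed
 finally have "(\<integral>\<^sup>+Z. ennreal \<bar>gam bl \<delta> i c Z\<bar> \<partial>matG n) = (\<integral>\<^sup>+Y. D Y \<partial>Pi\<^sub>M {..<n - 1} (\<lambda>_. rowG n))" ..
 also have "\<dots> = (\<Prod>r<n - 1. 1) * (\<integral>\<^sup>+Y. eadet (n - 1) (\<lambda>(r, d). sdeg bl \<delta> (insert_index i r) (insert_index c d) * Y r d) \<partial>matG (n - 1))"
  unfolding D_def
 proof (rule expected_abs_det_cong[where \<rho> = "\<lambda>r d z. sdeg bl \<delta> (insert_index i r) (insert_index c d) * z (insert_index c d)"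
    and \<rho>' = "\<lambda>r d z. sdeg bl \<delta> (insert_index i r) (insert_index c d) * z d", OF sf_rowG sf_rowG])
  fix r q assume "r < n - 1"
  define a where "a d = sdeg bl \<delta> (insert_index i r) (insert_index c d) * q d" for d
  have "(\<Sum>d<n - 1. sdeg bl \<delta> (insert_index i r) (insert_index c d) * z (f d) * q d) = (\<Sum>d<n - 1. a d * z (f d))" for z :: "nat => real" and f
   by (simp add: a_def mult_ac)
  note this[of _ "insert_index c"] this[of _ "\<lambda>d. d"]
  moreover have "(\<integral>\<^sup>+z. ennreal \<bar>\<Sum>d<n - 1. a d * z (insert_index c d)\<bar> \<partial>rowG n) = ennreal (sqrt (2 / pi) * sqrt (\<Sum>d<n - 1. (a d)\<^sup>2))"
   by (rule rowG_abs_form[OF inj_on_subset[OF inj_insert_index subset_UNIV]]) (use insert_index_less[of c n] c in \<open>auto simp: n_def\<close>)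
  ultimately show "(\<integral>\<^sup>+z. ennreal \<bar>\<Sum>d<n - 1. sdeg bl \<delta> (insert_index i r) (insert_index c d) * z (insert_index c d) * q d\<bar> \<partial>rowG n) =
   1 * (\<integral>\<^sup>+z. ennreal \<bar>\<Sum>d<n - 1. sdeg bl \<delta> (insert_index i r) (insert_index c d) * z d * q d\<bar> \<partial>rowG (n - 1))"
   by (simp add: rowG_abs_form')
 qed (use insert_index_less[of c n] c in \<open>auto simp: n_def intro!: borel_measurable_times measurable_rowG_entry\<close>)
 also have "\<dots> = expdet (del c bl) (remove_row i \<delta>)"
 proof -
  have "mat (n - 1) (n - 1) (\<lambda>(r, d). sdeg bl \<delta> (insert_index i r) (insert_index c d) * Y r d) =
    mat (n - 1) (n - 1) (\<lambda>(r, d). sqrt (real (remove_row i \<delta> r (del c bl ! d))) * Y r d)" for Y :: "nat => nat => real"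
   using c by (intro eq_matI) (auto simp: remove_row_insert_index nth_del n_def)
  then show ?thesis unfolding expdet_def length_del[OF c] n_def by simp
 qed
 finally show ?thesis unfolding n_def .
qed

lemma expdet_cong:
 assumes "\<And>i j. i < length bl \<Longrightarrow> j \<in> set bl \<Longrightarrow> \<delta> i j = \<delta>' i j"
 shows "expdet bl \<delta> = expdet bl \<delta>'"
proof -
 have "mat (length bl) (length bl) (\<lambda>(i, c). sdeg bl \<delta> i c * Z i c) = mat (length bl) (length bl) (\<lambda>(i, c). sqrt (real (\<delta>' i (bl ! c))) * Z i c)" for Z
  using assms by (intro eq_matI) auto
 then show ?thesis by (simp add: expdet_def)
qed

text \<open>The reference degrees: equation \<open>i\<close> is linear in the block of column
  \<open>i\<close> and does not involve the other blocks.\<close>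

definition lindeg :: "nat list => nat => nat => nat" where
 "lindeg bl i j = of_bool (bl ! i = j)"

lemma blocknorm_mean':
 assumes i: "i < length bl" and c: "c < length bl"
 shows "ennreal (sqrt (2 / pi)) * (\<integral>\<^sup>+Z. ennreal (blocknorm bl \<delta> i (bl ! c) Z) \<partial>matG (length bl)) =
  blockmean bl (bl ! c) * expdet (del c bl) (remove_row i \<delta>)"
 using blocknorm_mean[OF i, of c "bl ! c" \<delta>] gam_mean[OF i c, of \<delta>] c by (simp add: blockset_def)

text \<open>In row \<open>c\<close> only one block has nonzero weight, so the square root disappears
  and the expansion has a single term. The factor \<open>blockmean\<close> is the one in
  \<open>blocknorm_mean\<close> and cancels in \<open>ndet\<close>.\<close>

lemma expdet_lindeg:
 assumes c: "c < length bl"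
 shows "expdet bl (lindeg bl) = blockmean bl (bl ! c) * expdet (del c bl) (lindeg (del c bl))"
proof -
 have "(\<Sum>j\<in>set bl. real (lindeg bl c j) * (blocknorm bl (lindeg bl) c j Z)\<^sup>2) = (blocknorm bl (lindeg bl) c (bl ! c) Z)\<^sup>2" for Z
 proof -
  have "(\<Sum>j\<in>set bl. real (lindeg bl c j) * (blocknorm bl (lindeg bl) c j Z)\<^sup>2) =
    (\<Sum>j\<in>set bl. if bl ! c = j then (blocknorm bl (lindeg bl) c j Z)\<^sup>2 else 0)"
   by (intro sum.cong) (auto simp: lindeg_def)
  then show ?thesis using c by simp
 qed
 then have "expdet bl (lindeg bl) = ennreal (sqrt (2 / pi)) * (\<integral>\<^sup>+Z. ennreal (blocknorm bl (lindeg bl) c (bl ! c) Z) \<partial>matG (length bl))"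
  unfolding expdet_expand[OF c] by (simp add: blocknorm_def sum_nonneg)
 also have "\<dots> = blockmean bl (bl ! c) * expdet (del c bl) (remove_row c (lindeg bl))"
  by (rule blocknorm_mean'[OF c c])
 also have "expdet (del c bl) (remove_row c (lindeg bl)) = expdet (del c bl) (lindeg (del c bl))"
  using c by (intro expdet_cong) (simp add: remove_row_insert_index lindeg_def length_del nth_del)
 finally show ?thesis .
qed

section \<open>Almost sure nonvanishing and full support\<close>

text \<open>When coordinate \<open>a\<close> is resampled with the others fixed, the form vanishes
  at one value only, and single points are null for the normal law.\<close>

lemma AE_row_nonzero:
 assumes a: "a < n" "w a \<noteq> 0"
 shows "AE z in rowG n. (\<Sum>c<n. w c * z c) \<noteq> 0"
proof -
 define F where "F z = (of_bool ((\<Sum>c<n. w c * z c) = 0) :: ennreal)" for z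
 have [measurable]: "(\<lambda>z. \<Sum>c<n. w c * z c) \<in> borel_measurable (rowG n)"
  by (intro borel_measurable_sum borel_measurable_times measurable_rowG_entry) auto
 have F: "F \<in> borel_measurable (rowG n)" unfolding F_def by (rule measurable_of_bool_eq) auto
 have "(\<integral>\<^sup>+z. F z \<partial>rowG n) = (\<integral>\<^sup>+z. \<integral>\<^sup>+t. F (z(a := t)) \<partial>stdG \<partial>rowG n)"
  using a by (intro nn_integral_resample stdG.prob_space_axioms F) auto
 also have "\<dots> = (\<integral>\<^sup>+z. 0 \<partial>rowG n)"
 proof (rule nn_integral_cong)
  fix z
  define b where "b = (\<Sum>c\<in>{..<n} - {a}. w c * z c)"
  have Fz: "F (z(a := t)) = indicator {- b / w a} t" for t
  proof -
   have "(\<Sum>c<n. w c * (z(a := t)) c) = w a * t + (\<Sum>c\<in>{..<n} - {a}. w c * (z(a := t)) c)"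
    using a by (subst sum.remove[of _ a]) auto
   also have "(\<Sum>c\<in>{..<n} - {a}. w c * (z(a := t)) c) = b" unfolding b_def by (intro sum.cong) auto
   finally show ?thesis using a(2) by (auto simp: F_def indicator_def field_simps)
  qed
  have "(\<integral>\<^sup>+t. F (z(a := t)) \<partial>stdG) = (\<integral>\<^sup>+t. ennreal (std_normal_density t) * indicator {- b / w a} t \<partial>lborel)"
   unfolding Fz by (rule nn_integral_stdG) simp
  also have "(\<integral>\<^sup>+t. ennreal (std_normal_density t) * indicator {- b / w a} t \<partial>lborel) = (\<integral>\<^sup>+t. 0 \<partial>(lborel :: real measure))"
  proof (rule nn_integral_cong_AE)
   show "AE t in lborel. ennreal (std_normal_density t) * indicator {- b / w a} t = 0"
    using AE_lborel_singleton[of "- b / w a"] by eventually_elim (auto simp: indicator_def)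
  qed
  finally show "(\<integral>\<^sup>+t. F (z(a := t)) \<partial>stdG) = 0" by simp
 qed
 finally have "AE z in rowG n. F z = 0" using F by (simp add: nn_integral_0_iff_AE)
 then show ?thesis by eventually_elim (auto simp: F_def)
qed

text \<open>The rows are made random one at a time, starting from the unit rows of the permutation
  \<sigma>, whose determinant is a sign. At each exchange the determinant is a linear form in the
  new row whose coefficient at \<open>\<sigma> m\<close> is the nonzero determinant before the
  exchange.\<close>

lemma AE_det_nonzero:
 fixes \<mu> :: "nat => 'a measure" and \<rho> :: "nat => nat => 'a => real"
 assumes \<mu>: "\<And>i. sigma_finite_measure (\<mu> i)"
  and m: "\<And>i c. i < n \<Longrightarrow> c < n \<Longrightarrow> \<rho> i c \<in> borel_measurable (\<mu> i)"
  and \<sigma>: "\<sigma> permutes {..<n}"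
  and nz: "\<And>i q. i < n \<Longrightarrow> q (\<sigma> i) \<noteq> 0 \<Longrightarrow> AE w in \<mu> i. (\<Sum>c<n. \<rho> i c w * q c) \<noteq> 0"
 shows "AE w in Pi\<^sub>M {..<n} \<mu>. det (mat n n (\<lambda>(i, c). \<rho> i c (w i))) \<noteq> 0"
proof -
 interpret M: product_sigma_finite \<mu> using \<mu> by (simp add: product_sigma_finite_def)
 define N where "N m w R = mat n n (\<lambda>(i, c). if i < m then \<rho> i c (w i) else R i c)" for m w R
 have meas: "(\<lambda>w. of_bool (det (N m w R) = 0) :: ennreal) \<in> borel_measurable (Pi\<^sub>M {..<m} \<mu>)"
  if "m \<le> n" for m R
 proof -
  have "(\<lambda>w. if i < m then \<rho> i c (w i) else R i c) \<in> borel_measurable (Pi\<^sub>M {..<m} \<mu>)" if "i < n" "c < n" for i c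
   using measurable_component_comp[where M = \<mu>, OF m[OF that], of "{..<m}"] by (cases "i < m") auto
  then have [measurable]: "(\<lambda>w. det (N m w R)) \<in> borel_measurable (Pi\<^sub>M {..<m} \<mu>)"
   unfolding N_def by (rule det_measurable)
  have "indicator {w \<in> space (Pi\<^sub>M {..<m} \<mu>). det (N m w R) = 0} \<in> borel_measurable (Pi\<^sub>M {..<m} \<mu>)" by measurable
  then show ?thesis by (rule measurable_cong[THEN iffD1, rotated]) auto
 qed
 have main: "(\<integral>\<^sup>+w. of_bool (det (N m w R) = 0) \<partial>Pi\<^sub>M {..<m} \<mu>) = 0"
  if "m \<le> n" "det (mat n n (\<lambda>(i, c). if i < m then of_bool (c = \<sigma> i) else R i c)) \<noteq> 0" for m R using that
 proof (induction m arbitrary: R)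
  case 0
  then show ?case by (simp add: PiM_empty nn_integral_count_space_finite N_def)
 next
  case (Suc m)
  have mn: "m < n" using Suc.prems by simp
  obtain cof where cof: "\<And>q. det (mat n n (\<lambda>(i, c). if i = m then q c else if i < m then of_bool (c = \<sigma> i) else R i c)) = (\<Sum>c<n. q c * cof c)"
   using det_row_expand[OF mn, of "\<lambda>i c. if i < m then of_bool (c = \<sigma> i) else R i c"] by blast
  have e: "det (mat n n (\<lambda>(i, c). if i < m then of_bool (c = \<sigma> i) else if i = m then q c else R i c)) = (\<Sum>c<n. q c * cof c)" for q
   unfolding cof[symmetric] by (intro arg_cong[where f = det] eq_matI) auto
  have "det (mat n n (\<lambda>(i, c). if i < Suc m then of_bool (c = \<sigma> i) else R i c)) = (\<Sum>c<n. of_bool (c = \<sigma> m) * cof c)"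
   unfolding cof[symmetric] by (intro arg_cong[where f = det] eq_matI) auto
  also have "\<dots> = cof (\<sigma> m)" using permutes_in_image[OF \<sigma>, of m] mn by (intro sum_of_bool_lessThan) auto
  finally have "cof (\<sigma> m) \<noteq> 0" using Suc.prems(2) by simp
  from nz[OF mn, of cof, OF this]
  have AE: "AE z in \<mu> m. (\<integral>\<^sup>+w. of_bool (det (N m w (\<lambda>i c. if i = m then \<rho> m c z else R i c)) = 0) \<partial>Pi\<^sub>M {..<m} \<mu>) = 0"
  proof eventually_elim
   case (elim z)
   then show ?case using Suc.IH[of "\<lambda>i c. if i = m then \<rho> m c z else R i c"] mn e[of "\<lambda>c. \<rho> m c z"] by simp
  qed
  have "(\<integral>\<^sup>+w. of_bool (det (N (Suc m) w R) = 0) \<partial>Pi\<^sub>M {..<Suc m} \<mu>) =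
   (\<integral>\<^sup>+z. \<integral>\<^sup>+w. of_bool (det (N (Suc m) (w(m := z)) R) = 0) \<partial>Pi\<^sub>M {..<m} \<mu> \<partial>\<mu> m)"
   using meas[OF Suc.prems(1), of R] unfolding lessThan_Suc by (intro M.product_nn_integral_insert_rev) auto
  also have "\<dots> = (\<integral>\<^sup>+z. \<integral>\<^sup>+w. of_bool (det (N m w (\<lambda>i c. if i = m then \<rho> m c z else R i c)) = 0) \<partial>Pi\<^sub>M {..<m} \<mu> \<partial>\<mu> m)"
  proof -
   have "N (Suc m) (w(m := z)) R = N m w (\<lambda>i c. if i = m then \<rho> m c z else R i c)" for w z
    unfolding N_def by (rule eq_matI) auto
   then show ?thesis by simp
  qed
  also have "\<dots> = (\<integral>\<^sup>+z. 0 \<partial>\<mu> m)" by (rule nn_integral_cong_AE[OF AE])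
  finally show ?case by simp
 qed
 have "det (mat n n (\<lambda>(i, c). if i < n then of_bool (c = \<sigma> i) else (0::real))) \<noteq> 0"
 proof -
  have \<sigma>': "\<sigma> permutes {0..<n}" using \<sigma> by (simp add: atLeast0LessThan)
  have "mat n n (\<lambda>(i, c). if i < n then of_bool (c = \<sigma> i) else (0::real)) = mat n n (\<lambda>(i, c). 1\<^sub>m n $$ (\<sigma> i, c))"
   using permutes_in_image[OF \<sigma>] by (intro eq_matI) auto
  then show ?thesis using det_permute_rows[of "1\<^sub>m n :: real mat" n \<sigma>] \<sigma>' by (simp add: sign_def)
 qed
 from main[OF order_refl, of "\<lambda>_ _. 0", OF this]
 have "AE w in Pi\<^sub>M {..<n} \<mu>. (of_bool (det (N n w (\<lambda>_ _. 0)) = 0) :: ennreal) = 0"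
  using meas[of n "\<lambda>_ _. 0"] by (simp add: nn_integral_0_iff_AE)
 moreover have "N n w (\<lambda>_ _. 0) = mat n n (\<lambda>(i, c). \<rho> i c (w i))" for w
  unfolding N_def by (rule eq_matI) auto
 ultimately show ?thesis by (auto elim!: eventually_mono)
qed

text \<open>Row \<open>i\<close> stays the unit row of \<open>c0\<close>, and every other row has a
  positive weight in the column prescribed by \<sigma>, which is what \<open>AE_det_nonzero\<close>
  asks for.\<close>

lemma AE_gam_nonzero:
 assumes i: "i < length bl" and \<sigma>: "\<sigma> permutes {..<length bl}" "\<sigma> i = c0"
  and pos: "\<And>r. r < length bl \<Longrightarrow> r \<noteq> i \<Longrightarrow> \<delta> r (bl ! \<sigma> r) > 0"
 shows "AE Z in matG (length bl). gam bl \<delta> i c0 Z \<noteq> 0"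
proof -
 define n where "n = length bl"
 define \<rho> where "\<rho> r c z = (if r = i then of_bool (c = c0) else sdeg bl \<delta> r c * z c)" for r c and z :: "nat => real"
 have \<sigma>n: "\<sigma> r < n" if "r < n" for r using permutes_in_image[OF \<sigma>(1), of r] that by (simp add: n_def)
 have "AE Z in matG n. det (mat n n (\<lambda>(r, c). \<rho> r c (Z r))) \<noteq> 0"
 proof (rule AE_det_nonzero[OF sf_rowG])
  show "\<rho> r c \<in> borel_measurable (rowG n)" if "r < n" "c < n" for r c
   unfolding \<rho>_def using that by (cases "r = i") (auto intro!: borel_measurable_times measurable_rowG_entry)
  show "\<sigma> permutes {..<n}" using \<sigma> by (simp add: n_def)
  fix r q assume r: "r < n" "q (\<sigma> r) \<noteq> (0::real)"
  show "AE w in rowG n. (\<Sum>c<n. \<rho> r c w * q c) \<noteq> 0"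
  proof (cases "r = i")
   case True
   have "(\<Sum>c<n. \<rho> r c w * q c) = q c0" for w
    unfolding \<rho>_def using True \<sigma>n[OF r(1)] \<sigma>(2) by (simp add: sum_of_bool_lessThan)
   then show ?thesis using r(2) True \<sigma>(2) by simp
  next
   case False
   have "(\<Sum>c<n. \<rho> r c w * q c) = (\<Sum>c<n. (sdeg bl \<delta> r c * q c) * w c)" for w
    using False by (simp add: \<rho>_def mult_ac)
   then show ?thesis
    using AE_row_nonzero[of "\<sigma> r" n "\<lambda>c. sdeg bl \<delta> r c * q c"] \<sigma>n[OF r(1)] r pos[of r] False by (simp add: n_def)
  qed
 qed
 moreover have "det (mat n n (\<lambda>(r, c). \<rho> r c (Z r))) = gam bl \<delta> i c0 Z" for Z
  unfolding gam_def rdet_def n_def \<rho>_def by (intro arg_cong[where f = det] eq_matI) auto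
 ultimately show ?thesis unfolding n_def[symmetric] by simp
qed

lemma det_tendsto:
 assumes "\<And>i j. i < n \<Longrightarrow> j < n \<Longrightarrow> ((\<lambda>m. E m i j) \<longlongrightarrow> E0 i j) F"
 shows "((\<lambda>m. det (mat n n (\<lambda>(i, j). E m i j))) \<longlongrightarrow> det (mat n n (\<lambda>(i, j). E0 i j :: real))) F"
proof -
 have "p i < n" if "p permutes {0..<n}" "i < n" for p i using permutes_in_image[OF that(1), of i] that(2) by simp
 then show ?thesis unfolding det_mat_sum using assms by (auto intro!: tendsto_intros)
qed

text \<open>Open boxes have positive Gaussian measure, so an almost sure property holds at matrices
  arbitrarily close to any given \<open>Z0\<close>. Identities between continuous functions that
  hold almost surely thus extend to every matrix.\<close>

lemma AE_matG_approx:
 assumes P: "AE Z in matG n. P Z" and e: "e > 0"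
 shows "\<exists>Z. P Z \<and> (\<forall>r<n. \<forall>c<n. \<bar>Z r c - Z0 r c\<bar> < e)"
proof (rule ccontr)
 assume no: "\<not> ?thesis"
 have pos: "emeasure stdG {a - e<..<a + e} \<noteq> 0" for a
 proof
  assume "emeasure stdG {a - e<..<a + e} = 0"
  then have "{a - e<..<a + e} \<in> null_sets stdG" by (intro null_setsI) auto
  then have "AE x in lborel. x \<in> {a - e<..<a + e} \<longrightarrow> ennreal (std_normal_density x) = 0"
   unfolding stdG_def by (subst (asm) null_sets_density_iff) auto
  moreover have "ennreal (std_normal_density x) \<noteq> 0" for x
   using normal_density_pos[of 1 0 x] by (simp add: ennreal_eq_0_iff)
  ultimately have "{a - e<..<a + e} \<in> null_sets lborel" by (subst AE_iff_null_sets) auto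
  then show False using e by (auto simp: null_sets_def)
 qed
 interpret R: product_sigma_finite "\<lambda>_::nat. rowG n" using sf_rowG by (simp add: product_sigma_finite_def)
 define B where "B r = Pi\<^sub>E {..<n} (\<lambda>c. {Z0 r c - e<..<Z0 r c + e})" for r
 have Bs: "B r \<in> sets (rowG n)" for r unfolding B_def by (intro sets_PiM_I_finite) auto
 have "emeasure (matG n) (Pi\<^sub>E {..<n} B) = (\<Prod>r<n. \<Prod>c<n. emeasure stdG {Z0 r c - e<..<Z0 r c + e})"
  using Bs by (subst R.emeasure_PiM) (auto simp: B_def pG.emeasure_PiM)
 also have "\<dots> \<noteq> 0" using pos by simp
 finally have "emeasure (matG n) (Pi\<^sub>E {..<n} B) \<noteq> 0" .
 moreover have "AE Z in matG n. Z \<notin> Pi\<^sub>E {..<n} B" using P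
 proof eventually_elim
  case (elim Z)
  show ?case
  proof
   assume Z: "Z \<in> Pi\<^sub>E {..<n} B"
   have "\<bar>Z r c - Z0 r c\<bar> < e" if "r < n" "c < n" for r c
    using PiE_mem[OF PiE_mem[OF Z, of r, unfolded B_def], of c] that by auto
   then show False using no elim by blast
  qed
 qed
 then have "Pi\<^sub>E {..<n} B \<in> null_sets (matG n)"
  using Bs by (subst AE_iff_null_sets) (auto intro!: sets_PiM_I_finite)
 ultimately show False by auto
qed

text \<open>Proportionality would persist at every matrix by continuity; but clearing the column \<open>c\<close>
 of a matrix with nonzero minor \<open>gam c\<close> keeps that minor and kills all the others.\<close>

lemma blocknorm_proportional:
 assumes i: "i < length bl" and j: "j \<noteq> j'" and nz: "AE Z in matG (length bl). blocknorm bl \<delta> i j Z \<noteq> 0"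
  and pro: "AE Z in matG (length bl). a * blocknorm bl \<delta> i j Z = b * blocknorm bl \<delta> i j' Z"
 shows "a = 0"
proof -
 define n where "n = length bl"
 have "AE Z in matG n. blocknorm bl \<delta> i j Z \<noteq> 0" using nz unfolding n_def .
 from AE_matG_approx[OF this, of 1 "\<lambda>_ _. 0"] obtain Z0 where "blocknorm bl \<delta> i j Z0 \<noteq> 0" by auto
 then have "(\<Sum>c\<in>blockset bl j. (gam bl \<delta> i c Z0)\<^sup>2) \<noteq> 0" by (simp add: blocknorm_def)
 then obtain c where c: "c \<in> blockset bl j" "gam bl \<delta> i c Z0 \<noteq> 0" by (metis (no_types, lifting) sum.neutral zero_power2)
 have cn: "c < n" "bl ! c = j" using c(1) by (auto simp: blockset_def n_def)
 define Z1 where "Z1 r d = (if d = c then 0 else Z0 r d)" for r d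
 have "\<bar>gam bl \<delta> i c Z1\<bar> = \<bar>gam bl \<delta> i c Z0\<bar>"
  using gam_minor[OF i, of c] cn(1) insert_index_neq[of c] by (simp add: n_def Z1_def)
 then have g1: "gam bl \<delta> i c Z1 \<noteq> 0" using c(2) by auto
 have g0: "gam bl \<delta> i d Z1 = 0" if d: "d \<noteq> c" for d
 proof -
  define A where "A = mat n n (\<lambda>(r, e). if r = i then of_bool (e = d) else sdeg bl \<delta> r e * Z1 r e)"
  have "det A = (\<Sum>r<n. A $$ (r, c) * cofactor A r c)"
   using cn(1) by (intro laplace_expansion_column) (auto simp: A_def)
  also have "\<dots> = 0" using d cn(1) by (intro sum.neutral) (auto simp: A_def Z1_def)
  finally show ?thesis by (simp add: gam_def rdet_def A_def n_def)
 qed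
 have "\<forall>m. \<exists>Z. a * blocknorm bl \<delta> i j Z = b * blocknorm bl \<delta> i j' Z \<and> (\<forall>r<n. \<forall>d<n. \<bar>Z r d - Z1 r d\<bar> < inverse (real (Suc m)))"
  using AE_matG_approx[OF pro[folded n_def]] by simp
 then obtain Z where Z: "\<And>m. a * blocknorm bl \<delta> i j (Z m) = b * blocknorm bl \<delta> i j' (Z m)"
  "\<And>m r d. r < n \<Longrightarrow> d < n \<Longrightarrow> \<bar>Z m r d - Z1 r d\<bar> < inverse (real (Suc m))" by metis
 have lim: "(\<lambda>m. Z m r d) \<longlonglongrightarrow> Z1 r d" if "r < n" "d < n" for r d
  by (rule LIM_zero_cancel, rule Lim_null_comparison[OF _ LIMSEQ_inverse_real_of_nat])
   (use Z(2)[OF that] in \<open>auto intro!: always_eventually less_imp_le\<close>)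
 have bn: "(\<lambda>m. blocknorm bl \<delta> i l (Z m)) \<longlonglongrightarrow> blocknorm bl \<delta> i l Z1" for l
  unfolding blocknorm_def gam_def rdet_def n_def[symmetric]
  by (intro tendsto_intros det_tendsto) (auto intro!: tendsto_intros lim)
 have "(\<lambda>m. a * blocknorm bl \<delta> i j (Z m)) \<longlonglongrightarrow> b * blocknorm bl \<delta> i j' Z1"
  unfolding Z(1) by (intro tendsto_intros bn)
 then have "a * blocknorm bl \<delta> i j Z1 = b * blocknorm bl \<delta> i j' Z1"
  using LIMSEQ_unique tendsto_mult_left[OF bn] by blast
 also have "blocknorm bl \<delta> i j' Z1 = 0"
  using cn(2) j by (auto simp: blocknorm_def blockset_def intro!: sum.neutral g0)
 finally have "a * blocknorm bl \<delta> i j Z1 = 0" by simp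
 moreover have "blocknorm bl \<delta> i j Z1 \<noteq> 0"
 proof -
  have "0 < (gam bl \<delta> i c Z1)\<^sup>2" using g1 by simp
  also have "\<dots> \<le> (\<Sum>c\<in>blockset bl j. (gam bl \<delta> i c Z1)\<^sup>2)" using c(1) by (intro member_le_sum) auto
  finally show ?thesis by (simp add: blocknorm_def)
 qed
 ultimately show ?thesis by simp
qed

section \<open>Permanents\<close>

lemma permutation_insert_insert_index:
 assumes "p permutes {0..<n}" "r < n"
 shows "permutation_insert i j p (insert_index i r) = insert_index j (p r)"
 by (auto simp: permutation_insert_def insert_dom_def insert_ran_def insert_index_def delete_index_def)

text \<open>The permutations with \<open>\<sigma> i = c\<close> arise from those of \<open>n\<close>
  indices through \<open>permutation_insert\<close>, and no signs occur.\<close>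

lemma per_laplace:
 assumes i: "i < Suc n"
 shows "per (Suc n) D = (\<Sum>c<Suc n. D i c * per n (\<lambda>r d. D (insert_index i r) (insert_index c d)))"
proof -
 define f where "f \<sigma> = (\<Prod>r<Suc n. D r (\<sigma> r))" for \<sigma>
 define S where "S = {\<sigma>. \<sigma> permutes {0..<Suc n}}"
 have S: "S = {\<sigma>. \<sigma> permutes {..<Suc n}}" by (simp add: S_def atLeast0LessThan)
 have finS: "finite S" unfolding S_def by (intro finite_permutations) simp
 have rows: "{..<Suc n} = insert i (insert_index i ` {..<n})"
  using insert_index_image[of i n] i by (auto simp: atLeast0LessThan)
 have inj: "inj_on (insert_index i) {..<n}" by (rule inj_on_subset[OF inj_insert_index]) simp
 have "per (Suc n) D = sum f S" by (simp add: per_def f_def S)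
 also have "\<dots> = (\<Sum>c<Suc n. \<Sum>\<sigma>\<in>{\<sigma> \<in> S. \<sigma> i = c}. f \<sigma>)"
 proof (rule sum.group[symmetric])
  show "(\<lambda>\<sigma>. \<sigma> i) ` S \<subseteq> {..<Suc n}" using permutes_in_image[of _ "{..<Suc n}" i] i by (auto simp: S)
 qed (use finS in auto)
 also have "\<dots> = (\<Sum>c<Suc n. D i c * per n (\<lambda>r d. D (insert_index i r) (insert_index c d)))"
 proof (rule sum.cong)
  fix c assume "c \<in> {..<Suc n}"
  then have c: "c < Suc n" by simp
  have "{\<sigma> \<in> S. \<sigma> i = c} = permutation_insert i c ` {p. p permutes {0..<n}}"
   using permutation_fix[OF i c] by (simp add: S_def)
  then have "(\<Sum>\<sigma>\<in>{\<sigma> \<in> S. \<sigma> i = c}. f \<sigma>) = (\<Sum>p | p permutes {0..<n}. f (permutation_insert i c p))"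
   using permutation_insert_inj_on[OF i c] by (simp add: sum.reindex)
  also have "\<dots> = (\<Sum>p | p permutes {0..<n}. D i c * (\<Prod>r<n. D (insert_index i r) (insert_index c (p r))))"
  proof (rule sum.cong)
   fix p assume "p \<in> {p. p permutes {0..<n}}"
   then have p: "p permutes {0..<n}" by simp
   have "f (permutation_insert i c p) = D i (permutation_insert i c p i) * (\<Prod>r\<in>insert_index i ` {..<n}. D r (permutation_insert i c p r))"
    unfolding f_def rows using insert_index_neq[of i, THEN not_sym] by (subst prod.insert) auto
   also have "(\<Prod>r\<in>insert_index i ` {..<n}. D r (permutation_insert i c p r)) = (\<Prod>r<n. D (insert_index i r) (insert_index c (p r)))"
    unfolding prod.reindex[OF inj] o_def
    using permutation_insert_insert_index[OF p] by (intro prod.cong) auto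
   finally show "f (permutation_insert i c p) = D i c * (\<Prod>r<n. D (insert_index i r) (insert_index c (p r)))"
    by simp
  qed simp
  finally show "(\<Sum>\<sigma>\<in>{\<sigma> \<in> S. \<sigma> i = c}. f \<sigma>) = D i c * per n (\<lambda>r d. D (insert_index i r) (insert_index c d))"
   by (simp add: per_def sum_distrib_left atLeast0LessThan)
 qed simp
 finally show ?thesis .
qed

lemma per_nonneg: "(\<And>i c. i < n \<Longrightarrow> c < n \<Longrightarrow> 0 \<le> D i c) \<Longrightarrow> 0 \<le> per n D"
 unfolding per_def by (intro sum_nonneg prod_nonneg) (auto dest: permutes_in_image)

lemma per_pos_iff:
 assumes "\<And>i c. i < n \<Longrightarrow> c < n \<Longrightarrow> 0 \<le> D i c"
 shows "per n D > 0 \<longleftrightarrow> (\<exists>\<sigma>. \<sigma> permutes {..<n} \<and> (\<forall>i<n. D i (\<sigma> i) > 0))"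
proof -
 have lt: "\<sigma> i < n" if "\<sigma> permutes {..<n}" "i < n" for \<sigma> i using permutes_in_image[OF that(1), of i] that(2) by simp
 have nn: "0 \<le> (\<Prod>i<n. D i (\<sigma> i))" if "\<sigma> permutes {..<n}" for \<sigma>
  using assms lt[OF that] by (intro prod_nonneg) auto
 have pos: "(\<Prod>i<n. D i (\<sigma> i)) > 0 \<longleftrightarrow> (\<forall>i<n. D i (\<sigma> i) > 0)" if "\<sigma> permutes {..<n}" for \<sigma>
 proof
  assume "(\<Prod>i<n. D i (\<sigma> i)) > 0"
  then have "(\<Prod>i<n. D i (\<sigma> i)) \<noteq> 0" by linarith
  then have "\<forall>i<n. D i (\<sigma> i) \<noteq> 0" unfolding prod_zero_iff[OF finite_lessThan] by blast
  then show "\<forall>i<n. D i (\<sigma> i) > 0" using assms lt[OF that] by (simp add: less_le)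
 qed (auto intro: prod_pos)
 have "per n D > 0 \<longleftrightarrow> per n D \<noteq> 0" using per_nonneg[of n D, OF assms] by linarith
 also have "\<dots> \<longleftrightarrow> (\<exists>\<sigma>. \<sigma> permutes {..<n} \<and> (\<Prod>i<n. D i (\<sigma> i)) \<noteq> 0)"
  unfolding per_def using nn by (subst sum_nonneg_eq_0_iff) (auto intro: finite_permutations)
 also have "\<dots> \<longleftrightarrow> (\<exists>\<sigma>. \<sigma> permutes {..<n} \<and> (\<forall>i<n. D i (\<sigma> i) > 0))" using pos nn by (metis less_le)
 finally show ?thesis .
qed

lemma per_cong: "(\<And>i c. i < n \<Longrightarrow> c < n \<Longrightarrow> D i c = D' i c) \<Longrightarrow> per n D = per n D'"
 unfolding per_def by (intro sum.cong prod.cong refl) (auto dest: permutes_in_image)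

text \<open>A permanent does not depend on the order of its columns, so minors obtained by deleting
  different columns of one block agree.\<close>

lemma per_mset_cong:
 assumes "mset xs = mset ys"
 shows "per (length xs) (\<lambda>i c. D i (xs ! c)) = per (length ys) (\<lambda>i c. D i (ys ! c))"
proof -
 obtain \<pi> where \<pi>: "\<pi> permutes {..<length ys}" "permute_list \<pi> ys = xs"
  using mset_eq_permutation[OF assms] by blast
 have len: "length xs = length ys" using assms by (metis size_mset)
 have nth: "xs ! c = ys ! \<pi> c" if "c < length ys" for c using permute_list_nth[OF \<pi>(1) that] \<pi>(2) by simp
 have "per (length ys) (\<lambda>i c. D i (xs ! c)) = (\<Sum>\<sigma> | \<sigma> permutes {..<length ys}. \<Prod>i<length ys. D i (ys ! (\<pi> \<circ> \<sigma>) i))"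
  unfolding per_def
 proof (intro sum.cong prod.cong refl)
  fix \<sigma> i assume "\<sigma> \<in> {\<sigma>. \<sigma> permutes {..<length ys}}" "i \<in> {..<length ys}"
  then have "\<sigma> i < length ys" using permutes_in_image[of \<sigma> "{..<length ys}" i] by simp
  then show "D i (xs ! \<sigma> i) = D i (ys ! (\<pi> \<circ> \<sigma>) i)" by (simp add: nth)
 qed
 also have "\<dots> = per (length ys) (\<lambda>i c. D i (ys ! c))"
  unfolding per_def by (rule setum_permutations_compose_left[OF \<pi>(1), symmetric])
 finally show ?thesis by (simp add: len)
qed

text \<open>The order of the columns is left open, so that the induction may delete any of
  them.\<close>

definition blk :: "nat => (nat => nat) => nat list => bool" where
 "blk k nv bl \<longleftrightarrow> set bl \<subseteq> {..<k} \<and> (\<forall>j<k. count (mset bl) j = nv j)"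

definition nper :: "nat => (nat => nat) => nat list => (nat => nat => real) => real" where
 "nper k nv bl D = per (length bl) (\<lambda>i c. D i (bl ! c)) / (\<Prod>j<k. fact (nv j))"

lemma blk_length: "blk k nv bl \<Longrightarrow> length bl = total_dim k nv" unfolding blk_def total_dim_def
 by (metis (no_types, lifting) count_mset lessThan_iff sum.cong sum_count_set finite_lessThan)

lemma blk_mem: "blk k nv bl \<Longrightarrow> j \<in> set bl \<longleftrightarrow> j < k \<and> nv j > 0"
 unfolding blk_def by (metis count_greater_zero_iff lessThan_iff set_mset_mset subsetD)

lemma blk_del: "blk k nv bl \<Longrightarrow> c < length bl \<Longrightarrow> blk k (decrement (bl ! c) nv) (del c bl)"
 using mset_del[of c bl] unfolding blk_def decrement_def
 by (auto simp: del_def dest: in_set_takeD in_set_dropD)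

lemma nper_nonneg: "(\<And>i j. 0 \<le> D i j) \<Longrightarrow> 0 \<le> nper k nv bl D"
 unfolding nper_def by (intro divide_nonneg_nonneg per_nonneg prod_nonneg) auto

lemma nper_pos_iff: "nper k nv bl D > 0 \<longleftrightarrow> per (length bl) (\<lambda>i c. D i (bl ! c)) > 0"
 unfolding nper_def by (simp add: zero_less_divide_iff prod_pos less_le_trans) (metis not_less_iff_gr_or_eq prod_pos fact_gt_zero)

text \<open>The \<open>nv j\<close> columns of block \<open>j\<close> have equal minors, represented
  by column \<open>ix j\<close>. Their number cancels against \<open>fact (nv j)\<close> and leaves
  the factorial of the decremented block, so the normalized permanent obeys a recursion over blocks
  instead of columns.\<close>

lemma nper_expand:
 assumes b: "blk k nv bl" and i: "i < length bl"
  and ix: "\<And>j. j \<in> set bl \<Longrightarrow> ix j < length bl \<and> bl ! ix j = j"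
 shows "nper k nv bl D = (\<Sum>j\<in>set bl. D i j * nper k (decrement j nv) (del (ix j) bl) (\<lambda>r. D (insert_index i r)))"
proof -
 obtain n where n: "length bl = Suc n" using i by (cases "length bl") auto
 define Q where "Q c = per n (\<lambda>r d. D (insert_index i r) (del c bl ! d))" for c
 have Q: "per n (\<lambda>r d. D (insert_index i r) (bl ! insert_index c d)) = Q c" if "c < Suc n" for c
  unfolding Q_def using that n by (intro per_cong) (simp add: nth_del)
 have Qc: "Q c = Q (ix (bl ! c))" if c: "c < Suc n" for c
 proof -
  have m: "bl ! c \<in> set bl" using c n by simp
  have "mset (del c bl) = mset (del (ix (bl ! c)) bl)"
   using mset_del[of c bl] mset_del[of "ix (bl ! c)" bl] ix[OF m] c n by simp
  from per_mset_cong[OF this, of "\<lambda>r. D (insert_index i r)"] show ?thesis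
   using c n ix[OF m] by (simp add: Q_def length_del)
 qed
 have "per (length bl) (\<lambda>i c. D i (bl ! c)) = (\<Sum>c<Suc n. D i (bl ! c) * Q (ix (bl ! c)))"
  unfolding n per_laplace[OF i[unfolded n]] using Q Qc by (intro sum.cong) auto
 also have "\<dots> = (\<Sum>j\<in>set bl. \<Sum>c\<in>blockset bl j. D i (bl ! c) * Q (ix (bl ! c)))"
  using sum_blocks[where bl = bl] n by simp
 also have "\<dots> = (\<Sum>j\<in>set bl. real (nv j) * (D i j * Q (ix j)))"
 proof (rule sum.cong)
  fix j assume j: "j \<in> set bl"
  have "card (blockset bl j) = count (mset bl) j"
   by (simp add: blockset_def count_mset count_list_eq_length_filter length_filter_conv_card eq_commute)
  also have "\<dots> = nv j" using b j by (auto simp: blk_def)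
  finally have "card (blockset bl j) = nv j" .
  moreover have "(\<Sum>c\<in>blockset bl j. D i (bl ! c) * Q (ix (bl ! c))) = (\<Sum>c\<in>blockset bl j. D i j * Q (ix j))"
   by (intro sum.cong) (auto simp: blockset_def)
  ultimately show "(\<Sum>c\<in>blockset bl j. D i (bl ! c) * Q (ix (bl ! c))) = real (nv j) * (D i j * Q (ix j))" by simp
 qed simp
 finally have P: "per (length bl) (\<lambda>i c. D i (bl ! c)) = (\<Sum>j\<in>set bl. real (nv j) * (D i j * Q (ix j)))" .
 show ?thesis unfolding nper_def P sum_divide_distrib
 proof (rule sum.cong)
  fix j assume j: "j \<in> set bl"
  then have jk: "j < k" "nv j > 0" using blk_mem[OF b] by auto
  have rest: "(\<Prod>l<k. fact (nv' l) :: real) = fact (nv' j) * (\<Prod>l\<in>{..<k} - {j}. fact (nv' l))" for nv' :: "nat => nat"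
   using jk by (intro prod.remove) auto
  have "(\<Prod>l\<in>{..<k} - {j}. fact (decrement j nv l) :: real) = (\<Prod>l\<in>{..<k} - {j}. fact (nv l))"
   by (intro prod.cong) (auto simp: decrement_def)
  moreover have "(fact (nv j) :: real) = real (nv j) * fact (decrement j nv j)"
   using jk(2) by (simp add: decrement_def fact_reduce)
  ultimately have "(\<Prod>l<k. fact (nv l) :: real) = real (nv j) * (\<Prod>l<k. fact (decrement j nv l))"
   unfolding rest by simp
  then show "real (nv j) * (D i j * Q (ix j)) / (\<Prod>l<k. fact (nv l)) =
    D i j * (per (length (del (ix j) bl)) (\<lambda>ia c. D (insert_index i ia) (del (ix j) bl ! c)) / (\<Prod>l<k. fact (decrement j nv l)))"
   using jk(2) ix[OF j] n by (simp add: Q_def length_del)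
 qed simp
qed

section \<open>Means of Euclidean norms and their equality cases\<close>

lemma sqrt_sum_squares_le_sum:
 assumes "finite J" "\<And>j. j \<in> J \<Longrightarrow> 0 \<le> u j"
 shows "sqrt (\<Sum>j\<in>J. (u j)\<^sup>2) \<le> (\<Sum>j\<in>J. u j)" using L2_set_le_sum[of J u] assms by (simp add: L2_set_def)

text \<open>With \<open>R\<close> the length of the vector without entry \<open>j\<close>, equality
  forces the square of \<open>u j + R\<close> to be at most the sum of the squares of
  \<open>u j\<close> and \<open>R\<close>. Hence \<open>u j * R = 0\<close>, and \<open>R\<close>
  dominates \<open>u j'\<close>.\<close>

lemma sqrt_sum_squares_eq_sum:
 assumes J: "finite J" "\<And>j. j \<in> J \<Longrightarrow> 0 \<le> u j" and jj: "j \<in> J" "j' \<in> J" "j \<noteq> j'"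
  and eq: "sqrt (\<Sum>j\<in>J. (u j)\<^sup>2) = (\<Sum>j\<in>J. u j)"
 shows "u j * u j' = (0::real)"
proof -
 define R where "R = sqrt (\<Sum>l\<in>J - {j}. (u l)\<^sup>2)"
 have R: "R \<ge> 0" "R\<^sup>2 = (\<Sum>l\<in>J - {j}. (u l)\<^sup>2)" by (auto simp: R_def sum_nonneg)
 have "R \<le> (\<Sum>l\<in>J - {j}. u l)" unfolding R_def using J by (intro sqrt_sum_squares_le_sum) auto
 moreover have "(\<Sum>l\<in>J. u l) = u j + (\<Sum>l\<in>J - {j}. u l)" "(\<Sum>l\<in>J. (u l)\<^sup>2) = (u j)\<^sup>2 + R\<^sup>2"
  using J jj R by (simp_all add: sum.remove)
 ultimately have "u j + R \<le> sqrt ((u j)\<^sup>2 + R\<^sup>2)" using eq by simp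
 then have "(u j + R)\<^sup>2 \<le> (u j)\<^sup>2 + R\<^sup>2"
 proof -
  have "(u j + R)\<^sup>2 \<le> (sqrt ((u j)\<^sup>2 + R\<^sup>2))\<^sup>2"
   using \<open>u j + R \<le> _\<close> J(2)[OF jj(1)] R(1) by (intro power_mono) auto
  then show ?thesis by simp
 qed
 then have "u j * R \<le> 0" by (simp add: power2_sum mult.commute)
 moreover have "0 \<le> u j * R" using J(2)[OF jj(1)] R(1) by simp
 ultimately have 0: "u j * R = 0" by simp
 have "(u j')\<^sup>2 \<le> R\<^sup>2" unfolding R using J jj by (intro member_le_sum) auto
 then have "u j' \<le> R" using R(1) by (rule power2_le_imp_le)
 then have "u j * u j' \<le> u j * R" using J(2)[OF jj(1)] by (rule mult_left_mono)
 moreover have "0 \<le> u j * u j'" using J(2)[OF jj(1)] J(2)[OF jj(2)] by simp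
 ultimately show ?thesis using 0 by simp
qed

context prob_space
begin

text \<open>The upper bound compares the Euclidean norm with the sum of the entries; the lower one
  is the Cauchy-Schwarz inequality against the vector of means \<open>a j * m j\<close>. Both
  equality cases are read off pointwise: vanishing products for the upper bound, proportionality to
  the mean vector for the lower one.\<close>

lemma mean_sqrt_bounds:
 fixes X :: "nat => 'a => real" and a :: "nat => real"
 assumes J: "finite J" and X: "\<And>j. j \<in> J \<Longrightarrow> integrable M (X j)" "\<And>j w. j \<in> J \<Longrightarrow> 0 \<le> X j w"
  and a: "\<And>j. j \<in> J \<Longrightarrow> 0 \<le> a j"
 defines "m j \<equiv> expectation (X j)"
 defines "S \<equiv> (\<lambda>w. sqrt (\<Sum>j\<in>J. (a j * X j w)\<^sup>2))"
 shows "integrable M S" "expectation S \<le> (\<Sum>j\<in>J. a j * m j)"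
  "sqrt (\<Sum>j\<in>J. (a j * m j)\<^sup>2) \<le> expectation S"
  and "expectation S = (\<Sum>j\<in>J. a j * m j) \<Longrightarrow> j \<in> J \<Longrightarrow> j' \<in> J \<Longrightarrow> j \<noteq> j' \<Longrightarrow>
   AE w in M. (a j * X j w) * (a j' * X j' w) = 0"
  and "sqrt (\<Sum>j\<in>J. (a j * m j)\<^sup>2) = expectation S \<Longrightarrow> j \<in> J \<Longrightarrow> j' \<in> J \<Longrightarrow> a j * m j > 0 \<Longrightarrow> a j' * m j' > 0 \<Longrightarrow>
   AE w in M. m j' * X j w = m j * X j' w" proof -
 have meas[measurable]: "X j \<in> borel_measurable M" if "j \<in> J" for j using X(1)[OF that] by simp
 have Smeas: "S \<in> borel_measurable M"
 proof -
  have [measurable]: "(\<lambda>w. \<Sum>j\<in>J. (a j * X j w)\<^sup>2) \<in> borel_measurable M"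
   using meas by (intro borel_measurable_sum borel_measurable_power borel_measurable_times) auto
  show ?thesis unfolding S_def by measurable
 qed
 have int1: "integrable M (\<lambda>w. \<Sum>j\<in>J. a j * X j w)" using X by (intro Bochner_Integration.integrable_sum) auto
 have e1: "expectation (\<lambda>w. \<Sum>j\<in>J. a j * X j w) = (\<Sum>j\<in>J. a j * m j)"
  using X by (subst Bochner_Integration.integral_sum) (auto simp: m_def)
 have nn: "0 \<le> a j * X j w" if "j \<in> J" for j w using a X(2) that by simp
 have Sle: "S w \<le> (\<Sum>j\<in>J. a j * X j w)" for w unfolding S_def using J nn by (intro sqrt_sum_squares_le_sum)
 have S0: "0 \<le> S w" for w by (simp add: S_def sum_nonneg)
 show intS: "integrable M S"
  by (rule Bochner_Integration.integrable_bound[OF int1 Smeas]) (use order_trans[OF Sle abs_ge_self] S0 in \<open>auto intro!: AE_I2\<close>)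
 show "expectation S \<le> (\<Sum>j\<in>J. a j * m j)"
  unfolding e1[symmetric] using intS int1 Sle by (intro integral_mono)
 show "AE w in M. (a j * X j w) * (a j' * X j' w) = 0"
  if "expectation S = (\<Sum>j\<in>J. a j * m j)" "j \<in> J" "j' \<in> J" "j \<noteq> j'"
 proof -
  have "expectation (\<lambda>w. (\<Sum>j\<in>J. a j * X j w) - S w) = 0" using that(1) e1 intS int1 by simp
  then have "AE w in M. (\<Sum>j\<in>J. a j * X j w) - S w = 0"
   using intS int1 Sle by (subst (asm) integral_nonneg_eq_0_iff_AE) auto
  then show ?thesis
  proof eventually_elim
   case (elim w)
   then have "sqrt (\<Sum>j\<in>J. (a j * X j w)\<^sup>2) = (\<Sum>j\<in>J. a j * X j w)" by (simp add: S_def)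
   then show ?case using sqrt_sum_squares_eq_sum[of J "\<lambda>j. a j * X j w", OF J nn that(2-4)] by simp
  qed
 qed
 define R where "R = sqrt (\<Sum>j\<in>J. (a j * m j)\<^sup>2)"
 have R2: "R\<^sup>2 = (\<Sum>j\<in>J. (a j * m j)\<^sup>2)" by (simp add: R_def sum_nonneg)
 have R0: "R \<ge> 0" by (simp add: R_def sum_nonneg)
 \<comment> \<open>Inner product of the random vector with its mean vector, so that its expectation
   is the square of \<open>R\<close>.\<close>
 define T where "T w = (\<Sum>j\<in>J. (a j * m j) * (a j * X j w))" for w
 have intT: "integrable M T" unfolding T_def using X by (intro Bochner_Integration.integrable_sum) auto
 have eT: "expectation T = R\<^sup>2"
  unfolding T_def R2 using X by (subst Bochner_Integration.integral_sum) (auto simp: m_def power2_eq_square mult_ac)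
 have CS: "T w \<le> R * S w" for w
 proof -
  have "(T w)\<^sup>2 \<le> (\<Sum>j\<in>J. (a j * m j)\<^sup>2) * (\<Sum>j\<in>J. (a j * X j w)\<^sup>2)"
   unfolding T_def by (rule Cauchy_Schwarz_ineq_sum)
  then show ?thesis unfolding R_def S_def real_sqrt_mult[symmetric] by (rule real_le_rsqrt)
 qed
 have RS: "R\<^sup>2 \<le> R * expectation S"
  unfolding eT[symmetric] using intS intT CS by (subst integral_mult_right_zero[symmetric]) (intro integral_mono, auto)
 show "sqrt (\<Sum>j\<in>J. (a j * m j)\<^sup>2) \<le> expectation S"
 proof (cases "R = 0")
  case True
  then show ?thesis using Bochner_Integration.integral_nonneg[of M S] S0 by (simp add: R_def[symmetric])
 next
  case False
  then have "R \<le> expectation S" using RS R0 by (metis less_eq_real_def mult_le_cancel_left_pos power2_eq_square)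
  then show ?thesis by (simp only: R_def)
 qed
 show "AE w in M. m j' * X j w = m j * X j' w"
  if eq: "sqrt (\<Sum>j\<in>J. (a j * m j)\<^sup>2) = expectation S" and jj: "j \<in> J" "j' \<in> J" and pos: "a j * m j > 0" "a j' * m j' > 0"
 proof -
  have "(a j * m j)\<^sup>2 \<le> R\<^sup>2" unfolding R2 using J jj by (intro member_le_sum) auto
  moreover have "0 < (a j * m j)\<^sup>2" using pos(1) by (rule zero_less_power)
  ultimately have "R\<^sup>2 > 0" by linarith
  then have Rpos: "R > 0" using R0 by (auto simp: less_le)
  have "expectation (\<lambda>w. R * S w - T w) = 0"
   using eq[folded R_def] intS intT by (simp add: eT power2_eq_square)
  then have "AE w in M. R * S w - T w = 0"
   using intS intT CS by (subst (asm) integral_nonneg_eq_0_iff_AE) auto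
  then show ?thesis
  proof eventually_elim
   case (elim w)
   have S2: "(S w)\<^sup>2 = (\<Sum>j\<in>J. (a j * X j w)\<^sup>2)" by (simp add: S_def sum_nonneg)
   \<comment> \<open>Equality in the Cauchy-Schwarz inequality, in the form that \<open>R\<close>
     times the random vector and \<open>S w\<close> times the mean vector have distance 0.\<close>
   have "(\<Sum>l\<in>J. (R * (a l * X l w) - S w * (a l * m l))\<^sup>2) =
     (\<Sum>l\<in>J. R\<^sup>2 * (a l * X l w)\<^sup>2 - 2 * R * S w * ((a l * m l) * (a l * X l w)) + (S w)\<^sup>2 * (a l * m l)\<^sup>2)"
    by (intro sum.cong refl) (simp add: power2_eq_square algebra_simps)
   also have "\<dots> = R\<^sup>2 * (S w)\<^sup>2 - 2 * R * S w * T w + (S w)\<^sup>2 * R\<^sup>2"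
    unfolding S2 R2 T_def by (simp only: sum.distrib sum_subtractf sum_distrib_left)
   also have "T w = R * S w" using elim by simp
   also have "R\<^sup>2 * (S w)\<^sup>2 - 2 * R * S w * (R * S w) + (S w)\<^sup>2 * R\<^sup>2 = 0"
    by (simp add: power2_eq_square algebra_simps)
   finally have z: "R * (a l * X l w) = S w * (a l * m l)" if "l \<in> J" for l
    using that J by (subst (asm) sum_nonneg_eq_0_iff) auto
   have nz: "a j \<noteq> 0" "a j' \<noteq> 0" using pos by auto
   have "R * X j w = S w * m j" "R * X j' w = S w * m j'"
    using z[OF jj(1)] z[OF jj(2)] nz by (simp_all add: mult.left_commute)
   then have "R * (m j' * X j w) = R * (m j * X j' w)" 
    by (simp only: mult.left_commute[of R]) (simp only: mult_ac)
   then show ?case using Rpos by simp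
  qed
 qed
qed

end

section \<open>The normalized mean determinant and the induction for the bounds\<close>

lemma expdet_Nil: "expdet [] \<delta> = 1"
 by (simp add: expdet_def PiM_empty nn_integral_count_space_finite det_dim_zero)

lemma blockmean_pos:
 assumes "j \<in> set bl"
 shows "blockmean bl j > 0"
proof -
 obtain c where c: "c < length bl" "bl ! c = j" using assms by (auto simp: in_set_conv_nth)
 then have cb: "c \<in> blockset bl j" by (simp add: blockset_def)
 have m: "(\<lambda>z. ennreal (sqrt (\<Sum>c\<in>blockset bl j. (z c)\<^sup>2))) \<in> borel_measurable (rowG (length bl))"
 proof -
  have [measurable]: "(\<lambda>z. \<Sum>c\<in>blockset bl j. (z c)\<^sup>2) \<in> borel_measurable (rowG (length bl))"
   by (intro borel_measurable_sum borel_measurable_power measurable_rowG_entry) (auto simp: blockset_def)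
  show ?thesis by measurable
 qed
 have "blockmean bl j \<noteq> 0"
 proof
  assume "blockmean bl j = 0"
  then have "AE z in rowG (length bl). ennreal (sqrt (\<Sum>c\<in>blockset bl j. (z c)\<^sup>2)) = 0"
   unfolding blockmean_def using m by (simp add: nn_integral_0_iff_AE)
  moreover have "AE z in rowG (length bl). (\<Sum>d<length bl. of_bool (d = c) * z d) \<noteq> 0"
   using c by (intro AE_row_nonzero[of c]) auto
  ultimately have "AE z in rowG (length bl). False"
  proof eventually_elim
   case (elim z)
   have "z c \<noteq> 0" using elim(2) sum_of_bool_lessThan(3)[OF c(1), of z] by argo
   then have "0 < (z c)\<^sup>2" by simp
   also have "\<dots> \<le> (\<Sum>c\<in>blockset bl j. (z c)\<^sup>2)" using cb by (intro member_le_sum) auto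
   finally have "0 < sqrt (\<Sum>c\<in>blockset bl j. (z c)\<^sup>2)" by simp
   then show False using elim(1) by (simp add: ennreal_eq_0_iff)
  qed
  then show False using prob_space.AE_False[OF prob_rowG] by simp
 qed
 then show ?thesis by (simp add: zero_less_iff_neq_zero)
qed

lemma blockmean_finite: "blockmean bl j < \<infinity>"
proof -
 have "blockmean bl j \<le> (\<integral>\<^sup>+z. (\<Sum>c\<in>blockset bl j. ennreal \<bar>\<Sum>d<length bl. of_bool (d = c) * z d\<bar>) \<partial>rowG (length bl))"
  unfolding blockmean_def
 proof (rule nn_integral_mono)
  fix z :: "nat => real"
  have "sqrt (\<Sum>c\<in>blockset bl j. (z c)\<^sup>2) \<le> (\<Sum>c\<in>blockset bl j. \<bar>z c\<bar>)"
   using sqrt_sum_squares_le_sum[of "blockset bl j" "\<lambda>c. \<bar>z c\<bar>"] by simp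
  also have "\<dots> = (\<Sum>c\<in>blockset bl j. \<bar>\<Sum>d<length bl. of_bool (d = c) * z d\<bar>)"
   by (intro sum.cong refl arg_cong[where f = abs] sum_of_bool_lessThan(3)[symmetric]) (auto simp: blockset_def)
  finally show "ennreal (sqrt (\<Sum>c\<in>blockset bl j. (z c)\<^sup>2)) \<le> (\<Sum>c\<in>blockset bl j. ennreal \<bar>\<Sum>d<length bl. of_bool (d = c) * z d\<bar>)"
   by (subst sum_ennreal) (auto intro: ennreal_leI)
 qed
 also have "\<dots> = (\<Sum>c\<in>blockset bl j. \<integral>\<^sup>+z. ennreal \<bar>\<Sum>d<length bl. of_bool (d = c) * z d\<bar> \<partial>rowG (length bl))"
  by (rule nn_integral_sum) (intro measurable_compose[OF _ measurable_ennreal] borel_measurable_abs borel_measurable_sum borel_measurable_times borel_measurable_const measurable_rowG_entry, simp)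
 also have "\<dots> < \<infinity>" unfolding rowG_abs_form' by (simp add: sum_ennreal[symmetric])
 finally show ?thesis .
qed

text \<open>The length in the row expansion is at most a weighted sum of block norms, whose means
  are finite by induction on the size.\<close>

lemma expdet_finite: "expdet bl \<delta> < \<infinity>"
proof (induction "length bl" arbitrary: bl \<delta>)
 case 0
 then show ?case by (simp add: expdet_Nil)
next
 case (Suc n)
 then have i: "0 < length bl" by linarith
 define X where "X j Z = blocknorm bl \<delta> 0 j Z" for j Z
 have fin: "ennreal (sqrt (2 / pi)) * (\<integral>\<^sup>+Z. ennreal (X j Z) \<partial>matG (length bl)) < \<infinity>" if "j \<in> set bl" for j
 proof -
  obtain c where c: "c < length bl" "bl ! c = j" using \<open>j \<in> set bl\<close> by (auto simp: in_set_conv_nth)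
  have "expdet (del c bl) (remove_row 0 \<delta>) < \<infinity>"
   using Suc.hyps(2) length_del[OF c(1)] by (intro Suc.hyps(1)) linarith
  then show ?thesis using blocknorm_mean'[OF i c(1), of \<delta>] blockmean_finite[of bl j] c(2)
   by (simp add: X_def ennreal_mult_less_top)
 qed
 have "expdet bl \<delta> \<le> ennreal (sqrt (2 / pi)) * (\<integral>\<^sup>+Z. (\<Sum>j\<in>set bl. ennreal (sqrt (real (\<delta> 0 j))) * ennreal (X j Z)) \<partial>matG (length bl))"
  unfolding expdet_expand[OF i]
 proof (intro mult_left_mono nn_integral_mono)
  fix Z
  have X0: "0 \<le> X j Z" for j by (simp add: X_def blocknorm_def sum_nonneg)
  have "sqrt (\<Sum>j\<in>set bl. (sqrt (real (\<delta> 0 j)) * X j Z)\<^sup>2) \<le> (\<Sum>j\<in>set bl. sqrt (real (\<delta> 0 j)) * X j Z)"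
   using X0 by (intro sqrt_sum_squares_le_sum) auto
  then show "ennreal (sqrt (\<Sum>j\<in>set bl. real (\<delta> 0 j) * (blocknorm bl \<delta> 0 j Z)\<^sup>2)) \<le> (\<Sum>j\<in>set bl. ennreal (sqrt (real (\<delta> 0 j))) * ennreal (X j Z))"
   using X0 by (simp add: X_def power_mult_distrib ennreal_mult[symmetric] ennreal_leI)
 qed simp
 also have "\<dots> = (\<Sum>j\<in>set bl. ennreal (sqrt (real (\<delta> 0 j))) * (ennreal (sqrt (2 / pi)) * (\<integral>\<^sup>+Z. ennreal (X j Z) \<partial>matG (length bl))))"
 proof -
  have m: "(\<lambda>Z. ennreal (X j Z)) \<in> borel_measurable (matG (length bl))" for j
   unfolding X_def by (intro measurable_compose[OF _ measurable_ennreal] blocknorm_measurable)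
  have "(\<integral>\<^sup>+Z. (\<Sum>j\<in>set bl. ennreal (sqrt (real (\<delta> 0 j))) * ennreal (X j Z)) \<partial>matG (length bl)) =
    (\<Sum>j\<in>set bl. \<integral>\<^sup>+Z. ennreal (sqrt (real (\<delta> 0 j))) * ennreal (X j Z) \<partial>matG (length bl))"
   by (rule nn_integral_sum) (intro borel_measurable_times_ennreal borel_measurable_const m)
  then show ?thesis unfolding nn_integral_cmult[OF m] by (simp add: sum_distrib_left mult.left_commute)
 qed
 also have "\<dots> < \<infinity>" using fin by (auto simp: ennreal_mult_less_top infinity_ennreal_def)
 finally show ?case .
qed

lemma expdet_lindeg_pos: "expdet bl (lindeg bl) > 0"
proof (induction "length bl" arbitrary: bl)
 case 0
 then show ?case by (simp add: expdet_Nil)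
next
 case (Suc n)
 then have i: "0 < length bl" by linarith
 have "expdet (del 0 bl) (lindeg (del 0 bl)) > 0" using Suc.hyps(2) length_del[OF i] by (intro Suc.hyps(1)) linarith
 then show ?case
  unfolding expdet_lindeg[OF i] using blockmean_pos[of "bl ! 0" bl] i by (simp add: ennreal_zero_less_mult_iff)
qed

text \<open>Division by the value at the reference degrees removes \<open>sqrt (2 / pi)\<close> and
  all factors \<open>blockmean\<close>; the quotient turns out to be the expected number of
  roots.\<close>

definition ndet :: "nat list => (nat => nat => nat) => real" where
 "ndet bl \<delta> = enn2real (expdet bl \<delta>) / enn2real (expdet bl (lindeg bl))"

lemma expdet_ndet: "expdet bl \<delta> = ennreal (ndet bl \<delta>) * expdet bl (lindeg bl)"
proof -
 have "ennreal (ndet bl \<delta>) * expdet bl (lindeg bl) = ennreal (ndet bl \<delta>) * ennreal (enn2real (expdet bl (lindeg bl)))"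
  using expdet_finite[of bl "lindeg bl"] by simp
 also have "\<dots> = ennreal (enn2real (expdet bl \<delta>))"
  using expdet_lindeg_pos[of bl] expdet_finite[of bl "lindeg bl"]
  by (subst ennreal_mult[symmetric]) (auto simp: ndet_def enn2real_eq_0_iff)
 finally show ?thesis using expdet_finite[of bl \<delta>] by simp
qed

lemma ndet_nonneg: "0 \<le> ndet bl \<delta>" by (simp add: ndet_def)

text \<open>Multiplication by \<open>s / e\<close> turns the mean of the norm of block
  \<open>j\<close> into \<open>f j\<close>, because the same factor \<open>blockmean\<close> occurs
  in \<open>expdet_lindeg\<close>. The inequalities for means then contain no Gaussian constants.
  Strictness rests on two contributing blocks whose norms are almost surely nonzero.\<close>

lemma ndet_row_bounds:
 fixes i :: nat and ix :: "nat => nat" and bl :: "nat list" and \<delta> :: "nat => nat => nat"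
 assumes i: "i < length bl" and ix: "\<And>j. j \<in> set bl \<Longrightarrow> ix j < length bl \<and> bl ! ix j = j"
 defines "f j \<equiv> ndet (del (ix j) bl) (remove_row i \<delta>)"
 defines "a j \<equiv> sqrt (real (\<delta> i j))"
 shows "ndet bl \<delta> \<le> (\<Sum>j\<in>set bl. a j * f j)" (is ?A)
  and "sqrt (\<Sum>j\<in>set bl. (a j * f j)\<^sup>2) \<le> ndet bl \<delta>" (is ?B)
  and "(\<And>j. j \<in> set bl \<Longrightarrow> a j * f j > 0 \<Longrightarrow> AE Z in matG (length bl). blocknorm bl \<delta> i j Z \<noteq> 0) \<Longrightarrow>
   j \<in> set bl \<Longrightarrow> j' \<in> set bl \<Longrightarrow> j \<noteq> j' \<Longrightarrow> a j * f j > 0 \<Longrightarrow> a j' * f j' > 0 \<Longrightarrow>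
   ndet bl \<delta> \<noteq> (\<Sum>j\<in>set bl. a j * f j) \<and> sqrt (\<Sum>j\<in>set bl. (a j * f j)\<^sup>2) \<noteq> ndet bl \<delta>" proof -
 define n where "n = length bl"
 interpret prob_space "matG n" by (rule prob_matG)
 define X where "X = blocknorm bl \<delta> i"
 have X0: "0 \<le> X j Z" for j Z by (simp add: X_def blocknorm_def sum_nonneg)
 have Xm: "X j \<in> borel_measurable (matG n)" for j unfolding X_def n_def by (rule blocknorm_measurable)
 define s where "s = sqrt (2 / pi)"
 have s: "s > 0" by (simp add: s_def)
 define e where "e = enn2real (expdet bl (lindeg bl))"
 have e: "e > 0" using expdet_lindeg_pos[of bl] expdet_finite[of bl "lindeg bl"] by (simp add: e_def enn2real_positive_iff)
 have mean: "ennreal s * (\<integral>\<^sup>+Z. ennreal (X j Z) \<partial>matG n) = ennreal (f j * e)" if j: "j \<in> set bl" for j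
 proof -
  define bm where "bm = enn2real (blockmean bl j)"
  define e' where "e' = enn2real (expdet (del (ix j) bl) (lindeg (del (ix j) bl)))"
  have bm: "blockmean bl j = ennreal bm" using blockmean_finite[of bl j] by (simp add: bm_def)
  have e': "expdet (del (ix j) bl) (lindeg (del (ix j) bl)) = ennreal e'" using expdet_finite by (simp add: e'_def)
  have bm0: "bm \<ge> 0" "e' \<ge> 0" by (auto simp: bm_def e'_def)
  have "expdet bl (lindeg bl) = ennreal (bm * e')"
   using expdet_lindeg[of "ix j" bl] ix[OF j] bm e' bm0 by (simp add: ennreal_mult)
  then have ee: "e = bm * e'" using bm0 by (simp add: e_def)
  have "ennreal s * (\<integral>\<^sup>+Z. ennreal (X j Z) \<partial>matG n) = blockmean bl j * expdet (del (ix j) bl) (remove_row i \<delta>)"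
   using blocknorm_mean'[OF i, of "ix j" \<delta>] ix[OF j] by (simp add: s_def X_def n_def)
  also have "\<dots> = ennreal bm * (ennreal (f j) * ennreal e')"
   unfolding bm e'[symmetric] f_def by (simp only: expdet_ndet[of "del (ix j) bl" "remove_row i \<delta>"])
  also have "\<dots> = ennreal (f j * e)"
   unfolding ee using bm0 ndet_nonneg by (simp add: f_def ennreal_mult[symmetric] mult_ac)
  finally show ?thesis .
 qed
 have intX: "integrable (matG n) (X j)" "s * expectation (X j) = f j * e" if j: "j \<in> set bl" for j
 proof -
  have "(\<integral>\<^sup>+Z. ennreal (X j Z) \<partial>matG n) < \<infinity>"
   using mean[OF j] s by (metis ennreal_less_top ennreal_mult_eq_top_iff infinity_ennreal_def less_top ennreal_eq_0_iff not_le)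
  then show I: "integrable (matG n) (X j)" using X0 Xm by (intro integrableI_nonneg) auto
  have "ennreal (s * expectation (X j)) = ennreal (f j * e)"
   using mean[OF j] nn_integral_eq_integral[OF I] X0 s by (simp add: ennreal_mult)
  then show "s * expectation (X j) = f j * e"
   using s e ndet_nonneg X0 by (subst (asm) ennreal_inj) (auto simp: f_def intro!: mult_nonneg_nonneg)
 qed
 have a0: "a j \<ge> 0" for j by (simp add: a_def)
 define S where "S = (\<lambda>Z. sqrt (\<Sum>j\<in>set bl. (a j * X j Z)\<^sup>2))"
 have B: "integrable (matG n) S" "expectation S \<le> (\<Sum>j\<in>set bl. a j * expectation (X j))"
  "sqrt (\<Sum>j\<in>set bl. (a j * expectation (X j))\<^sup>2) \<le> expectation S"
  unfolding S_def by (rule mean_sqrt_bounds; use intX(1) X0 a0 in simp)+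
 have B4: "AE w in matG n. (a j * X j w) * (a j' * X j' w) = 0"
  if "expectation S = (\<Sum>j\<in>set bl. a j * expectation (X j))" "j \<in> set bl" "j' \<in> set bl" "j \<noteq> j'" for j j'
  by (rule mean_sqrt_bounds(4)[OF finite_set _ _ _ that[unfolded S_def]]) (use intX(1) X0 a0 in simp_all)
 have B5: "AE w in matG n. expectation (X j') * X j w = expectation (X j) * X j' w"
  if "sqrt (\<Sum>j\<in>set bl. (a j * expectation (X j))\<^sup>2) = expectation S" "j \<in> set bl" "j' \<in> set bl"
   "a j * expectation (X j) > 0" "a j' * expectation (X j') > 0" for j j'
  by (rule mean_sqrt_bounds(5)[OF finite_set _ _ _ that[unfolded S_def]]) (use intX(1) X0 a0 in simp_all)
 have S: "s * expectation S = ndet bl \<delta> * e"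
 proof -
  have "(\<lambda>Z. sqrt (\<Sum>j\<in>set bl. real (\<delta> i j) * (blocknorm bl \<delta> i j Z)\<^sup>2)) = S"
   by (auto simp: S_def a_def X_def power_mult_distrib)
  then have "expdet bl \<delta> = ennreal s * (\<integral>\<^sup>+Z. ennreal (S Z) \<partial>matG n)"
   using expdet_expand[OF i, of \<delta>] by (simp add: s_def n_def fun_eq_iff)
  also have "\<dots> = ennreal (s * expectation S)"
   using B(1) s by (subst nn_integral_eq_integral) (auto simp: S_def sum_nonneg ennreal_mult)
  finally have "ennreal (s * expectation S) = ennreal (ndet bl \<delta> * e)"
   using expdet_ndet[of bl \<delta>] expdet_finite[of bl "lindeg bl"] e by (simp add: e_def ennreal_mult ndet_nonneg)
  moreover have "0 \<le> expectation S" by (intro Bochner_Integration.integral_nonneg) (simp add: S_def sum_nonneg)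
  ultimately show ?thesis using s e ndet_nonneg by (subst (asm) ennreal_inj) (auto intro!: mult_nonneg_nonneg)
 qed
 have fm: "f j = s / e * expectation (X j)" if "j \<in> set bl" for j using intX(2)[OF that] e by (simp add: field_simps)
 have nd: "ndet bl \<delta> = s / e * expectation S" using S e by (simp add: field_simps)
 have se: "s / e > 0" using s e by simp
 have sumf: "(\<Sum>j\<in>set bl. a j * f j) = s / e * (\<Sum>j\<in>set bl. a j * expectation (X j))"
  unfolding sum_distrib_left using fm by (intro sum.cong) auto
 have sqf: "sqrt (\<Sum>j\<in>set bl. (a j * f j)\<^sup>2) = s / e * sqrt (\<Sum>j\<in>set bl. (a j * expectation (X j))\<^sup>2)"
 proof -
  have "(\<Sum>j\<in>set bl. (a j * f j)\<^sup>2) = (s / e)\<^sup>2 * (\<Sum>j\<in>set bl. (a j * expectation (X j))\<^sup>2)"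
   unfolding sum_distrib_left using fm by (intro sum.cong refl) (simp add: power_mult_distrib power_divide)
  then show ?thesis using s e by (simp add: real_sqrt_mult)
 qed
 show ?A unfolding sumf nd using B(2) se by (intro mult_left_mono) auto
 show ?B unfolding sqf nd using B(3) se by (intro mult_left_mono) auto
 show "ndet bl \<delta> \<noteq> (\<Sum>j\<in>set bl. a j * f j) \<and> sqrt (\<Sum>j\<in>set bl. (a j * f j)\<^sup>2) \<noteq> ndet bl \<delta>"
  if ae: "\<And>j. j \<in> set bl \<Longrightarrow> a j * f j > 0 \<Longrightarrow> AE Z in matG (length bl). blocknorm bl \<delta> i j Z \<noteq> 0"
   and jj: "j \<in> set bl" "j' \<in> set bl" "j \<noteq> j'" and pos: "a j * f j > 0" "a j' * f j' > 0"
 proof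
  have apos: "a j > 0" "a j' > 0" using pos a0[of j] a0[of j'] by (auto simp: less_le)
  note nz = ae[OF jj(1) pos(1)] ae[OF jj(2) pos(2)]
  show "ndet bl \<delta> \<noteq> (\<Sum>j\<in>set bl. a j * f j)"
  proof
   assume "ndet bl \<delta> = (\<Sum>j\<in>set bl. a j * f j)"
   then have "expectation S = (\<Sum>j\<in>set bl. a j * expectation (X j))" using s e unfolding nd sumf by simp
   from B4[OF this jj] have "AE Z in matG n. (a j * X j Z) * (a j' * X j' Z) = 0" .
   then have "AE Z in matG n. False"
    using nz[folded n_def] by eventually_elim (use apos in \<open>simp add: X_def\<close>)
   then show False by simp
  qed
  show "sqrt (\<Sum>j\<in>set bl. (a j * f j)\<^sup>2) \<noteq> ndet bl \<delta>"
  proof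
   assume "sqrt (\<Sum>j\<in>set bl. (a j * f j)\<^sup>2) = ndet bl \<delta>"
   then have eq: "sqrt (\<Sum>j\<in>set bl. (a j * expectation (X j))\<^sup>2) = expectation S" using s e unfolding nd sqf by simp
   have "f j > 0" "f j' > 0" using pos apos by (auto simp: zero_less_mult_iff)
   then have mp: "expectation (X j) > 0" "expectation (X j') > 0"
    using fm[OF jj(1)] fm[OF jj(2)] s e by (simp_all add: zero_less_mult_iff zero_less_divide_iff)
   have "AE Z in matG n. expectation (X j') * X j Z = expectation (X j) * X j' Z"
    using apos mp by (intro B5[OF eq jj(1,2)]) auto
   then show False
    using blocknorm_proportional[OF i jj(3) nz(1), folded n_def X_def, of "expectation (X j')" "expectation (X j)"] mp by auto
  qed
 qed
qed

text \<open>A positive permanent of the minor provides a transversal of positive degrees. Extended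
  by \<open>\<sigma> i = c\<close> it is a permutation to which \<open>AE_gam_nonzero\<close>
  applies.\<close>

lemma AE_blocknorm_nonzero:
 assumes b: "blk k nv bl" and i: "i < length bl" and c: "c < length bl"
  and pos: "nper k nv' (del c bl) (\<lambda>r j. real (remove_row i \<delta> r j)) > 0"
 shows "AE Z in matG (length bl). blocknorm bl \<delta> i (bl ! c) Z \<noteq> 0"
proof -
 obtain n where n: "length bl = Suc n" using i by (cases "length bl") auto
 have ld: "length (del c bl) = n" using length_del[OF c] n by simp
 have "per n (\<lambda>r d. real (remove_row i \<delta> r (del c bl ! d))) > 0" using pos unfolding nper_pos_iff ld .
 then obtain p where p: "p permutes {..<n}" "\<And>r. r < n \<Longrightarrow> real (remove_row i \<delta> r (del c bl ! p r)) > 0"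
  by (subst (asm) per_pos_iff) auto
 define \<sigma> where "\<sigma> = permutation_insert i c p"
 have p0: "p permutes {0..<n}" using p(1) by (simp add: atLeast0LessThan)
 have "\<sigma> permutes {..<Suc n}"
  using permutation_insert_permutes[OF p0, of i c] i c n by (simp add: \<sigma>_def atLeast0LessThan)
 then have \<sigma>: "\<sigma> permutes {..<length bl}" by (simp add: n)
 have \<sigma>i: "\<sigma> i = c" by (simp add: \<sigma>_def)
 have "\<delta> r (bl ! \<sigma> r) > 0" if r: "r < length bl" "r \<noteq> i" for r
 proof -
  have "r \<in> insert_index i ` {0..<n}" using insert_index_image[of i n] r i n by auto
  then obtain r' where r': "r' < n" "r = insert_index i r'" by auto
  have "p r' < n" using permutes_in_image[OF p(1), of r'] r'(1) by simp
  then have "bl ! \<sigma> r = del c bl ! p r'"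
   using permutation_insert_insert_index[OF p0 r'(1), of i c] nth_del[OF c, of "p r'"] n by (simp add: \<sigma>_def r'(2))
  then show ?thesis using p(2)[OF r'(1)] by (simp add: remove_row_insert_index r'(2))
 qed
 then have "AE Z in matG (length bl). gam bl \<delta> i c Z \<noteq> 0" by (intro AE_gam_nonzero[OF i \<sigma> \<sigma>i]) auto
 then show ?thesis
 proof eventually_elim
  case (elim Z)
  then have "0 < (gam bl \<delta> i c Z)\<^sup>2" by simp
  also have "\<dots> \<le> (\<Sum>c\<in>blockset bl (bl ! c). (gam bl \<delta> i c Z)\<^sup>2)"
   using c by (intro member_le_sum) (auto simp: blockset_def)
  finally show ?case by (simp add: blocknorm_def)
 qed
qed

lemma nper_pos_sqrt:
 "nper k nv bl (\<lambda>i j. sqrt (real (\<delta> i j))) > 0 \<longleftrightarrow> nper k nv bl (\<lambda>i j. real (\<delta> i j)) > 0"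
 unfolding nper_pos_iff by (subst (1 2) per_pos_iff) auto

lemma simply_reducible_iff:
 "simply_reducible k nv \<delta> \<longleftrightarrow> (\<exists>i<total_dim k nv.
   (\<forall>j j'. reduction_index k nv \<delta> i j \<longrightarrow> reduction_index k nv \<delta> i j' \<longrightarrow> j = j') \<and>
   (\<forall>j. total_dim k nv > 1 \<longrightarrow> reduction_index k nv \<delta> i j \<longrightarrow> simply_reducible k (decrement j nv) (remove_row i \<delta>)))"
proof
 assume "simply_reducible k nv \<delta>"
 then show "\<exists>i<total_dim k nv. (\<forall>j j'. reduction_index k nv \<delta> i j \<longrightarrow> reduction_index k nv \<delta> i j' \<longrightarrow> j = j') \<and>
   (\<forall>j. total_dim k nv > 1 \<longrightarrow> reduction_index k nv \<delta> i j \<longrightarrow> simply_reducible k (decrement j nv) (remove_row i \<delta>))"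
  by cases metis
qed (elim exE conjE, rule simply_reducible.intros, assumption, blast, blast)

text \<open>Induction on the number of columns by expansion along a row, in which the permanent of
  roots, \<open>ndet\<close> and the permanent obey comparable relations. The lower bound is stated
  in squares to match the recursion of the permanent. Dimension 0 is a separate alternative because
  \<open>simply_reducible\<close> demands a row, whereas the bounds are equalities there. The
  hypothesis \<open>bkk\<close> translates \<open>reduction_index\<close> into permanents.\<close>

lemma ndet_bounds:
 assumes bkk: "\<And>nv \<delta> bl. blk k nv bl \<Longrightarrow> BKK k nv \<delta> = nper k nv bl (\<lambda>i j. real (\<delta> i j))"
  and "blk k nv bl"
 shows "ndet bl \<delta> \<le> nper k nv bl (\<lambda>i j. sqrt (real (\<delta> i j))) \<and>
  nper k nv bl (\<lambda>i j. real (\<delta> i j)) \<le> (ndet bl \<delta>)\<^sup>2 \<and>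
  (ndet bl \<delta> = nper k nv bl (\<lambda>i j. sqrt (real (\<delta> i j))) \<longleftrightarrow> total_dim k nv = 0 \<or> simply_reducible k nv \<delta>) \<and>
  (nper k nv bl (\<lambda>i j. real (\<delta> i j)) = (ndet bl \<delta>)\<^sup>2 \<longleftrightarrow> total_dim k nv = 0 \<or> simply_reducible k nv \<delta>)"
 using assms(2)
proof (induction "length bl" arbitrary: bl nv \<delta>)
 case 0
 then have bl: "bl = []" by simp
 have "nv j = 0" if "j < k" for j using 0(2) that bl by (auto simp: blk_def)
 then have "total_dim k nv = 0" "(\<Prod>j<k. fact (nv j)) = (1::real)" by (auto simp: total_dim_def)
 moreover have "ndet [] \<delta> = 1" by (simp add: ndet_def expdet_Nil)
 ultimately show ?case by (simp add: bl nper_def per_def)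
next
 case (Suc n)
 define N where "N = length bl"
 have N: "N = Suc n" using Suc.hyps(2) by (simp add: N_def)
 have dim: "total_dim k nv = N" using blk_length[OF Suc.prems] by (simp add: N_def)
 define P where "P = nper k nv bl (\<lambda>i j. sqrt (real (\<delta> i j)))"
 define B where "B = nper k nv bl (\<lambda>i j. real (\<delta> i j))"
 define R where "R i \<longleftrightarrow> (\<forall>j j'. reduction_index k nv \<delta> i j \<longrightarrow> reduction_index k nv \<delta> i j' \<longrightarrow> j = j') \<and>
   (\<forall>j. reduction_index k nv \<delta> i j \<longrightarrow> total_dim k (decrement j nv) = 0 \<or> simply_reducible k (decrement j nv) (remove_row i \<delta>))" for i
 define ix where "ix j = (SOME c. c < length bl \<and> bl ! c = j)" for j
 have ix: "ix j < length bl \<and> bl ! ix j = j" if "j \<in> set bl" for j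
  unfolding ix_def by (rule someI_ex) (use that in \<open>auto simp: in_set_conv_nth\<close>)
 have blkd: "blk k (decrement j nv) (del (ix j) bl)" if "j \<in> set bl" for j
  using blk_del[OF Suc.prems, of "ix j"] ix[OF that] by simp
 have dimd: "total_dim k (decrement j nv) = n" if "j \<in> set bl" for j
  using blk_length[OF blkd[OF that]] ix[OF that] length_del[of "ix j" bl] N by (simp add: N_def)
 \<comment> \<open>This holds for every row \<open>i\<close>, so each \<open>R i\<close> is
   equivalent to equality and all of them to one another. It is therefore immaterial that simple
   reducibility asks for one suitable row only.\<close>
 have step: "ndet bl \<delta> \<le> P \<and> B \<le> (ndet bl \<delta>)\<^sup>2 \<and> (ndet bl \<delta> = P \<longleftrightarrow> R i) \<and> (B = (ndet bl \<delta>)\<^sup>2 \<longleftrightarrow> R i)"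
  if i: "i < length bl" for i
 proof -
  define f where "f j = ndet (del (ix j) bl) (remove_row i \<delta>)" for j
  define p where "p j = nper k (decrement j nv) (del (ix j) bl) (\<lambda>r l. sqrt (real (remove_row i \<delta> r l)))" for j
  define b where "b j = nper k (decrement j nv) (del (ix j) bl) (\<lambda>r l. real (remove_row i \<delta> r l))" for j
  define a where "a j = sqrt (real (\<delta> i j))" for j
  define Q where "Q j \<longleftrightarrow> total_dim k (decrement j nv) = 0 \<or> simply_reducible k (decrement j nv) (remove_row i \<delta>)" for j
  have rr: "remove_row i \<delta> = (\<lambda>r. \<delta> (insert_index i r))" by (rule ext) (simp add: remove_row_insert_index)
  have IH: "f j \<le> p j" "b j \<le> (f j)\<^sup>2" "f j = p j \<longleftrightarrow> Q j" "b j = (f j)\<^sup>2 \<longleftrightarrow> Q j" if "j \<in> set bl" for j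
  proof -
   have "n = length (del (ix j) bl)" using blk_length[OF blkd[OF that]] dimd[OF that] by simp
   from Suc.hyps(1)[OF this blkd[OF that], of "remove_row i \<delta>"]
   show "f j \<le> p j" "b j \<le> (f j)\<^sup>2" "f j = p j \<longleftrightarrow> Q j" "b j = (f j)\<^sup>2 \<longleftrightarrow> Q j"
    unfolding f_def p_def b_def Q_def by argo+
  qed
  have f0: "f j \<ge> 0" for j by (simp add: f_def ndet_nonneg)
  have b0: "b j \<ge> 0" for j by (simp add: b_def nper_nonneg)
  have a0: "a j \<ge> 0" "(a j)\<^sup>2 = real (\<delta> i j)" for j by (auto simp: a_def)
  \<comment> \<open>The link between BKK numbers and mean determinants of the reduced systems. In
    the converse direction the permanent of roots mediates: it bounds \<open>f j\<close> and is
    positive together with \<open>b j\<close>.\<close>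
  have bpos: "b j > 0 \<longleftrightarrow> f j > 0" if j: "j \<in> set bl" for j
  proof
   assume "b j > 0"
   then have "f j \<noteq> 0" using IH(2)[OF j] by auto
   then show "f j > 0" using f0[of j] by linarith
  next
   assume "f j > 0"
   then have "p j > 0" using IH(1)[OF j] by linarith
   then show "b j > 0" unfolding p_def b_def nper_pos_sqrt .
  qed
  have P: "P = (\<Sum>j\<in>set bl. a j * p j)"
   using nper_expand[OF Suc.prems i ix, of "\<lambda>i j. sqrt (real (\<delta> i j))"] by (simp add: P_def a_def p_def rr)
  have B: "B = (\<Sum>j\<in>set bl. real (\<delta> i j) * b j)"
   using nper_expand[OF Suc.prems i ix, of "\<lambda>i j. real (\<delta> i j)"] by (simp add: B_def b_def rr)
  have red: "reduction_index k nv \<delta> i j \<longleftrightarrow> j \<in> set bl \<and> a j * f j > 0" for j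
  proof (cases "j \<in> set bl")
   case True
   then show ?thesis
    using blk_mem[OF Suc.prems, of j] bkk[OF blkd[OF True], of "remove_row i \<delta>"] bpos[OF True] f0[of j]
    by (auto simp: reduction_index_def b_def[symmetric] a_def zero_less_mult_iff)
  next
   case False
   then show ?thesis using blk_mem[OF Suc.prems, of j] by (auto simp: reduction_index_def)
  qed
  note rb = ndet_row_bounds[OF i ix, of \<delta>, folded f_def a_def]
  have ub: "ndet bl \<delta> \<le> (\<Sum>j\<in>set bl. a j * f j)" by (rule rb(1))
  have lb: "sqrt (\<Sum>j\<in>set bl. (a j * f j)\<^sup>2) \<le> ndet bl \<delta>" by (rule rb(2))
  have lb2: "(\<Sum>j\<in>set bl. (a j * f j)\<^sup>2) \<le> (ndet bl \<delta>)\<^sup>2" using lb by (rule sqrt_le_D)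
  have fp: "a j * f j \<le> a j * p j" if "j \<in> set bl" for j using IH(1)[OF that] a0(1) by (intro mult_left_mono)
  have bf: "real (\<delta> i j) * b j \<le> (a j * f j)\<^sup>2" if "j \<in> set bl" for j
   unfolding power_mult_distrib a0(2) using IH(2)[OF that] by (intro mult_left_mono) auto
  have fpS: "(\<Sum>j\<in>set bl. a j * f j) \<le> P" unfolding P by (intro sum_mono fp)
  have bfS: "B \<le> (\<Sum>j\<in>set bl. (a j * f j)\<^sup>2)" unfolding B by (intro sum_mono bf)
  \<comment> \<open>Positivity of \<open>f l\<close> passes through \<open>b l\<close> to a positive
    permanent of a minor, which makes the block norm almost surely nonzero as the strictness
    criterion requires.\<close>
  have strict: "ndet bl \<delta> \<noteq> (\<Sum>j\<in>set bl. a j * f j) \<and> sqrt (\<Sum>j\<in>set bl. (a j * f j)\<^sup>2) \<noteq> ndet bl \<delta>"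
   if "j \<in> set bl" "j' \<in> set bl" "j \<noteq> j'" "a j * f j > 0" "a j' * f j' > 0" for j j'
  proof (rule rb(3)[OF _ _ that])
   show "AE Z in matG (length bl). blocknorm bl \<delta> i l Z \<noteq> 0" if l: "l \<in> set bl" "a l * f l > 0" for l
   proof -
    have "f l > 0" using l(2) f0[of l] a0(1)[of l] by (simp add: zero_less_mult_iff)
    then have "b l > 0" using bpos[OF l(1)] by simp
    then show ?thesis
     using AE_blocknorm_nonzero[OF Suc.prems i, of "ix l"] ix[OF l(1)] by (simp add: b_def)
   qed
  qed simp_all
  \<comment> \<open>With at most one positive term the Euclidean norm and the sum agree, and
    \<open>ndet\<close> is squeezed between them.\<close>
  have single: "ndet bl \<delta> = (\<Sum>j\<in>set bl. a j * f j)" "(\<Sum>j\<in>set bl. (a j * f j)\<^sup>2) = (ndet bl \<delta>)\<^sup>2"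
   if uniq: "\<And>j j'. reduction_index k nv \<delta> i j \<Longrightarrow> reduction_index k nv \<delta> i j' \<Longrightarrow> j = j'"
  proof -
   have "sqrt (\<Sum>j\<in>set bl. (a j * f j)\<^sup>2) = (\<Sum>j\<in>set bl. a j * f j)"
   proof (cases "\<exists>j. reduction_index k nv \<delta> i j")
    case True
    then obtain j where j: "reduction_index k nv \<delta> i j" by blast
    then have js: "j \<in> set bl" "a j * f j > 0" using red by auto
    have "a l * f l = 0" if "l \<in> set bl - {j}" for l
    proof -
     have "\<not> a l * f l > 0" using that uniq[OF j, of l] red by blast
     moreover have "0 \<le> a l * f l" using a0(1) f0 by simp
     ultimately show ?thesis by linarith
    qed
    then have "(\<Sum>j\<in>set bl - {j}. a j * f j) = 0" "(\<Sum>j\<in>set bl - {j}. (a j * f j)\<^sup>2) = 0"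
     by (intro sum.neutral ballI, simp only: zero_power2)+
    then have "(\<Sum>j\<in>set bl. a j * f j) = a j * f j" "(\<Sum>j\<in>set bl. (a j * f j)\<^sup>2) = (a j * f j)\<^sup>2"
     using js(1) by (simp_all add: sum.remove[of "set bl" j])
    then show ?thesis using js(2) by (simp only: real_sqrt_abs abs_of_pos)
   next
    case False
    have "a l * f l = 0" if "l \<in> set bl" for l
    proof -
     have "\<not> a l * f l > 0" using that False red by blast
     moreover have "0 \<le> a l * f l" using a0(1) f0 by simp
     ultimately show ?thesis by linarith
    qed
    then have "(\<Sum>j\<in>set bl. a j * f j) = 0" "(\<Sum>j\<in>set bl. (a j * f j)\<^sup>2) = 0"
     by (intro sum.neutral ballI, simp only: zero_power2)+
    then show ?thesis by simp
   qed
   then have e: "ndet bl \<delta> = sqrt (\<Sum>j\<in>set bl. (a j * f j)\<^sup>2)" "ndet bl \<delta> = (\<Sum>j\<in>set bl. a j * f j)"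
    using ub lb by linarith+
   show "ndet bl \<delta> = (\<Sum>j\<in>set bl. a j * f j)" by (rule e(2))
   show "(\<Sum>j\<in>set bl. (a j * f j)\<^sup>2) = (ndet bl \<delta>)\<^sup>2" unfolding e(1) by (simp add: sum_nonneg)
  qed
  have RQ: "R i \<longleftrightarrow> (\<forall>j j'. reduction_index k nv \<delta> i j \<longrightarrow> reduction_index k nv \<delta> i j' \<longrightarrow> j = j') \<and>
    (\<forall>j. reduction_index k nv \<delta> i j \<longrightarrow> Q j)" by (simp add: R_def Q_def)
  have zero: "a j * p j = a j * f j" "real (\<delta> i j) * b j = (a j * f j)\<^sup>2"
   if j: "j \<in> set bl" and Qj: "reduction_index k nv \<delta> i j \<Longrightarrow> Q j" for j
  proof -
   have "a j * p j = a j * f j \<and> real (\<delta> i j) * b j = (a j * f j)\<^sup>2"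
   proof (cases "a j * f j > 0")
    case True
    then have "Q j" using Qj red j by blast
    then show ?thesis using IH(3,4)[OF j] by (simp add: power_mult_distrib a0(2))
   next
    case False
    then have "a j = 0 \<or> f j = 0" using a0(1)[of j] f0[of j] by (auto simp: zero_less_mult_iff)
    then show ?thesis
    proof
     assume "a j = 0" then show ?thesis by (simp add: a_def)
    next
     assume f: "f j = 0"
     then have "\<not> b j > 0" using bpos[OF j] by simp
     then have "\<not> p j > 0" unfolding p_def b_def nper_pos_sqrt .
     then have "p j = 0" using IH(1)[OF j] f by linarith
     moreover have "b j = 0" using \<open>\<not> b j > 0\<close> b0[of j] by linarith
     ultimately show ?thesis using f by simp
    qed
   qed
   then show "a j * p j = a j * f j" "real (\<delta> i j) * b j = (a j * f j)\<^sup>2" by auto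
  qed
  have "ndet bl \<delta> = P \<longleftrightarrow> R i"
  proof
   assume eq: "ndet bl \<delta> = P"
   then have e: "ndet bl \<delta> = (\<Sum>j\<in>set bl. a j * f j)" "(\<Sum>j\<in>set bl. a j * p j) = (\<Sum>j\<in>set bl. a j * f j)"
    using ub fpS P by linarith+
   have "Q j" if "reduction_index k nv \<delta> i j" for j
   proof -
    have j: "j \<in> set bl" "a j * f j > 0" using that red by auto
    have "a j * f j = a j * p j" using sum_mono_inv[OF e(2)[symmetric] fp j(1)] by simp
    then show ?thesis using j(2) IH(3)[OF j(1)] by auto
   qed
   moreover have "j = j'" if "reduction_index k nv \<delta> i j" "reduction_index k nv \<delta> i j'" for j j'
    using strict[of j j'] that red e(1) by blast
   ultimately show "R i" unfolding RQ by blast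
  next
   assume "R i"
   then show "ndet bl \<delta> = P" using single(1) zero(1) unfolding RQ P by (metis (no_types, lifting) sum.cong)
  qed
  moreover have "B = (ndet bl \<delta>)\<^sup>2 \<longleftrightarrow> R i"
  proof
   assume eq: "B = (ndet bl \<delta>)\<^sup>2"
   then have e: "(\<Sum>j\<in>set bl. (a j * f j)\<^sup>2) = (ndet bl \<delta>)\<^sup>2" "(\<Sum>j\<in>set bl. real (\<delta> i j) * b j) = (\<Sum>j\<in>set bl. (a j * f j)\<^sup>2)"
    using lb2 bfS B by linarith+
   have e1: "sqrt (\<Sum>j\<in>set bl. (a j * f j)\<^sup>2) = ndet bl \<delta>" unfolding e(1) using ndet_nonneg[of bl \<delta>] by simp
   have "Q j" if "reduction_index k nv \<delta> i j" for j
   proof -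
    have j: "j \<in> set bl" "a j * f j > 0" using that red by auto
    have "real (\<delta> i j) * b j = (a j * f j)\<^sup>2" using sum_mono_inv[OF e(2) bf j(1)] by simp
    then have "b j = (f j)\<^sup>2" using j(2) by (auto simp: power_mult_distrib a0(2)[symmetric])
    then show ?thesis using IH(4)[OF j(1)] by simp
   qed
   moreover have "j = j'" if "reduction_index k nv \<delta> i j" "reduction_index k nv \<delta> i j'" for j j'
    using strict[of j j'] that red e1 by blast
   ultimately show "R i" unfolding RQ by blast
  next
   assume "R i"
   then show "B = (ndet bl \<delta>)\<^sup>2" using single(2) zero(2) unfolding RQ B by (metis (no_types, lifting) sum.cong)
  qed
  ultimately show ?thesis using ub fpS lb2 bfS by linarith
 qed
 \<comment> \<open>The guard \<open>total_dim k nv > 1\<close> of the recursive clause appears in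
   \<open>R\<close> as the alternative that the reduced dimension is 0.\<close>
 have "simply_reducible k nv \<delta> \<longleftrightarrow> (\<exists>i<length bl. R i)"
 proof -
  have "R i \<longleftrightarrow> (\<forall>j j'. reduction_index k nv \<delta> i j \<longrightarrow> reduction_index k nv \<delta> i j' \<longrightarrow> j = j') \<and>
   (\<forall>j. total_dim k nv > 1 \<longrightarrow> reduction_index k nv \<delta> i j \<longrightarrow> simply_reducible k (decrement j nv) (remove_row i \<delta>))" for i
  proof -
   have "total_dim k (decrement j nv) = n" if "reduction_index k nv \<delta> i j" for j
    using dimd[of j] that blk_mem[OF Suc.prems, of j] by (auto simp: reduction_index_def)
   then show ?thesis unfolding R_def dim N by auto
  qed
  then show ?thesis by (subst simply_reducible_iff) (simp add: dim N_def)
 qed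
 moreover have "0 < length bl" using N by (simp add: N_def)
 ultimately show ?case using step unfolding P_def[symmetric] B_def[symmetric] dim using N by blast
qed

section \<open>The mixed volume of products of simplices\<close>

text \<open>Products of simplices with real sizes \<open>t j\<close>, over an arbitrary coordinate
  set, so that the volume can be computed by adding one coordinate at a time.\<close>

definition scaled_corner :: "(nat \<times> nat) set => nat => (nat => real) => (nat \<times> nat => real) set" where
 "scaled_corner I k t = {z \<in> fvec I. (\<forall>c\<in>I. 0 \<le> z c) \<and> (\<forall>j<k. (\<Sum>c | c \<in> I \<and> fst c = j. z c) \<le> t j)}"

lemma nn_integral_power_simplex:
 fixes t :: real
 assumes "0 \<le> t"
 shows "(\<integral>\<^sup>+u. ennreal ((t - u) ^ m / fact m) * indicator {0..t} u \<partial>lborel) = ennreal (t ^ Suc m / fact (Suc m))"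
proof -
 have "(\<integral>\<^sup>+u. ennreal ((t - u) ^ m / fact m) * indicator {0..t} u \<partial>lborel) =
   ennreal (- ((t - t) ^ Suc m / fact (Suc m)) - - ((t - 0) ^ Suc m / fact (Suc m)))"
 proof (rule nn_integral_FTC_Icc)
  fix u :: real
  have "((\<lambda>u. - ((t - u) ^ Suc m / fact (Suc m))) has_real_derivative - (real (Suc m) * (t - u) ^ m * (-1) / fact (Suc m))) (at u)"
   by (auto intro!: derivative_eq_intros simp del: power_Suc fact_Suc)
  also have "- (real (Suc m) * (t - u) ^ m * (-1) / fact (Suc m)) = (t - u) ^ m / fact m"
   by (simp add: field_simps del: of_nat_Suc)
  finally show "((\<lambda>u. - ((t - u) ^ Suc m / fact (Suc m))) has_real_derivative (t - u) ^ m / fact m) (at u)" .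
 qed (use assms in auto)
 then show ?thesis by simp
qed

text \<open>Fixing the new coordinate at \<open>u\<close> leaves a body of the same kind in which
  the size of its block is reduced by \<open>u\<close>; integration over \<open>u\<close> raises the
  exponent of that block by one.\<close>

lemma emeasure_scaled_corner:
 assumes "finite I" "fst ` I \<subseteq> {..<k}" "\<And>j. j < k \<Longrightarrow> 0 \<le> t j"
 shows "scaled_corner I k t \<in> sets (lebR I)"
  "emeasure (lebR I) (scaled_corner I k t) = ennreal (\<Prod>j<k. t j ^ card {c \<in> I. fst c = j} / fact (card {c \<in> I. fst c = j}))"
proof -
 have S: "scaled_corner I k t \<in> sets (lebR I)" if "finite I" "fst ` I \<subseteq> {..<k}" for I t
 proof -
  have "scaled_corner I k t = {z \<in> space (lebR I). (\<forall>c\<in>I. 0 \<le> z c) \<and> (\<forall>j\<in>{..<k}. (\<Sum>c | c \<in> I \<and> fst c = j. z c) \<le> t j)}"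
   by (auto simp: scaled_corner_def space_PiM)
  also have "\<dots> \<in> sets (lebR I)" using that(1)
   by (intro sets.sets_Collect_conj sets.sets_Collect_finite_All borel_measurable_le borel_measurable_sum borel_measurable_const)
    (auto intro!: measurable_component_comp[where M = "\<lambda>_. lborel"] simp: id_def)
  finally show ?thesis .
 qed
 show "scaled_corner I k t \<in> sets (lebR I)" by (rule S[OF assms(1,2)])
 show "emeasure (lebR I) (scaled_corner I k t) = ennreal (\<Prod>j<k. t j ^ card {c \<in> I. fst c = j} / fact (card {c \<in> I. fst c = j}))"
  using assms
 proof (induction I arbitrary: t rule: finite_induct)
  case empty
  then show ?case by (simp add: scaled_corner_def PiM_empty)
 next
  case (insert c0 I)
  define j0 where "j0 = fst c0"
  have j0: "j0 < k" using insert.prems(1) by (simp add: j0_def)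
  define m where "m j = card {c \<in> I. fst c = j}" for j
  define C where "C = (\<Prod>j\<in>{..<k} - {j0}. t j ^ m j / fact (m j))"
  have C0: "C \<ge> 0" unfolding C_def using insert.prems(2) by (intro prod_nonneg) auto
  have upd: "fun_upd z c0 u \<in> scaled_corner (insert c0 I) k t \<longleftrightarrow> u \<in> {0..t j0} \<and> z \<in> scaled_corner I k (fun_upd t j0 (t j0 - u))"
   if z: "z \<in> fvec I" for z u
  proof -
   have s0: "(\<Sum>c | c \<in> insert c0 I \<and> fst c = j. fun_upd z c0 u c) = (\<Sum>c | c \<in> I \<and> fst c = j. z c) + (if j = j0 then u else 0)" for j
   proof -
    have e: "(\<Sum>c | c \<in> I \<and> fst c = j. fun_upd z c0 u c) = (\<Sum>c | c \<in> I \<and> fst c = j. z c)"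
     using insert.hyps by (intro sum.cong) auto
    show ?thesis
    proof (cases "j = j0")
     case True
     then have "{c. c \<in> insert c0 I \<and> fst c = j} = insert c0 {c. c \<in> I \<and> fst c = j}" by (auto simp: j0_def)
     then show ?thesis using e insert.hyps True by simp
    next
     case False
     then have "{c. c \<in> insert c0 I \<and> fst c = j} = {c. c \<in> I \<and> fst c = j}" by (auto simp: j0_def)
     then show ?thesis using e False by simp
    qed
   qed
   have ext: "fun_upd z c0 u \<in> fvec (insert c0 I)" using z by (auto simp: PiE_def extensional_def)
   have c: "(\<forall>c\<in>insert c0 I. 0 \<le> fun_upd z c0 u c) \<longleftrightarrow> 0 \<le> u \<and> (\<forall>c\<in>I. 0 \<le> z c)" using insert.hyps by auto
   have nn: "0 \<le> (\<Sum>c | c \<in> I \<and> fst c = j. z c)" if "\<forall>c\<in>I. 0 \<le> z c" for j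
    using that by (intro sum_nonneg) auto
   have "(\<forall>j<k. (\<Sum>c | c \<in> I \<and> fst c = j. z c) + (if j = j0 then u else 0) \<le> t j) \<longleftrightarrow>
    (\<forall>j<k. (\<Sum>c | c \<in> I \<and> fst c = j. z c) \<le> fun_upd t j0 (t j0 - u) j)" by (intro all_cong) auto
   moreover have "u \<le> t j0" if "\<forall>c\<in>I. 0 \<le> z c" "\<forall>j<k. (\<Sum>c | c \<in> I \<and> fst c = j. z c) \<le> fun_upd t j0 (t j0 - u) j"
    using nn[OF that(1), of j0] that(2)[rule_format, OF j0] by simp
   ultimately show ?thesis using ext z unfolding scaled_corner_def mem_Collect_eq s0 c atLeastAtMost_iff by blast
  qed
  have "emeasure (lebR (insert c0 I)) (scaled_corner (insert c0 I) k t) =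
    (\<integral>\<^sup>+z. indicator (scaled_corner (insert c0 I) k t) z \<partial>lebR (insert c0 I))"
   using S[of "insert c0 I" t] insert by simp
  also have "\<dots> = (\<integral>\<^sup>+u. \<integral>\<^sup>+z. indicator (scaled_corner (insert c0 I) k t) (fun_upd z c0 u) \<partial>lebR I \<partial>lborel)"
   using insert S[of "insert c0 I" t] by (intro plb.product_nn_integral_insert_rev) auto
  also have "\<dots> = (\<integral>\<^sup>+u. ennreal ((t j0 - u) ^ m j0 / fact (m j0)) * indicator {0..t j0} u * ennreal C \<partial>lborel)"
  proof (rule nn_integral_cong)
   fix u :: real
   show "(\<integral>\<^sup>+z. indicator (scaled_corner (insert c0 I) k t) (fun_upd z c0 u) \<partial>lebR I) =
    ennreal ((t j0 - u) ^ m j0 / fact (m j0)) * indicator {0..t j0} u * ennreal C"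
   proof (cases "u \<in> {0..t j0}")
    case True
    have "(\<integral>\<^sup>+z. indicator (scaled_corner (insert c0 I) k t) (fun_upd z c0 u) \<partial>lebR I) =
      (\<integral>\<^sup>+z. indicator (scaled_corner I k (fun_upd t j0 (t j0 - u))) z \<partial>lebR I)"
     using upd True by (intro nn_integral_cong) (auto simp: indicator_def space_PiM)
    also have "\<dots> = emeasure (lebR I) (scaled_corner I k (fun_upd t j0 (t j0 - u)))"
     using S[of I] insert by simp
    also have "\<dots> = ennreal (\<Prod>j<k. fun_upd t j0 (t j0 - u) j ^ m j / fact (m j))"
     unfolding m_def using insert.prems True by (intro insert.IH) auto
    also have "(\<Prod>j<k. fun_upd t j0 (t j0 - u) j ^ m j / fact (m j)) = (t j0 - u) ^ m j0 / fact (m j0) * C"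
     unfolding C_def using j0 by (subst prod.remove[of _ j0]) auto
    also have "ennreal \<dots> = ennreal ((t j0 - u) ^ m j0 / fact (m j0)) * ennreal C"
     using True C0 by (intro ennreal_mult) auto
    finally show ?thesis unfolding indicator_simps(1)[OF True] mult_1_right .
   next
    case False
    then have "(\<integral>\<^sup>+z. indicator (scaled_corner (insert c0 I) k t) (fun_upd z c0 u) \<partial>lebR I) = (\<integral>\<^sup>+z. 0 \<partial>lebR I)"
     using upd by (intro nn_integral_cong) (auto simp: indicator_def space_PiM)
    then show ?thesis using False by simp
   qed
  qed
  also have "\<dots> = ennreal (t j0 ^ Suc (m j0) / fact (Suc (m j0))) * ennreal C"
   using nn_integral_power_simplex[of "t j0" "m j0"] insert.prems(2)[OF j0] by (subst nn_integral_multc) auto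
  also have "\<dots> = ennreal (t j0 ^ Suc (m j0) / fact (Suc (m j0)) * C)"
   using insert.prems(2)[OF j0] C0 by (intro ennreal_mult[symmetric]) auto
  also have "t j0 ^ Suc (m j0) / fact (Suc (m j0)) * C = (\<Prod>j<k. t j ^ card {c \<in> insert c0 I. fst c = j} / fact (card {c \<in> insert c0 I. fst c = j}))"
  proof -
   have "{c \<in> insert c0 I. fst c = j0} = insert c0 {c \<in> I. fst c = j0}" by (auto simp: j0_def)
   then have 1: "card {c \<in> insert c0 I. fst c = j0} = Suc (m j0)" using insert.hyps by (simp add: m_def)
   have 2: "card {c \<in> insert c0 I. fst c = j} = m j" if "j \<noteq> j0" for j
    unfolding m_def using that by (intro arg_cong[where f = card]) (auto simp: j0_def)
   show ?thesis unfolding C_def using j0 1 2 by (subst prod.remove[of _ j0]) auto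
  qed
  finally show ?case .
 qed
qed

lemma coords_slice: "{c \<in> coords k nv. fst c = j} = (if j < k then Pair j ` {1..nv j} else {})"
 by (auto simp: coords_def)

text \<open>The degenerate cases fit: dilation by 0 collapses the simplex to the origin, just as
  nonnegative coordinates with sum at most 0 must vanish, and a block without coordinates imposes no
  condition.\<close>

lemma simplex_product_scaled: "simplex_product k nv d = scaled_corner (coords k nv) k (\<lambda>j. real (d j))"
proof -
 have D: "w \<in> dilate m (real c) (corner_simplex m) \<longleftrightarrow> w \<in> fvec {1..m} \<and> (\<forall>h\<in>{1..m}. 0 \<le> w h) \<and> (\<Sum>h=1..m. w h) \<le> real c" (is "_ \<longleftrightarrow> ?R")
  for w :: "nat => real" and m c
 proof
  assume "w \<in> dilate m (real c) (corner_simplex m)"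
  then obtain v where v: "v \<in> corner_simplex m" "w = (\<lambda>h\<in>{1..m}. real c * v h)" unfolding dilate_def by blast
  have "(\<Sum>h=1..m. w h) = real c * (\<Sum>h=1..m. v h)" unfolding v(2) sum_distrib_left by (intro sum.cong) auto
  also have "\<dots> \<le> real c * 1" using v(1) by (intro mult_left_mono) (auto simp: corner_simplex_def)
  finally show ?R using v by (auto simp: corner_simplex_def)
 next
  assume R: ?R
  define v where "v = (\<lambda>h\<in>{1..m}. w h / real c)"
  have v: "v \<in> corner_simplex m"
  proof -
   have "(\<Sum>h=1..m. v h) = (\<Sum>h=1..m. w h) / real c" unfolding v_def sum_divide_distrib by (intro sum.cong) auto
   also have "\<dots> \<le> 1" using R by (cases "c = 0") auto
   finally show ?thesis using R by (auto simp: corner_simplex_def v_def)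
  qed
  have "w h = real c * v h" if h: "h \<in> {1..m}" for h
  proof (cases "c = 0")
   case True
   have "w h \<le> (\<Sum>h=1..m. w h)" using R h by (intro member_le_sum) auto
   then have "w h \<le> 0" using R True by simp
   then show ?thesis using R h True by force
  qed (use h in \<open>simp add: v_def\<close>)
  then have "w = (\<lambda>h\<in>{1..m}. real c * v h)" using R by (auto simp: fun_eq_iff PiE_def extensional_def)
  then show "w \<in> dilate m (real c) (corner_simplex m)" unfolding dilate_def using v by blast
 qed
 have s: "(\<Sum>c | c \<in> coords k nv \<and> fst c = j. z c) = (\<Sum>h=1..nv j. z (j, h))" if "j < k" for z :: "nat \<times> nat => real" and j
  using coords_slice[of k nv j] that by (simp add: sum.reindex inj_on_def)
 have "z \<in> simplex_product k nv d \<longleftrightarrow> z \<in> scaled_corner (coords k nv) k (\<lambda>j. real (d j))" for z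
 proof -
  have "(nv j > 0 \<longrightarrow> (\<lambda>h\<in>{1..nv j}. z (j, h)) \<in> dilate (nv j) (real (d j)) (corner_simplex (nv j))) \<longleftrightarrow>
    (\<forall>h\<in>{1..nv j}. 0 \<le> z (j, h)) \<and> (\<Sum>h=1..nv j. z (j, h)) \<le> real (d j)" for j
   unfolding D by (cases "nv j = 0") (auto simp: restrict_def)
  then have "z \<in> simplex_product k nv d \<longleftrightarrow> z \<in> fvec (coords k nv) \<and>
    (\<forall>j<k. (\<forall>h\<in>{1..nv j}. 0 \<le> z (j, h)) \<and> (\<Sum>h=1..nv j. z (j, h)) \<le> real (d j))"
   unfolding simplex_product_def mem_Collect_eq by simp
  also have "\<dots> \<longleftrightarrow> z \<in> scaled_corner (coords k nv) k (\<lambda>j. real (d j))"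
   unfolding scaled_corner_def mem_Collect_eq using s[of _ z] by (auto simp: coords_def)
  finally show ?thesis .
 qed
 then show ?thesis by blast
qed

text \<open>For the nontrivial inclusion a point is split proportionally: in block \<open>j\<close>
  the point \<open>q i\<close> is the multiple \<open>real (\<delta> i j) / t j\<close> of it. If
  \<open>t j = 0\<close>, the coordinates of that block are 0 and the division by zero does no
  harm.\<close>

lemma minkowski_comb_scaled_corner:
 assumes I: "finite I" "fst ` I \<subseteq> {..<k}" and l: "\<And>i. i < n \<Longrightarrow> 0 \<le> l i"
 shows "minkowski_comb I n l (\<lambda>i. scaled_corner I k (\<lambda>j. real (\<delta> i j))) = scaled_corner I k (\<lambda>j. \<Sum>i<n. l i * real (\<delta> i j))"
proof (intro equalityI subsetI)
 fix z assume "z \<in> minkowski_comb I n l (\<lambda>i. scaled_corner I k (\<lambda>j. real (\<delta> i j)))"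
 then obtain q where q: "\<forall>i<n. q i \<in> scaled_corner I k (\<lambda>j. real (\<delta> i j))" "z = (\<lambda>c\<in>I. \<Sum>i<n. l i * q i c)"
  unfolding minkowski_comb_def by blast
 have "0 \<le> z c" if "c \<in> I" for c
  using that q l by (auto simp: scaled_corner_def intro!: sum_nonneg mult_nonneg_nonneg)
 moreover have "(\<Sum>c | c \<in> I \<and> fst c = j. z c) \<le> (\<Sum>i<n. l i * real (\<delta> i j))" if "j < k" for j
 proof -
  have "(\<Sum>c | c \<in> I \<and> fst c = j. z c) = (\<Sum>c | c \<in> I \<and> fst c = j. \<Sum>i<n. l i * q i c)"
   using q(2) by (intro sum.cong) auto
  also have "\<dots> = (\<Sum>i<n. l i * (\<Sum>c | c \<in> I \<and> fst c = j. q i c))"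
   unfolding sum_distrib_left by (rule sum.swap)
  also have "\<dots> \<le> (\<Sum>i<n. l i * real (\<delta> i j))"
   using q(1) l that by (intro sum_mono mult_left_mono) (auto simp: scaled_corner_def)
  finally show ?thesis .
 qed
 ultimately show "z \<in> scaled_corner I k (\<lambda>j. \<Sum>i<n. l i * real (\<delta> i j))"
  using q(2) by (auto simp: scaled_corner_def)
next
 fix z assume z: "z \<in> scaled_corner I k (\<lambda>j. \<Sum>i<n. l i * real (\<delta> i j))"
 define t where "t j = (\<Sum>i<n. l i * real (\<delta> i j))" for j
 define q where "q i = (\<lambda>c\<in>I. real (\<delta> i (fst c)) * z c / t (fst c))" for i
 have t0: "t j \<ge> 0" for j unfolding t_def using l by (intro sum_nonneg) auto
 have zt: "\<And>c. c \<in> I \<Longrightarrow> 0 \<le> z c" "\<And>j. j < k \<Longrightarrow> (\<Sum>c | c \<in> I \<and> fst c = j. z c) \<le> t j" "z \<in> fvec I"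
  using z by (auto simp: scaled_corner_def t_def)
 have "q i \<in> scaled_corner I k (\<lambda>j. real (\<delta> i j))" for i
 proof -
  have "(\<Sum>c | c \<in> I \<and> fst c = j. q i c) \<le> real (\<delta> i j)" if "j < k" for j
  proof -
   have "(\<Sum>c | c \<in> I \<and> fst c = j. q i c) = real (\<delta> i j) * ((\<Sum>c | c \<in> I \<and> fst c = j. z c) / t j)"
    unfolding sum_divide_distrib sum_distrib_left by (intro sum.cong) (auto simp: q_def)
   also have "\<dots> \<le> real (\<delta> i j) * 1"
    using zt(2)[OF that] t0[of j] by (intro mult_left_mono) (auto simp: divide_le_eq_1 less_le)
   finally show ?thesis by simp
  qed
  then show ?thesis using zt(1) t0 by (auto simp: scaled_corner_def q_def)
 qed
 moreover have "z = (\<lambda>c\<in>I. \<Sum>i<n. l i * q i c)"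
 proof (rule ext)
  fix c
  show "z c = (\<lambda>c\<in>I. \<Sum>i<n. l i * q i c) c"
  proof (cases "c \<in> I")
   case True
   then have ck: "fst c < k" using I by auto
   have "(\<Sum>i<n. l i * q i c) = (\<Sum>i<n. l i * real (\<delta> i (fst c))) * (z c / t (fst c))"
    unfolding sum_distrib_right by (intro sum.cong) (auto simp: q_def True)
   also have "\<dots> = t (fst c) * (z c / t (fst c))" by (simp add: t_def)
   also have "\<dots> = z c"
   proof (cases "t (fst c) = 0")
    case t: True
    have "z c \<le> (\<Sum>d | d \<in> I \<and> fst d = fst c. z d)" using True zt(1) I by (intro member_le_sum) auto
    then have "z c = 0" using zt(2)[OF ck] t zt(1)[OF True] by linarith
    then show ?thesis by simp
   qed simp
   finally show ?thesis using True by simp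
  qed (simp add: PiE_arb[OF zt(3)])
 qed
 ultimately show "z \<in> minkowski_comb I n l (\<lambda>i. scaled_corner I k (\<lambda>j. real (\<delta> i j)))"
  unfolding minkowski_comb_def by blast
qed

section \<open>The volume polynomial: uniqueness and multilinear coefficient\<close>

definition pm_eval :: "nat => (nat => real) => ((nat \<Rightarrow>\<^sub>0 nat) \<Rightarrow>\<^sub>0 real) => real" where
 "pm_eval n l p = (\<Sum>e\<in>Poly_Mapping.keys p. Poly_Mapping.lookup p e * (\<Prod>i<n. l i ^ Poly_Mapping.lookup e i))"

lemma digits_inj:
 fixes d e :: "nat => nat"
 assumes "\<And>i. i < n \<Longrightarrow> d i < B" "\<And>i. i < n \<Longrightarrow> e i < B" "(\<Sum>i<n. d i * B ^ i) = (\<Sum>i<n. e i * B ^ i)" "i < n"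
 shows "d i = e i" using assms
proof (induction n arbitrary: d e i)
 case (Suc n)
 have split: "(\<Sum>i<Suc n. f i * B ^ i) = f 0 + B * (\<Sum>i<n. f (Suc i) * B ^ i)" for f :: "nat => nat"
  unfolding sum.lessThan_Suc_shift sum_distrib_left by (simp add: mult_ac)
 have B: "d 0 < B" "e 0 < B" using Suc.prems by auto
 have eq: "d 0 + B * (\<Sum>i<n. d (Suc i) * B ^ i) = e 0 + B * (\<Sum>i<n. e (Suc i) * B ^ i)"
  using Suc.prems(3) unfolding split .
 have "d 0 = e 0" using arg_cong[OF eq, of "\<lambda>x. x mod B"] B by simp
 moreover have "(\<Sum>i<n. d (Suc i) * B ^ i) = (\<Sum>i<n. e (Suc i) * B ^ i)" using eq B \<open>d 0 = e 0\<close> by simp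
 then have "d (Suc i') = e (Suc i')" if "i' < n" for i'
  using Suc.IH[of "\<lambda>i. d (Suc i)" "\<lambda>i. e (Suc i)" i'] Suc.prems(1,2) that by simp
 ultimately show ?case using Suc.prems(4) by (cases i) auto
qed simp

text \<open>Kronecker substitution: for large \<open>B\<close> the monomials become distinct powers of \<open>s\<close>
 under \<open>l\<^sub>i = s ^ (B ^ i)\<close>.\<close>

lemma pm_eval_unique:
 assumes p: "\<forall>e\<in>Poly_Mapping.keys p. Poly_Mapping.keys e \<subseteq> {..<n}" and q: "\<forall>e\<in>Poly_Mapping.keys q. Poly_Mapping.keys e \<subseteq> {..<n}"
  and eq: "\<And>l. (\<forall>i<n. 0 \<le> l i) \<Longrightarrow> pm_eval n l p = pm_eval n l q"
 shows "p = q"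
proof -
 define K where "K = Poly_Mapping.keys p \<union> Poly_Mapping.keys q"
 have K: "finite K" by (simp add: K_def)
 \<comment> \<open>Exceeds every exponent that occurs, so that exponent vectors are digit strings in
   base \<open>B\<close>; the inserted 0 keeps the maximum defined.\<close>
 define B where "B = Suc (Max ((\<lambda>(e, i). Poly_Mapping.lookup e i) ` (K \<times> {..<n}) \<union> {0}))"
 have B: "Poly_Mapping.lookup e i < B" if "e \<in> K" "i < n" for e i
 proof -
  have "Poly_Mapping.lookup e i \<in> (\<lambda>(e, i). Poly_Mapping.lookup e i) ` (K \<times> {..<n}) \<union> {0}" using that by force
  then show ?thesis unfolding B_def using K by (intro le_imp_less_Suc Max_ge) auto
 qed
 define code where "code e = (\<Sum>i<n. Poly_Mapping.lookup e i * B ^ i)" for e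
 have inj: "inj_on code K"
 proof (rule inj_onI)
  fix d e assume de: "d \<in> K" "e \<in> K" "code d = code e"
  have "Poly_Mapping.lookup d i = Poly_Mapping.lookup e i" for i
  proof (cases "i < n")
   case True
   show ?thesis using digits_inj[OF _ _ de(3)[unfolded code_def] True] B de by blast
  next
   case False
   then have "i \<notin> Poly_Mapping.keys d" "i \<notin> Poly_Mapping.keys e" using de p q by (auto simp: K_def)
   then show ?thesis by (simp add: in_keys_iff)
  qed
  then show "d = e" by (intro poly_mapping_eqI)
 qed
 define c where "c e = Poly_Mapping.lookup p e - Poly_Mapping.lookup q e" for e
 define P where "P = (\<Sum>e\<in>K. Polynomial.monom (c e) (code e))"
 have "poly P s = 0" if s: "s \<ge> 0" for s
 proof -
  define l where "l i = s ^ (B ^ i)" for i :: nat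
  have M: "(\<Prod>i<n. l i ^ Poly_Mapping.lookup e i) = s ^ code e" for e
   unfolding l_def code_def power_sum by (intro prod.cong) (auto simp: power_mult[symmetric] mult.commute)
  have E: "pm_eval n l r = (\<Sum>e\<in>K. Poly_Mapping.lookup r e * s ^ code e)" if "Poly_Mapping.keys r \<subseteq> K" for r
   unfolding pm_eval_def M using K that by (intro sum.mono_neutral_left) (auto simp: in_keys_iff)
  have "pm_eval n l p = pm_eval n l q" using s by (intro eq) (simp add: l_def)
  then have "(\<Sum>e\<in>K. c e * s ^ code e) = 0"
   using E[of p] E[of q] by (simp add: K_def c_def left_diff_distrib sum_subtractf)
  then show ?thesis by (simp add: P_def poly_sum poly_monom)
 qed
 then have "{0..} \<subseteq> {s. poly P s = 0}" by auto
 then have "P = 0" using poly_roots_finite[of P] infinite_Ici[of "0::real"] finite_subset by blast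
 have "c e = 0" if e: "e \<in> K" for e
 proof -
  have "Polynomial.coeff P (code e) = (\<Sum>d\<in>K. if d = e then c d else 0)"
   unfolding P_def coeff_sum using inj e by (intro sum.cong) (auto simp: coeff_monom inj_on_eq_iff)
  then show ?thesis using K e \<open>P = 0\<close> by simp
 qed
 then have "Poly_Mapping.lookup p e = Poly_Mapping.lookup q e" for e
  by (cases "e \<in> K") (auto simp: c_def K_def in_keys_iff)
 then show ?thesis by (rule poly_mapping_eqI)
qed

text \<open>Expanding the product picks a row \<open>\<phi> c\<close> for every column
  \<open>c\<close>, and \<open>E \<phi>\<close> counts how often each row is picked. The multilinear
  monomial comes exactly from the bijective choices, whose weights add up to the permanent.\<close>

lemma prod_linear_forms_polynomial:
 fixes a :: "nat => nat => real"
 shows "\<exists>p. (\<forall>e\<in>Poly_Mapping.keys p. Poly_Mapping.keys e \<subseteq> {..<n}) \<and>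
   (\<forall>l. pm_eval n l p = (\<Prod>c<n. \<Sum>i<n. l i * a i c) * r) \<and>
   Poly_Mapping.lookup p (\<Sum>i<n. Poly_Mapping.single i 1) = per n a * r" proof -
 define \<Phi> where "\<Phi> = (\<Pi>\<^sub>E c\<in>{..<n}. {..<n})"
 have fin: "finite \<Phi>" unfolding \<Phi>_def by (intro finite_PiE) auto
 define E :: "(nat => nat) => nat \<Rightarrow>\<^sub>0 nat" where "E \<phi> = (\<Sum>c<n. Poly_Mapping.single (\<phi> c) 1)" for \<phi>
 define w where "w \<phi> = (\<Prod>c<n. a (\<phi> c) c) * r" for \<phi>
 define p where "p = (\<Sum>\<phi>\<in>\<Phi>. Poly_Mapping.single (E \<phi>) (w \<phi>))"
 have lp: "Poly_Mapping.lookup p e = (\<Sum>\<phi>\<in>{\<phi>\<in>\<Phi>. E \<phi> = e}. w \<phi>)" for e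
  unfolding p_def lookup_sum lookup_single using fin by (simp add: sum.inter_filter when_def)
 have E: "Poly_Mapping.lookup (E \<phi>) i = card {c. c < n \<and> \<phi> c = i}" for \<phi> i
 proof -
  have "Poly_Mapping.lookup (E \<phi>) i = (\<Sum>c<n. if \<phi> c = i then 1 else 0)"
   unfolding E_def lookup_sum lookup_single by (intro sum.cong) (auto simp: when_def)
  also have "\<dots> = card {c. c < n \<and> \<phi> c = i}" by (subst sum.inter_filter[symmetric]) auto
  finally show ?thesis .
 qed
 have keysE: "Poly_Mapping.keys (E \<phi>) \<subseteq> {..<n}" if "\<phi> \<in> \<Phi>" for \<phi>
 proof
  fix i assume "i \<in> Poly_Mapping.keys (E \<phi>)"
  then have "{c. c < n \<and> \<phi> c = i} \<noteq> {}" by (auto simp: in_keys_iff E)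
  then show "i \<in> {..<n}" using that by (auto simp: \<Phi>_def)
 qed
 have keysp: "Poly_Mapping.keys p \<subseteq> E ` \<Phi>"
 proof
  fix e assume "e \<in> Poly_Mapping.keys p"
  then have "{\<phi>\<in>\<Phi>. E \<phi> = e} \<noteq> {}" unfolding in_keys_iff lp by (metis sum.empty)
  then show "e \<in> E ` \<Phi>" by auto
 qed
 have "pm_eval n l p = (\<Prod>c<n. \<Sum>i<n. l i * a i c) * r" for l
 proof -
  define M where "M e = (\<Prod>i<n. l i ^ Poly_Mapping.lookup e i)" for e :: "nat \<Rightarrow>\<^sub>0 nat"
  have ME: "M (E \<phi>) = (\<Prod>c<n. l (\<phi> c))" if "\<phi> \<in> \<Phi>" for \<phi>
  proof -
   have "(\<Prod>c<n. l (\<phi> c)) = (\<Prod>i<n. \<Prod>c\<in>{c \<in> {..<n}. \<phi> c = i}. l (\<phi> c))"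
    using that by (intro prod.group[symmetric]) (auto simp: \<Phi>_def)
   also have "\<dots> = (\<Prod>i<n. l i ^ card {c. c < n \<and> \<phi> c = i})"
   proof (rule prod.cong)
    fix i
    have "(\<Prod>c\<in>{c \<in> {..<n}. \<phi> c = i}. l (\<phi> c)) = (\<Prod>c\<in>{c. c < n \<and> \<phi> c = i}. l i)" by (intro prod.cong) auto
    then show "(\<Prod>c\<in>{c \<in> {..<n}. \<phi> c = i}. l (\<phi> c)) = l i ^ card {c. c < n \<and> \<phi> c = i}" by simp
   qed simp
   finally show ?thesis by (simp add: M_def E)
  qed
  have "pm_eval n l p = (\<Sum>e\<in>E ` \<Phi>. Poly_Mapping.lookup p e * M e)"
   unfolding pm_eval_def M_def using fin keysp by (intro sum.mono_neutral_left) (auto simp: in_keys_iff)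
  also have "\<dots> = (\<Sum>e\<in>E ` \<Phi>. \<Sum>\<phi>\<in>{\<phi>\<in>\<Phi>. E \<phi> = e}. w \<phi> * M (E \<phi>))"
   unfolding lp sum_distrib_right by (intro sum.cong) auto
  also have "\<dots> = (\<Sum>\<phi>\<in>\<Phi>. w \<phi> * M (E \<phi>))" using fin by (intro sum.group) auto
  also have "\<dots> = (\<Sum>\<phi>\<in>\<Phi>. (\<Prod>c<n. l (\<phi> c) * a (\<phi> c) c) * r)"
   using ME by (intro sum.cong) (auto simp: w_def prod.distrib mult_ac)
  also have "\<dots> = (\<Prod>c<n. \<Sum>i<n. l i * a i c) * r"
   unfolding sum_distrib_right[symmetric] \<Phi>_def by (subst prod_sum_PiE) auto
  finally show ?thesis .
 qed
 moreover have "Poly_Mapping.lookup p (\<Sum>i<n. Poly_Mapping.single i 1) = per n a * r"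
 proof -
  have one: "E \<phi> = (\<Sum>i<n. Poly_Mapping.single i 1) \<longleftrightarrow> bij_betw \<phi> {..<n} {..<n}" if \<phi>: "\<phi> \<in> \<Phi>" for \<phi>
  proof
   have l1: "Poly_Mapping.lookup (\<Sum>i<n. Poly_Mapping.single i (1::nat)) i = of_bool (i < n)" for i
    unfolding lookup_sum lookup_single by (simp add: when_def)
   {
    assume "E \<phi> = (\<Sum>i<n. Poly_Mapping.single i 1)"
    then have c1: "card {c. c < n \<and> \<phi> c = i} = 1" if "i < n" for i using E[of \<phi> i] l1[of i] that by simp
    have "{..<n} \<subseteq> \<phi> ` {..<n}"
    proof
     fix i assume "i \<in> {..<n}"
     then have "{c. c < n \<and> \<phi> c = i} \<noteq> {}" using c1[of i] by (metis card.empty lessThan_iff zero_neq_one)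
     then show "i \<in> \<phi> ` {..<n}" by auto
    qed
    then have "\<phi> ` {..<n} = {..<n}" using \<phi> by (auto simp: \<Phi>_def)
    then show "bij_betw \<phi> {..<n} {..<n}" by (simp add: bij_betw_def eq_card_imp_inj_on)
   }
   {
    assume b: "bij_betw \<phi> {..<n} {..<n}"
    have "card {c. c < n \<and> \<phi> c = i} = of_bool (i < n)" for i
    proof (cases "i < n")
     case True
     then have "i \<in> \<phi> ` {..<n}" using b by (simp add: bij_betw_def)
     then obtain c where c: "c < n" "\<phi> c = i" by auto
     then have "{c. c < n \<and> \<phi> c = i} = {c}" using b by (auto simp: bij_betw_def inj_on_def)
     then show ?thesis using True by simp
    next
     case False
     then have "{c. c < n \<and> \<phi> c = i} = {}" using b by (auto simp: bij_betw_def)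
     then show ?thesis using False by simp
    qed
    then show "E \<phi> = (\<Sum>i<n. Poly_Mapping.single i 1)" by (intro poly_mapping_eqI) (simp only: E l1)
   }
  qed
  have "Poly_Mapping.lookup p (\<Sum>i<n. Poly_Mapping.single i 1) = (\<Sum>\<phi>\<in>{\<phi>\<in>\<Phi>. bij_betw \<phi> {..<n} {..<n}}. w \<phi>)"
   unfolding lp using one by (intro sum.cong) auto
  \<comment> \<open>Choice functions are \<open>undefined\<close> off \<open>{..<n}\<close> while
    permutations are the identity there, hence the two translations.\<close>
  also have "\<dots> = (\<Sum>\<sigma> | \<sigma> permutes {..<n}. w (restrict \<sigma> {..<n}))"
  proof (rule sum.reindex_bij_witness[where i = "\<lambda>\<sigma>. restrict \<sigma> {..<n}" and j = "\<lambda>\<phi> x. if x < n then \<phi> x else x"])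
   fix \<phi> assume a: "\<phi> \<in> {\<phi> \<in> \<Phi>. bij_betw \<phi> {..<n} {..<n}}"
   then show r: "restrict (\<lambda>x. if x < n then \<phi> x else x) {..<n} = \<phi>" by (auto simp: \<Phi>_def PiE_def extensional_def fun_eq_iff)
   have "bij_betw (\<lambda>x. if x < n then \<phi> x else x) {..<n} {..<n}"
    using a by (subst bij_betw_cong[where g = \<phi>]) auto
   then show "(\<lambda>x. if x < n then \<phi> x else x) \<in> {\<sigma>. \<sigma> permutes {..<n}}" by (intro CollectI bij_imp_permutes) auto
   show "w (restrict (\<lambda>x. if x < n then \<phi> x else x) {..<n}) = w \<phi>" by (simp only: r)
  next
   fix \<sigma> assume "\<sigma> \<in> {\<sigma>. \<sigma> permutes {..<n}}"
   then have \<sigma>: "\<sigma> permutes {..<n}" by simp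
   show "(\<lambda>x. if x < n then restrict \<sigma> {..<n} x else x) = \<sigma>"
    using \<sigma> by (auto simp: fun_eq_iff permutes_def)
   have "bij_betw (restrict \<sigma> {..<n}) {..<n} {..<n}"
    using permutes_imp_bij[OF \<sigma>] by (subst bij_betw_cong[where g = \<sigma>]) auto
   then show "restrict \<sigma> {..<n} \<in> {\<phi> \<in> \<Phi>. bij_betw \<phi> {..<n} {..<n}}" by (auto simp: \<Phi>_def bij_betw_def)
  qed
  also have "\<dots> = (\<Sum>\<sigma> | \<sigma> permutes {..<n}. (\<Prod>c<n. a (\<sigma> c) c) * r)" by (intro sum.cong) (auto simp: w_def)
  also have "\<dots> = (\<Sum>\<sigma> | \<sigma> permutes {..<n}. \<Prod>c<n. a (\<sigma> c) c) * r" by (simp add: sum_distrib_right)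
  \<comment> \<open>The choices map columns to rows, whereas \<open>per\<close> maps rows to
    columns; inverting the permutations reconciles the two.\<close>
  also have "(\<Sum>\<sigma> | \<sigma> permutes {..<n}. \<Prod>c<n. a (\<sigma> c) c) = per n a"
  proof -
   have "(\<Sum>\<sigma> | \<sigma> permutes {..<n}. \<Prod>c<n. a (\<sigma> c) c) = (\<Sum>\<sigma> | \<sigma> permutes {..<n}. \<Prod>c<n. a (inv_into UNIV \<sigma> c) c)"
    by (rule sum_permutations_inverse)
   also have "\<dots> = (\<Sum>\<sigma> | \<sigma> permutes {..<n}. \<Prod>i<n. a i (\<sigma> i))"
   proof (rule sum.cong)
    fix \<sigma> assume "\<sigma> \<in> {\<sigma>. \<sigma> permutes {..<n}}"
    then have \<sigma>: "\<sigma> permutes {..<n}" by simp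
    show "(\<Prod>c<n. a (inv_into UNIV \<sigma> c) c) = (\<Prod>i<n. a i (\<sigma> i))"
     using prod.permute[OF \<sigma>, of "\<lambda>c. a (inv_into UNIV \<sigma> c) c"] permutes_inverses[OF \<sigma>] by (simp add: o_def)
   qed simp
   finally show ?thesis by (simp add: per_def)
  qed
  finally show ?thesis .
 qed
 ultimately show ?thesis using keysp keysE by (intro exI[of _ p]) blast
qed

text \<open>A Minkowski combination of the polytopes is a product of simplices with sizes linear in
  the weights, so its volume is the product of the \<open>n\<close> linear forms attached to the
  columns, divided by factorials. The permanent is its multilinear coefficient, and uniqueness of
  the polynomial makes the description in \<open>mixed_volume\<close> definite.\<close>

lemma BKK_eq_nper:
 assumes b: "blk k nv bl"
 shows "BKK k nv \<delta> = nper k nv bl (\<lambda>i j. real (\<delta> i j))"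
proof -
 define n where "n = length bl"
 have n: "card (coords k nv) = n" using blk_length[OF b] by (simp add: n_def card_coords)
 have fin: "finite (coords k nv)" "fst ` coords k nv \<subseteq> {..<k}" by (auto simp: coords_def)
 have cd: "card {c \<in> coords k nv. fst c = j} = nv j" if "j < k" for j
  unfolding coords_slice using that by (simp add: card_image inj_on_def)
 have vol: "measure (lebR (coords k nv)) (minkowski_comb (coords k nv) n l (\<lambda>i. simplex_product k nv (\<delta> i))) =
   (\<Prod>c<n. \<Sum>i<n. l i * real (\<delta> i (bl ! c))) * (1 / (\<Prod>j<k. fact (nv j)))" if l: "\<forall>i<n. 0 \<le> l i" for l proof -
  define t where "t j = (\<Sum>i<n. l i * real (\<delta> i j))" for j
  have t0: "t j \<ge> 0" for j unfolding t_def using l by (intro sum_nonneg) auto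
  have mk: "minkowski_comb (coords k nv) n l (\<lambda>i. simplex_product k nv (\<delta> i)) = scaled_corner (coords k nv) k t"
   unfolding simplex_product_scaled t_def using l by (intro minkowski_comb_scaled_corner[OF fin]) auto
  have "measure (lebR (coords k nv)) (scaled_corner (coords k nv) k t) = (\<Prod>j<k. t j ^ nv j / fact (nv j))"
   unfolding measure_def emeasure_scaled_corner(2)[of "coords k nv" k t, OF fin t0] using t0 cd
   by (subst enn2real_ennreal) (auto intro!: prod_nonneg prod.cong)
  also have "\<dots> = (\<Prod>j<k. t j ^ nv j) / (\<Prod>j<k. fact (nv j))" by (rule prod_dividef)
  also have "(\<Prod>j<k. t j ^ nv j) = (\<Prod>c<n. t (bl ! c))"
  proof -
   have "(\<Prod>c<n. t (bl ! c)) = (\<Prod>j<k. \<Prod>c\<in>{c \<in> {..<n}. bl ! c = j}. t (bl ! c))"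
    using b nth_mem[of _ bl] by (intro prod.group[symmetric]) (auto simp: blk_def n_def simp del: nth_mem)
   also have "\<dots> = (\<Prod>j<k. t j ^ nv j)"
   proof (rule prod.cong)
    fix j assume "j \<in> {..<k}"
    have "card {c \<in> {..<n}. bl ! c = j} = count (mset bl) j"
     by (simp add: n_def count_mset count_list_eq_length_filter length_filter_conv_card eq_commute)
    then have "card {c \<in> {..<n}. bl ! c = j} = nv j" using b \<open>j \<in> {..<k}\<close> by (auto simp: blk_def)
    moreover have "(\<Prod>c\<in>{c \<in> {..<n}. bl ! c = j}. t (bl ! c)) = (\<Prod>c\<in>{c \<in> {..<n}. bl ! c = j}. t j)" by (intro prod.cong) auto
    ultimately show "(\<Prod>c\<in>{c \<in> {..<n}. bl ! c = j}. t (bl ! c)) = t j ^ nv j" by simp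
   qed simp
   finally show ?thesis ..
  qed
  finally show ?thesis unfolding mk unfolding t_def by simp
 qed
 have iv: "is_volume_polynomial (coords k nv) n (\<lambda>i. simplex_product k nv (\<delta> i)) p \<longleftrightarrow>
   (\<forall>e\<in>Poly_Mapping.keys p. Poly_Mapping.keys e \<subseteq> {..<n}) \<and>
   (\<forall>l. (\<forall>i<n. 0 \<le> l i) \<longrightarrow> (\<Prod>c<n. \<Sum>i<n. l i * real (\<delta> i (bl ! c))) * (1 / (\<Prod>j<k. fact (nv j))) = pm_eval n l p)" for p
  unfolding is_volume_polynomial_def pm_eval_def using vol by (intro conj_cong refl all_cong) auto
 obtain p where p: "\<forall>e\<in>Poly_Mapping.keys p. Poly_Mapping.keys e \<subseteq> {..<n}"
   "\<forall>l. pm_eval n l p = (\<Prod>c<n. \<Sum>i<n. l i * real (\<delta> i (bl ! c))) * (1 / (\<Prod>j<k. fact (nv j)))"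
   "Poly_Mapping.lookup p (\<Sum>i<n. Poly_Mapping.single i 1) = per n (\<lambda>i c. real (\<delta> i (bl ! c))) * (1 / (\<Prod>j<k. fact (nv j)))"
  using prod_linear_forms_polynomial[of n "\<lambda>i c. real (\<delta> i (bl ! c))" "1 / (\<Prod>j<k. fact (nv j))"] by blast
 show ?thesis unfolding BKK_def mixed_volume_def n
 proof (rule the_equality)
  show "\<exists>p. is_volume_polynomial (coords k nv) n (\<lambda>i. simplex_product k nv (\<delta> i)) p \<and>
    nper k nv bl (\<lambda>i j. real (\<delta> i j)) = Poly_Mapping.lookup p (\<Sum>i<n. Poly_Mapping.single i 1)"
   unfolding iv using p by (intro exI[of _ p]) (simp add: nper_def n_def)
 next
  fix v assume "\<exists>p. is_volume_polynomial (coords k nv) n (\<lambda>i. simplex_product k nv (\<delta> i)) p \<and>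
    v = Poly_Mapping.lookup p (\<Sum>i<n. Poly_Mapping.single i 1)"
  then obtain q where q: "\<forall>e\<in>Poly_Mapping.keys q. Poly_Mapping.keys e \<subseteq> {..<n}"
   "\<And>l. (\<forall>i<n. 0 \<le> l i) \<Longrightarrow> pm_eval n l p = pm_eval n l q"
   "v = Poly_Mapping.lookup q (\<Sum>i<n. Poly_Mapping.single i 1)" unfolding iv using p(2) by auto
  have "p = q" by (rule pm_eval_unique[OF p(1) q(1,2)])
  then show "v = nper k nv bl (\<lambda>i j. real (\<delta> i j))" using q(3) p(3) by (simp add: nper_def n_def)
 qed
qed

section \<open>The expected number of zeros in an affine chart\<close>

lemma sigma_finite_density_real:
 assumes "sigma_finite_measure M" "f \<in> borel_measurable M"
 shows "sigma_finite_measure (density M (\<lambda>x. ennreal (f x)))"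
 using assms by (subst sigma_finite_measure.sigma_finite_iff_density_finite) auto

text \<open>Serves both for the normal law on the target and for row laws weighted by the density of
  the value of the row; the latter need not be probability measures.\<close>

lemma PiM_density:
 fixes f :: "'i => 'a => real"
 assumes I: "finite I" and M: "\<And>i. sigma_finite_measure (M i)" and f: "\<And>i. f i \<in> borel_measurable (M i)"
 shows "Pi\<^sub>M I (\<lambda>i. density (M i) (\<lambda>x. ennreal (f i x))) = density (Pi\<^sub>M I M) (\<lambda>x. \<Prod>i\<in>I. ennreal (f i (x i)))"
proof -
 interpret product_sigma_finite M using M by (simp add: product_sigma_finite_def)
 interpret D: product_sigma_finite "\<lambda>i. density (M i) (\<lambda>x. ennreal (f i x))"
  using M f by (simp add: product_sigma_finite_def sigma_finite_density_real)
 have fm: "(\<lambda>x. ennreal (f i x)) \<in> borel_measurable (M i)" for i using f by simp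
 have pm: "(\<lambda>x. \<Prod>i\<in>I. ennreal (f i (x i))) \<in> borel_measurable (Pi\<^sub>M I M)"
  by (intro borel_measurable_prod_ennreal measurable_component_comp[where M = M and f = "\<lambda>x. ennreal (f i x)" for i] fm)
 show ?thesis
 proof (rule D.PiM_eqI[OF I, symmetric])
  show "sets (density (Pi\<^sub>M I M) (\<lambda>x. \<Prod>i\<in>I. ennreal (f i (x i)))) = sets (Pi\<^sub>M I (\<lambda>i. density (M i) (\<lambda>x. ennreal (f i x))))"
   by (simp cong: sets_PiM_cong)
  fix A assume "\<And>i. i \<in> I \<Longrightarrow> A i \<in> sets (density (M i) (\<lambda>x. ennreal (f i x)))"
  then have A: "\<And>i. i \<in> I \<Longrightarrow> A i \<in> sets (M i)" by simp
  have "emeasure (density (Pi\<^sub>M I M) (\<lambda>x. \<Prod>i\<in>I. ennreal (f i (x i)))) (Pi\<^sub>E I A) =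
    (\<integral>\<^sup>+x. (\<Prod>i\<in>I. ennreal (f i (x i))) * indicator (Pi\<^sub>E I A) x \<partial>Pi\<^sub>M I M)"
   using A I by (intro emeasure_density pm) auto
  also have "\<dots> = (\<integral>\<^sup>+x. (\<Prod>i\<in>I. ennreal (f i (x i)) * indicator (A i) (x i)) \<partial>Pi\<^sub>M I M)"
  proof (rule nn_integral_cong)
   fix x assume x: "x \<in> space (Pi\<^sub>M I M)"
   have "indicator (Pi\<^sub>E I A) x = (\<Prod>i\<in>I. indicator (A i) (x i) :: ennreal)"
   proof (cases "x \<in> Pi\<^sub>E I A")
    case False
    then obtain i where "i \<in> I" "x i \<notin> A i" using x by (auto simp: space_PiM PiE_def extensional_def)
    then have "(\<Prod>i\<in>I. indicator (A i) (x i) :: ennreal) = 0" using I by (intro prod_zero) (auto intro!: bexI[of _ i])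
    then show ?thesis using False by simp
   qed (auto simp: PiE_mem)
   then show "(\<Prod>i\<in>I. ennreal (f i (x i))) * indicator (Pi\<^sub>E I A) x = (\<Prod>i\<in>I. ennreal (f i (x i)) * indicator (A i) (x i))"
    by (simp add: prod.distrib)
  qed
  also have "\<dots> = (\<Prod>i\<in>I. \<integral>\<^sup>+x. ennreal (f i x) * indicator (A i) x \<partial>M i)"
   using A fm by (intro product_nn_integral_prod I borel_measurable_times_ennreal) auto
  also have "\<dots> = (\<Prod>i\<in>I. emeasure (density (M i) (\<lambda>x. ennreal (f i x))) (A i))"
   using A fm by (intro prod.cong refl emeasure_density[symmetric])
  finally show "emeasure (density (Pi\<^sub>M I M) (\<lambda>x. \<Prod>i\<in>I. ennreal (f i (x i)))) (Pi\<^sub>E I A) =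
    (\<Prod>i\<in>I. emeasure (density (M i) (\<lambda>x. ennreal (f i x))) (A i))" . qed qed  lemma kac_rice:
 fixes cs :: "'b::countable list" and S :: "nat => 'a set" and \<sigma> :: "nat => 'a => real"
  and u :: "nat => 'a => ('b => real) => real" and u' :: "nat => 'a => 'b => ('b => real) => real"
  and L :: "nat => nat => ('b => real) => real" and bl :: "nat list" and \<delta> :: "nat => nat => nat"
 assumes cs: "distinct cs" "length cs = n" and S: "\<And>i. finite (S i)" and \<sigma>: "\<And>i a. \<sigma> i a > 0"
  and A: "A \<subseteq> fvec (set cs)" "sigma_compact A"
  and u: "\<And>i a. continuous_on UNIV (u i a)" "\<And>i a c. continuous_on UNIV (u' i a c)"
   "\<And>i a c x. i < n \<Longrightarrow> a \<in> S i \<Longrightarrow> c \<in> set cs \<Longrightarrow> ((\<lambda>t. u i a (x(c := t))) has_real_derivative u' i a c x) (at (x c))"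
  and bl: "length bl = n" and L: "\<And>c d. c < n \<Longrightarrow> d < n \<Longrightarrow> L c d \<in> borel_measurable (lebR (set cs))"
  and form: "\<And>x i q. x \<in> A \<Longrightarrow> i < n \<Longrightarrow>
   (\<Sum>a\<in>S i. (\<sigma> i a * (\<Sum>d<n. u' i a (cs ! d) x * q d))\<^sup>2) / (1 + (\<Sum>a\<in>S i. (\<sigma> i a * u i a x)\<^sup>2)) -
   ((\<Sum>a\<in>S i. (\<sigma> i a)\<^sup>2 * u i a x * (\<Sum>d<n. u' i a (cs ! d) x * q d)) / (1 + (\<Sum>a\<in>S i. (\<sigma> i a * u i a x)\<^sup>2)))\<^sup>2 =
   (\<Sum>c<n. real (\<delta> i (bl ! c)) * (\<Sum>d<n. L c d x * q d)\<^sup>2)"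
 shows "(\<integral>\<^sup>+X. \<integral>\<^sup>+Y. ncard {x \<in> A. \<forall>i<n. Y i + (\<Sum>a\<in>S i. X i a * u i a x) = 0} \<partial>rowG n
   \<partial>Pi\<^sub>M {..<n} (\<lambda>i. Pi\<^sub>M (S i) (\<lambda>a. normalM (\<sigma> i a)))) =
  (\<integral>\<^sup>+x. indicator A x * (ennreal (1 / sqrt (2 * pi)) ^ n * eadet n (\<lambda>(c, d). L c d x)) \<partial>lebR (set cs)) * expdet bl \<delta>"
proof -
 \<comment> \<open>Given \<open>X\<close>, the vector \<open>Y\<close> is the value of the map
   \<open>g X\<close>, so the area formula with the normal density as weight counts the zeros. After
   an exchange of the integrals the rows at a fixed \<open>x\<close> are independent, each weighted
   by the density of its own value: this is conditioning on a zero at \<open>x\<close>. By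
   \<open>gauss_conditional_abs\<close> and the hypothesis \<open>form\<close>, the weighted rows
   have the same mean absolute forms, up to \<open>1 / sqrt (2 * pi)\<close>, as Gaussian rows with
   weights \<open>sdeg\<close> multiplied from the right by the matrix \<open>L\<close>.\<close>
 define R where "R i = Pi\<^sub>M (S i) (\<lambda>a. normalM (\<sigma> i a))" for i
 define RR where "RR = Pi\<^sub>M {..<n} R"
 define \<phi> where "\<phi> = std_normal_density"
 have \<phi>_meas: "\<phi> \<in> borel_measurable borel" by (simp add: \<phi>_def)
 have \<phi>_neg: "\<phi> (- t) = \<phi> t" for t by (simp add: \<phi>_def normal_density_def)
 have \<phi>0: "0 \<le> \<phi> t" for t by (simp add: \<phi>_def)
 define g where "g X i x = - (\<Sum>a\<in>S i. X i a * u i a x)" for X :: "nat => 'a => real" and i x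
 define g' where "g' X i c x = - (\<Sum>a\<in>S i. X i a * u' i a c x)" for X :: "nat => 'a => real" and i c x
 have probR: "prob_space (R i)" for i
  unfolding R_def using \<sigma> by (intro prob_space_PiM prob_space_normal_density)
 have sfR: "sigma_finite_measure (R i)" for i using probR by (rule prob_space_imp_sigma_finite)
 have sfRR: "sigma_finite_measure RR"
  unfolding RR_def by (intro prob_space_imp_sigma_finite prob_space_PiM probR)
 have entry: "(\<lambda>w. w a) \<in> borel_measurable (R i)" if "a \<in> S i" for i a
  using that measurable_component_comp[of "\<lambda>x. x" "\<lambda>a. normalM (\<sigma> i a)" a "S i"] by (simp add: R_def)
 have entry2: "(\<lambda>X. X i a) \<in> borel_measurable RR" if "i < n" "a \<in> S i" for i a
  using that measurable_component_comp[of "\<lambda>w. w a" R i "{..<n}"] entry by (simp add: RR_def)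
 have ulm: "u i a \<in> borel_measurable (lebR (set cs))" "u' i a c \<in> borel_measurable (lebR (set cs))" for i a c
  using measurable_compose[OF id_lebR_borel borel_measurable_continuous_onI[OF u(1)]]
   measurable_compose[OF id_lebR_borel borel_measurable_continuous_onI[OF u(2)]] by auto
 have cg: "continuous_on B (g X i)" "continuous_on B (g' X i c)" for B X i c
  unfolding g_def g'_def using u(1,2)
  by (auto intro!: continuous_intros continuous_on_subset[OF u(1)] continuous_on_subset[OF u(2)])
 have row: "rowG n = density (lebR {..<n}) (\<lambda>y. \<Prod>i<n. ennreal (\<phi> (y i)))"
  unfolding stdG_def \<phi>_def by (intro PiM_density sigma_finite_lborel) auto
 define h where "h y = (\<Prod>i<n. ennreal (\<phi> (y i)))" for y
 have hm: "h \<in> borel_measurable (lebR {..<n})" unfolding h_def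
  by (intro borel_measurable_prod_ennreal measurable_compose[OF _ measurable_ennreal] measurable_component_comp[where M = "\<lambda>_. lborel"])
   (use \<phi>_meas in auto)
 have inner: "(\<integral>\<^sup>+Y. ncard {x \<in> A. \<forall>i<n. Y i + (\<Sum>a\<in>S i. X i a * u i a x) = 0} \<partial>rowG n) =
   (\<integral>\<^sup>+x. indicator A x * eadet n (\<lambda>(i, d). g' X i (cs ! d) x) * (\<Prod>i<n. ennreal (\<phi> (g X i x))) \<partial>lebR (set cs))" for X
 proof -
  have eq: "Y i + (\<Sum>a\<in>S i. X i a * u i a x) = 0 \<longleftrightarrow> g X i x = Y i" for Y i x by (auto simp: g_def)
  have "(\<integral>\<^sup>+Y. ncard {x \<in> A. \<forall>i<n. Y i + (\<Sum>a\<in>S i. X i a * u i a x) = 0} \<partial>rowG n) =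
    (\<integral>\<^sup>+y. ncard {x \<in> A. \<forall>i<n. g X i x = y i} * h y \<partial>lebR {..<n})" unfolding row eq h_def[symmetric]
   by (subst nn_integral_density[OF hm]) (auto intro!: area_count_measurable A cg simp: mult.commute)
  also have "\<dots> = (\<integral>\<^sup>+x. indicator A x * eadet n (\<lambda>(i, d). g' X i (cs ! d) x) * h (\<lambda>i\<in>{..<n}. g X i x) \<partial>lebR (set cs))"
  proof -
   have "C1_map (set cs) (UNIV \<inter> fvec (set cs)) n (g X) (g' X)" unfolding C1_map_def g_def g'_def
    by (auto intro!: continuous_intros continuous_on_subset[OF u(1)] continuous_on_subset[OF u(2)] derivative_eq_intros u(3) simp: mult.commute)
   from area_formula[OF cs open_UNIV _ A(2) this] A(1) hm show ?thesis unfolding area_holds_def by blast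
  qed
  also have "\<dots> = (\<integral>\<^sup>+x. indicator A x * eadet n (\<lambda>(i, d). g' X i (cs ! d) x) * (\<Prod>i<n. ennreal (\<phi> (g X i x))) \<partial>lebR (set cs))"
   unfolding h_def by (intro nn_integral_cong arg_cong2[where f = times] prod.cong refl) auto
  finally show ?thesis .
 qed
 have Alm: "A \<in> sets (lebR (set cs))"
  using borel_Int_lebR[OF sigma_compact_borel[OF A(2)], of "set cs"] A(1) by (simp add: Int_absorb2)
 define G where "G X x = indicator A x * eadet n (\<lambda>(i, d). g' X i (cs ! d) x) * (\<Prod>i<n. ennreal (\<phi> (g X i x)))" for X x
 have Gm: "(\<lambda>(X, x). G X x) \<in> borel_measurable (RR \<Otimes>\<^sub>M lebR (set cs))"
 proof -
  have e: "(\<lambda>p. fst p i a) \<in> borel_measurable (RR \<Otimes>\<^sub>M lebR (set cs))" if "i < n" "a \<in> S i" for i a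
   by (rule measurable_compose[OF measurable_fst entry2[OF that]])
  have ul: "(\<lambda>p. u i a (snd p)) \<in> borel_measurable (RR \<Otimes>\<^sub>M lebR (set cs))"
   "(\<lambda>p. u' i a c (snd p)) \<in> borel_measurable (RR \<Otimes>\<^sub>M lebR (set cs))" for i a c
   using measurable_compose[OF measurable_snd ulm(1)] measurable_compose[OF measurable_snd ulm(2)] by auto
  have gm: "(\<lambda>p. g (fst p) i (snd p)) \<in> borel_measurable (RR \<Otimes>\<^sub>M lebR (set cs))"
   "(\<lambda>p. g' (fst p) i c (snd p)) \<in> borel_measurable (RR \<Otimes>\<^sub>M lebR (set cs))" if "i < n" for i c
   unfolding g_def g'_def using that by (intro borel_measurable_uminus borel_measurable_sum borel_measurable_times e ul; simp)+
  have ind: "(\<lambda>p. indicator A (snd p) :: ennreal) \<in> borel_measurable (RR \<Otimes>\<^sub>M lebR (set cs))"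
   by (rule measurable_compose[OF measurable_snd borel_measurable_indicator[OF Alm]])
  have "(\<lambda>p. G (fst p) (snd p)) \<in> borel_measurable (RR \<Otimes>\<^sub>M lebR (set cs))" unfolding G_def
   by (intro borel_measurable_times_ennreal borel_measurable_prod_ennreal ind eadet_measurable gm measurable_compose[OF measurable_compose[OF gm(1) \<phi>_meas] measurable_ennreal]) auto
  then show ?thesis by (simp add: case_prod_beta)
 qed
 interpret P: pair_sigma_finite RR "lebR (set cs)"
  using sfRR plb.sigma_finite[of "set cs"] by (simp add: pair_sigma_finite_def)
 have "(\<integral>\<^sup>+X. \<integral>\<^sup>+Y. ncard {x \<in> A. \<forall>i<n. Y i + (\<Sum>a\<in>S i. X i a * u i a x) = 0} \<partial>rowG n \<partial>RR) =
   (\<integral>\<^sup>+X. \<integral>\<^sup>+x. G X x \<partial>lebR (set cs) \<partial>RR)" unfolding inner G_def ..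
 also have "\<dots> = (\<integral>\<^sup>+x. \<integral>\<^sup>+X. G X x \<partial>RR \<partial>lebR (set cs))" using P.Fubini'[OF Gm] by simp
 also have "\<dots> = (\<integral>\<^sup>+x. indicator A x * (ennreal (1 / sqrt (2 * pi)) ^ n * eadet n (\<lambda>(c, d). L c d x)) * expdet bl \<delta> \<partial>lebR (set cs))"
 proof (rule nn_integral_cong)
  fix x :: "'b => real"
  show "(\<integral>\<^sup>+X. G X x \<partial>RR) = indicator A x * (ennreal (1 / sqrt (2 * pi)) ^ n * eadet n (\<lambda>(c, d). L c d x)) * expdet bl \<delta>"
  proof (cases "x \<in> A")
   case True
   define f where "f i w = \<phi> (\<Sum>a\<in>S i. u i a x * w a)" for i and w :: "'a => real"
   have fm: "f i \<in> borel_measurable (R i)" for i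
    unfolding f_def by (intro measurable_compose[OF _ \<phi>_meas] borel_measurable_sum borel_measurable_times entry) auto
   define \<rho> where "\<rho> i d w = - (\<Sum>a\<in>S i. w a * u' i a (cs ! d) x)" for i d and w :: "'a => real"
   have \<rho>m: "\<rho> i d \<in> borel_measurable (R i)" for i d
    unfolding \<rho>_def by (intro borel_measurable_uminus borel_measurable_sum borel_measurable_times entry) auto
   define \<rho>' where "\<rho>' i d z = (\<Sum>c<n. sdeg bl \<delta> i c * L c d x * z c)" for i d and z :: "nat => real"
   define \<mu> where "\<mu> i = density (R i) (\<lambda>w. ennreal (f i w))" for i
   have dm: "(\<lambda>X. eadet n (\<lambda>(i, d). \<rho> i d (X i))) \<in> borel_measurable RR"
    unfolding RR_def by (intro eadet_measurable measurable_component_comp \<rho>m) auto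
   have pm: "(\<lambda>X. \<Prod>i<n. ennreal (f i (X i))) \<in> borel_measurable RR" unfolding RR_def
    by (intro borel_measurable_prod_ennreal measurable_compose[OF _ measurable_ennreal] measurable_component_comp fm) auto
   have "(\<integral>\<^sup>+X. G X x \<partial>RR) = (\<integral>\<^sup>+X. (\<Prod>i<n. ennreal (f i (X i))) * eadet n (\<lambda>(i, d). \<rho> i d (X i)) \<partial>RR)"
    using True by (simp add: G_def f_def g_def g'_def \<rho>_def \<phi>_neg mult.commute)
   also have "\<dots> = (\<integral>\<^sup>+X. eadet n (\<lambda>(i, d). \<rho> i d (X i)) \<partial>density RR (\<lambda>X. \<Prod>i<n. ennreal (f i (X i))))"
    by (rule nn_integral_density[OF pm dm, symmetric])
   also have "density RR (\<lambda>X. \<Prod>i<n. ennreal (f i (X i))) = Pi\<^sub>M {..<n} \<mu>"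
    unfolding \<mu>_def RR_def by (intro PiM_density[symmetric] sfR fm) simp
   also have "(\<integral>\<^sup>+X. eadet n (\<lambda>(i, d). \<rho> i d (X i)) \<partial>Pi\<^sub>M {..<n} \<mu>) =
     (\<Prod>i<n. ennreal (1 / sqrt (2 * pi))) * (\<integral>\<^sup>+Z. eadet n (\<lambda>(i, d). \<rho>' i d (Z i)) \<partial>matG n)"
   proof (rule expected_abs_det_cong)
    show "sigma_finite_measure (\<mu> i)" for i unfolding \<mu>_def by (intro sigma_finite_density_real sfR fm)
    show "sigma_finite_measure (rowG n)" by (rule sf_rowG)
    show "\<rho> i d \<in> borel_measurable (\<mu> i)" for i d using \<rho>m by (simp add: \<mu>_def)
    show "\<rho>' i d \<in> borel_measurable (rowG n)" for i d
     unfolding \<rho>'_def by (intro borel_measurable_sum borel_measurable_times measurable_rowG_entry) auto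
    fix i :: nat and q :: "nat => real" assume i: "i < n"
    define v where "v a = (\<Sum>d<n. u' i a (cs ! d) x * q d)" for a
    have lin: "(\<Sum>d<n. \<rho> i d w * q d) = - (\<Sum>a\<in>S i. v a * w a)" for w
     unfolding \<rho>_def v_def sum_distrib_right sum_negf[symmetric] minus_mult_left
     by (subst sum.swap) (simp add: mult_ac)
    have linm: "(\<lambda>w. ennreal \<bar>\<Sum>d<n. \<rho> i d w * q d\<bar>) \<in> borel_measurable (R i)"
     by (intro measurable_compose[OF _ measurable_ennreal] borel_measurable_abs borel_measurable_sum borel_measurable_times \<rho>m) auto
    have "(\<integral>\<^sup>+w. ennreal \<bar>\<Sum>d<n. \<rho> i d w * q d\<bar> \<partial>\<mu> i) = (\<integral>\<^sup>+w. ennreal (\<bar>\<Sum>a\<in>S i. v a * w a\<bar> * std_normal_density (\<Sum>a\<in>S i. u i a x * w a)) \<partial>R i)"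
     unfolding \<mu>_def nn_integral_density[OF measurable_compose[OF fm measurable_ennreal] linm]
     unfolding lin abs_minus_cancel f_def \<phi>_def
     by (intro nn_integral_cong) (simp add: ennreal_mult[symmetric] mult.commute)
    also have "\<dots> = ennreal (1 / pi * sqrt (\<Sum>c<n. real (\<delta> i (bl ! c)) * (\<Sum>d<n. L c d x * q d)\<^sup>2))"
     unfolding R_def gauss_conditional_abs[OF S \<sigma>] form[OF True i, of q, folded v_def] ..
    also have "\<dots> = ennreal (1 / sqrt (2 * pi)) * ennreal (sqrt (2 / pi) * sqrt (\<Sum>c<n. (sdeg bl \<delta> i c * (\<Sum>d<n. L c d x * q d))\<^sup>2))"
    proof -
     \<comment> \<open>The factor \<open>sqrt (2 / pi)\<close> belongs to the absolute moment of a
       normal form, so \<open>1 / sqrt (2 * pi)\<close> is what each row contributes.\<close>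
     have "1 / sqrt (2 * pi) * sqrt (2 / pi) = 1 / pi" by (simp add: real_sqrt_mult real_sqrt_divide)
     then show ?thesis
      by (subst ennreal_mult[symmetric]) (auto simp: power_mult_distrib mult.assoc[symmetric] sum_nonneg)
    qed
    also have "\<dots> = ennreal (1 / sqrt (2 * pi)) * (\<integral>\<^sup>+z. ennreal \<bar>\<Sum>d<n. \<rho>' i d z * q d\<bar> \<partial>rowG n)"
    proof -
     have "(\<Sum>d<n. \<rho>' i d z * q d) = (\<Sum>c<n. (sdeg bl \<delta> i c * (\<Sum>d<n. L c d x * q d)) * z c)" for z
      unfolding \<rho>'_def sum_distrib_right sum_distrib_left by (subst sum.swap) (simp add: mult_ac)
     then show ?thesis unfolding rowG_abs_form'[symmetric] by simp
    qed
    finally show "(\<integral>\<^sup>+w. ennreal \<bar>\<Sum>d<n. \<rho> i d w * q d\<bar> \<partial>\<mu> i) = ennreal (1 / sqrt (2 * pi)) * (\<integral>\<^sup>+z. ennreal \<bar>\<Sum>d<n. \<rho>' i d z * q d\<bar> \<partial>rowG n)" .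
   qed
   also have "(\<integral>\<^sup>+Z. eadet n (\<lambda>(i, d). \<rho>' i d (Z i)) \<partial>matG n) = expdet bl \<delta> * eadet n (\<lambda>(c, d). L c d x)"
   proof -
    have "det (mat n n (\<lambda>(i, d). \<rho>' i d (Z i))) = det (mat n n (\<lambda>(i, c). sdeg bl \<delta> i c * Z i c)) * det (mat n n (\<lambda>(c, d). L c d x))" for Z
    proof -
     have "mat n n (\<lambda>(i, d). \<rho>' i d (Z i)) = mat n n (\<lambda>(i, c). sdeg bl \<delta> i c * Z i c) * mat n n (\<lambda>(c, d). L c d x)"
      by (intro eq_matI) (auto simp: \<rho>'_def scalar_prod_def atLeast0LessThan mult_ac)
     then show ?thesis by (simp add: det_mult[where n = n])
    qed
    then have "(\<integral>\<^sup>+Z. eadet n (\<lambda>(i, d). \<rho>' i d (Z i)) \<partial>matG n) =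
      (\<integral>\<^sup>+Z. eadet n (\<lambda>(i, c). sdeg bl \<delta> i c * Z i c) * eadet n (\<lambda>(c, d). L c d x) \<partial>matG n)"
     by (simp add: abs_mult ennreal_mult)
    also have "\<dots> = expdet bl \<delta> * eadet n (\<lambda>(c, d). L c d x)" unfolding expdet_def bl
     by (intro nn_integral_multc eadet_measurable borel_measurable_times measurable_matG_entry) auto
    finally show ?thesis .
   qed
   finally show ?thesis using True by (simp add: mult_ac)
  qed (simp add: G_def)
 qed
 also have "\<dots> = (\<integral>\<^sup>+x. indicator A x * (ennreal (1 / sqrt (2 * pi)) ^ n * eadet n (\<lambda>(c, d). L c d x)) \<partial>lebR (set cs)) * expdet bl \<delta>"
  by (intro nn_integral_multc borel_measurable_times_ennreal borel_measurable_indicator Alm borel_measurable_const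
    eadet_measurable L) auto
 finally show ?thesis unfolding RR_def R_def .
qed

section \<open>The covariance kernel of the random polynomials\<close>

text \<open>The truncated exponent \<open>a p - 1\<close> does no harm for \<open>a p = 0\<close>,
  because the term carries the factor \<open>real (a p)\<close>. Nothing is divided by
  \<open>f p s\<close>, so zeros of the factors are allowed.\<close>

lemma has_real_derivative_prod_power:
 fixes f :: "'i => real => real"
 assumes "finite C" "\<And>p. p \<in> C \<Longrightarrow> (f p has_real_derivative f' p) (at s)"
 shows "((\<lambda>t. \<Prod>p\<in>C. f p t ^ a p) has_real_derivative
  (\<Sum>p\<in>C. f' p * (real (a p) * f p s ^ (a p - 1) * (\<Prod>r\<in>C - {p}. f r s ^ a r)))) (at s)" using assms
proof (induction C rule: finite_induct)
 case (insert c C)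
 have "((\<lambda>t. f c t ^ a c * (\<Prod>p\<in>C. f p t ^ a p)) has_real_derivative
   (real (a c) * f c s ^ (a c - 1) * f' c) * (\<Prod>p\<in>C. f p s ^ a p) +
   (\<Sum>p\<in>C. f' p * (real (a p) * f p s ^ (a p - 1) * (\<Prod>r\<in>C - {p}. f r s ^ a r))) * f c s ^ a c) (at s)"
  using insert by (intro DERIV_mult insert.IH) (auto intro!: derivative_eq_intros)
 also have "(\<Sum>p\<in>C. f' p * (real (a p) * f p s ^ (a p - 1) * (\<Prod>r\<in>C - {p}. f r s ^ a r))) * f c s ^ a c =
   (\<Sum>p\<in>C. f' p * (real (a p) * f p s ^ (a p - 1) * (\<Prod>r\<in>insert c C - {p}. f r s ^ a r)))"
  unfolding sum_distrib_right
 proof (rule sum.cong)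
  fix p assume "p \<in> C"
  then have "insert c C - {p} = insert c (C - {p})" using insert.hyps by auto
  then show "f' p * (real (a p) * f p s ^ (a p - 1) * (\<Prod>r\<in>C - {p}. f r s ^ a r)) * f c s ^ a c =
   f' p * (real (a p) * f p s ^ (a p - 1) * (\<Prod>r\<in>insert c C - {p}. f r s ^ a r))" using insert.hyps by (simp add: mult_ac)
 qed simp
 also have "(real (a c) * f c s ^ (a c - 1) * f' c) * (\<Prod>p\<in>C. f p s ^ a p) =
   f' c * (real (a c) * f c s ^ (a c - 1) * (\<Prod>r\<in>insert c C - {c}. f r s ^ a r))"
  using insert.hyps by (simp add: mult_ac)
 finally show ?case using insert.hyps by simp
qed simp

definition degree_fns :: "nat => nat => (nat => nat) set" where
 "degree_fns m d = {\<alpha> \<in> {..m} \<rightarrow>\<^sub>E UNIV. (\<Sum>h\<le>m. \<alpha> h) = d}"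

lemma finite_degree_fns [simp]: "finite (degree_fns m d)"
proof (rule finite_subset)
 show "degree_fns m d \<subseteq> {..m} \<rightarrow>\<^sub>E {..d}"
 proof
  fix \<alpha> assume a: "\<alpha> \<in> degree_fns m d"
  have "\<alpha> h \<le> d" if "h \<le> m" for h using a that member_le_sum[of h "{..m}" \<alpha>] by (auto simp: degree_fns_def)
  then show "\<alpha> \<in> {..m} \<rightarrow>\<^sub>E {..d}" using a by (auto simp: degree_fns_def PiE_def)
 qed
 show "finite ({..m} \<rightarrow>\<^sub>E {..d})" by (intro finite_PiE) auto
qed

text \<open>With factorials divided out, splitting off the exponent \<open>e\<close> of the last
  variable turns the induction step into the binomial theorem.\<close>

lemma multinomial:
 fixes z :: "nat => real"
 shows "(\<Sum>\<alpha>\<in>degree_fns m d. \<Prod>h\<le>m. z h ^ \<alpha> h / fact (\<alpha> h)) = (\<Sum>h\<le>m. z h) ^ d / fact d"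
proof (induction m arbitrary: d)
 case 0
 have "degree_fns 0 d = {\<lambda>h\<in>{..0}. d}" by (auto simp: degree_fns_def PiE_def extensional_def fun_eq_iff)
 then show ?case by simp
next
 case (Suc m)
 have "(\<Sum>\<alpha>\<in>degree_fns (Suc m) d. \<Prod>h\<le>Suc m. z h ^ \<alpha> h / fact (\<alpha> h)) =
   (\<Sum>(e, \<alpha>)\<in>(SIGMA e:{..d}. degree_fns m (d - e)). (\<Prod>h\<le>m. z h ^ \<alpha> h / fact (\<alpha> h)) * (z (Suc m) ^ e / fact e))"
 proof (rule sum.reindex_bij_witness[where i = "\<lambda>(e, \<alpha>). \<alpha>(Suc m := e)" and j = "\<lambda>\<alpha>. (\<alpha> (Suc m), restrict \<alpha> {..m})"])
  fix \<alpha> assume a: "\<alpha> \<in> degree_fns (Suc m) d"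
  show "(case (\<alpha> (Suc m), restrict \<alpha> {..m}) of (e, \<alpha>) => \<alpha>(Suc m := e)) = \<alpha>"
   using a by (auto simp: degree_fns_def PiE_def extensional_def fun_eq_iff)
  show "(\<alpha> (Suc m), restrict \<alpha> {..m}) \<in> (SIGMA e:{..d}. degree_fns m (d - e))"
   using a by (auto simp: degree_fns_def)
  show "(case (\<alpha> (Suc m), restrict \<alpha> {..m}) of (e, \<alpha>) => (\<Prod>h\<le>m. z h ^ \<alpha> h / fact (\<alpha> h)) * (z (Suc m) ^ e / fact e)) =
    (\<Prod>h\<le>Suc m. z h ^ \<alpha> h / fact (\<alpha> h))" by simp next
  fix p assume p: "p \<in> (SIGMA e:{..d}. degree_fns m (d - e))"
  obtain e \<alpha> where ea: "p = (e, \<alpha>)" by (cases p)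
  have e: "e \<le> d" "(\<Sum>h\<le>m. \<alpha> h) = d - e" "\<alpha> \<in> {..m} \<rightarrow>\<^sub>E UNIV" using p ea by (auto simp: degree_fns_def)
  show "((case p of (e, \<alpha>) => \<alpha>(Suc m := e)) (Suc m), restrict (case p of (e, \<alpha>) => \<alpha>(Suc m := e)) {..m}) = p"
   using e(3) by (auto simp: ea PiE_def extensional_def fun_eq_iff)
  then show "(case p of (e, \<alpha>) => \<alpha>(Suc m := e)) \<in> degree_fns (Suc m) d"
   using e by (auto simp: ea degree_fns_def PiE_def extensional_def)
 qed
 also have "\<dots> = (\<Sum>e\<le>d. (\<Sum>\<alpha>\<in>degree_fns m (d - e). \<Prod>h\<le>m. z h ^ \<alpha> h / fact (\<alpha> h)) * (z (Suc m) ^ e / fact e))"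
  by (subst sum.Sigma[symmetric]) (auto simp: sum_distrib_right sum_divide_distrib)
 also have "\<dots> = (\<Sum>e\<le>d. real (d choose e) * z (Suc m) ^ e * (\<Sum>h\<le>m. z h) ^ (d - e)) / fact d"
  unfolding Suc.IH sum_divide_distrib by (intro sum.cong refl) (simp add: binomial_fact field_simps)
 also have "\<dots> = (z (Suc m) + (\<Sum>h\<le>m. z h)) ^ d / fact d" unfolding binomial_ring ..
 finally show ?case by (simp add: add.commute)
qed

lemma exponents_degree_fns: "exponents k nv d = (\<Pi>\<^sub>E j\<in>{..<k}. degree_fns (nv j) (d j))"
 by (simp add: exponents_def degree_fns_def)

lemma finite_exponents [simp]: "finite (exponents k nv d)"
 unfolding exponents_degree_fns by (intro finite_PiE) auto

lemma eta_pos: "eta k nv a > 0" unfolding eta_def by (intro prod_pos) (auto intro!: divide_pos_pos prod_pos)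

text \<open>The variances \<open>inverse (eta k nv a)\<close> are products of multinomial
  coefficients, so the weighted sum over monomials factors into powers of sums. With
  \<open>w j h\<close> a product of two coordinates this is the covariance kernel, a function of
  inner products alone.\<close>

lemma kernel_sum:
 fixes w :: "nat => nat => real"
 shows "(\<Sum>a\<in>exponents k nv d. inverse (eta k nv a) * (\<Prod>j<k. \<Prod>h\<le>nv j. w j h ^ a j h)) = (\<Prod>j<k. (\<Sum>h\<le>nv j. w j h) ^ d j)"
proof -
 have "(\<Prod>j<k. (\<Sum>h\<le>nv j. w j h) ^ d j) = (\<Prod>j<k. \<Sum>\<alpha>\<in>degree_fns (nv j) (d j). fact (d j) * (\<Prod>h\<le>nv j. w j h ^ \<alpha> h / fact (\<alpha> h)))"
  unfolding sum_distrib_left[symmetric] multinomial by simp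
 also have "\<dots> = (\<Sum>a\<in>exponents k nv d. \<Prod>j<k. fact (d j) * (\<Prod>h\<le>nv j. w j h ^ a j h / fact (a j h)))"
  unfolding exponents_degree_fns by (intro prod_sum_PiE) auto
 also have "\<dots> = (\<Sum>a\<in>exponents k nv d. inverse (eta k nv a) * (\<Prod>j<k. \<Prod>h\<le>nv j. w j h ^ a j h))"
 proof (rule sum.cong)
  fix a assume a: "a \<in> exponents k nv d"
  have "inverse (eta k nv a) = (\<Prod>j<k. fact (d j) / (\<Prod>h\<le>nv j. fact (a j h)))"
   using a by (auto simp: eta_def prod_inversef[symmetric] exponents_def PiE_iff intro!: prod.cong)
  then show "(\<Prod>j<k. fact (d j) * (\<Prod>h\<le>nv j. w j h ^ a j h / fact (a j h))) = inverse (eta k nv a) * (\<Prod>j<k. \<Prod>h\<le>nv j. w j h ^ a j h)"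
   by (simp add: prod.distrib[symmetric] prod_dividef)
 qed simp
 finally show ?thesis ..
qed

definition pairs :: "nat => (nat => nat) => (nat \<times> nat) set" where
 "pairs k nv = (SIGMA j:{..<k}. {..nv j})"

definition monom_eval :: "nat => (nat => nat) => (nat => nat => nat) => (nat \<times> nat => real) => real" where
 "monom_eval k nv a y = (\<Prod>p\<in>pairs k nv. y p ^ a (fst p) (snd p))"

definition mono_deriv :: "nat => (nat => nat) => (nat => nat => nat) => nat \<times> nat => (nat \<times> nat => real) => real" where
 "mono_deriv k nv a p y = real (a (fst p) (snd p)) * y p ^ (a (fst p) (snd p) - 1) * (\<Prod>r\<in>pairs k nv - {p}. y r ^ a (fst r) (snd r))"

lemma finite_pairs [simp]: "finite (pairs k nv)" by (simp add: pairs_def)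

lemma monom_alt: "monom_eval k nv a y = (\<Prod>j<k. \<Prod>h\<le>nv j. y (j, h) ^ a j h)"
 unfolding monom_eval_def pairs_def by (subst prod.Sigma) (auto simp: case_prod_beta)

lemma mono_has_derivative:
 assumes "\<And>p. p \<in> pairs k nv \<Longrightarrow> ((\<lambda>t. f t p) has_real_derivative f' p) (at s)"
 shows "((\<lambda>t. monom_eval k nv a (f t)) has_real_derivative (\<Sum>p\<in>pairs k nv. f' p * mono_deriv k nv a p (f s))) (at s)"
 unfolding monom_eval_def mono_deriv_def
 by (rule has_real_derivative_prod_power[of _ "\<lambda>p t. f t p"]) (use assms in auto)

lemma kernel_mono:
 "(\<Sum>a\<in>exponents k nv d. inverse (eta k nv a) * (monom_eval k nv a y * monom_eval k nv a z)) = (\<Prod>j<k. (\<Sum>h\<le>nv j. y (j, h) * z (j, h)) ^ d j)"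
 unfolding monom_alt prod.distrib[symmetric] power_mult_distrib[symmetric] kernel_sum ..

text \<open>The two derivatives at the origin of \<open>F(s, t) = K(y + s q, y + t q)\<close>, where \<open>K\<close> is the
 covariance kernel of the random polynomial; together they give the second mixed derivative of \<open>ln K\<close>.\<close>

lemma kernel_form:
 fixes y q :: "nat \<times> nat => real" and d nv :: "nat => nat" and k :: nat
 defines "S j \<equiv> (\<Sum>h\<le>nv j. (y (j, h))\<^sup>2)" and "B j \<equiv> (\<Sum>h\<le>nv j. y (j, h) * q (j, h))" and "C j \<equiv> (\<Sum>h\<le>nv j. (q (j, h))\<^sup>2)"
 defines "v a \<equiv> (\<Sum>p\<in>pairs k nv. q p * mono_deriv k nv a p y)"
 defines "N \<equiv> (\<Sum>a\<in>exponents k nv d. inverse (eta k nv a) * (monom_eval k nv a y)\<^sup>2)"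
 assumes S: "\<And>j. j < k \<Longrightarrow> S j > 0"
 shows "(\<Sum>a\<in>exponents k nv d. inverse (eta k nv a) * (v a)\<^sup>2) / N - ((\<Sum>a\<in>exponents k nv d. inverse (eta k nv a) * monom_eval k nv a y * v a) / N)\<^sup>2 =
  (\<Sum>j<k. real (d j) * (C j / S j - (B j)\<^sup>2 / (S j)\<^sup>2))" proof - define E where "E = exponents k nv d"
 define w where "w a = inverse (eta k nv a)" for a
 define P where "P s = (\<Prod>j<k. (S j + s * B j) ^ d j)" for s
 define \<beta> where "\<beta> = (\<Sum>j<k. real (d j) * (B j / S j))"
 have dm: "((\<lambda>t. monom_eval k nv a (\<lambda>p. y p + t * q p)) has_real_derivative v a) (at 0)" for a
 proof -
  have "((\<lambda>t. y p + t * q p) has_real_derivative q p) (at 0)" for p by (auto intro!: derivative_eq_intros)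
  from mono_has_derivative[of k nv "\<lambda>t p. y p + t * q p" q 0 a, OF this] show ?thesis by (simp add: v_def)
 qed
 \<comment> \<open>The kernel at two points of the line through \<open>y\<close> in direction
   \<open>q\<close>; the inner product of block \<open>j\<close> is affine in \<open>s\<close> and
   in \<open>t\<close>.\<close>
 have F: "(\<Sum>a\<in>E. w a * (monom_eval k nv a (\<lambda>p. y p + s * q p) * monom_eval k nv a (\<lambda>p. y p + t * q p))) =
   (\<Prod>j<k. (S j + s * B j + t * (B j + s * C j)) ^ d j)" for s t unfolding E_def w_def kernel_mono
 proof (intro prod.cong arg_cong2[where f = power] refl)
  fix j
  have "(\<Sum>h\<le>nv j. (y (j, h) + s * q (j, h)) * (y (j, h) + t * q (j, h))) =
   (\<Sum>h\<le>nv j. (y (j, h))\<^sup>2 + s * (y (j, h) * q (j, h)) + (t * (y (j, h) * q (j, h)) + t * (s * (q (j, h))\<^sup>2)))"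
   by (intro sum.cong) (auto simp: power2_eq_square algebra_simps)
  also have "\<dots> = S j + s * B j + (t * B j + t * (s * C j))"
   by (simp only: S_def B_def C_def sum.distrib sum_distrib_left)
  finally show "(\<Sum>h\<le>nv j. (y (j, h) + s * q (j, h)) * (y (j, h) + t * q (j, h))) = S j + s * B j + t * (B j + s * C j)"
   by (simp add: algebra_simps)
 qed
 \<comment> \<open>Derivative of \<open>F\<close> in \<open>t\<close> at 0 with the factor
   \<open>P s\<close> split off; the quotients that this creates are the reason for demanding
   positivity.\<close>
 have G: "(\<Sum>a\<in>E. w a * (monom_eval k nv a (\<lambda>p. y p + s * q p) * v a)) =
   P s * (\<Sum>j<k. real (d j) * ((B j + s * C j) / (S j + s * B j)))" if s: "\<And>j. j < k \<Longrightarrow> S j + s * B j > 0" for s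
 proof -
  have 1: "((\<lambda>t. \<Sum>a\<in>E. w a * (monom_eval k nv a (\<lambda>p. y p + s * q p) * monom_eval k nv a (\<lambda>p. y p + t * q p))) has_real_derivative
    (\<Sum>a\<in>E. w a * (monom_eval k nv a (\<lambda>p. y p + s * q p) * v a))) (at 0)"
   by (intro DERIV_sum DERIV_cmult dm)
  have 2: "((\<lambda>t. \<Prod>j<k. (S j + s * B j + t * (B j + s * C j)) ^ d j) has_real_derivative
    (\<Sum>j<k. (B j + s * C j) * (real (d j) * (S j + s * B j + 0 * (B j + s * C j)) ^ (d j - 1) *
     (\<Prod>r\<in>{..<k} - {j}. (S r + s * B r + 0 * (B r + s * C r)) ^ d r)))) (at 0)"
   by (rule has_real_derivative_prod_power) (auto intro!: derivative_eq_intros)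
  have "(\<Sum>a\<in>E. w a * (monom_eval k nv a (\<lambda>p. y p + s * q p) * v a)) =
    (\<Sum>j<k. (B j + s * C j) * (real (d j) * (S j + s * B j + 0 * (B j + s * C j)) ^ (d j - 1) *
     (\<Prod>r\<in>{..<k} - {j}. (S r + s * B r + 0 * (B r + s * C r)) ^ d r)))"
   using DERIV_unique[OF 1[unfolded F] 2] .
  also have "\<dots> = (\<Sum>j<k. P s * (real (d j) * ((B j + s * C j) / (S j + s * B j))))"
  proof (rule sum.cong)
   fix j assume j: "j \<in> {..<k}"
   have P: "P s = (S j + s * B j) ^ d j * (\<Prod>r\<in>{..<k} - {j}. (S r + s * B r) ^ d r)"
    unfolding P_def using j by (subst prod.remove[of _ j]) auto
   show "(B j + s * C j) * (real (d j) * (S j + s * B j + 0 * (B j + s * C j)) ^ (d j - 1) *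
     (\<Prod>r\<in>{..<k} - {j}. (S r + s * B r + 0 * (B r + s * C r)) ^ d r)) = P s * (real (d j) * ((B j + s * C j) / (S j + s * B j)))"
   proof (cases "d j")
    case (Suc m)
    then show ?thesis using s[of j] j unfolding P by simp
   qed simp
  qed simp
  finally show ?thesis by (simp add: sum_distrib_left)
 qed
 have N: "N = P 0" unfolding N_def P_def using F[of 0 0] by (simp add: E_def w_def power2_eq_square)
 have Np: "N > 0" unfolding N P_def using S by (intro prod_pos) auto
 have uv: "(\<Sum>a\<in>E. w a * (monom_eval k nv a y * v a)) = N * \<beta>" using G[of 0] S by (simp add: N \<beta>_def)
 have dP: "(P has_real_derivative N * \<beta>) (at 0)"
 proof -
  have "(P has_real_derivative (\<Sum>j<k. B j * (real (d j) * (S j + 0 * B j) ^ (d j - 1) * (\<Prod>r\<in>{..<k} - {j}. (S r + 0 * B r) ^ d r)))) (at 0)"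
   unfolding P_def by (rule has_real_derivative_prod_power) (auto intro!: derivative_eq_intros)
  also have "(\<Sum>j<k. B j * (real (d j) * (S j + 0 * B j) ^ (d j - 1) * (\<Prod>r\<in>{..<k} - {j}. (S r + 0 * B r) ^ d r))) = N * \<beta>"
   unfolding \<beta>_def sum_distrib_left
  proof (rule sum.cong)
   fix j assume j: "j \<in> {..<k}"
   have P: "N = S j ^ d j * (\<Prod>r\<in>{..<k} - {j}. S r ^ d r)"
    unfolding N P_def using j by (subst prod.remove[of _ j]) auto
   show "B j * (real (d j) * (S j + 0 * B j) ^ (d j - 1) * (\<Prod>r\<in>{..<k} - {j}. (S r + 0 * B r) ^ d r)) = N * (real (d j) * (B j / S j))"
   proof (cases "d j")
    case (Suc m)
    then show ?thesis using S[of j] j unfolding P by simp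
   qed simp
  qed simp
  finally show ?thesis .
 qed
 \<comment> \<open>Positivity at 0 persists nearby, so the formula \<open>G\<close> may be
   differentiated in \<open>s\<close> at 0.\<close>
 have ev: "\<forall>\<^sub>F s in nhds 0. \<forall>j<k. S j + s * B j > 0"
 proof -
  have "\<forall>\<^sub>F s in nhds 0. S j + s * B j > 0" if "j < k" for j
  proof (rule order_tendstoD(1))
   show "((\<lambda>s. S j + s * B j) \<longlongrightarrow> S j + 0 * B j) (nhds 0)" by (intro tendsto_intros filterlim_ident)
  qed (use S that in simp)
  then have "\<forall>\<^sub>F s in nhds 0. \<forall>j\<in>{..<k}. S j + s * B j > 0" by (intro eventually_ball_finite) auto
  then show ?thesis by (rule eventually_mono) auto
 qed
 have vv: "(\<Sum>a\<in>E. w a * (v a)\<^sup>2) = N * \<beta> * \<beta> + N * (\<Sum>j<k. real (d j) * (C j / S j - (B j)\<^sup>2 / (S j)\<^sup>2))"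
 proof -
  have 1: "((\<lambda>s. \<Sum>a\<in>E. w a * (monom_eval k nv a (\<lambda>p. y p + s * q p) * v a)) has_real_derivative (\<Sum>a\<in>E. w a * (v a * v a))) (at 0)"
   by (intro DERIV_sum DERIV_cmult DERIV_cmult_right dm)
  have "((\<lambda>s. P s * (\<Sum>j<k. real (d j) * ((B j + s * C j) / (S j + s * B j)))) has_real_derivative
    N * \<beta> * (\<Sum>j<k. real (d j) * ((B j + 0 * C j) / (S j + 0 * B j))) +
    (\<Sum>j<k. real (d j) * ((C j * (S j + 0 * B j) - (B j + 0 * C j) * B j) / ((S j + 0 * B j) * (S j + 0 * B j)))) * P 0) (at 0)"
   using S by (intro DERIV_mult dP DERIV_sum DERIV_cmult DERIV_divide) (auto intro!: derivative_eq_intros simp: less_imp_neq[THEN not_sym])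
  then have 2: "((\<lambda>s. \<Sum>a\<in>E. w a * (monom_eval k nv a (\<lambda>p. y p + s * q p) * v a)) has_real_derivative
    N * \<beta> * (\<Sum>j<k. real (d j) * ((B j + 0 * C j) / (S j + 0 * B j))) +
    (\<Sum>j<k. real (d j) * ((C j * (S j + 0 * B j) - (B j + 0 * C j) * B j) / ((S j + 0 * B j) * (S j + 0 * B j)))) * P 0) (at 0)"
   by (rule DERIV_cong_ev[THEN iffD1, rotated -1]) (use ev in \<open>auto elim!: eventually_mono simp: G\<close>)
  have "(\<Sum>j<k. real (d j) * ((C j * (S j + 0 * B j) - (B j + 0 * C j) * B j) / ((S j + 0 * B j) * (S j + 0 * B j)))) =
    (\<Sum>j<k. real (d j) * (C j / S j - (B j)\<^sup>2 / (S j)\<^sup>2))" proof (intro sum.cong refl)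
   fix j assume "j \<in> {..<k}"
   then show "real (d j) * ((C j * (S j + 0 * B j) - (B j + 0 * C j) * B j) / ((S j + 0 * B j) * (S j + 0 * B j))) =
    real (d j) * (C j / S j - (B j)\<^sup>2 / (S j)\<^sup>2)" by (simp add: power2_eq_square diff_divide_distrib) qed
  then show ?thesis using DERIV_unique[OF 1 2] by (simp add: N \<beta>_def power2_eq_square mult.commute)
 qed
 have "(\<Sum>a\<in>E. w a * monom_eval k nv a y * v a) / N = \<beta>" using uv Np by (simp add: mult.assoc)
 moreover have "(\<Sum>a\<in>E. w a * (v a)\<^sup>2) / N = \<beta>\<^sup>2 + (\<Sum>j<k. real (d j) * (C j / S j - (B j)\<^sup>2 / (S j)\<^sup>2))"
  unfolding vv using Np by (simp add: power2_eq_square add_divide_distrib)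
 ultimately show ?thesis by (simp add: E_def w_def)
qed

text \<open>On each block \<open>Lmat\<close> is the symmetric square root of the Fubini--Study form
 \<open>|q|\<^sup>2 / s - \<langle>x, q\<rangle>\<^sup>2 / s\<^sup>2\<close>, where \<open>s = 1 + |x|\<^sup>2\<close>.\<close>

definition blocksq :: "nat list => nat => (nat => real) => real" where
 "blocksq bl j z = 1 + (\<Sum>e\<in>blockset bl j. (z e)\<^sup>2)"

definition Lmat :: "nat list => nat => nat => (nat => real) => real" where
 "Lmat bl c d z = (of_bool (c = d) - of_bool (bl ! c = bl ! d) * z c * z d /
   (sqrt (blocksq bl (bl ! c) z) * (sqrt (blocksq bl (bl ! c) z) + 1))) / sqrt (blocksq bl (bl ! c) z)" 
lemma Lmat_form:
 assumes "c < length bl"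
 shows "(\<Sum>d<length bl. Lmat bl c d z * q d) = (q c - z c * (\<Sum>d\<in>blockset bl (bl ! c). z d * q d) /
   (sqrt (blocksq bl (bl ! c) z) * (sqrt (blocksq bl (bl ! c) z) + 1))) / sqrt (blocksq bl (bl ! c) z)"
proof -
 define r where "r = sqrt (blocksq bl (bl ! c) z)"
 have b: "(\<Sum>d\<in>blockset bl (bl ! c). z d * q d) = (\<Sum>d<length bl. of_bool (bl ! c = bl ! d) * (z d * q d))"
  by (rule sum.mono_neutral_cong_left) (auto simp: blockset_def)
 have "(\<Sum>d<length bl. Lmat bl c d z * q d) = (\<Sum>d<length bl. (of_bool (c = d) * q d - z c * (of_bool (bl ! c = bl ! d) * (z d * q d)) / (r * (r + 1))) / r)"
  unfolding Lmat_def r_def[symmetric] by (intro sum.cong refl) (simp add: left_diff_distrib right_diff_distrib mult_ac)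
 also have "\<dots> = ((\<Sum>d<length bl. of_bool (c = d) * q d) - z c * (\<Sum>d<length bl. of_bool (bl ! c = bl ! d) * (z d * q d)) / (r * (r + 1))) / r"
  by (simp only: sum_subtractf sum_divide_distrib[symmetric] sum_distrib_left[symmetric])
 also have "(\<Sum>d<length bl. of_bool (c = d) * q d) = q c" by (rule sum_of_bool_lessThan(4)[OF assms])
 finally show ?thesis unfolding b r_def .
qed

text \<open>With \<open>r = sqrt s\<close> the number \<open>\<theta> = 1 / (r * (r + 1))\<close>
  satisfies \<open>2 * \<theta> - \<theta>\<^sup>2 * (s - 1) = 1 / s\<close>, where
  \<open>s - 1\<close> is the squared length of \<open>z\<close> in the block. This is exactly what
  squaring the identity minus \<theta> times the rank-one matrix of \<open>z\<close>
  requires.\<close>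

lemma Lmat_square_sum:
 "(\<Sum>c<length bl. D (bl ! c) * (\<Sum>d<length bl. Lmat bl c d z * q d)\<^sup>2) =
  (\<Sum>j\<in>set bl. D j * ((\<Sum>c\<in>blockset bl j. (q c)\<^sup>2) / blocksq bl j z - (\<Sum>c\<in>blockset bl j. z c * q c)\<^sup>2 / (blocksq bl j z)\<^sup>2))"
proof (rule trans[OF sum_blocks], rule sum.cong)
 fix j assume "j \<in> set bl"
 define s where "s = blocksq bl j z"
 define r where "r = sqrt s"
 define b where "b = (\<Sum>c\<in>blockset bl j. z c * q c)"
 define \<theta> where "\<theta> = 1 / (r * (r + 1))"
 have s1: "s \<ge> 1" by (simp add: s_def blocksq_def sum_nonneg)
 then have r: "r \<ge> 1" "r\<^sup>2 = s" by (auto simp: r_def)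
 have zz: "(\<Sum>c\<in>blockset bl j. (z c)\<^sup>2) = s - 1" by (simp add: s_def blocksq_def)
 have "(\<Sum>c\<in>blockset bl j. D (bl ! c) * (\<Sum>d<length bl. Lmat bl c d z * q d)\<^sup>2) =
   (\<Sum>c\<in>blockset bl j. D j / s * ((q c)\<^sup>2 - 2 * \<theta> * b * (z c * q c) + (\<theta> * b)\<^sup>2 * (z c)\<^sup>2))"
 proof (rule sum.cong)
  fix c assume c: "c \<in> blockset bl j"
  then have cl: "c < length bl" "bl ! c = j" by (auto simp: blockset_def)
  have "(\<Sum>d<length bl. Lmat bl c d z * q d) = (q c - \<theta> * b * z c) / r"
   unfolding Lmat_form[OF cl(1)] cl(2) b_def[symmetric] s_def[symmetric] r_def[symmetric] \<theta>_def by simp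
  then have "(\<Sum>d<length bl. Lmat bl c d z * q d)\<^sup>2 = (q c - \<theta> * b * z c)\<^sup>2 / s" by (simp add: power_divide r(2))
  also have "(q c - \<theta> * b * z c)\<^sup>2 = (q c)\<^sup>2 - 2 * \<theta> * b * (z c * q c) + (\<theta> * b)\<^sup>2 * (z c)\<^sup>2"
   by (simp add: power2_eq_square algebra_simps)
  finally show "D (bl ! c) * (\<Sum>d<length bl. Lmat bl c d z * q d)\<^sup>2 = D j / s * ((q c)\<^sup>2 - 2 * \<theta> * b * (z c * q c) + (\<theta> * b)\<^sup>2 * (z c)\<^sup>2)"
   by (simp add: cl(2))
 qed simp
 also have "\<dots> = D j / s * ((\<Sum>c\<in>blockset bl j. (q c)\<^sup>2) - 2 * \<theta> * b * b + (\<theta> * b)\<^sup>2 * (s - 1))"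
  unfolding sum_distrib_left[symmetric] sum.distrib sum_subtractf zz b_def ..
 also have "2 * \<theta> * b * b - (\<theta> * b)\<^sup>2 * (s - 1) = b\<^sup>2 / s"
 proof -
  have "2 * \<theta> - \<theta>\<^sup>2 * (s - 1) = 1 / s"
  proof -
   have "s - 1 = (r - 1) * (r + 1)" by (simp add: r(2)[symmetric] power2_eq_square algebra_simps)
   then have "\<theta>\<^sup>2 * (s - 1) = (r - 1) / (r\<^sup>2 * (r + 1))" by (simp add: \<theta>_def power2_eq_square divide_simps)
   moreover have "2 * \<theta> = 2 * r / (r\<^sup>2 * (r + 1))" by (simp add: \<theta>_def power2_eq_square)
   ultimately have "2 * \<theta> - \<theta>\<^sup>2 * (s - 1) = (2 * r - (r - 1)) / (r\<^sup>2 * (r + 1))" by (simp only: diff_divide_distrib)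
   also have "\<dots> = 1 / r\<^sup>2" using r(1) by simp
   finally show ?thesis by (simp add: r(2))
  qed
  then have "(2 * \<theta> - \<theta>\<^sup>2 * (s - 1)) * b\<^sup>2 = 1 / s * b\<^sup>2" by simp
  then show ?thesis by (simp add: power2_eq_square algebra_simps)
 qed
 then have "(\<Sum>c\<in>blockset bl j. (q c)\<^sup>2) - 2 * \<theta> * b * b + (\<theta> * b)\<^sup>2 * (s - 1) = (\<Sum>c\<in>blockset bl j. (q c)\<^sup>2) - b\<^sup>2 / s" by linarith
 finally show "(\<Sum>c\<in>blockset bl j. D (bl ! c) * (\<Sum>d<length bl. Lmat bl c d z * q d)\<^sup>2) =
   D j * ((\<Sum>c\<in>blockset bl j. (q c)\<^sup>2) / blocksq bl j z - (\<Sum>c\<in>blockset bl j. z c * q c)\<^sup>2 / (blocksq bl j z)\<^sup>2)"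
  unfolding s_def[symmetric] b_def[symmetric] by (simp add: diff_divide_distrib right_diff_distrib power2_eq_square)
qed simp

section \<open>The coefficient law and the standard affine charts\<close>

text \<open>The coefficient law is indexed by pairs \<open>(i, a)\<close>, whereas
  \<open>kac_rice\<close> wants one distinguished variable per equation and the others grouped by
  rows. \<open>T\<close> reassembles a system from these two parts.\<close>

lemma PiM_Sigma_split:
 fixes M :: "nat \<times> 'a => real measure" and S :: "nat => 'a set" and a0 :: "nat => 'a" and n :: nat
 assumes S: "\<And>i. finite (S i)" "\<And>i. a0 i \<notin> S i" and M: "\<And>p. prob_space (M p)"
 defines "J \<equiv> (SIGMA i:{..<n}. insert (a0 i) (S i))"
 defines "N \<equiv> Pi\<^sub>M {..<n} (\<lambda>i. Pi\<^sub>M (S i) (\<lambda>a. M (i, a))) \<Otimes>\<^sub>M Pi\<^sub>M {..<n} (\<lambda>i. M (i, a0 i))"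
 defines "T \<equiv> (\<lambda>(X, Y). \<lambda>p\<in>J. if snd p = a0 (fst p) then Y (fst p) else X (fst p) (snd p))"
 shows "T \<in> N \<rightarrow>\<^sub>M Pi\<^sub>M J M" "Pi\<^sub>M J M = distr N (Pi\<^sub>M J M) T"
proof -
 interpret M: product_sigma_finite M using M by (simp add: product_sigma_finite_def prob_space_imp_sigma_finite)
 define R where "R = (\<lambda>i. Pi\<^sub>M (S i) (\<lambda>a. M (i, a)))"
 have pR: "prob_space (R i)" for i unfolding R_def by (intro prob_space_PiM M)
 interpret R: product_sigma_finite R using pR by (simp add: product_sigma_finite_def prob_space_imp_sigma_finite)
 interpret Y: product_sigma_finite "\<lambda>i. M (i, a0 i)" using M by (simp add: product_sigma_finite_def prob_space_imp_sigma_finite)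
 have N: "N = Pi\<^sub>M {..<n} R \<Otimes>\<^sub>M Pi\<^sub>M {..<n} (\<lambda>i. M (i, a0 i))" by (simp add: N_def R_def)
 have sfY: "sigma_finite_measure (Pi\<^sub>M {..<n} (\<lambda>i. M (i, a0 i)))"
  by (intro prob_space_imp_sigma_finite prob_space_PiM M)
 have finJ: "finite J" unfolding J_def using S(1) by auto
 have mT: "(\<lambda>w. T w p) \<in> N \<rightarrow>\<^sub>M M p" if p: "p \<in> J" for p
 proof -
  obtain i a where ia: "p = (i, a)" "i < n" "a = a0 i \<or> a \<in> S i" using p by (auto simp: J_def)
  show ?thesis
  proof (cases "a = a0 i")
   case True
   have "(\<lambda>w. snd w i) \<in> N \<rightarrow>\<^sub>M M (i, a0 i)"
    unfolding N using ia(2) by (intro measurable_compose[OF measurable_snd, of "\<lambda>y. y i"]) (auto intro!: measurable_component_singleton)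
   then show ?thesis using p True by (simp add: T_def ia(1) case_prod_beta)
  next
   case False
   then have a: "a \<in> S i" using ia(3) by simp
   have "(\<lambda>w. fst w i a) \<in> N \<rightarrow>\<^sub>M M (i, a)"
   proof -
    have 1: "(\<lambda>X. X i) \<in> Pi\<^sub>M {..<n} R \<rightarrow>\<^sub>M R i" using ia(2) by (intro measurable_component_singleton) simp
    have 2: "(\<lambda>w. w a) \<in> R i \<rightarrow>\<^sub>M M (i, a)" unfolding R_def using a by (rule measurable_component_singleton)
    from measurable_compose[OF measurable_fst measurable_compose[OF 1 2]] show ?thesis unfolding N .
   qed
   then show ?thesis using p False by (simp add: T_def ia(1) case_prod_beta)
  qed
 qed
 show mTT: "T \<in> N \<rightarrow>\<^sub>M Pi\<^sub>M J M"
 proof -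
  have "(\<lambda>w. \<lambda>p\<in>J. T w p) \<in> N \<rightarrow>\<^sub>M Pi\<^sub>M J M" by (rule measurable_restrict[OF mT])
  moreover have "(\<lambda>w. \<lambda>p\<in>J. T w p) = T" by (auto simp: T_def fun_eq_iff)
  ultimately show ?thesis by simp
 qed
 show "Pi\<^sub>M J M = distr N (Pi\<^sub>M J M) T"
 proof (rule M.PiM_eqI[OF finJ, symmetric])
  fix A assume A: "\<And>p. p \<in> J \<Longrightarrow> A p \<in> sets (M p)"
  define B where "B i = Pi\<^sub>E (S i) (\<lambda>a. A (i, a))" for i
  have Bs: "B i \<in> sets (R i)" if "i < n" for i
   unfolding B_def R_def using S A that by (intro sets_PiM_I_finite) (auto simp: J_def)
  have As: "A (i, a0 i) \<in> sets (M (i, a0 i))" if "i < n" for i using A that by (auto simp: J_def)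
  have "T -` Pi\<^sub>E J A \<inter> space N = Pi\<^sub>E {..<n} B \<times> Pi\<^sub>E {..<n} (\<lambda>i. A (i, a0 i))"
  proof (rule Set.set_eqI)
   fix w :: "(nat => 'a => real) \<times> (nat => real)"
   obtain X Y where w: "w = (X, Y)" by (cases w)
   have T: "T w p = (if snd p = a0 (fst p) then Y (fst p) else X (fst p) (snd p))" if "p \<in> J" for p
    using that by (simp add: T_def w)
   have Text: "T w \<in> extensional J" by (simp add: T_def w)
   have sp: "w \<in> space N \<longleftrightarrow> X \<in> (\<Pi>\<^sub>E i\<in>{..<n}. \<Pi>\<^sub>E a\<in>S i. space (M (i, a))) \<and> Y \<in> (\<Pi>\<^sub>E i\<in>{..<n}. space (M (i, a0 i)))"
    by (simp add: N w space_pair_measure space_PiM R_def)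
   have "T w \<in> Pi\<^sub>E J A \<longleftrightarrow> (\<forall>i<n. Y i \<in> A (i, a0 i) \<and> (\<forall>a\<in>S i. X i a \<in> A (i, a)))"
    using Text T S(2) unfolding PiE_iff J_def by (fastforce split: if_splits)
   moreover have "X \<in> Pi\<^sub>E {..<n} B" "Y \<in> Pi\<^sub>E {..<n} (\<lambda>i. A (i, a0 i))"
    if "\<forall>i<n. Y i \<in> A (i, a0 i) \<and> (\<forall>a\<in>S i. X i a \<in> A (i, a))" "w \<in> space N"
    using that unfolding sp B_def by (auto simp: PiE_iff)
   moreover have "w \<in> space N" if "X \<in> Pi\<^sub>E {..<n} B" "Y \<in> Pi\<^sub>E {..<n} (\<lambda>i. A (i, a0 i))"
   proof -
    have "X i \<in> space (R i)" "Y i \<in> space (M (i, a0 i))" if i: "i < n" for i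
     using PiE_mem[OF \<open>X \<in> Pi\<^sub>E {..<n} B\<close>, of i] PiE_mem[OF \<open>Y \<in> Pi\<^sub>E {..<n} (\<lambda>i. A (i, a0 i))\<close>, of i] i
      sets.sets_into_space[OF Bs[OF i]] sets.sets_into_space[OF As[OF i]] by auto
    then show ?thesis using that unfolding N w space_pair_measure space_PiM by (simp add: PiE_iff)
   qed
   moreover have "\<forall>i<n. Y i \<in> A (i, a0 i) \<and> (\<forall>a\<in>S i. X i a \<in> A (i, a))"
    if "X \<in> Pi\<^sub>E {..<n} B" "Y \<in> Pi\<^sub>E {..<n} (\<lambda>i. A (i, a0 i))" using that by (auto simp: PiE_iff B_def)
   moreover have "w \<in> T -` Pi\<^sub>E J A \<inter> space N \<longleftrightarrow> T w \<in> Pi\<^sub>E J A \<and> w \<in> space N" by simp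
   moreover have "w \<in> Pi\<^sub>E {..<n} B \<times> Pi\<^sub>E {..<n} (\<lambda>i. A (i, a0 i)) \<longleftrightarrow> X \<in> Pi\<^sub>E {..<n} B \<and> Y \<in> Pi\<^sub>E {..<n} (\<lambda>i. A (i, a0 i))"
    unfolding w by (rule mem_Sigma_iff)
   ultimately show "w \<in> T -` Pi\<^sub>E J A \<inter> space N \<longleftrightarrow> w \<in> Pi\<^sub>E {..<n} B \<times> Pi\<^sub>E {..<n} (\<lambda>i. A (i, a0 i))" by argo
  qed
  then have "emeasure (distr N (Pi\<^sub>M J M) T) (Pi\<^sub>E J A) = emeasure N (Pi\<^sub>E {..<n} B \<times> Pi\<^sub>E {..<n} (\<lambda>i. A (i, a0 i)))"
   by (subst emeasure_distr[OF mTT sets_PiM_I_finite[OF finJ A]]) auto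
  also have "\<dots> = emeasure (Pi\<^sub>M {..<n} R) (Pi\<^sub>E {..<n} B) * emeasure (Pi\<^sub>M {..<n} (\<lambda>i. M (i, a0 i))) (Pi\<^sub>E {..<n} (\<lambda>i. A (i, a0 i)))"
   unfolding N using Bs As by (intro sigma_finite_measure.emeasure_pair_measure_Times[OF sfY] sets_PiM_I_finite) auto
  also have "\<dots> = (\<Prod>i<n. emeasure (R i) (B i)) * (\<Prod>i<n. emeasure (M (i, a0 i)) (A (i, a0 i)))"
   using Bs As by (intro arg_cong2[where f = times] R.emeasure_PiM Y.emeasure_PiM) auto
  also have "\<dots> = (\<Prod>i<n. emeasure (M (i, a0 i)) (A (i, a0 i)) * (\<Prod>a\<in>S i. emeasure (M (i, a)) (A (i, a))))"
  proof -
   have "emeasure (R i) (B i) = (\<Prod>a\<in>S i. emeasure (M (i, a)) (A (i, a)))" if i: "i < n" for i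
   proof -
    interpret Q: product_sigma_finite "\<lambda>a. M (i, a)" using M by (simp add: product_sigma_finite_def prob_space_imp_sigma_finite)
    show ?thesis unfolding R_def B_def using A S(1) i by (intro Q.emeasure_PiM) (auto simp: J_def)
   qed
   then show ?thesis by (simp add: prod.distrib mult.commute)
  qed
  also have "\<dots> = (\<Prod>i<n. \<Prod>a\<in>insert (a0 i) (S i). emeasure (M (i, a)) (A (i, a)))"
   using S by (intro prod.cong) auto
  also have "\<dots> = (\<Prod>p\<in>J. emeasure (M p) (A p))"
   unfolding J_def using S(1) by (subst prod.Sigma) (auto simp: case_prod_beta)
  finally show "emeasure (distr N (Pi\<^sub>M J M) T) (Pi\<^sub>E J A) = (\<Prod>p\<in>J. emeasure (M p) (A p))" .
 qed simp
qed

text \<open>Index set of the affine chart in which coordinate \<open>l j\<close> of block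
  \<open>j\<close> is set to 1. Charts other than \<open>l = (\<lambda>_. 0)\<close> serve to
  exclude roots outside that chart.\<close>

definition chart :: "nat => (nat => nat) => (nat => nat) => (nat \<times> nat) set" where
 "chart k nv l = (SIGMA j:{..<k}. {..nv j} - {l j})"

definition embp :: "(nat => nat) => (nat \<times> nat => real) => nat \<times> nat => real" where
 "embp l x p = (if snd p = l (fst p) then 1 else x p)"

definition chart_zeros :: "nat => (nat => nat) => (nat => nat => nat) => (nat => nat) =>
  (nat \<times> (nat => nat => nat) => real) => (nat \<times> nat => real) set" where
 "chart_zeros k nv \<delta> l f = {x \<in> fvec (chart k nv l). \<forall>i<total_dim k nv. poly_eval k nv (\<delta> i) (\<lambda>a. f (i, a)) (\<lambda>j h. embp l x (j, h)) = 0}"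

text \<open>The factor that does not depend on the degrees. Up to the power of \<open>2 * pi\<close>
  the integrand is the product of the Fubini-Study volume densities of the blocks.\<close>

definition chart_mass :: "(nat \<times> nat) list => (nat \<times> nat => real) set => ennreal" where
 "chart_mass cs A = (\<integral>\<^sup>+x. indicator A x * (ennreal (1 / sqrt (2 * pi)) ^ length cs *
   eadet (length cs) (\<lambda>(c, d). Lmat (map fst cs) c d (\<lambda>e. x (cs ! e)))) \<partial>lebR (set cs))" 
lemma chart_iff: "p \<in> chart k nv l \<longleftrightarrow> fst p < k \<and> snd p \<le> nv (fst p) \<and> snd p \<noteq> l (fst p)"
 by (cases p) (auto simp: chart_def)

lemma finite_chart [simp]: "finite (chart k nv l)" by (simp add: chart_def)

lemma card_chart: "(\<And>j. j < k \<Longrightarrow> l j \<le> nv j) \<Longrightarrow> card (chart k nv l) = total_dim k nv"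
 by (simp add: chart_def total_dim_def)

lemma poly_eval_monom: "poly_eval k nv d c (\<lambda>j h. y (j, h)) = (\<Sum>a\<in>exponents k nv d. c a * monom_eval k nv a y)"
 by (simp add: poly_eval_def monom_alt)

lemma blockset_sum:
 fixes F :: "nat \<times> nat => real"
 assumes cs: "distinct cs"
 shows "(\<Sum>d\<in>blockset (map fst cs) j. F (cs ! d)) = (\<Sum>p | p \<in> set cs \<and> fst p = j. F p)"
proof (rule sum.reindex_bij_betw)
 show "bij_betw ((!) cs) (blockset (map fst cs) j) {p. p \<in> set cs \<and> fst p = j}" unfolding bij_betw_def
 proof
  show "inj_on ((!) cs) (blockset (map fst cs) j)"
   using cs by (auto simp: inj_on_def blockset_def nth_eq_iff_index_eq)
  show "(!) cs ` blockset (map fst cs) j = {p. p \<in> set cs \<and> fst p = j}"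
  proof (rule Set.set_eqI)
   fix p
   have "p \<in> (!) cs ` blockset (map fst cs) j \<longleftrightarrow> (\<exists>d<length cs. cs ! d = p \<and> fst (cs ! d) = j)"
   proof -
    have "blockset (map fst cs) j = {d. d < length cs \<and> fst (cs ! d) = j}" by (auto simp: blockset_def)
    then show ?thesis by auto
   qed
   also have "\<dots> \<longleftrightarrow> p \<in> {p. p \<in> set cs \<and> fst p = j}" unfolding in_set_conv_nth mem_Collect_eq by auto
   finally show "p \<in> (!) cs ` blockset (map fst cs) j \<longleftrightarrow> p \<in> {p. p \<in> set cs \<and> fst p = j}" .
  qed
 qed
qed

lemma chart_block_sum:
 fixes F :: "nat \<times> nat => real"
 assumes cs: "distinct cs" "set cs = chart k nv l" and j: "j < k" "l j \<le> nv j"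
 shows "(\<Sum>h\<le>nv j. F (j, h)) = F (j, l j) + (\<Sum>d\<in>blockset (map fst cs) j. F (cs ! d))"
proof -
 have "{p. p \<in> set cs \<and> fst p = j} = Pair j ` ({..nv j} - {l j})" using j by (auto simp: cs(2) chart_def)
 then have "(\<Sum>d\<in>blockset (map fst cs) j. F (cs ! d)) = (\<Sum>h\<in>{..nv j} - {l j}. F (j, h))"
  unfolding blockset_sum[OF cs(1)] by (simp add: sum.reindex inj_on_def)
 then show ?thesis using j by (simp add: sum.remove)
qed

lemma Lmat_measurable:
 assumes "distinct cs" "c < length cs" "d < length cs"
 shows "(\<lambda>x. Lmat (map fst cs) c d (\<lambda>e. x (cs ! e))) \<in> borel_measurable (lebR (set cs))"
proof -
 have e [measurable]: "(\<lambda>x. x (cs ! e)) \<in> borel_measurable (lebR (set cs))" if "e < length cs" for e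
  using that measurable_component_comp[of "\<lambda>x. x" "\<lambda>_. lborel" "cs ! e" "set cs"] by simp
 have [measurable]: "(\<lambda>x. blocksq (map fst cs) j (\<lambda>e. x (cs ! e))) \<in> borel_measurable (lebR (set cs))" for j
  unfolding blocksq_def by (intro borel_measurable_add borel_measurable_const borel_measurable_sum borel_measurable_power e) (simp add: blockset_def)
 then have r: "(\<lambda>x. sqrt (blocksq (map fst cs) j (\<lambda>e. x (cs ! e)))) \<in> borel_measurable (lebR (set cs))" for j
  by measurable
 show ?thesis unfolding Lmat_def using assms
  by (intro borel_measurable_divide borel_measurable_diff borel_measurable_times borel_measurable_add borel_measurable_const r e)
qed

text \<open>In the chart the monomial \<open>a0 i\<close>, the power product of the coordinates set
  to 1, is identically 1, and its coefficient has variance 1: this coefficient is the variable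
  \<open>Y i\<close> of \<open>kac_rice\<close>. Its derivatives along the chart vanish, so it
  contributes only the summand 1 to the kernel, and the required quadratic form is that of
  \<open>kernel_form\<close>.\<close>

lemma expected_chart_zeros:
 fixes \<delta> :: "nat => nat => nat"
 assumes l: "\<And>j. j < k \<Longrightarrow> l j \<le> nv j" and cs: "distinct cs" "set cs = chart k nv l"
  and A: "A \<subseteq> fvec (chart k nv l)" "sigma_compact A"
 shows "(\<integral>\<^sup>+f. ncard (A \<inter> chart_zeros k nv \<delta> l f) \<partial>coeff_law k nv \<delta>) = chart_mass cs A * expdet (map fst cs) \<delta>"
  and "(\<lambda>f. ncard (A \<inter> chart_zeros k nv \<delta> l f)) \<in> borel_measurable (coeff_law k nv \<delta>)"
proof -
 define n where "n = total_dim k nv"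
 have len: "length cs = n" using distinct_card[OF cs(1)] card_chart[OF l] by (simp add: cs(2) n_def)
 define bl where "bl = map fst cs"
 define E where "E i = exponents k nv (\<delta> i)" for i
 define a0 where "a0 i = (\<lambda>j\<in>{..<k}. \<lambda>h\<in>{..nv j}. if h = l j then \<delta> i j else 0)" for i
 define S where "S i = E i - {a0 i}" for i
 define \<sigma> where "\<sigma> a = sqrt (inverse (eta k nv a))" for a
 have \<sigma>pos: "\<sigma> a > 0" and \<sigma>2: "(\<sigma> a)\<^sup>2 = inverse (eta k nv a)" for a
  using eta_pos[of k nv a] by (auto simp: \<sigma>_def)
 have finE: "finite (E i)" for i by (simp add: E_def)
 have a0v: "a0 i j h = (if h = l j then \<delta> i j else 0)" if "j < k" "h \<le> nv j" for i j h
  using that by (simp add: a0_def)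
 have a0sum: "(\<Sum>h\<le>nv j. a0 i j h) = \<delta> i j" if "j < k" for i j
 proof -
  have "(\<Sum>h\<le>nv j. a0 i j h) = (\<Sum>h\<le>nv j. if h = l j then \<delta> i j else 0)" using that by (intro sum.cong a0v) auto
  then show ?thesis using l[OF that] by simp
 qed
 have a0E: "a0 i \<in> E i" for i unfolding E_def exponents_def
 proof (rule PiE_I)
  fix j assume "j \<in> {..<k}"
  then show "a0 i j \<in> {\<alpha> \<in> {..nv j} \<rightarrow>\<^sub>E UNIV. (\<Sum>h\<le>nv j. \<alpha> h) = \<delta> i j}"
   using a0sum[of j i] by (simp add: a0_def)
 qed (simp add: a0_def)
 have ESi: "E i = insert (a0 i) (S i)" for i using a0E by (auto simp: S_def)
 have eta0: "eta k nv (a0 i) = 1" for i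
 proof -
  have "(\<Prod>h\<le>nv j. fact (a0 i j h)) / fact (\<Sum>h\<le>nv j. a0 i j h) = (1::real)" if j: "j < k" for j
  proof -
   have "(\<Prod>h\<le>nv j. fact (a0 i j h) :: real) = (\<Prod>h\<le>nv j. if h = l j then fact (\<delta> i j) else 1)"
    using j by (intro prod.cong) (simp_all add: a0v)
   also have "\<dots> = fact (\<delta> i j)" using l[OF j] by simp
   moreover have "(\<Sum>h\<le>nv j. a0 i j h) = \<delta> i j" by (rule a0sum[OF j])
   ultimately show ?thesis by simp
  qed
  then show ?thesis unfolding eta_def by (intro prod.neutral) auto
 qed
 have u0: "monom_eval k nv (a0 i) (embp l x) = 1" for i x
  unfolding monom_alt using l by (intro prod.neutral ballI) (simp add: a0v embp_def)
 have ud0: "mono_deriv k nv (a0 i) p y = 0" if "p \<in> chart k nv l" for i p y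
  using that unfolding chart_iff mono_deriv_def by (simp add: a0v)
 have sub: "chart k nv l \<subseteq> pairs k nv" by (auto simp: chart_def pairs_def)
 define u where "u a x = monom_eval k nv a (embp l x)" for a x
 define u' where "u' a p x = mono_deriv k nv a p (embp l x)" for a p x
 have embc: "continuous_on UNIV (\<lambda>x. embp l x p)" for p
  unfolding embp_def by (cases "snd p = l (fst p)") (auto intro!: continuous_intros)
 have uc: "continuous_on UNIV (u a)" "continuous_on UNIV (u' a p)" for a p
  unfolding u_def u'_def monom_eval_def mono_deriv_def by (intro continuous_intros embc)+
 have du: "((\<lambda>t. u a (x(c := t))) has_real_derivative u' a c x) (at (x c))" if c: "c \<in> set cs" for a c x
 proof -
  have dp: "((\<lambda>t. embp l (x(c := t)) p) has_real_derivative of_bool (p = c)) (at (x c))" for p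
  proof (cases "p = c")
   case True
   then have "snd p \<noteq> l (fst p)" using c unfolding cs(2) chart_iff by simp
   then show ?thesis by (simp add: embp_def)
  next
   case False
   then have "(\<lambda>t. embp l (x(c := t)) p) = (\<lambda>t. embp l x p)" by (auto simp: embp_def)
   then show ?thesis using False by simp
  qed
  have "((\<lambda>t. u a (x(c := t))) has_real_derivative (\<Sum>p\<in>pairs k nv. of_bool (p = c) * mono_deriv k nv a p (embp l (x(c := x c))))) (at (x c))"
   unfolding u_def by (rule mono_has_derivative[of k nv "\<lambda>t. embp l (x(c := t))" "\<lambda>p. of_bool (p = c)"]) (rule dp)
  moreover have "c \<in> pairs k nv" using c cs(2) sub by auto
  then have "(\<Sum>p\<in>pairs k nv. of_bool (p = c) * mono_deriv k nv a p (embp l x)) = u' a c x"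
   unfolding u'_def by (subst sum.remove[of _ c]) auto
  ultimately show ?thesis by simp
 qed
 have form: "(\<Sum>a\<in>S i. (\<sigma> a * (\<Sum>d<n. u' a (cs ! d) x * q d))\<^sup>2) / (1 + (\<Sum>a\<in>S i. (\<sigma> a * u a x)\<^sup>2)) -
   ((\<Sum>a\<in>S i. (\<sigma> a)\<^sup>2 * u a x * (\<Sum>d<n. u' a (cs ! d) x * q d)) / (1 + (\<Sum>a\<in>S i. (\<sigma> a * u a x)\<^sup>2)))\<^sup>2 =
   (\<Sum>c<n. real (\<delta> i (bl ! c)) * (\<Sum>d<n. Lmat bl c d (\<lambda>e. x (cs ! e)) * q d)\<^sup>2)" for x i q proof -
  define y where "y = embp l x"
  \<comment> \<open>The direction vector on all homogeneous coordinates; it is 0 at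
    \<open>(j, l j)\<close>, since that coordinate is constant in the chart.\<close>
  define qt where "qt p = (\<Sum>d<n. of_bool (cs ! d = p) * q d)" for p
  define v where "v a = (\<Sum>d<n. u' a (cs ! d) x * q d)" for a
  have qt1: "qt (cs ! d) = q d" if d: "d < n" for d
  proof -
   have "qt (cs ! d) = (\<Sum>e<n. of_bool (e = d) * q e)"
    unfolding qt_def using cs(1) d len by (intro sum.cong) (auto simp: nth_eq_iff_index_eq)
   then show ?thesis using sum_of_bool_lessThan(3)[OF d, of q] by simp
  qed
  have csm: "cs ! d \<in> chart k nv l" if "d < n" for d using that len cs(2) nth_mem by blast
  have qt0: "qt (j, l j) = 0" for j
  proof -
   have "cs ! d \<noteq> (j, l j)" if "d < n" for d using csm[OF that] unfolding chart_iff by auto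
   then show ?thesis by (simp add: qt_def)
  qed
  have v: "v a = (\<Sum>p\<in>pairs k nv. qt p * mono_deriv k nv a p y)" for a
  proof -
   have "(\<Sum>p\<in>pairs k nv. qt p * mono_deriv k nv a p y) = (\<Sum>d<n. \<Sum>p\<in>pairs k nv. of_bool (cs ! d = p) * (q d * mono_deriv k nv a p y))"
    unfolding qt_def sum_distrib_right by (subst sum.swap) (simp add: mult_ac)
   also have "\<dots> = (\<Sum>d<n. q d * mono_deriv k nv a (cs ! d) y)"
   proof (rule sum.cong)
    fix d assume "d \<in> {..<n}"
    then have "cs ! d \<in> pairs k nv" using csm sub by auto
    then show "(\<Sum>p\<in>pairs k nv. of_bool (cs ! d = p) * (q d * mono_deriv k nv a p y)) = q d * mono_deriv k nv a (cs ! d) y"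
     by (subst sum.remove[of _ "cs ! d"]) auto
   qed simp
   finally show ?thesis by (simp add: v_def u'_def y_def mult.commute)
  qed
  have v0: "v (a0 i) = 0" unfolding v_def u'_def using csm ud0 by simp
  have split: "(\<Sum>a\<in>E i. F a) = F (a0 i) + (\<Sum>a\<in>S i. F a)" for F :: "_ => real"
   unfolding S_def using finE a0E by (simp add: sum.remove)
  define N where "N = (\<Sum>a\<in>E i. inverse (eta k nv a) * (monom_eval k nv a y)\<^sup>2)"
  have N: "1 + (\<Sum>a\<in>S i. (\<sigma> a * u a x)\<^sup>2) = N"
   unfolding N_def split y_def by (simp add: u0 eta0 u_def power_mult_distrib \<sigma>2)
  have V: "(\<Sum>a\<in>S i. (\<sigma> a * v a)\<^sup>2) = (\<Sum>a\<in>E i. inverse (eta k nv a) * (v a)\<^sup>2)"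
   unfolding split v0 by (simp add: power_mult_distrib \<sigma>2)
  have W: "(\<Sum>a\<in>S i. (\<sigma> a)\<^sup>2 * u a x * v a) = (\<Sum>a\<in>E i. inverse (eta k nv a) * monom_eval k nv a y * v a)"
   unfolding split v0 by (simp add: \<sigma>2 u_def y_def)
  have embcs: "y (cs ! d) = x (cs ! d)" if "d < n" for d
   using csm[OF that] unfolding chart_iff y_def embp_def by simp
  have bln: "d < n" if "d \<in> blockset bl j" for d j using that len by (auto simp: blockset_def bl_def)
  have Sj: "(\<Sum>h\<le>nv j. (y (j, h))\<^sup>2) = blocksq bl j (\<lambda>e. x (cs ! e))"
   and Bj: "(\<Sum>h\<le>nv j. y (j, h) * qt (j, h)) = (\<Sum>d\<in>blockset bl j. x (cs ! d) * q d)"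
   and Cj: "(\<Sum>h\<le>nv j. (qt (j, h))\<^sup>2) = (\<Sum>d\<in>blockset bl j. (q d)\<^sup>2)" if j: "j < k" for j
  proof -
   note cb = chart_block_sum[OF cs j l[OF j], folded bl_def]
   show "(\<Sum>h\<le>nv j. (y (j, h))\<^sup>2) = blocksq bl j (\<lambda>e. x (cs ! e))"
    unfolding cb[of "\<lambda>p. (y p)\<^sup>2"] blocksq_def using embcs bln by (simp add: y_def embp_def)
   show "(\<Sum>h\<le>nv j. y (j, h) * qt (j, h)) = (\<Sum>d\<in>blockset bl j. x (cs ! d) * q d)"
    unfolding cb[of "\<lambda>p. y p * qt p"] qt0 using embcs bln qt1 by simp
   show "(\<Sum>h\<le>nv j. (qt (j, h))\<^sup>2) = (\<Sum>d\<in>blockset bl j. (q d)\<^sup>2)"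
    unfolding cb[of "\<lambda>p. (qt p)\<^sup>2"] qt0 using bln qt1 by simp
  qed
  have spos: "blocksq bl j z > 0" for j z unfolding blocksq_def by (intro add_pos_nonneg) (auto intro: sum_nonneg)
  have "(\<Sum>a\<in>S i. (\<sigma> a * v a)\<^sup>2) / N - ((\<Sum>a\<in>S i. (\<sigma> a)\<^sup>2 * u a x * v a) / N)\<^sup>2 =
    (\<Sum>j<k. real (\<delta> i j) * ((\<Sum>h\<le>nv j. (qt (j, h))\<^sup>2) / (\<Sum>h\<le>nv j. (y (j, h))\<^sup>2) -
     (\<Sum>h\<le>nv j. y (j, h) * qt (j, h))\<^sup>2 / (\<Sum>h\<le>nv j. (y (j, h))\<^sup>2)\<^sup>2))"
   unfolding V W N_def unfolding v E_def by (rule kernel_form) (simp add: Sj spos)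
  also have "\<dots> = (\<Sum>j<k. real (\<delta> i j) * ((\<Sum>d\<in>blockset bl j. (q d)\<^sup>2) / blocksq bl j (\<lambda>e. x (cs ! e)) -
    (\<Sum>d\<in>blockset bl j. x (cs ! d) * q d)\<^sup>2 / (blocksq bl j (\<lambda>e. x (cs ! e)))\<^sup>2))"
   by (intro sum.cong) (auto simp: Sj Bj Cj)
  also have "\<dots> = (\<Sum>j\<in>set bl. real (\<delta> i j) * ((\<Sum>d\<in>blockset bl j. (q d)\<^sup>2) / blocksq bl j (\<lambda>e. x (cs ! e)) -
    (\<Sum>d\<in>blockset bl j. x (cs ! d) * q d)\<^sup>2 / (blocksq bl j (\<lambda>e. x (cs ! e)))\<^sup>2))"
  proof (rule sum.mono_neutral_right)
   show "set bl \<subseteq> {..<k}" unfolding bl_def set_map cs(2) by (auto simp: chart_iff)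
   have "blockset bl j = {}" if "j \<notin> set bl" for j using that by (auto simp: blockset_def)
   then show "\<forall>j\<in>{..<k} - set bl. real (\<delta> i j) * ((\<Sum>d\<in>blockset bl j. (q d)\<^sup>2) / blocksq bl j (\<lambda>e. x (cs ! e)) -
    (\<Sum>d\<in>blockset bl j. x (cs ! d) * q d)\<^sup>2 / (blocksq bl j (\<lambda>e. x (cs ! e)))\<^sup>2) = 0" by simp qed simp
  also have "\<dots> = (\<Sum>c<n. real (\<delta> i (bl ! c)) * (\<Sum>d<n. Lmat bl c d (\<lambda>e. x (cs ! e)) * q d)\<^sup>2)"
   using Lmat_square_sum[where bl = bl and D = "\<lambda>j. real (\<delta> i j)" and z = "\<lambda>e. x (cs ! e)" and q = q] len by (simp add: bl_def)
  finally show ?thesis unfolding N[symmetric] v_def .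
 qed
 have KR: "(\<integral>\<^sup>+X. \<integral>\<^sup>+Y. ncard {x \<in> A. \<forall>i<n. Y i + (\<Sum>a\<in>S i. X i a * u a x) = 0} \<partial>rowG n
   \<partial>Pi\<^sub>M {..<n} (\<lambda>i. Pi\<^sub>M (S i) (\<lambda>a. normalM (\<sigma> a)))) = chart_mass cs A * expdet bl \<delta>"
  unfolding chart_mass_def len bl_def[symmetric]
 proof (rule kac_rice[where u = "\<lambda>i. u" and u' = "\<lambda>i. u'" and \<sigma> = "\<lambda>i. \<sigma>", OF _ _ _ _ _ _ _ _ _ _ _ form])
  show "(\<lambda>x. Lmat bl c d (\<lambda>e. x (cs ! e))) \<in> borel_measurable (lebR (set cs))" if "c < n" "d < n" for c d
   unfolding bl_def using that len cs(1) by (intro Lmat_measurable) auto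
 qed (use cs len A uc du \<sigma>pos finE in \<open>auto simp: bl_def S_def\<close>)
 define J where "J = (SIGMA i:{..<n}. insert (a0 i) (S i))"
 define M where "M p = normalM (\<sigma> (snd p))" for p :: "nat \<times> (nat => nat => nat)"
 define P where "P = Pi\<^sub>M {..<n} (\<lambda>i. Pi\<^sub>M (S i) (\<lambda>a. M (i, a)))"
 define T where "T = (\<lambda>(X, Y). \<lambda>p\<in>J. if snd p = a0 (fst p) then Y (fst p) else X (fst p) (snd p) :: real)"
 have M: "prob_space (M p)" for p unfolding M_def by (intro prob_space_normal_density \<sigma>pos)
 have M0: "M (i, a0 i) = stdG" for i by (simp add: M_def \<sigma>_def eta0 stdG_def)
 have law: "coeff_law k nv \<delta> = Pi\<^sub>M J M" unfolding coeff_law_def J_def E_def[symmetric] n_def[symmetric] ESi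
  by (intro arg_cong2[where f = "Pi\<^sub>M"] refl) (auto simp: M_def \<sigma>_def fun_eq_iff)
 have S': "finite (S i)" "a0 i \<notin> S i" for i using finE by (auto simp: S_def)
 have T: "T \<in> P \<Otimes>\<^sub>M rowG n \<rightarrow>\<^sub>M Pi\<^sub>M J M" "Pi\<^sub>M J M = distr (P \<Otimes>\<^sub>M rowG n) (Pi\<^sub>M J M) T"
  using PiM_Sigma_split[of S a0 M n, OF S' M] unfolding P_def T_def J_def M0 by - assumption+
 have zero: "x \<in> A \<inter> chart_zeros k nv \<delta> l f \<longleftrightarrow> x \<in> A \<and> (\<forall>i<n. (\<Sum>a\<in>E i. f (i, a) * u a x) = 0)" for x f
  using A(1) by (auto simp: chart_zeros_def poly_eval_monom n_def E_def u_def)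
 have countm: "(\<lambda>f. ncard (A \<inter> chart_zeros k nv \<delta> l f)) \<in> borel_measurable (coeff_law k nv \<delta>)"
 proof -
  have "(\<lambda>f. ncard {x \<in> A. \<forall>i<n. (\<Sum>a\<in>E i. f (i, a) * u a x) = 0}) \<in> borel_measurable (Pi\<^sub>M J M)"
  proof (rule ncard_zero_set_measurable[OF A(2)])
   show "continuous_on A (\<lambda>x. \<Sum>a\<in>E i. f (i, a) * u a x)" for f :: "nat \<times> (nat => nat => nat) => real" and i
    by (intro continuous_intros continuous_on_subset[OF uc(1)]) simp
   show "(\<lambda>f. \<Sum>a\<in>E i. f (i, a) * u a x) \<in> borel_measurable (Pi\<^sub>M J M)" if "i < n" for i x
   proof (intro borel_measurable_sum borel_measurable_times borel_measurable_const)
    fix a assume "a \<in> E i"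
    then have "(i, a) \<in> J" using that ESi by (auto simp: J_def)
    then show "(\<lambda>f. f (i, a)) \<in> borel_measurable (Pi\<^sub>M J M)"
     using measurable_component_comp[of "\<lambda>x. x" M "(i, a)" J] by (simp add: M_def)
   qed
  qed
  moreover have "A \<inter> chart_zeros k nv \<delta> l f = {x \<in> A. \<forall>i<n. (\<Sum>a\<in>E i. f (i, a) * u a x) = 0}" for f
   using zero by blast
  ultimately show ?thesis unfolding law by simp
 qed
 then show "(\<lambda>f. ncard (A \<inter> chart_zeros k nv \<delta> l f)) \<in> borel_measurable (coeff_law k nv \<delta>)" .
 have countT: "A \<inter> chart_zeros k nv \<delta> l (T (X, Y)) = {x \<in> A. \<forall>i<n. Y i + (\<Sum>a\<in>S i. X i a * u a x) = 0}" for X Y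
 proof -
  have "(\<Sum>a\<in>E i. T (X, Y) (i, a) * u a x) = Y i + (\<Sum>a\<in>S i. X i a * u a x)" if i: "i < n" for i x
  proof -
   have "(\<Sum>a\<in>S i. T (X, Y) (i, a) * u a x) = (\<Sum>a\<in>S i. X i a * u a x)"
    using S'(2)[of i] i by (intro sum.cong) (auto simp: T_def J_def)
   moreover have "T (X, Y) (i, a0 i) * u (a0 i) x = Y i" using i by (simp add: T_def J_def u_def u0)
   ultimately show ?thesis unfolding ESi using S' by simp
  qed
  then have "(\<forall>i<n. (\<Sum>a\<in>E i. T (X, Y) (i, a) * u a x) = 0) \<longleftrightarrow> (\<forall>i<n. Y i + (\<Sum>a\<in>S i. X i a * u a x) = 0)" for x by simp
  then show ?thesis by (intro Set.set_eqI) (simp only: zero mem_Collect_eq)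
 qed
 interpret rG: sigma_finite_measure "rowG n" by (rule sf_rowG)
 have "(\<integral>\<^sup>+f. ncard (A \<inter> chart_zeros k nv \<delta> l f) \<partial>coeff_law k nv \<delta>) = (\<integral>\<^sup>+w. ncard (A \<inter> chart_zeros k nv \<delta> l (T w)) \<partial>(P \<Otimes>\<^sub>M rowG n))"
 proof -
  have "(\<integral>\<^sup>+f. ncard (A \<inter> chart_zeros k nv \<delta> l f) \<partial>coeff_law k nv \<delta>) = (\<integral>\<^sup>+f. ncard (A \<inter> chart_zeros k nv \<delta> l f) \<partial>distr (P \<Otimes>\<^sub>M rowG n) (Pi\<^sub>M J M) T)"
   using law T(2) by simp
  also have "\<dots> = (\<integral>\<^sup>+w. ncard (A \<inter> chart_zeros k nv \<delta> l (T w)) \<partial>(P \<Otimes>\<^sub>M rowG n))"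
   using countm unfolding law by (intro nn_integral_distr T(1)) (simp add: measurable_distr_eq1)
  finally show ?thesis .
 qed
 also have "\<dots> = (\<integral>\<^sup>+X. \<integral>\<^sup>+Y. ncard (A \<inter> chart_zeros k nv \<delta> l (T (X, Y))) \<partial>rowG n \<partial>P)"
  using measurable_compose[OF T(1) countm[unfolded law]] by (intro rG.nn_integral_fst[symmetric])
 also have "\<dots> = chart_mass cs A * expdet bl \<delta>" unfolding countT P_def M_def using KR by simp
 finally show "(\<integral>\<^sup>+f. ncard (A \<inter> chart_zeros k nv \<delta> l f) \<partial>coeff_law k nv \<delta>) = chart_mass cs A * expdet (map fst cs) \<delta>"
  by (simp add: bl_def)
qed

section \<open>The number of roots in the product of projective spaces\<close>

text \<open>Rather than integrating the density, \<open>kac_rice\<close> is applied to affine linear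
  equations \<open>Y i + (\<Sum>d<n. X i d * (B i d * x (cs ! d))) = 0\<close>, whose quadratic
  forms are those of the reference degrees. For an invertible coefficient matrix they have one
  solution whatever \<open>Y\<close> is.\<close>

lemma chart_mass_calibration:
 assumes cs: "distinct cs"
 shows "chart_mass cs (fvec (set cs)) * expdet (map fst cs) (lindeg (map fst cs)) = 1"
proof -
 define n where "n = length cs"
 define bl where "bl = map fst cs"
 have bl: "length bl = n" by (simp add: bl_def n_def)
 \<comment> \<open>Mask that keeps in equation \<open>i\<close> the variables of its own block;
   being 0 or 1 it is idempotent, so squares of masked terms collapse to sums over the
   block.\<close>
 define B where "B i d = (of_bool (bl ! d = bl ! i) :: real)" for i d
 have BB: "B i d * B i d = B i d" for i d by (simp add: B_def)
 have blksum: "(\<Sum>d<n. B i d * F d) = (\<Sum>d\<in>blockset bl (bl ! i). F d)" for i and F :: "nat => real"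
  by (rule sum.mono_neutral_cong_right) (auto simp: blockset_def B_def bl)
 have KR: "(\<integral>\<^sup>+X. \<integral>\<^sup>+Y. ncard {x \<in> fvec (set cs). \<forall>i<n. Y i + (\<Sum>d\<in>{..<n}. X i d * (B i d * x (cs ! d))) = 0} \<partial>rowG n
   \<partial>Pi\<^sub>M {..<n} (\<lambda>i. Pi\<^sub>M {..<n} (\<lambda>d. normalM 1))) = chart_mass cs (fvec (set cs)) * expdet bl (lindeg bl)"
  unfolding chart_mass_def n_def[symmetric] bl_def[symmetric]
 proof (rule kac_rice[where u = "\<lambda>i d x. B i d * x (cs ! d)" and u' = "\<lambda>i d c x. B i d * of_bool (cs ! d = c)" and \<sigma> = "\<lambda>i d. 1" and S = "\<lambda>i. {..<n}"])
  show "sigma_compact (fvec (set cs))" by (rule sigma_compact_fvec) simp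
  show "(\<lambda>x. Lmat bl c d (\<lambda>e. x (cs ! e))) \<in> borel_measurable (lebR (set cs))" if "c < n" "d < n" for c d
   unfolding bl_def using that cs by (intro Lmat_measurable) (auto simp: n_def)
  show "((\<lambda>t. B i d * (x(c := t)) (cs ! d)) has_real_derivative B i d * of_bool (cs ! d = c)) (at (x c))" for i d c and x :: "nat \<times> nat => real"
   by (cases "cs ! d = c") (auto intro!: derivative_eq_intros)
  fix x :: "nat \<times> nat => real" and i and q :: "nat => real" assume i: "i < n"
  define s where "s = blocksq bl (bl ! i) (\<lambda>e. x (cs ! e))"
  have v: "(\<Sum>e<n. B i d * of_bool (cs ! d = cs ! e) * q e) = B i d * q d" if d: "d < n" for d
  proof -
   have "(\<Sum>e<n. B i d * of_bool (cs ! d = cs ! e) * q e) = (\<Sum>e<n. of_bool (e = d) * (B i d * q e))"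
    using cs d by (intro sum.cong) (auto simp: nth_eq_iff_index_eq n_def)
   also have "\<dots> = B i d * q d" by (rule sum_of_bool_lessThan(3)[OF d])
   finally show ?thesis .
  qed
  have 1: "1 + (\<Sum>d<n. (1 * (B i d * x (cs ! d)))\<^sup>2) = s"
   unfolding s_def blocksq_def blksum[symmetric] by (simp add: power2_eq_square mult_ac BB mult.assoc[symmetric, of "B i d" "B i d" for d])
  have 2: "(\<Sum>d<n. (1 * (\<Sum>e<n. B i d * of_bool (cs ! d = cs ! e) * q e))\<^sup>2) = (\<Sum>d\<in>blockset bl (bl ! i). (q d)\<^sup>2)"
   unfolding blksum[symmetric] by (intro sum.cong refl, simp only: v lessThan_iff) (simp add: B_def)
  have 3: "(\<Sum>d<n. 1\<^sup>2 * (B i d * x (cs ! d)) * (\<Sum>e<n. B i d * of_bool (cs ! d = cs ! e) * q e)) = (\<Sum>d\<in>blockset bl (bl ! i). x (cs ! d) * q d)"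
   unfolding blksum[symmetric] by (intro sum.cong refl, simp only: v lessThan_iff) (simp add: B_def)
  have "(\<Sum>c<n. real (lindeg bl i (bl ! c)) * (\<Sum>d<n. Lmat bl c d (\<lambda>e. x (cs ! e)) * q d)\<^sup>2) =
    (\<Sum>j\<in>set bl. real (lindeg bl i j) * ((\<Sum>c\<in>blockset bl j. (q c)\<^sup>2) / blocksq bl j (\<lambda>e. x (cs ! e)) -
     (\<Sum>c\<in>blockset bl j. x (cs ! c) * q c)\<^sup>2 / (blocksq bl j (\<lambda>e. x (cs ! e)))\<^sup>2))"
   using Lmat_square_sum[where bl = bl and D = "\<lambda>j. real (lindeg bl i j)" and z = "\<lambda>e. x (cs ! e)" and q = q] bl by simp
  also have "\<dots> = (\<Sum>c\<in>blockset bl (bl ! i). (q c)\<^sup>2) / s - (\<Sum>c\<in>blockset bl (bl ! i). x (cs ! c) * q c)\<^sup>2 / s\<^sup>2"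
   using i bl nth_mem[of i bl] by (subst sum.remove[of _ "bl ! i"]) (auto simp: lindeg_def s_def)
  finally show "(\<Sum>d<n. (1 * (\<Sum>e<n. B i d * of_bool (cs ! d = cs ! e) * q e))\<^sup>2) / (1 + (\<Sum>d<n. (1 * (B i d * x (cs ! d)))\<^sup>2)) -
   ((\<Sum>d<n. 1\<^sup>2 * (B i d * x (cs ! d)) * (\<Sum>e<n. B i d * of_bool (cs ! d = cs ! e) * q e)) / (1 + (\<Sum>d<n. (1 * (B i d * x (cs ! d)))\<^sup>2)))\<^sup>2 =
   (\<Sum>c<n. real (lindeg bl i (bl ! c)) * (\<Sum>d<n. Lmat bl c d (\<lambda>e. x (cs ! e)) * q d)\<^sup>2)"
   unfolding 1 2 3 by (simp add: power_divide)
 qed (use cs bl in \<open>auto simp: n_def intro!: continuous_intros\<close>)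
 have one: "(\<integral>\<^sup>+Y. ncard {x \<in> fvec (set cs). \<forall>i<n. Y i + (\<Sum>d\<in>{..<n}. Z i d * (B i d * x (cs ! d))) = 0} \<partial>rowG n) = 1"
  if nz: "det (mat n n (\<lambda>(i, c). B i c * Z i c)) \<noteq> 0" for Z :: "nat => nat => real"
 proof -
  define M where "M = mat n n (\<lambda>(i, c). B i c * Z i c)"
  have M: "M \<in> carrier_mat n n" by (simp add: M_def)
  then have "M \<in> Units (ring_mat TYPE(real) n ())" using det_non_zero_imp_unit[OF M] nz by (simp add: M_def)
  then obtain W where W: "W \<in> carrier_mat n n" "W * M = 1\<^sub>m n" "M * W = 1\<^sub>m n"
   unfolding Units_def by (auto simp: ring_mat_simps)
  have "ncard {x \<in> fvec (set cs). \<forall>i<n. Y i + (\<Sum>d\<in>{..<n}. Z i d * (B i d * x (cs ! d))) = 0} = 1" for Y :: "nat => real"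
  proof -
   define b where "b = vec n (\<lambda>i. - Y i)"
   define xv where "xv x = vec n (\<lambda>d. x (cs ! d))" for x :: "nat \<times> nat => real"
   have b: "b \<in> carrier_vec n" and xv: "xv x \<in> carrier_vec n" for x by (auto simp: b_def xv_def)
   have row: "(M *\<^sub>v xv x) $ i = (\<Sum>d<n. Z i d * (B i d * x (cs ! d)))" if "i < n" for i x
    using that by (auto simp: M_def xv_def scalar_prod_def atLeast0LessThan mult_ac intro!: sum.cong)
   have eqn: "(\<forall>i<n. Y i + (\<Sum>d\<in>{..<n}. Z i d * (B i d * x (cs ! d))) = 0) \<longleftrightarrow> M *\<^sub>v xv x = b" for x
   proof -
    have "M *\<^sub>v xv x = b \<longleftrightarrow> (\<forall>i<n. (M *\<^sub>v xv x) $ i = b $ i)" using M b by (auto intro!: eq_vecI)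
    also have "\<dots> \<longleftrightarrow> (\<forall>i<n. Y i + (\<Sum>d\<in>{..<n}. Z i d * (B i d * x (cs ! d))) = 0)"
     using row by (auto simp: b_def eq_neg_iff_add_eq_0 add.commute)
    finally show ?thesis ..
   qed
   define x0 where "x0 = (\<lambda>p\<in>set cs. (W *\<^sub>v b) $ (inv_into {..<n} ((!) cs) p))"
   have injcs: "inj_on ((!) cs) {..<n}" using cs by (auto simp: inj_on_def nth_eq_iff_index_eq n_def)
   have x0: "x0 (cs ! d) = (W *\<^sub>v b) $ d" if "d < n" for d
    using that inv_into_f_f[OF injcs, of d] by (simp add: x0_def n_def)
   have sol: "M *\<^sub>v xv x = b \<longleftrightarrow> xv x = W *\<^sub>v b" for x
   proof
    assume "M *\<^sub>v xv x = b"
    then have "W *\<^sub>v b = (W * M) *\<^sub>v xv x" using assoc_mult_mat_vec[OF W(1) M xv] by simp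
    then show "xv x = W *\<^sub>v b" using W(2) xv by simp
   next
    assume "xv x = W *\<^sub>v b"
    then have "M *\<^sub>v xv x = (M * W) *\<^sub>v b" using assoc_mult_mat_vec[OF M W(1) b] by simp
    then show "M *\<^sub>v xv x = b" using W(3) b by simp
   qed
   have "x \<in> fvec (set cs) \<and> xv x = W *\<^sub>v b \<longleftrightarrow> x = x0" for x
   proof
    assume x: "x \<in> fvec (set cs) \<and> xv x = W *\<^sub>v b"
    have "x p = x0 p" for p
    proof (cases "p \<in> set cs")
     case True
     then obtain d where d: "d < n" "p = cs ! d" by (auto simp: in_set_conv_nth n_def)
     have "x (cs ! d) = xv x $ d" using d by (simp add: xv_def)
     then show ?thesis using x x0[OF d(1)] d(2) by simp
    next
     case False
     then show ?thesis using x PiE_arb[of x "set cs" "\<lambda>_. UNIV" p] by (simp add: x0_def)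
    qed
    then show "x = x0" by (rule ext)
   next
    assume x: "x = x0"
    have "xv x0 = W *\<^sub>v b" using x0 W(1) by (intro eq_vecI) (auto simp: xv_def)
    then show "x \<in> fvec (set cs) \<and> xv x = W *\<^sub>v b" unfolding x by (simp add: x0_def)
   qed
   then have "{x \<in> fvec (set cs). \<forall>i<n. Y i + (\<Sum>d\<in>{..<n}. Z i d * (B i d * x (cs ! d))) = 0} = {x0}"
    unfolding eqn sol by blast
   then show ?thesis by simp
  qed
  then show ?thesis using prob_space.emeasure_space_1[OF prob_rowG, of n] by simp
 qed
 \<comment> \<open>The identity permutation serves as transversal, because the mask is 1 on the
   diagonal.\<close>
 have ae: "AE Z in matG n. det (mat n n (\<lambda>(i, c). B i c * Z i c)) \<noteq> 0"
 proof (rule AE_det_nonzero[where \<rho> = "\<lambda>i c z. B i c * z c", OF sf_rowG _ permutes_id])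
  show "(\<lambda>z. B i c * z c) \<in> borel_measurable (rowG n)" if "c < n" for i c
   using that by (intro borel_measurable_times borel_measurable_const measurable_rowG_entry)
  fix i and q :: "nat => real" assume i: "i < n" and q: "q (id i) \<noteq> 0"
  have "AE z in rowG n. (\<Sum>c<n. (B i c * q c) * z c) \<noteq> 0"
   using q by (intro AE_row_nonzero[OF i]) (simp add: B_def)
  then show "AE z in rowG n. (\<Sum>c<n. B i c * z c * q c) \<noteq> 0" by (simp add: mult_ac)
 qed
 have "(\<integral>\<^sup>+Z. \<integral>\<^sup>+Y. ncard {x \<in> fvec (set cs). \<forall>i<n. Y i + (\<Sum>d\<in>{..<n}. Z i d * (B i d * x (cs ! d))) = 0} \<partial>rowG n \<partial>matG n) = (\<integral>\<^sup>+Z. 1 \<partial>matG n)"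
  by (rule nn_integral_cong_AE) (use ae in eventually_elim, rule one)
 also have "\<dots> = 1" using prob_space.emeasure_space_1[OF prob_matG, of n] by simp
 finally show ?thesis using KR unfolding bl_def stdG_def by simp
qed

lemma null_coordinate_hyperplane:
 assumes I: "finite I" "p \<in> I"
 shows "emeasure (lebR I) {x \<in> fvec I. x p = (0::real)} = 0"
proof -
 define H where "H = {x \<in> fvec I. x p = (0::real)}"
 have H: "H \<in> sets (lebR I)"
 proof -
  have "(\<lambda>x. x p) \<in> borel_measurable (lebR I)"
   using I(2) measurable_component_comp[of "\<lambda>x. x" "\<lambda>_. lborel" p I] by simp
  then have "{x \<in> space (lebR I). x p = 0} \<in> sets (lebR I)" by measurable
  then show ?thesis by (simp add: H_def)
 qed
 have I': "insert p (I - {p}) = I" using I by auto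
 have "emeasure (lebR I) H = (\<integral>\<^sup>+x. indicator H x \<partial>lebR (insert p (I - {p})))" unfolding I' using H by simp
 also have "\<dots> = (\<integral>\<^sup>+x. \<integral>\<^sup>+t. indicator H (fun_upd x p t) \<partial>lborel \<partial>lebR (I - {p}))"
 proof (rule plb.product_nn_integral_insert)
  show "indicator H \<in> borel_measurable (lebR (insert p (I - {p})))" unfolding I' using H by simp
 qed (use I in auto)
 also have "\<dots> = (\<integral>\<^sup>+x. 0 \<partial>lebR (I - {p}))"
 proof (rule nn_integral_cong)
  fix x :: "_ => real"
  have "(\<integral>\<^sup>+t. indicator H (fun_upd x p t) \<partial>lborel) \<le> (\<integral>\<^sup>+t. indicator {0::real} t \<partial>lborel)"
   by (intro nn_integral_mono) (auto simp: H_def indicator_def)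
  then show "(\<integral>\<^sup>+t. indicator H (fun_upd x p t) \<partial>lborel) = 0" by simp
 qed
 finally show ?thesis by (simp add: H_def)
qed

text \<open>The zeros in question lie in a coordinate hyperplane, which is a null set, so
  \<open>chart_mass\<close> vanishes there and with it their expected number.\<close>

lemma AE_no_zeros_at_infinity:
 assumes l: "\<And>j. j < k \<Longrightarrow> l j \<le> nv j" and j: "j < k" "l j \<noteq> 0"
 shows "AE f in coeff_law k nv \<delta>. \<forall>x\<in>chart_zeros k nv \<delta> l f. x (j, 0) \<noteq> 0"
proof -
 define A where "A = {x \<in> fvec (chart k nv l). x (j, 0) = (0::real)}"
 obtain cs where cs: "set cs = chart k nv l" "distinct cs"
  using finite_distinct_list[OF finite_chart] by blast
 have A: "A \<subseteq> fvec (chart k nv l)" "sigma_compact A"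
 proof -
  have "A = fvec (chart k nv l) \<inter> {x. x (j, 0) = 0}" by (auto simp: A_def)
  moreover have "closed {x :: nat \<times> nat => real. x (j, 0) = 0}"
   by (intro closed_Collect_eq continuous_on_product_coordinates continuous_on_const)
  ultimately show "sigma_compact A"
   using sigma_compact_Int_closed[OF sigma_compact_fvec[OF finite_chart]] by metis
 qed (auto simp: A_def)
 have jc: "(j, 0) \<in> chart k nv l" using j by (simp add: chart_iff)
 have null: "emeasure (lebR (set cs)) A = 0"
  unfolding A_def cs(1) by (rule null_coordinate_hyperplane[OF finite_chart jc])
 have Am: "A \<in> sets (lebR (set cs))"
  using borel_Int_lebR[OF sigma_compact_borel[OF A(2)], of "set cs"] A(1) by (simp add: Int_absorb2 cs(1))
 have "AE x in lebR (set cs). x \<notin> A" using null Am by (intro AE_not_in) auto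
 then have "chart_mass cs A = (\<integral>\<^sup>+x. 0 \<partial>lebR (set cs))"
  unfolding chart_mass_def by (intro nn_integral_cong_AE) (auto elim!: eventually_mono)
 then have "(\<integral>\<^sup>+f. ncard (A \<inter> chart_zeros k nv \<delta> l f) \<partial>coeff_law k nv \<delta>) = 0"
  using expected_chart_zeros(1)[OF l cs(2,1) A, of \<delta>] by simp
 then have "AE f in coeff_law k nv \<delta>. ncard (A \<inter> chart_zeros k nv \<delta> l f) = 0"
  using expected_chart_zeros(2)[OF l cs(2,1) A, of \<delta>] by (simp add: nn_integral_0_iff_AE)
 then show ?thesis
 proof eventually_elim
  case (elim f)
  then have "A \<inter> chart_zeros k nv \<delta> l f = {}" by (simp add: emeasure_count_space_eq_0)
  then show ?case by (auto simp: A_def chart_zeros_def)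
 qed
qed

text \<open>A root with vanishing coordinate 0 in some block would be a zero with vanishing
  coordinate \<open>(j, 0)\<close> in a chart \<open>l\<close> that uses a nonzero coordinate of
  each block, which the hypothesis forbids. All roots therefore have unique representatives with
  coordinate 0 equal to 1.\<close>

lemma ncard_roots_eq:
 assumes inf: "\<And>l j x. (\<And>j. j < k \<Longrightarrow> l j \<le> nv j) \<Longrightarrow> (\<And>j. \<not> j < k \<Longrightarrow> l j = 0) \<Longrightarrow> j < k \<Longrightarrow> l j \<noteq> 0 \<Longrightarrow>
   x \<in> chart_zeros k nv \<delta> l f \<Longrightarrow> x (j, 0) \<noteq> 0"
 shows "ncard (roots k nv \<delta> f) = ncard (chart_zeros k nv \<delta> (\<lambda>_. 0) f)"
proof -
 define rep where "rep x j = (\<lambda>h\<in>{..nv j}. embp (\<lambda>_. 0) x (j, h))" for x j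
 define \<Phi> where "\<Phi> x = (\<lambda>j\<in>{..<k}. proportional (nv j) `` {rep x j})" for x
 have rep0: "rep x j 0 = 1" for x j by (simp add: rep_def embp_def)
 have repnz: "rep x j \<in> nonzero_vectors (nv j)" for x j unfolding nonzero_vectors_def mem_Collect_eq
 proof
  show "rep x j \<in> {..nv j} \<rightarrow>\<^sub>E UNIV" by (simp add: rep_def)
  show "\<exists>h\<le>nv j. rep x j h \<noteq> 0" using rep0[of x j] by (intro exI[of _ 0]) simp
 qed
 have "bij_betw \<Phi> (chart_zeros k nv \<delta> (\<lambda>_. 0) f) (roots k nv \<delta> f)" unfolding bij_betw_def
 proof
  show "inj_on \<Phi> (chart_zeros k nv \<delta> (\<lambda>_. 0) f)"
  proof (rule inj_onI)
   fix x x' assume x: "x \<in> chart_zeros k nv \<delta> (\<lambda>_. 0) f" "x' \<in> chart_zeros k nv \<delta> (\<lambda>_. 0) f" "\<Phi> x = \<Phi> x'"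
   have "x p = x' p" for p
   proof (cases "p \<in> chart k nv (\<lambda>_. 0)")
    case True
    obtain j h where p: "p = (j, h)" by (cases p)
    have jh: "j < k" "h \<le> nv j" "h \<noteq> 0" using True unfolding chart_iff p by auto
    have "proportional (nv j) `` {rep x j} = proportional (nv j) `` {rep x' j}"
     using fun_cong[OF x(3), of j] jh(1) by (simp add: \<Phi>_def)
    then have "(rep x j, rep x' j) \<in> proportional (nv j)"
     using eq_equiv_class[OF _ equiv_proportional repnz] by blast
    then obtain c where c: "\<forall>h\<le>nv j. rep x' j h = c * rep x j h" unfolding proportional_def by blast
    have "c = 1" using c rep0[of x j] rep0[of x' j] by (metis le0 mult.right_neutral)
    then have "rep x' j h = rep x j h" using c jh by simp
    then show ?thesis using jh by (simp add: p rep_def embp_def)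
   next
    case False
    have "x \<in> fvec (chart k nv (\<lambda>_. 0))" "x' \<in> fvec (chart k nv (\<lambda>_. 0))" using x(1,2) by (auto simp: chart_zeros_def)
    then show ?thesis using PiE_arb[OF _ False] by metis
   qed
   then show "x = x'" by (rule ext)
  qed
  show "\<Phi> ` chart_zeros k nv \<delta> (\<lambda>_. 0) f = roots k nv \<delta> f"
  proof (intro equalityI subsetI)
   fix \<zeta> assume "\<zeta> \<in> \<Phi> ` chart_zeros k nv \<delta> (\<lambda>_. 0) f"
   then obtain x where x: "x \<in> chart_zeros k nv \<delta> (\<lambda>_. 0) f" "\<zeta> = \<Phi> x" by blast
   have "\<zeta> \<in> (\<Pi>\<^sub>E j\<in>{..<k}. proj_space (nv j))"
    unfolding x(2) \<Phi>_def proj_space_def using quotientI[OF repnz] by auto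
   moreover have "poly_eval k nv (\<delta> i) (\<lambda>a. f (i, a)) y = 0" if i: "i < total_dim k nv" and y: "\<forall>j<k. y j \<in> \<zeta> j" for i y
   proof -
    have "\<forall>j. \<exists>c. j < k \<longrightarrow> (\<forall>h\<le>nv j. y j h = c * embp (\<lambda>_. 0) x (j, h))"
    proof
     fix j
     show "\<exists>c. j < k \<longrightarrow> (\<forall>h\<le>nv j. y j h = c * embp (\<lambda>_. 0) x (j, h))"
     proof (cases "j < k")
      case True
      then have "(rep x j, y j) \<in> proportional (nv j)" using y x(2) by (auto simp: \<Phi>_def)
      then show ?thesis unfolding proportional_def by (auto simp: rep_def)
     qed simp
    qed
    then obtain s where s: "\<forall>j. j < k \<longrightarrow> (\<forall>h\<le>nv j. y j h = s j * embp (\<lambda>_. 0) x (j, h))"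
     by (rule choice[THEN exE])
    have "poly_eval k nv (\<delta> i) (\<lambda>a. f (i, a)) y = (\<Prod>j<k. s j ^ \<delta> i j) * poly_eval k nv (\<delta> i) (\<lambda>a. f (i, a)) (\<lambda>j h. embp (\<lambda>_. 0) x (j, h))"
     by (rule poly_eval_scale) (use s in auto)
    then show ?thesis using x(1) i by (simp add: chart_zeros_def)
   qed
   ultimately show "\<zeta> \<in> roots k nv \<delta> f" by (simp add: roots_def)
  next
   fix \<zeta> assume \<zeta>: "\<zeta> \<in> roots k nv \<delta> f"
   have "\<forall>j. \<exists>v. j < k \<longrightarrow> v \<in> nonzero_vectors (nv j) \<and> \<zeta> j = proportional (nv j) `` {v}"
   proof
    fix j
    show "\<exists>v. j < k \<longrightarrow> v \<in> nonzero_vectors (nv j) \<and> \<zeta> j = proportional (nv j) `` {v}"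
    proof (cases "j < k")
     case True
     then have "\<zeta> j \<in> nonzero_vectors (nv j) // proportional (nv j)" using \<zeta> by (auto simp: roots_def proj_space_def)
     then show ?thesis by (auto elim!: quotientE)
    qed simp
   qed
   then obtain v where v: "\<And>j. j < k \<Longrightarrow> v j \<in> nonzero_vectors (nv j)" "\<And>j. j < k \<Longrightarrow> \<zeta> j = proportional (nv j) `` {v j}"
    using choice[of "\<lambda>j v. j < k \<longrightarrow> v \<in> nonzero_vectors (nv j) \<and> \<zeta> j = proportional (nv j) `` {v}"] by blast
   \<comment> \<open>Coordinate 0 is preferred whenever it is nonzero, so
     \<open>l j \<noteq> 0\<close> witnesses a root at infinity; the value 0 outside the range of
     the blocks leaves only finitely many charts to consider.\<close>
   define l where "l j = (if j < k \<and> v j 0 = 0 then SOME h. h \<le> nv j \<and> v j h \<noteq> 0 else 0)" for j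
   have lv: "l j \<le> nv j \<and> v j (l j) \<noteq> 0" if "j < k" for j
   proof (cases "v j 0 = 0")
    case True
    have "\<exists>h. h \<le> nv j \<and> v j h \<noteq> 0" using v(1)[OF that] by (auto simp: nonzero_vectors_def)
    from someI_ex[OF this] show ?thesis using True that by (simp add: l_def)
   qed (simp add: l_def)
   define x where "x = (\<lambda>p\<in>chart k nv l. v (fst p) (snd p) / v (fst p) (l (fst p)))"
   have emb: "embp l x (j, h) = 1 / v j (l j) * v j h" if "j < k" "h \<le> nv j" for j h
    using that lv[OF that(1)] by (simp add: embp_def x_def chart_iff)
   have vself: "v j \<in> \<zeta> j" if "j < k" for j
    unfolding v(2)[OF that] by (rule equiv_class_self[OF equiv_proportional v(1)[OF that]])
   have xz: "x \<in> chart_zeros k nv \<delta> l f"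
   proof -
    have "poly_eval k nv (\<delta> i) (\<lambda>a. f (i, a)) (\<lambda>j h. embp l x (j, h)) = 0" if "i < total_dim k nv" for i
    proof -
     have "poly_eval k nv (\<delta> i) (\<lambda>a. f (i, a)) (\<lambda>j h. embp l x (j, h)) =
       (\<Prod>j<k. (1 / v j (l j)) ^ \<delta> i j) * poly_eval k nv (\<delta> i) (\<lambda>a. f (i, a)) v"
      by (rule poly_eval_scale) (rule emb)
     also have "poly_eval k nv (\<delta> i) (\<lambda>a. f (i, a)) v = 0" using \<zeta> that vself by (simp add: roots_def)
     finally show ?thesis by simp
    qed
    then show ?thesis by (simp add: chart_zeros_def x_def)
   qed
   have l0: "l j = 0" for j
   proof (rule ccontr)
    assume lj: "l j \<noteq> 0"
    then have j: "j < k" "v j 0 = 0" by (auto simp: l_def split: if_splits)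
    have "x (j, 0) \<noteq> 0" by (rule inf[OF _ _ j(1) lj xz]) (use lv in \<open>auto simp: l_def\<close>)
    moreover have "x (j, 0) = 0" using j lj by (simp add: x_def chart_iff)
    ultimately show False by simp
   qed
   then have l: "l = (\<lambda>_. 0)" by (rule ext)
   have "\<Phi> x = \<zeta>"
   proof (rule ext)
    fix j
    show "\<Phi> x j = \<zeta> j"
    proof (cases "j < k")
     case True
     have "(v j, rep x j) \<in> proportional (nv j)" unfolding proportional_def mem_Collect_eq prod.case
     proof (intro conjI v(1)[OF True] repnz exI[of _ "1 / v j (l j)"])
      show "1 / v j (l j) \<noteq> 0" using lv[OF True] by simp
      show "\<forall>h\<le>nv j. rep x j h = 1 / v j (l j) * v j h" using emb[OF True] by (simp add: rep_def l)
     qed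
     then show ?thesis using equiv_class_eq[OF equiv_proportional] True by (simp add: \<Phi>_def v(2)[OF True])
    next
     case False
     have "\<zeta> \<in> (\<Pi>\<^sub>E j\<in>{..<k}. proj_space (nv j))" using \<zeta> by (simp add: roots_def)
     then show ?thesis using False PiE_arb[of \<zeta> "{..<k}" "\<lambda>j. proj_space (nv j)" j] by (simp add: \<Phi>_def)
    qed
   qed
   then show "\<zeta> \<in> \<Phi> ` chart_zeros k nv \<delta> (\<lambda>_. 0) f" using xz unfolding l by blast
  qed
 qed
 then show ?thesis by (rule ncard_bij_betw[symmetric])
qed

text \<open>There are finitely many charts, so the exceptional null sets combine and only the count
  in one chart remains. The calibration identifies \<open>chart_mass\<close> as the reciprocal of
  the mean determinant at the reference degrees.\<close>

lemma expected_roots_ndet: "expected_roots k nv \<delta> = ennreal (ndet (map fst (columns k nv)) \<delta>)"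
proof -
 \<comment> \<open>The charts are indexed by the finite set \<open>\<L>\<close>, whose members are
   \<open>undefined\<close> from \<open>k\<close> on; \<open>ext\<close> replaces this by 0, as
   \<open>ncard_roots_eq\<close> expects.\<close>
 define ext where "ext l j = (if j < k then l j else 0)" for l :: "nat => nat" and j
 define \<L> where "\<L> = (\<Pi>\<^sub>E j\<in>{..<k}. {..nv j})"
 have "finite \<L>" unfolding \<L>_def by (intro finite_PiE) auto
 moreover have "AE f in coeff_law k nv \<delta>. \<forall>j\<in>{..<k}. ext l j \<noteq> 0 \<longrightarrow> (\<forall>x\<in>chart_zeros k nv \<delta> (ext l) f. x (j, 0) \<noteq> 0)" if "l \<in> \<L>" for l
 proof (rule AE_finite_allI)
  fix j assume "j \<in> {..<k}"
  moreover have "ext l j \<le> nv j" if "j < k" for j using \<open>l \<in> \<L>\<close> that by (auto simp: \<L>_def ext_def PiE_iff)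
  ultimately show "AE f in coeff_law k nv \<delta>. ext l j \<noteq> 0 \<longrightarrow> (\<forall>x\<in>chart_zeros k nv \<delta> (ext l) f. x (j, 0) \<noteq> 0)"
   using AE_no_zeros_at_infinity[of k "ext l" nv j \<delta>] by (cases "ext l j = 0") auto
 qed simp
 ultimately have "AE f in coeff_law k nv \<delta>. \<forall>l\<in>\<L>. \<forall>j\<in>{..<k}. ext l j \<noteq> 0 \<longrightarrow> (\<forall>x\<in>chart_zeros k nv \<delta> (ext l) f. x (j, 0) \<noteq> 0)"
  by (rule AE_finite_allI)
 then have "AE f in coeff_law k nv \<delta>. ncard (roots k nv \<delta> f) = ncard (chart_zeros k nv \<delta> (\<lambda>_. 0) f)"
 proof eventually_elim
  case (elim f)
  show ?case
  proof (rule ncard_roots_eq)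
   fix l j x assume l: "\<And>j. j < k \<Longrightarrow> l j \<le> nv j" "\<And>j. \<not> j < k \<Longrightarrow> l j = 0" "j < k" "l j \<noteq> 0" "x \<in> chart_zeros k nv \<delta> l f"
   have "restrict l {..<k} \<in> \<L>" using l(1) by (auto simp: \<L>_def)
   moreover have "ext (restrict l {..<k}) = l" using l(2) by (auto simp: ext_def fun_eq_iff)
   ultimately show "x (j, 0) \<noteq> 0" using elim l(3-5) by (metis lessThan_iff)
  qed
 qed
 then have "expected_roots k nv \<delta> = (\<integral>\<^sup>+f. ncard (chart_zeros k nv \<delta> (\<lambda>_. 0) f) \<partial>coeff_law k nv \<delta>)"
  unfolding expected_roots_def by (rule nn_integral_cong_AE)
 also have "\<dots> = (\<integral>\<^sup>+f. ncard (fvec (chart k nv (\<lambda>_. 0)) \<inter> chart_zeros k nv \<delta> (\<lambda>_. 0) f) \<partial>coeff_law k nv \<delta>)"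
  by (intro nn_integral_cong arg_cong[where f = ncard]) (auto simp: chart_zeros_def)
 also have "\<dots> = chart_mass (columns k nv) (fvec (chart k nv (\<lambda>_. 0))) * expdet (map fst (columns k nv)) \<delta>"
 proof (rule expected_chart_zeros(1))
  show "set (columns k nv) = chart k nv (\<lambda>_. 0)"
   unfolding columns_enumerate(1) by (auto simp: coords_def chart_def)
 qed (auto simp: columns_enumerate(2) sigma_compact_fvec)
 also have "fvec (chart k nv (\<lambda>_. 0)) = fvec (set (columns k nv))"
  unfolding columns_enumerate(1) by (intro arg_cong[where f = fvec]) (auto simp: coords_def chart_def)
 also have "chart_mass (columns k nv) (fvec (set (columns k nv))) * expdet (map fst (columns k nv)) \<delta> =
   ennreal (ndet (map fst (columns k nv)) \<delta>)" unfolding expdet_ndet[of "map fst (columns k nv)" \<delta>]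
  using chart_mass_calibration[OF columns_enumerate(2), of k nv] by (simp add: mult_ac)
 finally show ?thesis .
qed

lemma blk_columns: "blk k nv (map fst (columns k nv))" unfolding blk_def
proof
 show "set (map fst (columns k nv)) \<subseteq> {..<k}"
  unfolding set_map columns_enumerate(1) by (auto simp: coords_def)
 show "\<forall>j<k. count (mset (map fst (columns k nv))) j = nv j"
 proof (intro allI impI)
  fix j assume j: "j < k"
  have "count (mset (map fst (columns k nv))) j = card (blockset (map fst (columns k nv)) j)"
   by (simp only: blockset_def count_mset count_list_eq_length_filter length_filter_conv_card eq_commute)
  also have "real \<dots> = real (card {p. p \<in> coords k nv \<and> fst p = j})"
   using blockset_sum[OF columns_enumerate(2), where F = "\<lambda>_. 1" and j = j] by (simp add: columns_enumerate(1))
  also have "card {p. p \<in> coords k nv \<and> fst p = j} = nv j"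
   unfolding coords_slice using j by (simp add: card_image inj_on_def)
  finally show "count (mset (map fst (columns k nv))) j = nv j" by simp
 qed
qed

theorem theorem3:
  fixes k n :: nat and nv :: "nat \<Rightarrow> nat" and \<delta> :: "nat \<Rightarrow> nat \<Rightarrow> nat"
  assumes "k \<ge> 1" and "n = (\<Sum>j<k. nv j)" and "n \<ge> 1"
  shows "ennreal (per n (Delta_half k nv \<delta>) / (\<Prod>j<k. fact (nv j))) \<ge> expected_roots k nv \<delta> \<and>
    expected_roots k nv \<delta> \<ge> ennreal (sqrt (BKK k nv \<delta>)) \<and>
    sqrt (BKK k nv \<delta>) = sqrt (per n (Delta k nv \<delta>) / (\<Prod>j<k. fact (nv j))) \<and>
    (ennreal (per n (Delta_half k nv \<delta>) / (\<Prod>j<k. fact (nv j))) = expected_roots k nv \<delta>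
       \<longleftrightarrow> simply_reducible k nv \<delta>) \<and>
    (expected_roots k nv \<delta> = ennreal (sqrt (BKK k nv \<delta>)) \<longleftrightarrow> simply_reducible k nv \<delta>)"
proof -
 define bl where "bl = map fst (columns k nv)"
 have b: "blk k nv bl" unfolding bl_def by (rule blk_columns)
 have dim: "total_dim k nv = n" using assms(2) by (simp add: total_dim_def)
 have len: "length bl = n" using blk_length[OF b] dim by simp
 have nth: "bl ! c = fst (columns k nv ! c)" if "c < n" for c using that len by (simp add: bl_def)
 define P where "P = nper k nv bl (\<lambda>i j. sqrt (real (\<delta> i j)))"
 define B where "B = nper k nv bl (\<lambda>i j. real (\<delta> i j))"
 have "per n (Delta_half k nv \<delta>) = per n (\<lambda>i c. sqrt (real (\<delta> i (bl ! c))))"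
  "per n (Delta k nv \<delta>) = per n (\<lambda>i c. real (\<delta> i (bl ! c)))"
  by (intro per_cong, simp add: Delta_half_def Delta_def nth)+
 then have PB: "per n (Delta_half k nv \<delta>) / (\<Prod>j<k. fact (nv j)) = P" "per n (Delta k nv \<delta>) / (\<Prod>j<k. fact (nv j)) = B"
  by (simp_all add: P_def B_def nper_def len)
 have bkk: "BKK k nv \<delta> = B" unfolding B_def by (rule BKK_eq_nper[OF b])
 have E: "expected_roots k nv \<delta> = ennreal (ndet bl \<delta>)" unfolding bl_def by (rule expected_roots_ndet)
 have pos: "0 \<le> P" "0 \<le> B" "0 \<le> ndet bl \<delta>" by (auto simp: P_def B_def nper_nonneg ndet_nonneg)
 have bounds: "ndet bl \<delta> \<le> P \<and> B \<le> (ndet bl \<delta>)\<^sup>2 \<and> (ndet bl \<delta> = P \<longleftrightarrow> simply_reducible k nv \<delta>) \<and>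
   (B = (ndet bl \<delta>)\<^sup>2 \<longleftrightarrow> simply_reducible k nv \<delta>)"
  using ndet_bounds[OF BKK_eq_nper b, of \<delta>] dim assms(3) unfolding P_def B_def by simp
 \<comment> \<open>\<open>ndet_bounds\<close> compares \<open>B\<close> with a square; nonnegativity
   of \<open>ndet\<close> permits taking roots.\<close>
 have "sqrt B \<le> ndet bl \<delta>" using bounds pos by (intro real_le_lsqrt) auto
 moreover have "ndet bl \<delta> = sqrt B \<longleftrightarrow> B = (ndet bl \<delta>)\<^sup>2"
  using pos by (metis real_sqrt_abs abs_of_nonneg real_sqrt_pow2)
 ultimately show ?thesis unfolding PB bkk E using bounds pos by (auto simp: ennreal_inj intro!: ennreal_leI)
qed

end
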